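(* The following orientation algorithm (of Asahiro et al.) can be implemented in $O(m)$ time on a simple graph with $n$ vertices and $m$ edges; for edge-weighted graphs (with degrees and density replaced by their weighted counterparts) it can be implemented in $O(m+n\log n)$ time. The algorithm: set $l\leftarrow m/n$. Repeat the following: while there is a vertex $v$ whose degree in the current graph is at most $\lceil 2l\rceil-1$, orient all edges currently incident with $v$ towards $v$ and delete $v$ and these edges; if no vertex remains, return the orientation; otherwise set $l\leftarrow |E|/|V|$ for the current vertex and edge sets; continue repeating until every remaining vertex has degree exactly $\lceil 2l\rceil$. Then, while the remaining graph contains a cycle $(v_1,\dots,v_r)$, orient it as $v_1\to v_2\to\cdots\to v_r\to v_1$ and delete its edges. Finally, while there is a vertex $v$ of degree at most $1$, orient its unique incident edge (if any) towards $v$ and delete $v$ with that edge. Return the orientation of all edges.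
   Context: An orientation of a simple graph assigns each edge one of its two directions. In the weighted version each edge carries a weight, the degree of a vertex is replaced by the total weight of its incident edges, and $m$ in the density $l=m/n$ is replaced by the total edge weight of the current graph.
   Formalization: Edge weights are taken to be natural numbers (for one edge of weight 1/2 the repetition never ends), and in the final phase "degree at most 1" counts incident edges also for weighted graphs (otherwise an edge of weight 2 would never be oriented). *)

theory Defs
  imports Complex_Main
begin

text \<open>
  Graphs are given by a vertex set and a set of two-element edges.  An edge weight function
  is a map \<open>w\<close> on edges; the unweighted case is \<open>w = (\<lambda>_. 1)\<close>
  (see \<open>wdeg_unweighted\<close> and \<open>edge_density_unweighted\<close> below).  Weights are natural numbers: for
  non-integral weights the loop of the algorithm need not terminate (take one edge of weight 1/2).
\<close>

definition simple_graph :: "'a set \<Rightarrow> 'a set set \<Rightarrow> bool" where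
  "simple_graph V E \<longleftrightarrow> finite V \<and> (\<forall>e\<in>E. e \<subseteq> V \<and> card e = 2)"

definition incident :: "'a set set \<Rightarrow> 'a \<Rightarrow> 'a set set" where
  "incident E v = {e \<in> E. v \<in> e}"

definition wdeg :: "('a set \<Rightarrow> nat) \<Rightarrow> 'a set set \<Rightarrow> 'a \<Rightarrow> nat" where
  "wdeg w E v = (\<Sum>e\<in>incident E v. w e)"

definition edge_density :: "('a set \<Rightarrow> nat) \<Rightarrow> 'a set \<Rightarrow> 'a set set \<Rightarrow> real" where
  "edge_density w V E = real (\<Sum>e\<in>E. w e) / real (card V)"

lemma wdeg_unweighted: "wdeg (\<lambda>_. 1) E v = card (incident E v)"
  by (simp add: wdeg_def)

lemma edge_density_unweighted: "edge_density (\<lambda>_. 1) V E = real (card E) / real (card V)"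
  by (simp add: edge_density_def)

section \<open>The orientation algorithm\<close>

text \<open>
  A configuration consists of the current vertices, the current edges, and the arcs chosen so
  far; the arc \<open>(u, v)\<close> is the edge \<open>{u, v}\<close> directed from \<open>u\<close> to \<open>v\<close>.
  The algorithm is nondeterministic, since it leaves open which vertex or cycle is
  picked; it is therefore modelled as a relation.
\<close>

type_synonym 'a config = "'a set \<times> 'a set set \<times> ('a \<times> 'a) set"

definition arcs_towards :: "'a set set \<Rightarrow> 'a \<Rightarrow> ('a \<times> 'a) set" where
  "arcs_towards E v = {(u, v) | u. {u, v} \<in> E}"

definition while_do :: "('c \<Rightarrow> 'c \<Rightarrow> bool) \<Rightarrow> 'c \<Rightarrow> 'c \<Rightarrow> bool" where
  "while_do step c c' \<longleftrightarrow> rtranclp step c c' \<and> (\<nexists>d. step c' d)"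

inductive peel_step :: "('a set \<Rightarrow> nat) \<Rightarrow> real \<Rightarrow> 'a config \<Rightarrow> 'a config \<Rightarrow> bool"
  for w :: "'a set \<Rightarrow> nat" and l :: real where
  "\<lbrakk> v \<in> V; int (wdeg w E v) \<le> \<lceil>2 * l\<rceil> - 1 \<rbrakk> \<Longrightarrow>
   peel_step w l (V, E, A) (V - {v}, E - incident E v, A \<union> arcs_towards E v)"

definition cycle_arcs :: "'a list \<Rightarrow> ('a \<times> 'a) set" where
  "cycle_arcs vs = set (zip vs (rotate1 vs))"

definition cycle_edges :: "'a list \<Rightarrow> 'a set set" where
  "cycle_edges vs = (\<lambda>(u, v). {u, v}) ` cycle_arcs vs"

definition is_cycle :: "'a set set \<Rightarrow> 'a list \<Rightarrow> bool" where
  "is_cycle E vs \<longleftrightarrow> 3 \<le> length vs \<and> distinct vs \<and> cycle_edges vs \<subseteq> E"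

inductive cycle_step :: "'a config \<Rightarrow> 'a config \<Rightarrow> bool" where
  "is_cycle E vs \<Longrightarrow> cycle_step (V, E, A) (V, E - cycle_edges vs, A \<union> cycle_arcs vs)"

text \<open>
  The degree in the last phase is the number of incident edges also for weighted graphs: there
  the vertices in question are the leaves and isolated vertices of the remaining forest.
\<close>

inductive leaf_step :: "'a config \<Rightarrow> 'a config \<Rightarrow> bool" where
  "\<lbrakk> v \<in> V; card (incident E v) \<le> 1 \<rbrakk> \<Longrightarrow>
   leaf_step (V, E, A) (V - {v}, E - incident E v, A \<union> arcs_towards E v)"

text \<open>\<open>rounds w l c A\<close>: entering the outer loop in configuration \<open>c\<close> with the given value of
  \<open>l\<close>, the algorithm may return the orientation \<open>A\<close>.\<close>

inductive rounds :: "('a set \<Rightarrow> nat) \<Rightarrow> real \<Rightarrow> 'a config \<Rightarrow> ('a \<times> 'a) set \<Rightarrow> bool"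
  for w :: "'a set \<Rightarrow> nat" where
  rounds_empty:
    "while_do (peel_step w l) c ({}, E, A) \<Longrightarrow> rounds w l c A"
| rounds_repeat:
    "\<lbrakk> while_do (peel_step w l) c (V, E, A); V \<noteq> {};
       l' = edge_density w V E; \<not> (\<forall>v\<in>V. int (wdeg w E v) = \<lceil>2 * l'\<rceil>);
       rounds w l' (V, E, A) A' \<rbrakk> \<Longrightarrow> rounds w l c A'"
| rounds_exit:
    "\<lbrakk> while_do (peel_step w l) c (V, E, A); V \<noteq> {};
       l' = edge_density w V E; \<forall>v\<in>V. int (wdeg w E v) = \<lceil>2 * l'\<rceil>;
       while_do cycle_step (V, E, A) c';
       while_do leaf_step c' (V'', E'', A') \<rbrakk> \<Longrightarrow> rounds w l c A'"

definition orientation_algorithm ::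
    "('a set \<Rightarrow> nat) \<Rightarrow> 'a set \<Rightarrow> 'a set set \<Rightarrow> ('a \<times> 'a) set \<Rightarrow> bool" where
  "orientation_algorithm w V E A \<longleftrightarrow> rounds w (edge_density w V E) (V, E, {}) A"

section \<open>Machine model: a word RAM\<close>

text \<open>
  Programs have finitely many registers and finitely many random-access arrays (which could be
  interleaved in a single memory at the price of a constant factor).  Every arithmetic
  operation, comparison, memory access and branch costs one unit.  All values, including addresses
  and intermediate results, have to be at most the word limit \<open>B\<close>; there is no execution of a
  program that exceeds it.  Subtraction is truncated, division is integer division, and
  comparisons yield 0 or 1.
\<close>

datatype binop = Add | Sub | Mul | Div | Less | Equal

datatype aexp = Num nat | Reg string | Read string aexp | Op binop aexp aexp

datatype com =
    Skip
  | Assign string aexp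
  | Write string aexp aexp
  | Seq com com
  | Cond aexp com com
  | While aexp com

record state =
  regs :: "string \<Rightarrow> nat"
  arrs :: "string \<Rightarrow> nat \<Rightarrow> nat"

fun apply_op :: "binop \<Rightarrow> nat \<Rightarrow> nat \<Rightarrow> nat" where
  "apply_op Add a b = a + b"
| "apply_op Sub a b = a - b"
| "apply_op Mul a b = a * b"
| "apply_op Div a b = a div b"
| "apply_op Less a b = (if a < b then 1 else 0)"
| "apply_op Equal a b = (if a = b then 1 else 0)"

fun aval :: "aexp \<Rightarrow> state \<Rightarrow> nat" where
  "aval (Num c) s = c"
| "aval (Reg x) s = regs s x"
| "aval (Read a i) s = arrs s a (aval i s)"
| "aval (Op f a b) s = apply_op f (aval a s) (aval b s)"

fun fits :: "nat \<Rightarrow> aexp \<Rightarrow> state \<Rightarrow> bool" where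
  "fits B (Num c) s \<longleftrightarrow> c \<le> B"
| "fits B (Reg x) s \<longleftrightarrow> regs s x \<le> B"
| "fits B (Read a i) s \<longleftrightarrow> fits B i s \<and> arrs s a (aval i s) \<le> B"
| "fits B (Op f a b) s \<longleftrightarrow> fits B a s \<and> fits B b s \<and> apply_op f (aval a s) (aval b s) \<le> B"

fun cost :: "aexp \<Rightarrow> nat" where
  "cost (Num c) = 1"
| "cost (Reg x) = 1"
| "cost (Read a i) = cost i + 1"
| "cost (Op f a b) = cost a + cost b + 1"

text \<open>\<open>exec B p s t s'\<close>: started in \<open>s\<close>, program \<open>p\<close> halts after time \<open>t\<close> in \<open>s'\<close>.\<close>

inductive exec :: "nat \<Rightarrow> com \<Rightarrow> state \<Rightarrow> nat \<Rightarrow> state \<Rightarrow> bool" for B :: nat where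
  exec_Skip: "exec B Skip s 1 s"
| exec_Assign:
    "fits B a s \<Longrightarrow>
     exec B (Assign x a) s (cost a + 1) (s\<lparr>regs := (regs s)(x := aval a s)\<rparr>)"
| exec_Write:
    "\<lbrakk> fits B i s; fits B a s \<rbrakk> \<Longrightarrow>
     exec B (Write x i a) s (cost i + cost a + 1)
       (s\<lparr>arrs := (arrs s)(x := (arrs s x)(aval i s := aval a s))\<rparr>)"
| exec_Seq:
    "\<lbrakk> exec B p s t s'; exec B q s' t' s'' \<rbrakk> \<Longrightarrow> exec B (Seq p q) s (t + t') s''"
| exec_CondTrue:
    "\<lbrakk> fits B b s; aval b s \<noteq> 0; exec B p s t s' \<rbrakk> \<Longrightarrow> exec B (Cond b p q) s (cost b + 1 + t) s'"
| exec_CondFalse: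
    "\<lbrakk> fits B b s; aval b s = 0; exec B q s t s' \<rbrakk> \<Longrightarrow> exec B (Cond b p q) s (cost b + 1 + t) s'"
| exec_WhileFalse:
    "\<lbrakk> fits B b s; aval b s = 0 \<rbrakk> \<Longrightarrow> exec B (While b p) s (cost b + 1) s"
| exec_WhileTrue:
    "\<lbrakk> fits B b s; aval b s \<noteq> 0; exec B p s t s'; exec B (While b p) s' t' s'' \<rbrakk> \<Longrightarrow>
     exec B (While b p) s (cost b + 1 + t + t') s''"

inductive_cases exec_SkipE: "exec B Skip s t s'"
inductive_cases exec_AssignE: "exec B (Assign x a) s t s'"
inductive_cases exec_WriteE: "exec B (Write x i a) s t s'"
inductive_cases exec_SeqE: "exec B (Seq p q) s t s'"
inductive_cases exec_CondE: "exec B (Cond b p q) s t s'"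
inductive_cases exec_WhileE: "exec B (While b p) s t s'"

lemma exec_deterministic:
  "exec B p s t s' \<Longrightarrow> exec B p s u s'' \<Longrightarrow> u = t \<and> s'' = s'"
proof (induction arbitrary: u s'' rule: exec.induct)
  case exec_Skip
  then show ?case by (auto elim: exec_SkipE)
next
  case exec_Assign
  from exec_Assign.prems show ?case by (rule exec_AssignE) simp
next
  case exec_Write
  from exec_Write.prems show ?case by (rule exec_WriteE) simp
next
  case exec_Seq
  from exec_Seq.prems show ?case by (rule exec_SeqE) (auto dest!: exec_Seq.IH)
next
  case exec_CondTrue
  from exec_CondTrue.prems show ?case
    by (rule exec_CondE) (use exec_CondTrue.hyps in \<open>auto dest!: exec_CondTrue.IH\<close>)
next
  case exec_CondFalse
  from exec_CondFalse.prems show ?case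
    by (rule exec_CondE) (use exec_CondFalse.hyps in \<open>auto dest!: exec_CondFalse.IH\<close>)
next
  case exec_WhileFalse
  from exec_WhileFalse.prems show ?case
    by (rule exec_WhileE) (use exec_WhileFalse.hyps in auto)
next
  case exec_WhileTrue
  from exec_WhileTrue.prems show ?case
    by (rule exec_WhileE) (use exec_WhileTrue.hyps in \<open>auto dest!: exec_WhileTrue.IH\<close>)
qed

section \<open>Input and output conventions\<close>

text \<open>
  A graph on the vertices \<open>0, \<dots>, n - 1\<close> is presented as a list of its edges, in any order and
  with the two endpoints of each edge in any order; all memory not holding the input is 0.
  The output is one bit per edge, telling whether the edge is directed as listed (0) or reversed.
\<close>

definition edge_list :: "nat set set \<Rightarrow> (nat \<times> nat) list \<Rightarrow> bool" where
  "edge_list E es \<longleftrightarrow>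
     distinct (map (\<lambda>(u, v). {u, v}) es) \<and> set (map (\<lambda>(u, v). {u, v}) es) = E"

definition graph_input :: "nat \<Rightarrow> (nat \<times> nat) list \<Rightarrow> state" where
  "graph_input n es = \<lparr>
     regs = (\<lambda>_. 0)(''n'' := n, ''m'' := length es),
     arrs = (\<lambda>_ _. 0)(
       ''src'' := (\<lambda>i. if i < length es then fst (es ! i) else 0),
       ''tgt'' := (\<lambda>i. if i < length es then snd (es ! i) else 0)) \<rparr>"

definition weighted_graph_input ::
    "nat \<Rightarrow> (nat \<times> nat) list \<Rightarrow> (nat set \<Rightarrow> nat) \<Rightarrow> state" where
  "weighted_graph_input n es w = (graph_input n es)\<lparr>
     arrs := (arrs (graph_input n es))(
       ''weight'' := (\<lambda>i. if i < length es then w {fst (es ! i), snd (es ! i)} else 0)) \<rparr>"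

definition output_orientation :: "(nat \<times> nat) list \<Rightarrow> state \<Rightarrow> (nat \<times> nat) set" where
  "output_orientation es s =
     {if arrs s ''out'' i = 0 then (fst (es ! i), snd (es ! i)) else (snd (es ! i), fst (es ! i))
      | i. i < length es}"

end

theory Submission
  imports Defs
begin

text \<open>
  Peeling.  All vertices of positive degree are kept in a priority queue keyed by their current
  weighted degree.  Let \<open>k = \<lceil>2l\<rceil>\<close>.  If the minimum degree is less than \<open>k\<close>, a vertex of minimum degree is
  peeled; if it equals the average degree, all degrees are equal and the peeling ends; otherwise a
  new round starts, and the new \<open>k\<close> exceeds the minimum degree, so that the next step peels a
  vertex.  Hence there are at most twice as many queries as vertices, one deletion per vertex and one
  key decrease per edge.  For unit weights buckets give constant amortized time; for general
  weights a Fibonacci heap gives \<open>O(1)\<close> per decrease and \<open>O(log n)\<close> per query and deletion.  Isolated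
  vertices never enter the queue, as the unweighted time bound does not allow to touch them.

  Cycles and leaves.  A depth-first walk through unused edges orients every edge in walking
  direction.  When it closes a cycle, the cycle is popped from the stack; when it gets stuck in a
  vertex, that vertex is a leaf of the graph of the edges that are unused or on the stack, and it is
  popped as well.  A leaf lies on no cycle, so the leaf removals may be postponed until no cycle is
  left, and the result is the one of a run of the algorithm.
\<close>

section \<open>Abstract runs of the algorithm\<close>

text \<open>The algorithm is nondeterministic, so the machine only has to follow some run. The
  invariants therefore look forward: for a predicate \<open>G\<close> on results they say that every
  way of completing the present configuration ends in \<open>G\<close>. A program step has to turn
  completions of the new configuration into completions of the old one, and postponing leaves
  becomes an implication between two \<open>finishes\<close> statements. The Fibonacci heap has to
  live in arrays. Child lists are matrix rows, and a deletion moves the last entry into the gap,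
  which destroys the order in which children were linked. The usual rank argument compares children
  in that order; \<open>forest\<close> counts instead: at most \<open>j\<close> children of a vertex
  have \<open>deg_of + mark\<close> below \<open>j\<close>. This clause refers to no order and
  yields ranks below \<open>3 * h\<close> for \<open>n < 2 ^ h\<close>. Both queues implement one
  interface. There \<open>removable\<close> reflects that the heap deletes only roots, and
  \<open>decrement\<close> that buckets support only decrements by one.\<close>

lemma while_do_step: "step c c' \<Longrightarrow> while_do step c' d \<Longrightarrow> while_do step c d"
  by (auto simp: while_do_def intro: converse_rtranclp_into_rtranclp)

text \<open>Every rule of \<open>rounds\<close> begins with the peel loop for the same
  \<open>l\<close>, so a further step in front is absorbed by that loop.\<close>

lemma rounds_peel:
  assumes "peel_step w l c c'" and "rounds w l c' A"
  shows "rounds w l c A"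
  using assms(2,1)
proof (cases rule: rounds.cases)
  case (rounds_empty E)
  show ?thesis by (rule rounds.rounds_empty[OF while_do_step[OF assms(1) rounds_empty]])
next
  case (rounds_repeat V E A l')
  show ?thesis by (rule rounds.rounds_repeat[OF while_do_step[OF assms(1) rounds_repeat(1)] rounds_repeat(2-5)])
next
  case (rounds_exit V E A l' c' V'' E'')
  show ?thesis by (rule rounds.rounds_exit[OF while_do_step[OF assms(1) rounds_exit(1)] rounds_exit(2-6)])
qed

lemma rounds_peel_rtrancl:
  assumes "(peel_step w l)\<^sup>*\<^sup>* c c'" and "rounds w l c' A"
  shows "rounds w l c A"
  using assms by (induction rule: converse_rtranclp_induct) (auto intro: rounds_peel)

lemma arcs_towards_incident: "arcs_towards (incident E v) v = arcs_towards E v"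
  by (auto simp: arcs_towards_def incident_def)

text \<open>The step relation is a parameter because isolated vertices disappear in two ways: by
  \<open>peel_step\<close> if \<open>l\<close> is positive, by \<open>leaf_step\<close> after the
  cycles.\<close>

lemma remove_isolated_vertices:
  assumes "finite I" and "I \<subseteq> V" and iso: "\<And>v. v \<in> I \<Longrightarrow> incident E v = {}"
    and step: "\<And>V v A. v \<in> I \<Longrightarrow> v \<in> V \<Longrightarrow>
      step (V, E, A) (V - {v}, E - incident E v, A \<union> arcs_towards E v)"
  shows "step\<^sup>*\<^sup>* (V, E, A) (V - I, E, A)"
  using assms
proof (induction I)
  case (insert v I)
  have "arcs_towards E v = {}"
    using insert.prems(2)[of v] by (auto simp: arcs_towards_def incident_def)
  then have "step (V - I, E, A) (V - I - {v}, E, A)"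
    using insert.prems(3)[of v "V - I" A] insert.prems(1,2) insert.hyps by auto
  then show ?case
    using insert by (metis (no_types, lifting) Diff_insert insertCI insert_subset rtranclp.rtrancl_into_rtrancl)
qed simp

section \<open>Paths and cycles given as vertex lists\<close>

definition path_arcs :: "'a list \<Rightarrow> ('a \<times> 'a) set" where
  "path_arcs p = set (zip p (tl p))"

definition path_edges :: "'a list \<Rightarrow> 'a set set" where
  "path_edges p = (\<lambda>(u, v). {u, v}) ` path_arcs p"

lemma path_arcs_simps [simp]:
  "path_arcs [] = {}" "path_arcs [x] = {}" "path_arcs (x # y # p) = insert (x, y) (path_arcs (y # p))"
  by (auto simp: path_arcs_def)

lemma path_edges_simps [simp]:
  "path_edges [] = {}" "path_edges [x] = {}" "path_edges (x # y # p) = insert {x, y} (path_edges (y # p))"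
  by (auto simp: path_edges_def)

lemma path_arcs_append: "path_arcs (p @ x # q) = path_arcs (p @ [x]) \<union> path_arcs (x # q)"
proof (induction p)
  case (Cons a p)
  then show ?case by (cases p) auto
qed simp

lemma path_edges_append: "path_edges (p @ x # q) = path_edges (p @ [x]) \<union> path_edges (x # q)"
  by (simp add: path_edges_def path_arcs_append[of p x q] image_Un)

lemma path_arcs_subset: "(u, v) \<in> path_arcs p \<Longrightarrow> u \<in> set p \<and> v \<in> set p"
  by (induction p rule: induct_list012) auto

lemma path_edges_subset: "e \<in> path_edges p \<Longrightarrow> e \<subseteq> set p"
  by (induction p rule: induct_list012) auto

text \<open>A cycle is a path plus one closing arc; this is how a stack segment is recognized as a
  cycle.\<close>

lemma cycle_arcs_Cons: "cycle_arcs (x # q) = insert (last (x # q), x) (path_arcs (x # q))"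
proof -
  have "set (zip (y # q) (q @ [x])) = insert (last (y # q), x) (path_arcs (y # q))" for y
    by (induction q arbitrary: y) auto
  then show ?thesis by (simp add: cycle_arcs_def)
qed

lemma cycle_edges_Cons: "cycle_edges (x # q) = insert {last (x # q), x} (path_edges (x # q))"
  by (simp add: cycle_edges_def cycle_arcs_Cons path_edges_def)

text \<open>The edges to the successor and to the predecessor of \<open>v\<close> differ, as the two
  neighbours have different indices modulo a length of at least 3.\<close>

lemma cycle_two_edges:
  assumes "distinct vs" and "3 \<le> length vs" and "v \<in> set vs"
  obtains e e' where "e \<noteq> e'" "e \<in> cycle_edges vs" "e' \<in> cycle_edges vs" "v \<in> e" "v \<in> e'"
proof -
  let ?L = "length vs"
  obtain i where i: "i < ?L" "vs ! i = v"
    using assms(3) by (auto simp: in_set_conv_nth)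
  have arcs: "(vs ! j, vs ! (Suc j mod ?L)) \<in> cycle_arcs vs" if "j < ?L" for j
    using that by (auto simp: cycle_arcs_def set_zip nth_rotate1 intro!: exI[of _ j])
  \<comment> \<open>\<open>j\<close> is the cyclic predecessor of \<open>i\<close>, and
    \<open>k\<close> below is the cyclic successor.\<close>
  define j where "j = (if i = 0 then ?L - 1 else i - 1)"
  have j: "j < ?L" "Suc j mod ?L = i"
    using i assms(2) by (auto simp: j_def)
  define k where "k = Suc i mod ?L"
  have k: "k < ?L" "k \<noteq> j" "k \<noteq> i"
    using i assms(2) by (auto simp: j_def k_def mod_Suc)
  have "j \<noteq> i" using assms(2) i by (auto simp: j_def)
  then have "vs ! k \<noteq> vs ! j" "vs ! k \<noteq> v" "vs ! j \<noteq> v"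
    using assms(1) i j k by (auto simp: nth_eq_iff_index_eq)
  then have ne: "{v, vs ! k} \<noteq> {vs ! j, v}" by (auto simp: doubleton_eq_iff)
  have "{v, vs ! k} \<in> cycle_edges vs" "{vs ! j, v} \<in> cycle_edges vs"
    using arcs[of i] arcs[of j] i j by (force simp: cycle_edges_def k_def)+
  with ne show ?thesis by (rule that) auto
qed

section \<open>The cycle phase followed by the leaf phase\<close>

lemma cycle_stepD: "cycle_step (V, E, A) d \<Longrightarrow> \<exists>vs. is_cycle E vs"
  by (auto elim: cycle_step.cases)

text \<open>Demanding the empty vertex set at the end replaces the stopping condition of the leaf
  loop: without vertices no leaf step is possible.\<close>

definition finishes :: "'a config \<Rightarrow> ('a \<times> 'a) set \<Rightarrow> bool" where
  "finishes c A \<longleftrightarrow> (\<exists>c' E. while_do cycle_step c c' \<and> leaf_step\<^sup>*\<^sup>* c' ({}, E, A))"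

lemma finishes_cycle: "cycle_step c c' \<Longrightarrow> finishes c' A \<Longrightarrow> finishes c A"
  unfolding finishes_def using while_do_step by metis

lemma no_leaf_step_empty: "\<not> leaf_step ({}, E, A) d"
  by (auto elim: leaf_step.cases)

text \<open>A vertex of degree at most 1 lies on no cycle, so its removal may be postponed until all
  cycles have been removed.\<close>

lemma finishes_leaf:
  assumes fin: "finite E" and v: "v \<in> V" "card (incident E v) \<le> 1"
    and "finishes (V - {v}, E - incident E v, A \<union> arcs_towards E v) A'"
  shows "finishes (V, E, A) A'"
proof -
  let ?I = "incident E v" and ?T = "arcs_towards E v"
  obtain c E2 where c: "while_do cycle_step (V - {v}, E - ?I, A \<union> ?T) c"
    and leaf: "leaf_step\<^sup>*\<^sup>* c ({}, E2, A')"
    using assms(4) unfolding finishes_def by blast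
  have "cycle_step\<^sup>*\<^sup>* (V - {v}, E - ?I, A \<union> ?T) c"
    using c by (simp add: while_do_def)
  \<comment> \<open>Each cycle removed from the small graph is also a cycle of the large one; the
    edges at \<open>v\<close> are carried along and the arcs towards \<open>v\<close> are still
    missing.\<close>
  then have "\<exists>E1 A1. c = (V - {v}, E1, A1 \<union> ?T) \<and> E1 \<subseteq> E - ?I \<and> cycle_step\<^sup>*\<^sup>* (V, E, A) (V, E1 \<union> ?I, A1)"
  proof (induction rule: rtranclp_induct)
    case base
    show ?case by (rule exI[of _ "E - ?I"], rule exI[of _ A]) (auto simp: incident_def Un_absorb2)
  next
    case (step y z)
    then obtain E1 A1 where y: "y = (V - {v}, E1, A1 \<union> ?T)" "E1 \<subseteq> E - ?I"
      and path: "cycle_step\<^sup>*\<^sup>* (V, E, A) (V, E1 \<union> ?I, A1)" by blast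
    from step.hyps(2) obtain vs where vs: "is_cycle E1 vs"
      "z = (V - {v}, E1 - cycle_edges vs, A1 \<union> ?T \<union> cycle_arcs vs)"
      unfolding y(1) by (auto elim: cycle_step.cases)
    then have "is_cycle (E1 \<union> ?I) vs" by (auto simp: is_cycle_def)
    then have "cycle_step (V, E1 \<union> ?I, A1) (V, E1 \<union> ?I - cycle_edges vs, A1 \<union> cycle_arcs vs)"
      by (rule cycle_step.intros)
    moreover have "E1 \<union> ?I - cycle_edges vs = (E1 - cycle_edges vs) \<union> ?I"
      using y(2) vs(1) by (auto simp: is_cycle_def)
    ultimately have "cycle_step\<^sup>*\<^sup>* (V, E, A) (V, (E1 - cycle_edges vs) \<union> ?I, A1 \<union> cycle_arcs vs)"
      using path by simp
    then show ?case
      using y(2) vs(2) by (intro exI[of _ "E1 - cycle_edges vs"] exI[of _ "A1 \<union> cycle_arcs vs"]) auto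
  qed
  then obtain E1 A1 where c1: "c = (V - {v}, E1, A1 \<union> ?T)" "E1 \<subseteq> E - ?I"
    and path: "cycle_step\<^sup>*\<^sup>* (V, E, A) (V, E1 \<union> ?I, A1)" by blast
  have no: "\<not> is_cycle E1 vs" for vs
    using c unfolding while_do_def c1(1) by (auto intro: cycle_step.intros)
  have inc: "incident (E1 \<union> ?I) v = ?I" using c1(2) by (auto simp: incident_def)
  \<comment> \<open>A cycle through \<open>v\<close> would need two edges at \<open>v\<close>, but
    these all lie in \<open>?I\<close>; a cycle avoiding \<open>v\<close> already lies in
    \<open>E1\<close>.\<close>
  have "\<not> is_cycle (E1 \<union> ?I) vs" for vs
  proof
    assume cyc: "is_cycle (E1 \<union> ?I) vs"
    show False
    proof (cases "v \<in> set vs")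
      case True
      then obtain e e' where "e \<noteq> e'" "e \<in> cycle_edges vs" "e' \<in> cycle_edges vs" "v \<in> e" "v \<in> e'"
        using cyc cycle_two_edges unfolding is_cycle_def by metis
      moreover from this have "e \<in> E1 \<union> ?I" "e' \<in> E1 \<union> ?I"
        using cyc unfolding is_cycle_def by blast+
      ultimately have "{e, e'} \<subseteq> ?I" "card {e, e'} = 2"
        using c1(2) by (auto simp: incident_def)
      moreover have "finite ?I" using fin by (simp add: incident_def)
      ultimately have "2 \<le> card ?I" by (metis card_mono)
      then show False using v(2) by simp
    next
      case False
      have sub: "e \<subseteq> set vs" if "e \<in> cycle_edges vs" for e
        using that by (auto simp: cycle_edges_def cycle_arcs_def dest: set_zip_leftD set_zip_rightD)
      have "cycle_edges vs \<subseteq> E1"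
      proof
        fix e assume e: "e \<in> cycle_edges vs"
        then have "v \<notin> e" using sub False by blast
        moreover have "e \<in> E1 \<union> ?I" using cyc e unfolding is_cycle_def by blast
        ultimately show "e \<in> E1" by (simp add: incident_def)
      qed
      then have "is_cycle E1 vs" using cyc unfolding is_cycle_def by blast
      then show False using no by blast
    qed
  qed
  then have "\<not> cycle_step (V, E1 \<union> ?I, A1) d" for d
    using cycle_stepD by metis
  then have "while_do cycle_step (V, E, A) (V, E1 \<union> ?I, A1)"
    using path unfolding while_do_def by blast
  \<comment> \<open>Only now, with all cycles gone, the leaf is removed. This leads exactly to the
    configuration reached from the smaller graph.\<close>
  moreover have "leaf_step (V, E1 \<union> ?I, A1) (V - {v}, E1 \<union> ?I - ?I, A1 \<union> arcs_towards (E1 \<union> ?I) v)"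
    using leaf_step.intros[of v V "E1 \<union> ?I" A1] v inc by simp
  moreover have "arcs_towards (E1 \<union> ?I) v = ?T"
    using arcs_towards_incident[of "E1 \<union> ?I" v] arcs_towards_incident[of E v] inc by simp
  moreover have "E1 \<union> ?I - ?I = E1" using c1(2) by auto
  ultimately have "leaf_step (V, E1 \<union> ?I, A1) c" unfolding c1(1) by simp
  then have "leaf_step\<^sup>*\<^sup>* (V, E1 \<union> ?I, A1) ({}, E2, A')"
    using leaf by (rule converse_rtranclp_into_rtranclp)
  with \<open>while_do cycle_step (V, E, A) (V, E1 \<union> ?I, A1)\<close> show ?thesis
    unfolding finishes_def by blast
qed

lemma finishes_no_edges:
  fixes V :: "'a set"
  assumes "finite V"
  shows "finishes (V, {}, A) A"
proof -
  have "\<not> is_cycle {} vs" for vs :: "'a list"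
    by (cases vs) (auto simp: is_cycle_def cycle_edges_Cons)
  then have "while_do cycle_step (V, {}, A) (V, {}, A)"
    by (auto simp: while_do_def elim: cycle_step.cases)
  moreover have "leaf_step\<^sup>*\<^sup>* (V, {}, A) (V - V, {}, A)"
    using assms
  proof (rule remove_isolated_vertices)
    fix V' :: "'a set" and v and A' :: "('a \<times> 'a) set"
    assume "v \<in> V'"
    then show "leaf_step (V', {}, A') (V' - {v}, {} - incident {} v, A' \<union> arcs_towards {} v)"
      by (intro leaf_step.intros) (auto simp: incident_def)
  qed (auto simp: incident_def)
  ultimately show ?thesis unfolding finishes_def by auto
qed

text \<open>Isolated vertices have degree 0, so this is \<open>finishes_leaf\<close>
  repeated.\<close>

lemma finishes_isolated:
  assumes "finite E" "finite I" "I \<subseteq> V" "\<And>v. v \<in> I \<Longrightarrow> incident E v = {}" "finishes (V - I, E, A) A'"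
  shows "finishes (V, E, A) A'"
proof -
  show ?thesis using assms(2-5)
  proof (induction I arbitrary: V)
    case (insert v I)
    have "arcs_towards E v = {}"
      using insert.prems(2)[of v] by (auto simp: arcs_towards_def incident_def)
    moreover have "finishes (V - {v}, E, A) A'"
    proof (rule insert.IH)
      show "I \<subseteq> V - {v}" using insert.prems(1) insert.hyps by blast
      show "\<And>u. u \<in> I \<Longrightarrow> incident E u = {}" using insert.prems(2) by blast
      show "finishes (V - {v} - I, E, A) A'" using insert.prems(3) by (metis Diff_insert2)
    qed
    ultimately show ?case
      using finishes_leaf[OF assms(1), of v V A A'] insert.prems(1,2) by simp
  qed simp
qed

text \<open>Without vertices nothing can change. This allows the program to enter the walk also
  after peeling has consumed the whole graph.\<close>

lemma finishes_empty: "finishes ({}, {}, A) A' \<Longrightarrow> A' = A"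
proof -
  assume "finishes ({}, {}, A) A'"
  then obtain c E where c: "cycle_step\<^sup>*\<^sup>* ({}, {}, A) c" and l: "leaf_step\<^sup>*\<^sup>* c ({}, E, A')"
    by (auto simp: finishes_def while_do_def)
  have "\<not> is_cycle {} vs" for vs :: "'a list"
    by (cases vs) (auto simp: is_cycle_def cycle_edges_Cons)
  then have "\<not> cycle_step ({}, {}, A) d" for d :: "'a config"
    by (auto elim: cycle_step.cases)
  with c have "c = ({}, {}, A)" by (metis converse_rtranclpE)
  with l show "A' = A" by (metis converse_rtranclpE no_leaf_step_empty prod.inject)
qed

section \<open>Rounds whose peel loop is already stuck\<close>

lemma rounds_finish:
  assumes "V \<noteq> {}" and stuck: "\<And>d. \<not> peel_step w l (V, E, A) d"
    and "\<forall>v\<in>V. int (wdeg w E v) = \<lceil>2 * edge_density w V E\<rceil>" and "finishes (V, E, A) A'"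
  shows "rounds w l (V, E, A) A'"
proof -
  obtain c' E'' where "while_do cycle_step (V, E, A) c'" "leaf_step\<^sup>*\<^sup>* c' ({}, E'', A')"
    using assms(4) unfolding finishes_def by blast
  moreover have "while_do (peel_step w l) (V, E, A) (V, E, A)"
    using stuck by (simp add: while_do_def)
  ultimately show ?thesis
    using assms(1,3) rounds.rounds_exit[of w l "(V, E, A)" V E A _ c' "{}" E'' A']
    by (auto simp: while_do_def no_leaf_step_empty)
qed

lemma rounds_again:
  assumes "V \<noteq> {}" and "\<And>d. \<not> peel_step w l (V, E, A) d"
    and "\<not> (\<forall>v\<in>V. int (wdeg w E v) = \<lceil>2 * edge_density w V E\<rceil>)"
    and "rounds w (edge_density w V E) (V, E, A) A'"
  shows "rounds w l (V, E, A) A'"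
  using assms rounds.rounds_repeat[of w l "(V, E, A)" V E A] by (auto simp: while_do_def)

lemma no_peel_step: "(\<And>v. v \<in> V \<Longrightarrow> \<lceil>2 * l\<rceil> \<le> int (wdeg w E v)) \<Longrightarrow> \<not> peel_step w l (V, E, A) d"
  by (auto elim!: peel_step.cases) fastforce

text \<open>A version of \<open>rounds\<close> with the loops unrolled, in the form in which the program executes them.\<close>

inductive completes :: "('a set \<Rightarrow> nat) \<Rightarrow> real \<Rightarrow> 'a config \<Rightarrow> ('a \<times> 'a) set \<Rightarrow> bool"
  for w :: "'a set \<Rightarrow> nat" where
  completes_empty: "completes w l ({}, E, A) A"
| completes_peel: "peel_step w l c c' \<Longrightarrow> completes w l c' A \<Longrightarrow> completes w l c A"
| completes_again:
    "\<lbrakk> V \<noteq> {}; \<And>d. \<not> peel_step w l (V, E, A) d;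
       \<not> (\<forall>v\<in>V. int (wdeg w E v) = \<lceil>2 * edge_density w V E\<rceil>);
       completes w (edge_density w V E) (V, E, A) A' \<rbrakk> \<Longrightarrow> completes w l (V, E, A) A'"
| completes_finish:
    "\<lbrakk> V \<noteq> {}; \<And>d. \<not> peel_step w l (V, E, A) d;
       \<forall>v\<in>V. int (wdeg w E v) = \<lceil>2 * edge_density w V E\<rceil>;
       finishes (V, E, A) A' \<rbrakk> \<Longrightarrow> completes w l (V, E, A) A'"

lemma completes_rounds: "completes w l c A \<Longrightarrow> rounds w l c A"
proof (induction rule: completes.induct)
  case (completes_empty l E A)
  then show ?case
    by (intro rounds.rounds_empty[of _ _ _ E]) (auto simp: while_do_def elim: peel_step.cases)
qed (auto intro: rounds_peel rounds_again rounds_finish)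

text \<open>If the total weight is positive, the first round peels all isolated vertices; otherwise the
  first round exits immediately and they are removed as leaves.\<close>

lemma orientation_algorithm_nonisolated:
  assumes graph: "simple_graph V E" and X: "X = {v \<in> V. incident E v \<noteq> {}}"
    and start: "completes w (edge_density w V E) (X, E, {}) A"
  shows "orientation_algorithm w V E A"
proof -
  let ?l = "edge_density w V E"
  have finV: "finite V" and sub: "\<And>e. e \<in> E \<Longrightarrow> e \<subseteq> V \<and> e \<noteq> {}"
    using graph by (auto simp: simple_graph_def)
  then have finE: "finite E" by (meson Pow_iff finite_Pow_iff finite_subset subsetI)
  have VX: "V - (V - X) = X" and iso: "\<And>v. v \<in> V - X \<Longrightarrow> incident E v = {}" using X by auto
  have V0: "E = {}" if "X = {}"
    using that sub unfolding X incident_def by blast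
  show ?thesis
  proof (cases "(\<Sum>e\<in>E. w e) = 0")
    case False
    then have "V \<noteq> {}" using sub by (metis bot.extremum_uniqueI equals0I sum.empty)
    then have "0 < real (card V)" using finV by (simp add: card_gt_0_iff)
    moreover have "0 < real (\<Sum>e\<in>E. w e)" using False by (simp only: of_nat_0_less_iff neq0_conv)
    ultimately have "0 < ?l" unfolding edge_density_def by (rule divide_pos_pos[rotated])
    \<comment> \<open>For positive \<open>l\<close> the bound
      \<open>\<lceil>2 * l\<rceil> - 1\<close> is at least 0, so vertices of degree 0 are
      peeled.\<close>
    then have "1 \<le> \<lceil>2 * ?l\<rceil>" by linarith
    have "(peel_step w ?l)\<^sup>*\<^sup>* (V, E, {}) (V - (V - X), E, {})"
    proof (rule remove_isolated_vertices)
      fix V' v and A :: "('a \<times> 'a) set"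
      assume "v \<in> V - X" "v \<in> V'"
      then show "peel_step w ?l (V', E, A) (V' - {v}, E - incident E v, A \<union> arcs_towards E v)"
        using iso \<open>1 \<le> \<lceil>2 * ?l\<rceil>\<close> by (intro peel_step.intros) (auto simp: wdeg_def)
    qed (use iso finV in auto)
    then show ?thesis
      unfolding orientation_algorithm_def
      using completes_rounds[OF start] rounds_peel_rtrancl VX by metis
  next
    case True
    \<comment> \<open>Total weight zero, possibly with edges of weight 0: all weighted degrees and
      all densities are 0, nothing can be peeled and the exit test succeeds at once.\<close>
    then have w0: "\<And>e. e \<in> E \<Longrightarrow> w e = 0" using finE by simp
    have l0: "edge_density w Y E = 0" for Y using True by (simp add: edge_density_def)
    have wd: "wdeg w E v = 0" for v using w0 by (auto simp: wdeg_def incident_def)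
    have stuck: "\<not> peel_step w 0 (Y, E, A) d" for Y A d
      by (rule no_peel_step) (simp add: wd)
    have "X = {} \<and> A = {} \<or> finishes (X, E, {}) A"
      using start unfolding l0 by (cases rule: completes.cases) (auto simp: stuck l0 wd)
    then have "finishes (V, E, {}) A"
    proof
      assume "X = {} \<and> A = {}"
      then show ?thesis using finishes_no_edges[OF finV] V0 by auto
    next
      assume "finishes (X, E, {}) A"
      then show ?thesis
        using finishes_isolated[OF finE, of "V - X" V] finV iso VX by auto
    qed
    show ?thesis
    \<comment> \<open>\<open>rounds_exit\<close> requires a vertex, so the empty graph goes through
      \<open>completes_empty\<close>.\<close>
    proof (cases "V = {}")
      case True
      then have "E = {}" using sub by auto
      then have "A = {}" using \<open>finishes (V, E, {}) A\<close> True finishes_empty by blast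
      then show ?thesis
        using True \<open>E = {}\<close> unfolding orientation_algorithm_def
        by (intro completes_rounds) (auto intro: completes_empty)
    next
      case False
      then show ?thesis
        using \<open>finishes (V, E, {}) A\<close> unfolding orientation_algorithm_def l0
        by (intro rounds_finish) (auto simp: stuck wd l0)
    qed
  qed
qed

text \<open>The walk returns to the stack vertex \<open>x\<close>: the segment \<open>x # q\<close>
  is popped as a cycle and \<open>p @ [x]\<close> stays. The bound on \<open>length q\<close> makes
  the cycle long enough for \<open>is_cycle\<close>.\<close>

lemma walk_cycle:
  assumes "distinct (p @ x # q)" "2 \<le> length q" "{last (x # q), x} \<in> U" "path_edges (p @ x # q) \<inter> U = {}"
  shows "cycle_step (V, U \<union> path_edges (p @ x # q), A)
    (V, (U - {{last (x # q), x}}) \<union> path_edges (p @ [x]), A \<union> insert (last (x # q), x) (path_arcs (x # q)))"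
proof -
  have "is_cycle (U \<union> path_edges (p @ x # q)) (x # q)"
    using assms by (auto simp: is_cycle_def cycle_edges_Cons path_edges_append[of p x q])
  then have "cycle_step (V, U \<union> path_edges (p @ x # q), A)
    (V, U \<union> path_edges (p @ x # q) - cycle_edges (x # q), A \<union> cycle_arcs (x # q))"
    by (rule cycle_step.intros)
  \<comment> \<open>The kept prefix and the popped segment share only the vertex \<open>x\<close>,
    and an edge of a distinct path has two ends; so removing the cycle spares the prefix.\<close>
  moreover have "path_edges (p @ [x]) \<inter> path_edges (x # q) = {}"
  proof -
    have "e \<subseteq> {x}" if "e \<in> path_edges (p @ [x])" "e \<in> path_edges (x # q)" for e
      using path_edges_subset[OF that(1)] path_edges_subset[OF that(2)] assms(1) by auto
    moreover have "\<not> e \<subseteq> {x}" if "e \<in> path_edges (x # q)" for e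
    proof -
      have "u \<noteq> v" if "(u, v) \<in> path_arcs r" "distinct r" for u v :: 'a and r
        using that by (induction r rule: induct_list012) (auto dest: path_arcs_subset)
      then show ?thesis using that assms(1) unfolding path_edges_def by fastforce
    qed
    ultimately show ?thesis by blast
  qed
  then have "U \<union> path_edges (p @ x # q) - cycle_edges (x # q) = (U - {{last (x # q), x}}) \<union> path_edges (p @ [x])"
    using assms(3,4) unfolding cycle_edges_Cons path_edges_append[of p x q] by blast
  ultimately show ?thesis by (simp add: cycle_arcs_Cons)
qed

text \<open>The top \<open>v\<close> of the stack has no remaining edges, so its only edge is the
  one by which it was entered. The leaf rule directs this edge towards \<open>v\<close>, which is
  the walking direction already recorded.\<close>

lemma walk_leaf:
  assumes "distinct (p @ [a, v])" "incident U v = {}"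
  shows "incident (U \<union> path_edges (p @ [a, v])) v = {{a, v}}"
    and "U \<union> path_edges (p @ [a, v]) - {{a, v}} = U \<union> path_edges (p @ [a])"
    and "arcs_towards (U \<union> path_edges (p @ [a, v])) v = {(a, v)}"
proof -
  have "v \<notin> e" if "e \<in> path_edges (p @ [a])" for e
    using path_edges_subset[OF that] assms(1) by auto
  then show 1: "incident (U \<union> path_edges (p @ [a, v])) v = {{a, v}}"
    and "U \<union> path_edges (p @ [a, v]) - {{a, v}} = U \<union> path_edges (p @ [a])"
    using assms(2) by (auto simp: incident_def path_edges_append[of p a "[v]"])
  have "arcs_towards {{a, v}} v = {(a, v)}"
    using assms(1) by (auto simp: arcs_towards_def doubleton_eq_iff)
  then show "arcs_towards (U \<union> path_edges (p @ [a, v])) v = {(a, v)}"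
    using arcs_towards_incident 1 by metis
qed

text \<open>Handshake lemma, by exchanging the summations. It makes \<open>2 * l\<close> the average
  degree, so that minimum degree and density can be compared.\<close>

lemma wdeg_handshake:
  assumes "finite V" "finite E" "\<And>e. e \<in> E \<Longrightarrow> e \<subseteq> V \<and> card e = 2"
  shows "(\<Sum>v\<in>V. wdeg w E v) = 2 * (\<Sum>e\<in>E. w e)"
proof -
  have "(\<Sum>v\<in>V. wdeg w E v) = (\<Sum>v\<in>V. \<Sum>e\<in>E. if v \<in> e then w e else 0)"
    using assms(2) by (simp add: wdeg_def incident_def sum.inter_filter)
  also have "\<dots> = (\<Sum>e\<in>E. \<Sum>v\<in>V. if v \<in> e then w e else 0)" by (rule sum.swap)
  also have "\<dots> = (\<Sum>e\<in>E. 2 * w e)"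
  proof (rule sum.cong[OF refl])
    fix e assume "e \<in> E"
    then have "{v \<in> V. v \<in> e} = e" "card e = 2" using assms(3) by auto
    then show "(\<Sum>v\<in>V. if v \<in> e then w e else 0) = 2 * w e"
      using assms(1) by (simp add: sum.inter_filter[symmetric])
  qed
  finally show ?thesis by (simp add: sum_distrib_left)
qed

text \<open>Rounding up by truncated division, so that \<open>\<lceil>2 * l\<rceil>\<close> can be
  computed on the machine.\<close>

lemma ceiling_divide_nat: "0 < b \<Longrightarrow> \<lceil>real a / real b\<rceil> = int ((a + b - 1) div b)"
proof -
  assume b: "0 < b"
  let ?q = "(a + b - 1) div b"
  have "?q * b + (a + b - 1) mod b = a + b - 1" "(a + b - 1) mod b < b"
    using b by simp_all
  then have "?q * b < a + b" "a \<le> ?q * b" using b by linarith+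
  then have "real ?q * real b < real a + real b" "real a \<le> real ?q * real b"
    by (metis of_nat_add of_nat_less_iff of_nat_mult, metis of_nat_le_iff of_nat_mult)
  then have "real ?q - 1 < real a / real b" "real a / real b \<le> real ?q"
    using b by (auto simp: field_simps)
  then show ?thesis by (simp add: ceiling_eq_iff)
qed

section \<open>Programs with credits\<close>

text \<open>Updates in a shape that simp rules can read, in place of the nested record updates of
  \<open>exec\<close>.\<close>

definition setr :: "string \<Rightarrow> nat \<Rightarrow> state \<Rightarrow> state" where
  "setr x v s = s\<lparr>regs := (regs s)(x := v)\<rparr>"

definition seta :: "string \<Rightarrow> nat \<Rightarrow> nat \<Rightarrow> state \<Rightarrow> state" where
  "seta a i v s = s\<lparr>arrs := (arrs s)(a := (arrs s a)(i := v))\<rparr>"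

lemma regs_setr [simp]: "regs (setr x v s) y = (if y = x then v else regs s y)"
  by (simp add: setr_def)

lemma arrs_setr [simp]: "arrs (setr x v s) = arrs s"
  by (simp add: setr_def)

lemma regs_seta [simp]: "regs (seta a i v s) = regs s"
  by (simp add: seta_def)

lemma arrs_seta [simp]: "arrs (seta a i v s) b = (if b = a then (arrs s a)(i := v) else arrs s b)"
  by (simp add: seta_def)

text \<open>Credits: \<open>run B c s T Q\<close> says that \<open>c\<close> halts and that some state reached and some number
  of credits not exceeding the part of \<open>T\<close> left over satisfy \<open>Q\<close>.\<close>

definition run :: "nat \<Rightarrow> com \<Rightarrow> state \<Rightarrow> nat \<Rightarrow> (state \<Rightarrow> nat \<Rightarrow> bool) \<Rightarrow> bool" where
  "run B c s T Q \<longleftrightarrow> (\<exists>t s' T'. exec B c s t s' \<and> t + T' \<le> T \<and> Q s' T')"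

lemma runI: "exec B c s t s' \<Longrightarrow> t + T' \<le> T \<Longrightarrow> Q s' T' \<Longrightarrow> run B c s T Q"
  by (auto simp: run_def)

lemma run_Seq: "run B p s T (\<lambda>s' T'. run B q s' T' Q) \<Longrightarrow> run B (Seq p q) s T Q"
proof -
  assume "run B p s T (\<lambda>s' T'. run B q s' T' Q)"
  then obtain t s' T' t' s'' T'' where "exec B p s t s'" "t + T' \<le> T" "exec B q s' t' s''"
    "t' + T'' \<le> T'" "Q s'' T''"
    unfolding run_def by blast
  then show ?thesis by (intro runI[OF exec_Seq]) auto
qed

lemma run_Cond:
  assumes "fits B b s" and "cost b + 1 + T' \<le> T"
    and "aval b s \<noteq> 0 \<Longrightarrow> run B p s T' Q" and "aval b s = 0 \<Longrightarrow> run B q s T' Q"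
  shows "run B (Cond b p q) s T Q"
proof (cases "aval b s = 0")
  case True
  then obtain t s' U where "exec B q s t s'" "t + U \<le> T'" "Q s' U" using assms(4) by (auto simp: run_def)
  then show ?thesis using assms(1,2) True by (intro runI[OF exec_CondFalse]) auto
next
  case False
  then obtain t s' U where "exec B p s t s'" "t + U \<le> T'" "Q s' U" using assms(3) by (auto simp: run_def)
  then show ?thesis using assms(1,2) False by (intro runI[OF exec_CondTrue]) auto
qed

text \<open>Frame rule: \<open>F\<close> credits are withheld from \<open>c\<close> and are
  available again afterwards.\<close>

lemma run_conseq:
  assumes "run B c s T Q" and "T + F \<le> T2" and "\<And>s' T'. Q s' T' \<Longrightarrow> Q2 s' (T' + F)"
  shows "run B c s T2 Q2"
  using assms unfolding run_def by (metis add.assoc add_le_mono1 le_trans)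

lemma run_time_mono: "run B c s T Q \<Longrightarrow> T \<le> T2 \<Longrightarrow> run B c s T2 Q"
  unfolding run_def by (meson le_trans)

text \<open>The potential \<open>\<Phi>\<close> pays for the iterations and thereby also bounds their number.\<close>

lemma run_While:
  assumes "I s" and "cost b + 1 + \<Phi> s \<le> T"
    and fits: "\<And>s. I s \<Longrightarrow> fits B b s"
    and body: "\<And>s. I s \<Longrightarrow> aval b s \<noteq> 0 \<Longrightarrow>
      \<exists>T'. cost b + 1 + T' \<le> \<Phi> s \<and> run B c s T' (\<lambda>s' T''. I s' \<and> \<Phi> s' \<le> T'')"
    and exit: "\<And>s. I s \<Longrightarrow> aval b s = 0 \<Longrightarrow> Q s (\<Phi> s)"
  shows "run B (While b c) s T Q"
proof -
  \<comment> \<open>The term \<open>cost b + 1\<close> pays for the final failing test and is kept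
    apart from \<open>\<Phi>\<close>. Induction on \<open>\<Phi> s\<close> works because each
    iteration spends at least one credit.\<close>
  have "\<exists>t s'. exec B (While b c) s t s' \<and> t + \<Phi> s' \<le> \<Phi> s + cost b + 1 \<and> Q s' (\<Phi> s')" if "I s" for s
    using that
  proof (induction "\<Phi> s" arbitrary: s rule: less_induct)
    case less
    show ?case
    proof (cases "aval b s = 0")
      case True
      then have "exec B (While b c) s (cost b + 1) s" "Q s (\<Phi> s)"
        using fits[OF less.prems] exit[OF less.prems] exec_WhileFalse by blast+
      then show ?thesis by fastforce
    next
      case False
      then obtain T' t s' T'' where T: "cost b + 1 + T' \<le> \<Phi> s" "exec B c s t s'" "t + T'' \<le> T'"
        "I s'" "\<Phi> s' \<le> T''"
        using body[OF less.prems] unfolding run_def by blast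
      then obtain t' s'' where "exec B (While b c) s' t' s''" "t' + \<Phi> s'' \<le> \<Phi> s' + cost b + 1" "Q s'' (\<Phi> s'')"
        using less.hyps[of s'] by auto
      then show ?thesis
        using exec_WhileTrue[OF fits[OF less.prems] False T(2)] T by fastforce
    qed
  qed
  from this[OF assms(1)] assms(2) show ?thesis
    unfolding run_def by (metis add.assoc add.commute le_trans)
qed

section \<open>Loop-free programs: symbolic execution and worst-case cost\<close>

fun straight :: "com \<Rightarrow> bool" where
  "straight (Seq p q) \<longleftrightarrow> straight p \<and> straight q"
| "straight (Cond b p q) \<longleftrightarrow> straight p \<and> straight q"
| "straight (While b p) \<longleftrightarrow> False"
| "straight _ \<longleftrightarrow> True"

fun scost :: "com \<Rightarrow> nat" where
  "scost Skip = 1"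
| "scost (Assign x a) = cost a + 1"
| "scost (Write x i a) = cost i + cost a + 1"
| "scost (Seq p q) = scost p + scost q"
| "scost (Cond b p q) = cost b + 1 + max (scost p) (scost q)"
| "scost (While b p) = 0"

text \<open>Weakest preconditions of loop-free code, which simp executes by unfolding. Loops are
  rejected and go through \<open>run_While\<close>.\<close>

fun wp :: "nat \<Rightarrow> com \<Rightarrow> state \<Rightarrow> (state \<Rightarrow> bool) \<Rightarrow> bool" where
  "wp B Skip s Q \<longleftrightarrow> Q s"
| "wp B (Assign x a) s Q \<longleftrightarrow> fits B a s \<and> Q (setr x (aval a s) s)"
| "wp B (Write x i a) s Q \<longleftrightarrow> fits B i s \<and> fits B a s \<and> Q (seta x (aval i s) (aval a s) s)"
| "wp B (Seq p q) s Q \<longleftrightarrow> wp B p s (\<lambda>s'. wp B q s' Q)"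
| "wp B (Cond b p q) s Q \<longleftrightarrow> fits B b s \<and> (if aval b s \<noteq> 0 then wp B p s Q else wp B q s Q)"
| "wp B (While b p) s Q \<longleftrightarrow> False"

lemma wp_mono: "wp B c s Q \<Longrightarrow> (\<And>s'. Q s' \<Longrightarrow> R s') \<Longrightarrow> wp B c s R"
proof (induction c arbitrary: s Q R)
  case (Seq p q)
  from Seq.prems(1) have "wp B p s (\<lambda>s'. wp B q s' Q)" by simp
  then have "wp B p s (\<lambda>s'. wp B q s' R)"
    by (rule Seq.IH(1)) (rule Seq.IH(2)[OF _ Seq.prems(2)])
  then show ?case by simp
next
  case (Cond b p q)
  then show ?case by (auto split: if_splits)
qed auto

lemma wp_exec: "straight c \<Longrightarrow> wp B c s Q \<Longrightarrow> \<exists>t s'. exec B c s t s' \<and> t \<le> scost c \<and> Q s'"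
proof (induction c arbitrary: s Q)
  case Skip
  then show ?case by (auto intro!: exI exec_Skip)
next
  case (Assign x a)
  then show ?case using exec_Assign[of B a s x] by (auto simp: setr_def)
next
  case (Write x i a)
  then show ?case using exec_Write[of B i s a x] by (auto simp: seta_def)
next
  case (Seq p q)
  then obtain t s' where "exec B p s t s'" "t \<le> scost p" "wp B q s' Q" by (metis straight.simps(1) wp.simps(4))
  moreover from this obtain t' s'' where "exec B q s' t' s''" "t' \<le> scost q" "Q s''"
    using Seq by (metis straight.simps(1))
  ultimately show ?case by (auto intro!: exI exec_Seq)
next
  case (Cond b p q)
  show ?case
  proof (cases "aval b s = 0")
    case True
    then obtain t s' where "exec B q s t s'" "t \<le> scost q" "Q s'"
      using Cond.IH(2)[of s Q] Cond.prems by auto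
    then show ?thesis using Cond.prems True exec_CondFalse[of B b s q t s' p]
      by (intro exI[of _ "cost b + 1 + t"] exI[of _ s']) auto
  next
    case False
    then obtain t s' where "exec B p s t s'" "t \<le> scost p" "Q s'"
      using Cond.IH(1)[of s Q] Cond.prems by auto
    then show ?thesis using Cond.prems False exec_CondTrue[of B b s p t s' q]
      by (intro exI[of _ "cost b + 1 + t"] exI[of _ s']) auto
  qed
qed auto

text \<open>The block is charged \<open>scost\<close>, the worst case over its branches, whichever
  branch is taken.\<close>

lemma run_straight:
  assumes "straight c" and "wp B c s (\<lambda>s'. Q s' T')" and "scost c + T' \<le> T"
  shows "run B c s T Q"
  using wp_exec[OF assms(1,2)] assms(3) runI by (metis add_le_mono1 le_trans)

lemma run_straight_Seq:
  assumes "straight c" and "scost c + T' \<le> T" and "wp B c s (\<lambda>s'. run B d s' T' Q)"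
  shows "run B (Seq c d) s T Q"
  by (rule run_Seq, rule run_straight[OF assms(1) _ assms(2)], rule assms(3))

lemma run_call_Seq:
  assumes "run B c s T1 Q1" and "T1 + F \<le> T" and "\<And>s' T'. Q1 s' T' \<Longrightarrow> run B d s' (T' + F) Q"
  shows "run B (Seq c d) s T Q"
  by (rule run_Seq, rule run_conseq[OF assms(1,2)], rule assms(3))

text \<open>Registers and arrays whose names start with \<open>q\<close> belong to the priority queue.\<close>

definition qname :: "string \<Rightarrow> bool" where
  "qname x \<longleftrightarrow> x \<noteq> [] \<and> hd x = CHR ''q''"

lemma qname_Cons [simp]: "qname (c # x) \<longleftrightarrow> c = CHR ''q''"
  by (simp add: qname_def)

section \<open>Frame conditions: which registers and arrays survive\<close>

definition agree :: "(string \<Rightarrow> bool) \<Rightarrow> state \<Rightarrow> state \<Rightarrow> bool" where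
  "agree P s s' \<longleftrightarrow> (\<forall>x. P x \<longrightarrow> regs s' x = regs s x \<and> arrs s' x = arrs s x)"

lemma agree_refl [simp]: "agree P s s"
  by (simp add: agree_def)

lemma agree_mono: "agree P s s' \<Longrightarrow> (\<And>y. P' y \<Longrightarrow> P y) \<Longrightarrow> agree P' s s'"
  by (simp add: agree_def)

lemma agree_regs: "agree P s s' \<Longrightarrow> P y \<Longrightarrow> regs s' y = regs s y"
  and agree_arrs: "agree P s s' \<Longrightarrow> P y \<Longrightarrow> arrs s' y = arrs s y"
  by (auto simp: agree_def)

lemma agree_trans: "agree P s s' \<Longrightarrow> agree P s' s'' \<Longrightarrow> agree P s s''"
  by (simp add: agree_def)

lemma agree_setr: "agree P s s' \<Longrightarrow> \<not> P x \<Longrightarrow> agree P s (setr x v s')"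
  by (auto simp: agree_def)

lemma agree_seta: "agree P s s' \<Longrightarrow> \<not> P x \<Longrightarrow> agree P s (seta x i v s')"
  by (auto simp: agree_def)

section \<open>Child lists\<close>

abbreviation add_exp (infixl "\<oplus>" 65) where "a \<oplus> b \<equiv> Op Add a b"
abbreviation sub_exp (infixl "\<ominus>" 65) where "a \<ominus> b \<equiv> Op Sub a b"
abbreviation mul_exp (infixl "\<otimes>" 70) where "a \<otimes> b \<equiv> Op Mul a b"
abbreviation less_exp (infix "\<prec>" 50) where "a \<prec> b \<equiv> Op Less a b"
abbreviation equal_exp (infix "\<doteq>" 50) where "a \<doteq> b \<equiv> Op Equal a b"
abbreviation seq_com (infixr ";;" 60) where "p ;; q \<equiv> Seq p q"

text \<open>Row-major addresses in a matrix with rows of length \<open>n\<close> determine row and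
  column.\<close>

lemma index_eq_iff:
  fixes n :: nat
  assumes "i < n" "j < n"
  shows "p * n + i = q * n + j \<longleftrightarrow> p = q \<and> i = j"
proof
  assume eq: "p * n + i = q * n + j"
  then have "(p * n + i) div n = (q * n + j) div n" "(p * n + i) mod n = (q * n + j) mod n" by simp_all
  then show "p = q \<and> i = j" using assms by simp
qed simp

text \<open>Node \<open>p\<close> has the children \<open>qch[pn], \<dots>, qch[pn + qrk[p] - 1]\<close>, and \<open>qpar\<close> and \<open>qpos\<close> give
  the place of each \<open>v \<in> S\<close> among them.\<close>

definition lists :: "nat \<Rightarrow> nat set \<Rightarrow> state \<Rightarrow> bool" where
  "lists n S s \<longleftrightarrow> regs s ''n'' = n \<and> S \<subseteq> {..<n} \<and>
    (\<forall>v\<in>S. arrs s ''qpos'' v < arrs s ''qrk'' (arrs s ''qpar'' v) \<and>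
       arrs s ''qch'' (arrs s ''qpar'' v * n + arrs s ''qpos'' v) = v) \<and>
    (\<forall>p i. i < arrs s ''qrk'' p \<longrightarrow> arrs s ''qch'' (p * n + i) \<in> S \<and>
       arrs s ''qpar'' (arrs s ''qch'' (p * n + i)) = p \<and> arrs s ''qpos'' (arrs s ''qch'' (p * n + i)) = i)"

abbreviation children :: "nat set \<Rightarrow> state \<Rightarrow> nat \<Rightarrow> nat set" where
  "children S s p \<equiv> {v \<in> S. arrs s ''qpar'' v = p}"

lemma listsD:
  assumes "lists n S s"
  shows "regs s ''n'' = n" "finite S" "v \<in> S \<Longrightarrow> v < n"
    "v \<in> S \<Longrightarrow> arrs s ''qpos'' v < arrs s ''qrk'' (arrs s ''qpar'' v)"
    "v \<in> S \<Longrightarrow> arrs s ''qch'' (arrs s ''qpar'' v * n + arrs s ''qpos'' v) = v"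
    "i < arrs s ''qrk'' p \<Longrightarrow> arrs s ''qch'' (p * n + i) \<in> S"
    "i < arrs s ''qrk'' p \<Longrightarrow> arrs s ''qpar'' (arrs s ''qch'' (p * n + i)) = p"
    "i < arrs s ''qrk'' p \<Longrightarrow> arrs s ''qpos'' (arrs s ''qch'' (p * n + i)) = i"
  using assms finite_subset[of S "{..<n}"] unfolding lists_def by auto

text \<open>\<open>qpos\<close> inverts the enumeration of the row.\<close>

lemma lists_rk:
  assumes "lists n S s"
  shows "arrs s ''qrk'' p = card (children S s p)"
proof -
  have "bij_betw (\<lambda>i. arrs s ''qch'' (p * n + i)) {..<arrs s ''qrk'' p} (children S s p)"
    by (rule bij_betw_byWitness[where f' = "arrs s ''qpos''"]) (use listsD[OF assms] in auto)
  then show ?thesis using bij_betw_same_card by fastforce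
qed

lemma lists_rk_le:
  assumes "lists n S s"
  shows "arrs s ''qrk'' p \<le> n"
proof -
  have "children S s p \<subseteq> {..<n}" using listsD(3)[OF assms] by auto
  then show ?thesis using card_mono[of "{..<n}" "children S s p"] lists_rk[OF assms, of p] by simp
qed

lemma lists_pos_less: "lists n S s \<Longrightarrow> v \<in> S \<Longrightarrow> arrs s ''qpos'' v < n"
  by (rule order_less_le_trans[OF listsD(4) lists_rk_le])

lemma lists_last_child:
  assumes "lists n S s" and "0 < arrs s ''qrk'' p"
  shows "arrs s ''qch'' (p * n + (arrs s ''qrk'' p - Suc 0)) \<in> children S s p"
proof -
  have "arrs s ''qrk'' p - Suc 0 < arrs s ''qrk'' p" using assms(2) by simp
  from listsD(6,7)[OF assms(1) this] show ?thesis by simp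
qed

lemma lists_cong:
  assumes "agree (\<lambda>x. x \<in> {''n'', ''qpar'', ''qpos'', ''qrk'', ''qch''}) s s'"
  shows "lists n S s' = lists n S s"
  using assms by (simp add: agree_def lists_def)

text \<open>Deletion in constant time: the last child \<open>qy\<close> of the row is moved into the
  gap left by \<open>qx\<close>. If \<open>qx\<close> is itself the last child, the final writes are
  harmless.\<close>

definition detach :: com where
  "detach =
     Assign ''qp'' (Read ''qpar'' (Reg ''qx'')) ;;
     Assign ''qi'' (Read ''qpos'' (Reg ''qx'')) ;;
     Write ''qrk'' (Reg ''qp'') (Read ''qrk'' (Reg ''qp'') \<ominus> Num 1) ;;
     Assign ''qy'' (Read ''qch'' (Reg ''qp'' \<otimes> Reg ''n'' \<oplus> Read ''qrk'' (Reg ''qp''))) ;;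
     Write ''qch'' (Reg ''qp'' \<otimes> Reg ''n'' \<oplus> Reg ''qi'') (Reg ''qy'') ;;
     Write ''qpos'' (Reg ''qy'') (Reg ''qi'')"

definition attach :: com where
  "attach =
     Write ''qpar'' (Reg ''qx'') (Reg ''qt'') ;;
     Write ''qpos'' (Reg ''qx'') (Read ''qrk'' (Reg ''qt'')) ;;
     Write ''qch'' (Reg ''qt'' \<otimes> Reg ''n'' \<oplus> Read ''qrk'' (Reg ''qt'')) (Reg ''qx'') ;;
     Write ''qrk'' (Reg ''qt'') (Read ''qrk'' (Reg ''qt'') \<oplus> Num 1)"

definition move :: com where
  "move = detach ;; attach"

lemma wp_detach:
  assumes L: "lists n S s" and x: "regs s ''qx'' \<in> S"
    and B: "arrs s ''qpar'' (regs s ''qx'') * n + n \<le> B"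
    and Q: "\<And>s'. lists n (S - {regs s ''qx''}) s' \<Longrightarrow>
      agree (\<lambda>y. y \<notin> {''qp'', ''qi'', ''qy'', ''qrk'', ''qch'', ''qpos''}) s s' \<Longrightarrow> Q s'"
  shows "wp B detach s Q"
proof -
  define x where "x = regs s ''qx''"
  define p where "p = arrs s ''qpar'' x"
  define i where "i = arrs s ''qpos'' x"
  define k where "k = arrs s ''qrk'' p - 1"
  define y where "y = arrs s ''qch'' (p * n + k)"
  note D = listsD[OF L]
  have xS: "x \<in> S" "x < n" using assms D(3) by (auto simp: x_def)
  have i: "i < arrs s ''qrk'' p" "arrs s ''qch'' (p * n + i) = x" using D(4,5) xS by (auto simp: i_def p_def)
  have k: "k < arrs s ''qrk'' p" "arrs s ''qrk'' p = Suc k" using i by (auto simp: k_def)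
  have n: "arrs s ''qrk'' p \<le> n" using lists_rk_le[OF L] .
  have y: "y \<in> S" "arrs s ''qpar'' y = p" "arrs s ''qpos'' y = k" "y < n" using D k by (auto simp: y_def)
  define s' where "s' = seta ''qpos'' y i (seta ''qch'' (p * n + i) y (setr ''qy'' y
    (seta ''qrk'' p k (setr ''qi'' i (setr ''qp'' p s)))))"
  have pB: "p * n + n \<le> B" using B by (simp add: p_def x_def)
  \<comment> \<open>\<open>n\<close> is positive because \<open>x < n\<close>.\<close>
  moreover have "p \<le> p * n" using xS(2) by simp
  ultimately have bounds: "1 \<le> B" "x \<le> B" "p \<le> B" "i \<le> B" "k \<le> B" "y \<le> B" "p * n \<le> B" "n \<le> B" "p * n + k \<le> B"
    "Suc k \<le> B" "p * n + i \<le> B"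
    using xS y i k n by linarith+
  have "lists n (S - {x}) s'"
    unfolding lists_def
  proof (intro conjI ballI allI impI)
    show "regs s' ''n'' = n" using D(1) by (simp add: s'_def)
    show "S - {x} \<subseteq> {..<n}" using D(3) by auto
  next
    fix v assume v: "v \<in> S - {x}"
    then have vS: "v \<in> S" "v \<noteq> x" by auto
    have vp: "arrs s ''qpos'' v < n" using lists_pos_less[OF L vS(1)] .
    \<comment> \<open>Place and element determine each other: only \<open>y\<close> is in the last
      place \<open>k\<close> of row \<open>p\<close>, and only \<open>x\<close> in place
      \<open>i\<close>.\<close>
    have inj: "v = y \<longleftrightarrow> arrs s ''qpar'' v = p \<and> arrs s ''qpos'' v = k"
      using D(5)[OF vS(1)] y by (auto simp: y_def)
    have inj2: "\<not> (arrs s ''qpar'' v = p \<and> arrs s ''qpos'' v = i)"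
      using D(5)[OF vS(1)] vS(2) i(2) by auto
    show "arrs s' ''qpos'' v < arrs s' ''qrk'' (arrs s' ''qpar'' v)"
      using D(4)[OF vS(1)] inj inj2 i k by (auto simp: s'_def less_Suc_eq)
    show "arrs s' ''qch'' (arrs s' ''qpar'' v * n + arrs s' ''qpos'' v) = v"
      using D(5)[OF vS(1)] inj inj2 i k vp n y by (auto simp: s'_def index_eq_iff)
  next
    fix q j assume j: "j < arrs s' ''qrk'' q"
    then have jq: "j < arrs s ''qrk'' q" using k by (auto simp: s'_def split: if_splits)
    have jn: "j < n" using jq lists_rk_le[OF L, of q] by simp
    have jk: "\<not> (q = p \<and> j = k)" using j by (auto simp: s'_def)
    note Dj = D(6-8)[OF jq]
    show "arrs s' ''qch'' (q * n + j) \<in> S - {x}"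
      using Dj i k jn n y jk by (auto simp: s'_def index_eq_iff i_def p_def)
    show "arrs s' ''qpar'' (arrs s' ''qch'' (q * n + j)) = q"
      using Dj i k jn n y jk by (auto simp: s'_def index_eq_iff)
    show "arrs s' ''qpos'' (arrs s' ''qch'' (q * n + j)) = j"
      using Dj i k jn n y jk by (auto simp: s'_def index_eq_iff)
  qed
  moreover have "agree (\<lambda>y. y \<notin> {''qp'', ''qi'', ''qy'', ''qrk'', ''qch'', ''qpos''}) s s'"
    unfolding s'_def by (intro agree_seta agree_setr) simp_all
  ultimately have "Q s'" using Q by (simp add: x_def)
  then show ?thesis
    using bounds D(1) unfolding detach_def s'_def
    by (simp add: x_def[symmetric] p_def[symmetric] i_def[symmetric] k(2) y_def[symmetric])
qed

lemma wp_attach: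
  assumes L: "lists n S s" and x: "regs s ''qx'' \<notin> S" "regs s ''qx'' < n"
    and B: "regs s ''qt'' * n + n \<le> B"
    and Q: "\<And>s'. lists n (insert (regs s ''qx'') S) s' \<Longrightarrow>
      arrs s' ''qpar'' = (arrs s ''qpar'')(regs s ''qx'' := regs s ''qt'') \<Longrightarrow>
      agree (\<lambda>y. y \<notin> {''qrk'', ''qch'', ''qpos'', ''qpar''}) s s' \<Longrightarrow> Q s'"
  shows "wp B attach s Q"
proof -
  define x where "x = regs s ''qx''"
  define t where "t = regs s ''qt''"
  define k where "k = arrs s ''qrk'' t"
  note D = listsD[OF L]
  have xS: "x \<notin> S" "x < n" using assms by (auto simp: x_def)
  \<comment> \<open>Row \<open>t\<close> has a free cell because its children avoid \<open>x\<close>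
    and so number fewer than \<open>n\<close>.\<close>
  have ch: "children S s t \<subseteq> {..<n} - {x}" using D(3) xS by auto
  have "k < n"
    using card_mono[OF _ ch] xS(2) by (simp add: k_def lists_rk[OF L])
  define s' where "s' = seta ''qrk'' t (Suc k) (seta ''qch'' (t * n + k) x (seta ''qpos'' x k
    (seta ''qpar'' x t s)))"
  have tB: "t * n + n \<le> B" using B by (simp add: t_def)
  moreover have "t \<le> t * n" using xS(2) by simp
  ultimately have bounds: "1 \<le> B" "x \<le> B" "t \<le> B" "k \<le> B" "t * n \<le> B" "n \<le> B" "t * n + k \<le> B" "Suc k \<le> B"
    using xS \<open>k < n\<close> by linarith+
  have "lists n (insert x S) s'"
    unfolding lists_def
  proof (intro conjI ballI allI impI)
    show "regs s' ''n'' = n" using D(1) by (simp add: s'_def)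
    show "insert x S \<subseteq> {..<n}" using D(3) xS by auto
  next
    fix v assume v: "v \<in> insert x S"
    show "arrs s' ''qpos'' v < arrs s' ''qrk'' (arrs s' ''qpar'' v)"
      using D(4)[of v] v xS by (auto simp: s'_def k_def less_Suc_eq)
    show "arrs s' ''qch'' (arrs s' ''qpar'' v * n + arrs s' ''qpos'' v) = v"
      using D(4,5)[of v] v xS lists_pos_less[OF L, of v] \<open>k < n\<close> by (auto simp: s'_def index_eq_iff k_def)
  next
    fix q j assume j: "j < arrs s' ''qrk'' q"
    show "arrs s' ''qch'' (q * n + j) \<in> insert x S"
      "arrs s' ''qpar'' (arrs s' ''qch'' (q * n + j)) = q"
      "arrs s' ''qpos'' (arrs s' ''qch'' (q * n + j)) = j"
    proof (atomize (full), cases "q = t \<and> j = k")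
      case False
      then have jq: "j < arrs s ''qrk'' q" using j by (auto simp: s'_def k_def split: if_splits)
      have jn: "j < n" using jq lists_rk_le[OF L, of q] by simp
      have "arrs s ''qch'' (q * n + j) \<noteq> x" using D(6)[OF jq] xS by auto
      then show "arrs s' ''qch'' (q * n + j) \<in> insert x S \<and>
        arrs s' ''qpar'' (arrs s' ''qch'' (q * n + j)) = q \<and>
        arrs s' ''qpos'' (arrs s' ''qch'' (q * n + j)) = j"
        using D(6-8)[OF jq] jn \<open>k < n\<close> False by (auto simp: s'_def index_eq_iff)
    qed (auto simp: s'_def)
  qed
  moreover have "agree (\<lambda>y. y \<notin> {''qrk'', ''qch'', ''qpos'', ''qpar''}) s s'"
    unfolding s'_def by (intro agree_seta agree_setr) simp_all
  ultimately have "Q s'" using Q by (simp add: x_def s'_def t_def)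
  then show ?thesis
    using bounds D(1) unfolding attach_def s'_def
    by (simp add: x_def[symmetric] t_def[symmetric] k_def[symmetric])
qed

lemma wp_move:
  assumes L: "lists n S s" and x: "regs s ''qx'' \<in> S"
    and B: "arrs s ''qpar'' (regs s ''qx'') * n + n \<le> B" "regs s ''qt'' * n + n \<le> B"
    and Q: "\<And>s'. lists n S s' \<Longrightarrow>
      arrs s' ''qpar'' = (arrs s ''qpar'')(regs s ''qx'' := regs s ''qt'') \<Longrightarrow>
      agree (\<lambda>y. y \<notin> {''qp'', ''qi'', ''qy'', ''qrk'', ''qch'', ''qpos'', ''qpar''}) s s' \<Longrightarrow> Q s'"
  shows "wp B move s Q"
  unfolding move_def wp.simps
proof (rule wp_detach[OF L x B(1)])
  fix s1 assume L1: "lists n (S - {regs s ''qx''}) s1"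
    and a1: "agree (\<lambda>y. y \<notin> {''qp'', ''qi'', ''qy'', ''qrk'', ''qch'', ''qpos''}) s s1"
  have eq: "regs s1 ''qx'' = regs s ''qx''" "regs s1 ''qt'' = regs s ''qt''" "arrs s1 ''qpar'' = arrs s ''qpar''"
    using a1 by (auto simp: agree_def)
  show "wp B attach s1 Q"
  proof (rule wp_attach[OF L1])
    fix s' assume s': "lists n (insert (regs s1 ''qx'') (S - {regs s ''qx''})) s'"
      "arrs s' ''qpar'' = (arrs s1 ''qpar'')(regs s1 ''qx'' := regs s1 ''qt'')"
      "agree (\<lambda>y. y \<notin> {''qrk'', ''qch'', ''qpos'', ''qpar''}) s1 s'"
    show "Q s'"
    proof (rule Q)
      show "lists n S s'" using s'(1) x eq by (simp add: insert_absorb)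
      show "agree (\<lambda>y. y \<notin> {''qp'', ''qi'', ''qy'', ''qrk'', ''qch'', ''qpos'', ''qpar''}) s s'"
        using a1 s'(3) by (simp add: agree_def)
    qed (use s' eq in simp)
  qed (use eq x B listsD(3)[OF L] in auto)
qed

lemma straight_lists [simp]: "straight detach" "straight attach" "straight move"
  by (simp_all add: detach_def attach_def move_def)

lemma scost_lists [simp]: "scost attach = 21" "scost move = 51"
  by (simp_all add: detach_def attach_def move_def)

definition move_to :: "aexp \<Rightarrow> aexp \<Rightarrow> com" where
  "move_to e f = Assign ''qx'' e ;; Assign ''qt'' f ;; move"

text \<open>\<open>f\<close> is evaluated after \<open>qx\<close> has been written, hence the
  updated state in the premises about \<open>f\<close>.\<close>

lemma wp_move_to:
  assumes L: "lists n S s" and x: "x \<in> S" "fits B e s" "aval e s = x"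
    and t: "fits B f (setr ''qx'' x s)" "aval f (setr ''qx'' x s) = t"
    and B: "arrs s ''qpar'' x * n + n \<le> B" "t * n + n \<le> B"
    and Q: "\<And>s'. lists n S s' \<Longrightarrow> arrs s' ''qpar'' = (arrs s ''qpar'')(x := t) \<Longrightarrow>
      agree (\<lambda>y. y \<notin> {''qx'', ''qt'', ''qp'', ''qi'', ''qy'', ''qrk'', ''qch'', ''qpos'', ''qpar''}) s s' \<Longrightarrow>
      regs s' ''qx'' = x \<Longrightarrow> Q s'"
  shows "wp B (move_to e f) s Q"
proof -
  let ?s = "setr ''qt'' t (setr ''qx'' x s)"
  have "lists n S ?s" using L lists_cong[of s ?s n S] by (simp add: agree_def)
  then have "wp B move ?s Q"
  proof (rule wp_move, goal_cases)
    case (4 s')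
    have "agree (\<lambda>y. y \<notin> {''qx'', ''qt'', ''qp'', ''qi'', ''qy'', ''qrk'', ''qch'', ''qpos'', ''qpar''}) s ?s"
      by (intro agree_setr) simp_all
    moreover have "agree (\<lambda>y. y \<notin> {''qx'', ''qt'', ''qp'', ''qi'', ''qy'', ''qrk'', ''qch'', ''qpos'', ''qpar''}) ?s s'"
      using 4(3) by (rule agree_mono) auto
    ultimately have "agree (\<lambda>y. y \<notin> {''qx'', ''qt'', ''qp'', ''qi'', ''qy'', ''qrk'', ''qch'', ''qpos'', ''qpar''}) s s'"
      by (rule agree_trans)
    then show ?case
      using 4(1,2) agree_regs[OF 4(3), of "''qx''"] by (intro Q) simp_all
  qed (use x B in simp_all)
  then show ?thesis using x t unfolding move_to_def wp.simps by simp
qed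

lemma straight_move_to [simp]: "straight (move_to e f)"
  by (simp add: move_to_def)

lemma scost_move_to [simp]: "scost (move_to e f) = cost e + cost f + 53"
  by (simp add: move_to_def)

text \<open>Keys are the entries of \<open>deg\<close>; the operations receive their arguments in \<open>x\<close> and \<open>d\<close>, and
  \<open>cfind\<close> answers in \<open>u\<close>.  \<open>PQ0\<close> is the state of the queue during its construction.\<close>

locale priority_queue =
  fixes B n M :: nat
    and cins cfind cdel cdec :: com
    and PQ0 PQ :: "nat set \<Rightarrow> state \<Rightarrow> bool"
    and removable :: "state \<Rightarrow> nat \<Rightarrow> bool"
    and pot :: "nat set \<Rightarrow> state \<Rightarrow> nat"
    and kf kc k0 :: nat
    and decrement :: "nat \<Rightarrow> bool"
  assumes PQ0_init: "regs s ''n'' = n \<Longrightarrow> (\<And>y. qname y \<Longrightarrow> regs s y = 0 \<and> arrs s y = (\<lambda>_. 0)) \<Longrightarrow>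
      PQ0 {} s \<and> pot {} s \<le> k0"
    and PQ0_PQ: "PQ0 X s \<Longrightarrow> PQ X s"
    and run_insert: "PQ0 X s \<Longrightarrow> regs s ''x'' \<notin> X \<Longrightarrow> regs s ''x'' < n \<Longrightarrow>
      arrs s ''deg'' (regs s ''x'') \<le> M \<Longrightarrow>
      run B cins s (kc + pot X s) (\<lambda>s' T. PQ0 (insert (regs s ''x'') X) s' \<and>
        pot (insert (regs s ''x'') X) s' \<le> T \<and> agree (\<lambda>y. \<not> qname y) s s')"
    and run_find: "PQ X s \<Longrightarrow> X \<noteq> {} \<Longrightarrow>
      run B cfind s (kf + pot X s) (\<lambda>s' T. PQ X s' \<and> pot X s' \<le> T \<and> removable s' (regs s' ''u'') \<and>
        regs s' ''u'' \<in> X \<and> (\<forall>v\<in>X. arrs s ''deg'' (regs s' ''u'') \<le> arrs s ''deg'' v) \<and>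
        agree (\<lambda>y. \<not> qname y \<and> y \<noteq> ''u'') s s')"
    and run_delete: "PQ X s \<Longrightarrow> regs s ''x'' \<in> X \<Longrightarrow> removable s (regs s ''x'') \<Longrightarrow>
      run B cdel s (kf + pot X s) (\<lambda>s' T. PQ (X - {regs s ''x''}) s' \<and>
        pot (X - {regs s ''x''}) s' \<le> T \<and> agree (\<lambda>y. \<not> qname y) s s')"
    and run_decrease: "PQ X s \<Longrightarrow> regs s ''x'' \<in> X \<Longrightarrow> decrement (regs s ''d'') \<Longrightarrow>
      regs s ''d'' \<le> arrs s ''deg'' (regs s ''x'') \<Longrightarrow>
      run B cdec s (kc + pot X s) (\<lambda>s' T. PQ X s' \<and> pot X s' \<le> T \<and>
        arrs s' ''deg'' = (arrs s ''deg'')(regs s ''x'' := arrs s ''deg'' (regs s ''x'') - regs s ''d'') \<and>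
        agree (\<lambda>y. \<not> qname y \<and> y \<noteq> ''deg'') s s')"
    and PQ_cong: "agree (\<lambda>y. qname y \<or> y = ''n'' \<or> y = ''deg'') s s' \<Longrightarrow>
      PQ0 X s' = PQ0 X s \<and> PQ X s' = PQ X s \<and> pot X s' = pot X s \<and> removable s' = removable s"

section \<open>Bucket queue\<close>

definition bucket_insert :: com where
  "bucket_insert = Assign ''qx'' (Reg ''x'') ;; Assign ''qt'' (Read ''deg'' (Reg ''x'')) ;; attach"

text \<open>The cursor \<open>qcur\<close> is a lower bound of all keys and climbs to the first
  nonempty bucket.\<close>

definition bucket_find :: com where
  "bucket_find =
     While (Read ''qrk'' (Reg ''qcur'') \<doteq> Num 0) (Assign ''qcur'' (Reg ''qcur'' \<oplus> Num 1)) ;;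
     Assign ''u'' (Read ''qch'' (Reg ''qcur'' \<otimes> Reg ''n''))"

definition bucket_delete :: com where
  "bucket_delete = Assign ''qx'' (Reg ''x'') ;; detach"

definition bucket_decrease :: com where
  "bucket_decrease =
     Write ''deg'' (Reg ''x'') (Read ''deg'' (Reg ''x'') \<ominus> Reg ''d'') ;;
     Assign ''qx'' (Reg ''x'') ;; Assign ''qt'' (Read ''deg'' (Reg ''x'')) ;; move ;;
     Cond (Reg ''qt'' \<prec> Reg ''qcur'') (Assign ''qcur'' (Reg ''qt'')) Skip"

definition buckets :: "nat \<Rightarrow> nat \<Rightarrow> nat set \<Rightarrow> state \<Rightarrow> bool" where
  "buckets n M X s \<longleftrightarrow> lists n X s \<and>
    (\<forall>v\<in>X. arrs s ''qpar'' v = arrs s ''deg'' v \<and> arrs s ''deg'' v \<le> M \<and> regs s ''qcur'' \<le> arrs s ''deg'' v)"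

text \<open>One climb of the cursor costs 9 and is paid by 10 credits; a decrement by one lowers the
  cursor by at most one and so has to add at most 10.\<close>

definition bucket_pot :: "nat \<Rightarrow> nat set \<Rightarrow> state \<Rightarrow> nat" where
  "bucket_pot M X s = 10 * (M - regs s ''qcur'')"

text \<open>The buckets are the rows \<open>0\<close> to \<open>M\<close> of length
  \<open>n\<close>. During construction the cursor has to stay at 0, since a key of any size may
  follow; later keys only fall, by one at a time. Every element may be deleted.\<close>

lemma buckets_pq:
  assumes B: "(M + 1) * n + M \<le> B"
  shows "priority_queue B n M bucket_insert bucket_find bucket_delete bucket_decrease
    (\<lambda>X s. buckets n M X s \<and> regs s ''qcur'' = 0) (buckets n M) (\<lambda>_ _. True) (bucket_pot M) 100 100 (10 * M) (\<lambda>d. d = 1)"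
proof
  fix s :: state
  assume "regs s ''n'' = n" "\<And>y. qname y \<Longrightarrow> regs s y = 0 \<and> arrs s y = (\<lambda>_. 0)"
  then show "(buckets n M {} s \<and> regs s ''qcur'' = 0) \<and> bucket_pot M {} s \<le> 10 * M"
    by (auto simp: buckets_def lists_def bucket_pot_def)
next
  fix X and s :: state
  let ?x = "regs s ''x''"
  assume P: "buckets n M X s \<and> regs s ''qcur'' = 0" and x: "?x \<notin> X" "?x < n" "arrs s ''deg'' ?x \<le> M"
  have L: "lists n X s" using P by (simp add: buckets_def)
  have b: "arrs s ''deg'' ?x * n + n \<le> B"
    using B mult_le_mono1[OF x(3), of n] unfolding add_mult_distrib by linarith
  define s1 where "s1 = setr ''qt'' (arrs s ''deg'' ?x) (setr ''qx'' ?x s)"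
  have L1: "lists n X s1" using lists_cong[of s s1] L by (simp add: s1_def agree_def)
  have s1: "regs s1 ''qx'' = ?x" "regs s1 ''qt'' = arrs s ''deg'' ?x" by (auto simp: s1_def)
  have "wp B attach s1 (\<lambda>s'. (buckets n M (insert ?x X) s' \<and> regs s' ''qcur'' = 0) \<and>
        bucket_pot M (insert ?x X) s' \<le> bucket_pot M X s \<and> agree (\<lambda>y. \<not> qname y) s s')"
  proof (rule wp_attach[OF L1], goal_cases)
    case (4 s')
    have "agree (\<lambda>y. \<not> qname y) s s1"
      unfolding s1_def by (intro agree_setr) simp_all
    moreover have "agree (\<lambda>y. \<not> qname y) s1 s'"
      using 4(3) by (rule agree_mono) auto
    ultimately have ag: "agree (\<lambda>y. \<not> qname y) s s'" by (rule agree_trans)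
    have "regs s' ''qcur'' = 0" "arrs s' ''deg'' = arrs s ''deg''" "arrs s' ''qpar'' = (arrs s ''qpar'')(?x := arrs s ''deg'' ?x)"
      using 4(2) P agree_regs[OF 4(3), of "''qcur''"] agree_arrs[OF 4(3), of "''deg''"] by (auto simp: s1_def)
    moreover have "lists n (insert ?x X) s'" using 4(1) by (simp add: s1)
    ultimately show ?case
      using P x(3) ag by (simp add: buckets_def bucket_pot_def)
  qed (use x b s1 in auto)
  moreover have "?x \<le> B" "arrs s ''deg'' ?x \<le> B" using b x(2,3) B by (simp_all add: trans_le_add2)
  ultimately have "wp B bucket_insert s (\<lambda>s'. (buckets n M (insert ?x X) s' \<and> regs s' ''qcur'' = 0) \<and>
        bucket_pot M (insert ?x X) s' \<le> bucket_pot M X s \<and> agree (\<lambda>y. \<not> qname y) s s')"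
    by (simp add: bucket_insert_def s1_def)
  then show "run B bucket_insert s (100 + bucket_pot M X s) (\<lambda>s' T. (buckets n M (insert ?x X) s' \<and> regs s' ''qcur'' = 0) \<and>
        bucket_pot M (insert ?x X) s' \<le> T \<and> agree (\<lambda>y. \<not> qname y) s s')"
    by (intro run_straight[where T' = "bucket_pot M X s"]) (simp add: bucket_insert_def, assumption, simp add: bucket_insert_def)
next
  fix X and s :: state
  assume P: "buckets n M X s" and "X \<noteq> {}"
  then obtain v where v: "v \<in> X" by blast
  let ?b = "Read ''qrk'' (Reg ''qcur'') \<doteq> Num 0"
  define I where "I = (\<lambda>s'. buckets n M X s' \<and> agree (\<lambda>y. y \<noteq> ''qcur'') s s')"
  have qcur: "regs s' ''qcur'' \<le> M" "M \<le> B" "1 \<le> B" "n \<le> B" "arrs s' ''qrk'' (regs s' ''qcur'') \<le> B" if "I s'" for s'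
  proof -
    have *: "buckets n M X s'" using that by (simp add: I_def)
    then show "regs s' ''qcur'' \<le> M" using v by (fastforce simp: buckets_def)
    have n: "0 < n" using v * listsD(3) unfolding buckets_def by fastforce
    then show "M \<le> B" "1 \<le> B" "n \<le> B" using B by (auto simp: add_mult_distrib)
    then show "arrs s' ''qrk'' (regs s' ''qcur'') \<le> B"
      using * lists_rk_le unfolding buckets_def by (meson le_trans)
  qed
  \<comment> \<open>An element whose key equals the cursor is in the bucket at the cursor; so if
    that bucket is empty, all keys are larger.\<close>
  have kid: "arrs s' ''qrk'' (regs s' ''qcur'') \<noteq> 0" if "I s'" "v \<in> X" "arrs s' ''deg'' v = regs s' ''qcur''" for s' v
  proof -
    have "arrs s' ''qpar'' v = regs s' ''qcur''" "lists n X s'" using that by (auto simp: I_def buckets_def)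
    then show ?thesis using listsD(4)[of n X s' v] that(2) by simp
  qed
  show "run B bucket_find s (100 + bucket_pot M X s) (\<lambda>s' T. buckets n M X s' \<and> bucket_pot M X s' \<le> T \<and> True \<and>
        regs s' ''u'' \<in> X \<and> (\<forall>v\<in>X. arrs s ''deg'' (regs s' ''u'') \<le> arrs s ''deg'' v) \<and>
        agree (\<lambda>y. \<not> qname y \<and> y \<noteq> ''u'') s s')"
    unfolding bucket_find_def
  proof (rule run_call_Seq)
    show "run B (While ?b (Assign ''qcur'' (Reg ''qcur'' \<oplus> Num 1))) s (10 + bucket_pot M X s)
      (\<lambda>s' T. I s' \<and> aval ?b s' = 0 \<and> T = bucket_pot M X s')"
    proof (rule run_While[where I = I and \<Phi> = "bucket_pot M X"])
      show "I s" using P by (simp add: I_def)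
    next
      fix s' assume "I s'"
      then show "fits B ?b s'" using qcur[of s'] by simp
    next
      fix s' assume I: "I s'" and "aval ?b s' \<noteq> 0"
      then have 0: "arrs s' ''qrk'' (regs s' ''qcur'') = 0" by (simp split: if_splits)
      have less: "regs s' ''qcur'' < arrs s' ''deg'' v" if "v \<in> X" for v
      proof -
        have "regs s' ''qcur'' \<le> arrs s' ''deg'' v" using I that by (simp add: I_def buckets_def)
        moreover have "regs s' ''qcur'' \<noteq> arrs s' ''deg'' v" using kid[OF I that] 0 by auto
        ultimately show ?thesis by simp
      qed
      \<comment> \<open>All keys exceed the cursor and are at most \<open>M\<close>, so the search
        cannot leave the table.\<close>
      have "regs s' ''qcur'' < M"
        using less[OF v] v I unfolding I_def buckets_def by fastforce
      moreover have "I (setr ''qcur'' (Suc (regs s' ''qcur'')) s')"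
      proof -
        have "lists n X (setr ''qcur'' (Suc (regs s' ''qcur'')) s')"
          using I lists_cong[of s' "setr ''qcur'' (Suc (regs s' ''qcur'')) s'"]
          by (auto simp: I_def buckets_def agree_def)
        then show ?thesis using I less by (auto simp: I_def buckets_def agree_def Suc_le_eq)
      qed
      ultimately show "\<exists>T'. cost ?b + 1 + T' \<le> bucket_pot M X s' \<and>
        run B (Assign ''qcur'' (Reg ''qcur'' \<oplus> Num 1)) s' T' (\<lambda>s' T''. I s' \<and> bucket_pot M X s' \<le> T'')"
        using qcur[OF I]
        by (intro exI[of _ "4 + bucket_pot M X (setr ''qcur'' (Suc (regs s' ''qcur'')) s')"] conjI run_straight[where T' = "bucket_pot M X (setr ''qcur'' (Suc (regs s' ''qcur'')) s')"])
          (auto simp: bucket_pot_def)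
    qed auto
  next
    fix s' T assume s': "I s' \<and> aval ?b s' = 0 \<and> T = bucket_pot M X s'"
    let ?u = "arrs s' ''qch'' (regs s' ''qcur'' * n)"
    have L: "lists n X s'" using s' by (simp add: I_def buckets_def)
    have u: "?u \<in> X" "arrs s' ''qpar'' ?u = regs s' ''qcur''"
      using listsD(6,7)[OF L, of 0 "regs s' ''qcur''"] s' by (auto split: if_splits)
    have "regs s' ''qcur'' * n \<le> B" using qcur(1)[of s'] s' B
      by (metis add_leD1 add_mult_distrib le_trans mult_le_mono1)
    moreover have "?u \<le> B" using listsD(3)[OF L u(1)] qcur(4)[of s'] s' by simp
    moreover have "regs s' ''qcur'' \<le> B" using qcur[of s'] s' by simp
    moreover have "regs s' ''n'' = n" using listsD(1)[OF L] .
    moreover have "buckets n M X (setr ''u'' ?u s')"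
      using s' lists_cong[of s' "setr ''u'' ?u s'" n X] by (auto simp: I_def buckets_def agree_def)
    moreover have "agree (\<lambda>y. \<not> qname y \<and> y \<noteq> ''u'') s (setr ''u'' ?u s')"
    proof (rule agree_setr)
      have "agree (\<lambda>y. y \<noteq> ''qcur'') s s'" using s' by (simp add: I_def)
      then show "agree (\<lambda>y. \<not> qname y \<and> y \<noteq> ''u'') s s'" by (rule agree_mono) auto
    qed simp
    moreover have "\<forall>v\<in>X. arrs s ''deg'' ?u \<le> arrs s ''deg'' v"
      using s' u agree_arrs[of _ s s' "''deg''"] unfolding I_def buckets_def by fastforce
    ultimately show "run B (Assign ''u'' (Read ''qch'' (Reg ''qcur'' \<otimes> Reg ''n''))) s' (T + 90)
      (\<lambda>s' T. buckets n M X s' \<and> bucket_pot M X s' \<le> T \<and> True \<and>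
        regs s' ''u'' \<in> X \<and> (\<forall>v\<in>X. arrs s ''deg'' (regs s' ''u'') \<le> arrs s ''deg'' v) \<and>
        agree (\<lambda>y. \<not> qname y \<and> y \<noteq> ''u'') s s')"
      using s' u(1) qcur(4)[of s']
      by (intro run_straight[where T' = T]) (simp_all add: bucket_pot_def)
  qed simp
next
  fix X and s :: state
  let ?x = "regs s ''x''"
  assume P: "buckets n M X s" and x: "?x \<in> X"
  have L: "lists n X (setr ''qx'' ?x s)"
    using P lists_cong[of s "setr ''qx'' ?x s"] by (simp add: buckets_def agree_def)
  have "arrs s ''qpar'' ?x \<le> M" using P x by (auto simp: buckets_def)
  then have b: "arrs s ''qpar'' ?x * n + n \<le> B" using B mult_le_mono1[of "arrs s ''qpar'' ?x" M n] unfolding add_mult_distrib by linarith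
  have "wp B detach (setr ''qx'' ?x s) (\<lambda>s'. buckets n M (X - {?x}) s' \<and>
        bucket_pot M (X - {?x}) s' \<le> bucket_pot M X s \<and> agree (\<lambda>y. \<not> qname y) s s')"
  proof (rule wp_detach[OF L], goal_cases)
    case (3 s')
    have "agree (\<lambda>y. \<not> qname y) s (setr ''qx'' ?x s)"
      by (intro agree_setr) simp_all
    moreover have "agree (\<lambda>y. \<not> qname y) (setr ''qx'' ?x s) s'"
      using 3(2) by (rule agree_mono) auto
    ultimately have ag: "agree (\<lambda>y. \<not> qname y) s s'" by (rule agree_trans)
    have "regs s' ''qcur'' = regs s ''qcur''" "arrs s' ''deg'' = arrs s ''deg''" "arrs s' ''qpar'' = arrs s ''qpar''"
      using agree_regs[OF 3(2), of "''qcur''"] agree_arrs[OF 3(2), of "''deg''"] agree_arrs[OF 3(2), of "''qpar''"] by auto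
    then show ?case using P ag 3(1) by (simp add: buckets_def bucket_pot_def)
  qed (use x b in auto)
  moreover have "?x < n" using P x listsD(3) by (auto simp: buckets_def)
  ultimately have "wp B bucket_delete s (\<lambda>s'. buckets n M (X - {?x}) s' \<and>
        bucket_pot M (X - {?x}) s' \<le> bucket_pot M X s \<and> agree (\<lambda>y. \<not> qname y) s s')"
    using b by (simp add: bucket_delete_def)
  then show "run B bucket_delete s (100 + bucket_pot M X s) (\<lambda>s' T. buckets n M (X - {?x}) s' \<and>
        bucket_pot M (X - {?x}) s' \<le> T \<and> agree (\<lambda>y. \<not> qname y) s s')"
    by (intro run_straight[where T' = "bucket_pot M X s"]) (simp add: bucket_delete_def, assumption, simp add: bucket_delete_def detach_def)
next
  fix X and s :: state
  let ?x = "regs s ''x''"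
  define k where "k = arrs s ''deg'' ?x - 1"
  assume P: "buckets n M X s" and x: "?x \<in> X" and d: "regs s ''d'' = 1" "regs s ''d'' \<le> arrs s ''deg'' ?x"
  have L: "lists n X s" using P by (simp add: buckets_def)
  have "?x < n" using L x listsD(3) by auto
  have deg: "arrs s ''deg'' ?x = Suc k" "Suc k \<le> M" "arrs s ''qpar'' ?x \<le> M" "k \<le> M"
    using P x d by (auto simp: buckets_def k_def)
  then have "Suc k * n \<le> M * n" "k * n \<le> M * n" "arrs s ''qpar'' ?x * n \<le> M * n"
    by (auto intro: mult_le_mono1 simp del: mult_Suc)
  then have b: "arrs s ''qpar'' ?x * n + n \<le> B" "k * n + n \<le> B" "Suc k \<le> B" "?x \<le> B" "1 \<le> B" "M \<le> B"
    using B deg \<open>?x < n\<close> unfolding add_mult_distrib by linarith+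
  define s1 where "s1 = setr ''qt'' k (setr ''qx'' ?x (seta ''deg'' ?x k s))"
  have L1: "lists n X s1"
    using L lists_cong[of s s1] by (simp add: s1_def agree_def)
  have qc: "regs s ''qcur'' \<le> Suc k" using P x deg by (auto simp: buckets_def)
  have "wp B move s1 (\<lambda>s'. wp B (Cond (Reg ''qt'' \<prec> Reg ''qcur'') (Assign ''qcur'' (Reg ''qt'')) Skip) s'
     (\<lambda>s'. buckets n M X s' \<and> bucket_pot M X s' \<le> 10 + bucket_pot M X s \<and>
        arrs s' ''deg'' = (arrs s ''deg'')(?x := arrs s ''deg'' ?x - regs s ''d'') \<and>
        agree (\<lambda>y. \<not> qname y \<and> y \<noteq> ''deg'') s s'))"
  proof (rule wp_move[OF L1], goal_cases)
    case (4 s')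
    have ag: "agree (\<lambda>y. y \<notin> {''qp'', ''qi'', ''qy'', ''qrk'', ''qch'', ''qpos'', ''qpar''}) s1 s'" using 4(3) .
    have eq: "regs s' ''qt'' = k" "regs s' ''qcur'' = regs s ''qcur''" "arrs s' ''deg'' = (arrs s ''deg'')(?x := k)"
      "arrs s' ''qpar'' = (arrs s ''qpar'')(?x := k)"
      using 4(2) agree_regs[OF ag, of "''qt''"] agree_regs[OF ag, of "''qcur''"] agree_arrs[OF ag, of "''deg''"]
      by (auto simp: s1_def)
    have "agree (\<lambda>y. \<not> qname y \<and> y \<noteq> ''deg'') s s1"
      unfolding s1_def by (intro agree_setr agree_seta) simp_all
    moreover have "agree (\<lambda>y. \<not> qname y \<and> y \<noteq> ''deg'') s1 s'"
      using ag by (rule agree_mono) auto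
    ultimately have ag': "agree (\<lambda>y. \<not> qname y \<and> y \<noteq> ''deg'') s s'" by (rule agree_trans)
    have le: "regs s ''qcur'' \<le> arrs s ''deg'' v" if "v \<in> X" for v
      using P that by (auto simp: buckets_def)
    have bk: "buckets n M X s'" if "regs s ''qcur'' \<le> k"
      using 4(1) P eq deg that by (auto simp: buckets_def)
    have bk': "buckets n M X (setr ''qcur'' k s')" if "k < regs s ''qcur''"
    proof -
      have "lists n X (setr ''qcur'' k s')" using 4(1) lists_cong[of s' "setr ''qcur'' k s'"] by (simp add: agree_def)
      moreover have "k \<le> arrs s ''deg'' v" if "v \<in> X" for v
        using le[OF that] \<open>k < regs s ''qcur''\<close> by simp
      ultimately show ?thesis using P eq deg by (auto simp: buckets_def)
    qed
    show ?case
    \<comment> \<open>If the new key passes below the cursor, the cursor was exactly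
      \<open>Suc k\<close>, so the potential grows by 10 only.\<close>
    proof (cases "k < regs s ''qcur''")
      case True
      then have "regs s ''qcur'' = Suc k" using qc by simp
      moreover have "agree (\<lambda>y. \<not> qname y \<and> y \<noteq> ''deg'') s (setr ''qcur'' k s')"
        using ag' by (rule agree_setr) simp
      ultimately show ?thesis using True bk' eq d b deg by (simp add: bucket_pot_def k_def[symmetric])
    next
      case False
      then show ?thesis using bk eq d b deg ag' qc by (simp add: bucket_pot_def k_def[symmetric])
    qed
  qed (use x b in \<open>auto simp: s1_def\<close>)
  then have "wp B bucket_decrease s (\<lambda>s'. buckets n M X s' \<and> bucket_pot M X s' \<le> 10 + bucket_pot M X s \<and>
        arrs s' ''deg'' = (arrs s ''deg'')(?x := arrs s ''deg'' ?x - regs s ''d'') \<and>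
        agree (\<lambda>y. \<not> qname y \<and> y \<noteq> ''deg'') s s')"
    using b d deg by (simp add: bucket_decrease_def s1_def)
  then show "run B bucket_decrease s (100 + bucket_pot M X s) (\<lambda>s' T. buckets n M X s' \<and> bucket_pot M X s' \<le> T \<and>
        arrs s' ''deg'' = (arrs s ''deg'')(?x := arrs s ''deg'' ?x - regs s ''d'') \<and>
        agree (\<lambda>y. \<not> qname y \<and> y \<noteq> ''deg'') s s')"
    by (intro run_straight[where T' = "10 + bucket_pot M X s"]) (simp add: bucket_decrease_def, assumption, simp add: bucket_decrease_def)
next
  fix s s' :: state and X
  assume ag: "agree (\<lambda>y. qname y \<or> y = ''n'' \<or> y = ''deg'') s s'"
  then have "lists n X s' = lists n X s" by (intro lists_cong) (auto simp: agree_def)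
  then show "(buckets n M X s' \<and> regs s' ''qcur'' = 0) = (buckets n M X s \<and> regs s ''qcur'' = 0) \<and>
      buckets n M X s' = buckets n M X s \<and> bucket_pot M X s' = bucket_pot M X s \<and> (\<lambda>_. True) = (\<lambda>_. True)"
    using ag by (auto simp: buckets_def bucket_pot_def agree_def)
qed simp_all

section \<open>Fibonacci heaps\<close>

definition deg_of :: "nat set \<Rightarrow> (nat \<Rightarrow> nat) \<Rightarrow> nat \<Rightarrow> nat" where
  "deg_of X par p = card {v \<in> X. par v = p}"

lemma lists_deg_of: "lists n X s \<Longrightarrow> arrs s ''qrk'' p = deg_of X (arrs s ''qpar'') p"
  unfolding deg_of_def by (rule lists_rk)

text \<open>Parents \<open>\<ge> n\<close> stand for root lists.  A child that is marked has lost one of its own children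
  since it became a child.  Vertices in \<open>Y\<close> are about to be cut.\<close>

definition forest :: "nat \<Rightarrow> nat set \<Rightarrow> nat set \<Rightarrow> (nat \<Rightarrow> nat) \<Rightarrow> (nat \<Rightarrow> nat) \<Rightarrow> (nat \<Rightarrow> nat) \<Rightarrow> bool" where
  "forest n X Y par mark key \<longleftrightarrow> X \<subseteq> {..<n} \<and>
    (\<forall>v\<in>X. par v < n \<longrightarrow> par v \<in> X) \<and>
    (\<forall>v\<in>X - Y. par v < n \<longrightarrow> key (par v) \<le> key v) \<and>
    wf {(par v, v) | v. v \<in> X \<and> par v < n} \<and>
    (\<forall>v\<in>X. mark v \<le> 1) \<and>
    (\<forall>q<n. \<forall>j. card {c \<in> X - Y. par c = q \<and> deg_of X par c + mark c < j} \<le> j)"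

lemma forest_finite: "forest n X Y par mark key \<Longrightarrow> finite X"
  unfolding forest_def using finite_subset by blast

lemma deg_of_upd:
  assumes "finite X" "x \<in> X"
  shows "deg_of X (par(x := t)) q =
    (if t = par x then deg_of X par q else if q = par x then deg_of X par q - 1
     else if q = t then Suc (deg_of X par q) else deg_of X par q)"
proof -
  consider "t = par x" | "t \<noteq> par x" "q = par x" | "t \<noteq> par x" "q \<noteq> par x" "q = t"
    | "q \<noteq> par x" "q \<noteq> t" by blast
  then show ?thesis
  proof cases
    case 2
    then have "{v \<in> X. (par(x := t)) v = q} = {v \<in> X. par v = q} - {x}" by auto
    then show ?thesis using 2 assms by (simp add: deg_of_def)
  next
    case 3
    then have "{v \<in> X. (par(x := t)) v = q} = insert x {v \<in> X. par v = q}" using assms(2) by auto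
    then show ?thesis using 3 assms by (simp add: deg_of_def)
  next
    case 4
    then have "{v \<in> X. (par(x := t)) v = q} = {v \<in> X. par v = q}" by auto
    then show ?thesis using 4 by (simp add: deg_of_def)
  qed (auto simp: fun_upd_triv)
qed

text \<open>Common core of the operations that only drop tree edges. The counting clause survives
  because \<open>deg_of + mark\<close> never falls for children outside \<open>Y'\<close>, so the
  counted sets shrink.\<close>

lemma forest_subI:
  assumes "forest n X Y par mark key" and "X' \<subseteq> X"
    and "\<And>v. v \<in> X' \<Longrightarrow> par' v < n \<Longrightarrow> par' v = par v \<and> par v \<in> X'"
    and "\<And>v. v \<in> X' - Y' \<Longrightarrow> par' v < n \<Longrightarrow> v \<notin> Y \<and> key' (par v) \<le> key (par v) \<and> key v \<le> key' v"
    and "\<And>v. v \<in> X' \<Longrightarrow> mark' v \<le> 1"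
    and "\<And>c. c \<in> X' - Y' \<Longrightarrow> par' c < n \<Longrightarrow> deg_of X par c + mark c \<le> deg_of X' par' c + mark' c"
  shows "forest n X' Y' par' mark' key'"
  unfolding forest_def
proof (intro conjI allI impI ballI)
  note F = assms(1)[unfolded forest_def]
  show "X' \<subseteq> {..<n}" using F assms(2) by blast
  show "par' v \<in> X'" if "v \<in> X'" "par' v < n" for v using assms(3)[OF that] by simp
  show "key' (par' v) \<le> key' v" if v: "v \<in> X' - Y'" "par' v < n" for v
  proof -
    have "v \<in> X - Y" "par v < n" "par' v = par v" using assms(2,3,4) v by auto
    then have "key (par v) \<le> key v" using F by blast
    then show ?thesis using assms(4)[OF v] \<open>par' v = par v\<close> by simp
  qed
  show "wf {(par' v, v) | v. v \<in> X' \<and> par' v < n}"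
  proof (rule wf_subset)
    show "wf {(par v, v) | v. v \<in> X \<and> par v < n}" using F by blast
    show "{(par' v, v) | v. v \<in> X' \<and> par' v < n} \<subseteq> {(par v, v) | v. v \<in> X \<and> par v < n}"
      using assms(2,3) by force
  qed
  show "mark' v \<le> 1" if "v \<in> X'" for v using assms(5)[OF that] .
  show "card {c \<in> X' - Y'. par' c = q \<and> deg_of X' par' c + mark' c < j} \<le> j" if "q < n" for q j
  proof -
    have "{c \<in> X' - Y'. par' c = q \<and> deg_of X' par' c + mark' c < j}
      \<subseteq> {c \<in> X - Y. par c = q \<and> deg_of X par c + mark c < j}"
      using assms(2,3,4,6) that by fastforce
    then have "card {c \<in> X' - Y'. par' c = q \<and> deg_of X' par' c + mark' c < j}
      \<le> card {c \<in> X - Y. par c = q \<and> deg_of X par c + mark c < j}"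
      using forest_finite[OF assms(1)] by (intro card_mono) auto
    also have "\<dots> \<le> j" using F that by blast
    finally show ?thesis .
  qed
qed

lemma forest_mark_le: "forest n X Y par mark key \<Longrightarrow> v \<in> X \<Longrightarrow> mark v \<le> 1"
  by (simp add: forest_def)

lemma forest_par: "forest n X Y par mark key \<Longrightarrow> v \<in> X \<Longrightarrow> par v < n \<Longrightarrow> par v \<in> X"
  by (simp add: forest_def)

lemma forest_less: "forest n X Y par mark key \<Longrightarrow> v \<in> X \<Longrightarrow> v < n"
  by (auto simp: forest_def)

text \<open>\<open>Y\<close> suspends only conditions between a vertex and its parent, and a root
  has no parent.\<close>

lemma forest_drop_root:
  assumes "forest n X (insert y Y) par mark key" "n \<le> par y"
  shows "forest n X Y par mark key"
  by (rule forest_subI[OF assms(1)]) (use assms(2) in \<open>auto dest: forest_par[OF assms(1)] forest_mark_le[OF assms(1)]\<close>)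

text \<open>The parent of \<open>x\<close> loses a child without being marked, so its
  \<open>deg_of + mark\<close> drops and it is suspended in turn. \<open>x\<close> becomes a root
  and leaves the suspended set.\<close>

lemma forest_cut:
  assumes "forest n X Y par mark key" "x \<in> X" "n \<le> t"
  shows "forest n X (insert (par x) Y - {x}) (par(x := t)) mark key"
proof (rule forest_subI[OF assms(1)])
  fix c assume c: "c \<in> X - (insert (par x) Y - {x})" "(par(x := t)) c < n"
  then have "c < n" using forest_less[OF assms(1)] by blast
  then have "c \<noteq> t" using assms(3) by simp
  have "c \<noteq> x" using c(2) assms(3) by auto
  with c(1) have "c \<noteq> par x" by blast
  with \<open>c \<noteq> t\<close> show "deg_of X par c + mark c \<le> deg_of X (par(x := t)) c + mark c"
    using deg_of_upd[OF forest_finite[OF assms(1)] assms(2), of par t c] by auto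
next
  show "(par(x := t)) v = par v \<and> par v \<in> X" if "v \<in> X" "(par(x := t)) v < n" for v
    using that assms(3) forest_par[OF assms(1)] by (auto split: if_splits)
  show "v \<notin> Y \<and> key (par v) \<le> key (par v) \<and> key v \<le> key v"
    if "v \<in> X - (insert (par x) Y - {x})" "(par(x := t)) v < n" for v
    using that assms(3) by (auto split: if_splits)
qed (use forest_mark_le[OF assms(1)] in auto)

text \<open>An unmarked parent makes up for the lost child by its mark: \<open>deg_of + mark\<close>
  does not fall, and the cascade can stop.\<close>

lemma forest_cut_mark:
  assumes "forest n X Y par mark key" "x \<in> X" "n \<le> t" "mark (par x) = 0"
  shows "forest n X (Y - {x}) (par(x := t)) (mark(par x := 1)) key"
proof (rule forest_subI[OF assms(1)])
  fix c assume c: "c \<in> X - (Y - {x})" "(par(x := t)) c < n"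
  then have "c < n" using forest_less[OF assms(1)] by blast
  then have ne: "c \<noteq> t" using assms(3) by simp
  show "deg_of X par c + mark c \<le> deg_of X (par(x := t)) c + (mark(par x := 1)) c"
  proof (cases "c = par x")
    case True
    then have "deg_of X (par(x := t)) c = deg_of X par c - 1"
      using deg_of_upd[OF forest_finite[OF assms(1)] assms(2), of par t c] ne by auto
    then show ?thesis using True assms(4) by simp
  next
    case False
    then have "deg_of X (par(x := t)) c = deg_of X par c"
      using deg_of_upd[OF forest_finite[OF assms(1)] assms(2), of par t c] ne by auto
    then show ?thesis using False by simp
  qed
next
  show "(par(x := t)) v = par v \<and> par v \<in> X" if "v \<in> X" "(par(x := t)) v < n" for v
    using that assms(3) forest_par[OF assms(1)] by (auto split: if_splits)
  show "v \<notin> Y \<and> key (par v) \<le> key (par v) \<and> key v \<le> key v"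
    if "v \<in> X - (Y - {x})" "(par(x := t)) v < n" for v
    using that assms(3) by (auto split: if_splits)
qed (use forest_mark_le[OF assms(1)] in auto)

text \<open>Linking roots with equally many children keeps the counting clause: the new child
  \<open>r\<close> has as many children as \<open>t\<close> had, so it is counted only if
  \<open>j\<close> exceeds that number, and then all children of \<open>t\<close> together are at
  most \<open>j\<close>.\<close>

lemma forest_link:
  assumes F: "forest n X {} par mark key" and r: "r \<in> X" "n \<le> par r" and t: "t \<in> X" "n \<le> par t" "r \<noteq> t"
    and eq: "deg_of X par r = deg_of X par t" and key: "key t \<le> key r"
  shows "forest n X {} (par(r := t)) (mark(r := 0)) key"
  unfolding forest_def
proof (intro conjI allI impI ballI)
  note F' = F[unfolded forest_def]
  let ?par = "par(r := t)" and ?mark = "mark(r := 0)"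
  have fin: "finite X" using forest_finite[OF F] .
  have tn: "t < n" using forest_less[OF F t(1)] .
  show "X \<subseteq> {..<n}" using F' by blast
  show "?par v \<in> X" if "v \<in> X" "?par v < n" for v
    using that F' t by (auto split: if_splits)
  show "key (?par v) \<le> key v" if v: "v \<in> X - {}" "?par v < n" for v
    using that F' key by (auto split: if_splits)
  show "wf {(?par v, v) | v. v \<in> X \<and> ?par v < n}"
  proof -
    let ?R = "{(par v, v) | v. v \<in> X \<and> par v < n}"
    \<comment> \<open>\<open>t\<close> is a root, hence the child of nothing, so the new edge closes
      no circle.\<close>
    have "(r, t) \<notin> ?R\<^sup>*"
      using t(2,3) by (auto elim: rtranclE)
    then have "wf (insert (t, r) ?R)" using F' by (simp add: wf_insert)
    moreover have "{(?par v, v) | v. v \<in> X \<and> ?par v < n} \<subseteq> insert (t, r) ?R" by auto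
    ultimately show ?thesis by (rule wf_subset)
  qed
  show "?mark v \<le> 1" if "v \<in> X" for v using that F' by simp
  show "card {c \<in> X - {}. ?par c = q \<and> deg_of X ?par c + ?mark c < j} \<le> j" if q: "q < n" for q j
  proof -
    let ?D = "{c \<in> X - {}. ?par c = q \<and> deg_of X ?par c + ?mark c < j}"
    let ?C = "{c \<in> X - {}. par c = q \<and> deg_of X par c + mark c < j}"
    have C: "card ?C \<le> j" using F' q by blast
    have t_ne: "t \<noteq> par r" using r(2) tn by simp
    have deg: "deg_of X ?par c = (if c = t then Suc (deg_of X par c) else deg_of X par c)" if "c < n" for c
      using deg_of_upd[OF fin r(1), of par t c] t_ne r(2) that by auto
    have old: "c \<in> ?C" if "c \<in> ?D" "c \<noteq> r" for c
      using that deg[of c] forest_less[OF F, of c] by (auto split: if_splits)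
    show ?thesis
    proof (cases "r \<in> ?D")
      case False
      then have "?D \<subseteq> ?C" using old by blast
      then have "card ?D \<le> card ?C" using fin by (intro card_mono) auto
      then show ?thesis using C by simp
    next
      case True
      then have q: "q = t" and less: "deg_of X par t < j"
        using deg[of r] forest_less[OF F r(1)] t(3) eq by auto
      \<comment> \<open>All children of \<open>t\<close>, old and new, number at most
        \<open>deg_of X par t + 1\<close>, which is at most \<open>j\<close>.\<close>
      have "?D \<subseteq> insert r {c \<in> X. par c = t}" using q by auto
      then have "card ?D \<le> card (insert r {c \<in> X. par c = t})" using fin by (intro card_mono) auto
      also have "\<dots> \<le> Suc (deg_of X par t)" using fin by (simp add: card_insert_if deg_of_def)
      finally show ?thesis using less by simp
    qed
  qed
qed

lemma forest_insert:
  assumes F: "forest n X {} par mark key" and x: "x \<notin> X" "x < n" "n \<le> par x" "mark x \<le> 1"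
  shows "forest n (insert x X) {} par mark key"
  unfolding forest_def
proof (intro conjI allI impI ballI)
  note F' = F[unfolded forest_def]
  have fin: "finite X" using forest_finite[OF F] .
  show "insert x X \<subseteq> {..<n}" using F' x by auto
  show "par v \<in> insert x X" if "v \<in> insert x X" "par v < n" for v
    using that F' x by auto
  show "key (par v) \<le> key v" if v: "v \<in> insert x X - {}" "par v < n" for v
    using that F' x by auto
  have "{(par v, v) | v. v \<in> insert x X \<and> par v < n} = {(par v, v) | v. v \<in> X \<and> par v < n}"
    using x by auto
  then show "wf {(par v, v) | v. v \<in> insert x X \<and> par v < n}" using F' by auto
  show "mark v \<le> 1" if "v \<in> insert x X" for v using that F' x by auto
  show "card {c \<in> insert x X - {}. par c = q \<and> deg_of (insert x X) par c + mark c < j} \<le> j" if q: "q < n" for q j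
  proof -
    have "{v \<in> insert x X. par v = c} = {v \<in> X. par v = c}" if "c < n" for c using x that by auto
    then have "deg_of (insert x X) par c = deg_of X par c" if "c < n" for c using that by (simp add: deg_of_def)
    then have "deg_of (insert x X) par c = deg_of X par c" if "c \<in> X" for c
      using forest_less[OF F that] by blast
    moreover have "par x \<noteq> q" using x q by simp
    ultimately have "{c \<in> insert x X - {}. par c = q \<and> deg_of (insert x X) par c + mark c < j}
      = {c \<in> X - {}. par c = q \<and> deg_of X par c + mark c < j}"
      by auto
    moreover have "card {c \<in> X - {}. par c = q \<and> deg_of X par c + mark c < j} \<le> j"
      using F' q by blast
    ultimately show ?thesis by simp
  qed
qed

lemma forest_delete:
  assumes F: "forest n X {} par mark key" and x: "x \<in> X" "n \<le> par x" "deg_of X par x = 0"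
  shows "forest n (X - {x}) {} par mark key"
proof (rule forest_subI[OF F])
  have "finite {v \<in> X. par v = x}" using forest_finite[OF F] by simp
  with x(3) have no: "v \<in> X \<Longrightarrow> par v \<noteq> x" for v unfolding deg_of_def by simp
  show "par v = par v \<and> par v \<in> X - {x}" if "v \<in> X - {x}" "par v < n" for v
    using that no forest_par[OF F, of v] by auto
  fix c assume c: "c \<in> X - {x} - {}" "par c < n"
  then have "{v \<in> X - {x}. par v = c} = {v \<in> X. par v = c}"
    using x(2) forest_less[OF F, of c] by auto
  then show "deg_of X par c + mark c \<le> deg_of (X - {x}) par c + mark c" by (simp add: deg_of_def)
qed (auto dest: forest_mark_le[OF F])

text \<open>Climbing from \<open>v\<close> through its ancestors never increases the key, and it
  ends because the parent relation is well-founded.\<close>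

lemma forest_root:
  assumes F: "forest n X {} par mark key" and "v \<in> X"
  shows "\<exists>r\<in>X. n \<le> par r \<and> key r \<le> key v"
proof -
  note F' = F[unfolded forest_def]
  have "wf {(par v, v) | v. v \<in> X \<and> par v < n}" using F' by blast
  then show ?thesis using assms(2)
  proof (induction v rule: wf_induct_rule)
    case (less v)
    show ?case
    proof (cases "par v < n")
      case True
      then have p: "par v \<in> X" "key (par v) \<le> key v" using less.prems F' by auto
      then obtain r where "r \<in> X" "n \<le> par r" "key r \<le> key (par v)"
        using less.IH[of "par v"] True less.prems by auto
      then show ?thesis using p(2) le_trans by blast
    next
      case False
      then show ?thesis using less.prems by (intro bexI[of _ v]) auto
    qed
  qed
qed

text \<open>Of the at least \<open>j + 3\<close> children of a vertex at most \<open>j + 1\<close> have fewer than \<open>j\<close> children,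
  so the number of vertices at least halves when the number of children goes up by 3.\<close>

lemma forest_many_children:
  assumes F: "forest n X {} par mark key"
  shows "2 * card {v \<in> X. j + 3 \<le> deg_of X par v} \<le> card {v \<in> X. j \<le> deg_of X par v}"
proof -
  have fin: "finite X" using forest_finite[OF F] .
  let ?N = "{v \<in> X. j + 3 \<le> deg_of X par v}"
  let ?C = "\<lambda>v. {c \<in> X. par c = v \<and> j \<le> deg_of X par c}"
  have "2 \<le> card (?C v)" if "v \<in> ?N" for v
  proof -
    \<comment> \<open>Children with fewer than \<open>j\<close> children lie in \<open>?S\<close>,
      since a mark adds at most 1; by the counting clause there are at most \<open>j + 1\<close> of
      them.\<close>
    let ?S = "{c \<in> X - {}. par c = v \<and> deg_of X par c + mark c < j + 1}"
    have "card ?S \<le> j + 1" using F forest_less[OF F, of v] that unfolding forest_def by blast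
    moreover have "{c \<in> X. par c = v} \<subseteq> ?C v \<union> ?S"
      using forest_mark_le[OF F] by fastforce
    then have "deg_of X par v \<le> card (?C v \<union> ?S)" using fin unfolding deg_of_def by (intro card_mono) auto
    then have "deg_of X par v \<le> card (?C v) + card ?S" using card_Un_le le_trans by blast
    ultimately show ?thesis using that by auto
  qed
  then have "(\<Sum>v\<in>?N. 2) \<le> (\<Sum>v\<in>?N. card (?C v))" by (rule sum_mono)
  \<comment> \<open>Different vertices have disjoint sets of children.\<close>
  also have "\<dots> = card (\<Union>v\<in>?N. ?C v)"
    using fin by (intro card_UN_disjoint[symmetric]) auto
  also have "\<dots> \<le> card {v \<in> X. j \<le> deg_of X par v}"
    using fin by (intro card_mono) auto
  finally show ?thesis by simp
qed

text \<open>Halving \<open>h\<close> times in steps of three: a vertex with \<open>3 * h\<close>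
  children would force at least \<open>2 ^ h\<close> vertices. This is weaker than the golden ratio
  bound but of the same order.\<close>

lemma forest_rank_less:
  assumes F: "forest n X {} par mark key" and v: "v \<in> X" and h: "n < 2 ^ h"
  shows "deg_of X par v < 3 * h"
proof (rule ccontr)
  assume "\<not> ?thesis"
  then have "v \<in> {v \<in> X. 3 * h \<le> deg_of X par v}" using v by simp
  moreover have "finite {v \<in> X. 3 * h \<le> deg_of X par v}" using forest_finite[OF F] by simp
  ultimately have pos: "0 < card {v \<in> X. 3 * h \<le> deg_of X par v}" unfolding card_gt_0_iff by blast
  have pow: "2 ^ i * card {v \<in> X. 3 * i \<le> deg_of X par v} \<le> card X" for i
  proof (induction i)
    case (Suc i)
    have "2 ^ Suc i * card {v \<in> X. 3 * i + 3 \<le> deg_of X par v}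
      = 2 ^ i * (2 * card {v \<in> X. 3 * i + 3 \<le> deg_of X par v})" by simp
    also have "\<dots> \<le> 2 ^ i * card {v \<in> X. 3 * i \<le> deg_of X par v}"
      using forest_many_children[OF F] by (rule mult_le_mono2)
    also have "\<dots> \<le> card X" by (rule Suc.IH)
    finally show ?case by (simp only: mult_Suc_right add.commute)
  qed (use forest_finite[OF F] in \<open>auto intro: card_mono\<close>)
  have "2 ^ h * 1 \<le> 2 ^ h * card {v \<in> X. 3 * h \<le> deg_of X par v}"
    using pos by (intro mult_le_mono2) simp
  also have "\<dots> \<le> card X" by (rule pow)
  also have "\<dots> \<le> n"
    using card_mono[of "{..<n}" X] F unfolding forest_def by simp
  finally show False using h by simp
qed

text \<open>Entries are shifted by one because 0, the initial content of memory, means an empty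
  slot. The equivalence forces slotted roots to have pairwise different numbers of children.\<close>

definition slots :: "nat \<Rightarrow> nat set \<Rightarrow> (nat \<Rightarrow> nat) \<Rightarrow> (nat \<Rightarrow> nat) \<Rightarrow> bool" where
  "slots n X par slot \<longleftrightarrow> (\<forall>d r. slot d = Suc r \<longleftrightarrow> r \<in> X \<and> par r = Suc n \<and> deg_of X par r = d)"

lemma slotsD: "slots n X par slot \<Longrightarrow> slot d = Suc r \<Longrightarrow> r \<in> X \<and> par r = Suc n \<and> deg_of X par r = d"
  by (simp add: slots_def)

lemma slots_add:
  assumes "slots n X par slot" "X \<subseteq> {..<n}" "r \<in> X" "par r = n" "slot (deg_of X par r) = 0"
  shows "slots n X (par(r := Suc n)) (slot(deg_of X par r := Suc r))"
proof -
  have fin: "finite X" using assms(2) finite_subset by blast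
  have deg: "deg_of X (par(r := Suc n)) q = deg_of X par q" if "q \<in> X" for q
    using deg_of_upd[OF fin assms(3), of par "Suc n" q] assms(2,4) that by auto
  have no: "par q = Suc n \<Longrightarrow> q \<in> X \<Longrightarrow> deg_of X par q \<noteq> deg_of X par r" for q
    using assms(1,5) unfolding slots_def by (metis nat.distinct(1))
  show ?thesis
    unfolding slots_def
  proof (intro allI)
    fix d q
    have "slot d = Suc q \<longleftrightarrow> q \<in> X \<and> par q = Suc n \<and> deg_of X par q = d"
      using assms(1) by (simp add: slots_def)
    then show "(slot(deg_of X par r := Suc r)) d = Suc q \<longleftrightarrow>
        q \<in> X \<and> (par(r := Suc n)) q = Suc n \<and> deg_of X (par(r := Suc n)) q = d"
      using deg[of q] no[of q] assms(3,4) by (cases "q = r") auto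
  qed
qed

text \<open>The new parent map is left general since the removed root may be linked below another
  root, receive a child, or just return to list \<open>n\<close>.\<close>

lemma slots_remove:
  assumes "slots n X par slot" "q \<in> X" "par q = Suc n"
    and "\<And>v. v \<in> X \<Longrightarrow> par' v = Suc n \<longleftrightarrow> par v = Suc n \<and> v \<noteq> q"
    and "\<And>v. v \<in> X \<Longrightarrow> par v = Suc n \<Longrightarrow> v \<noteq> q \<Longrightarrow> deg_of X par' v = deg_of X par v"
  shows "slots n X par' (slot(deg_of X par q := 0))"
  unfolding slots_def
proof (intro allI)
  fix d v
  have sl: "slot d = Suc v \<longleftrightarrow> v \<in> X \<and> par v = Suc n \<and> deg_of X par v = d" for d v
    using assms(1) by (simp add: slots_def)
  have "v = q" if "v \<in> X" "par v = Suc n" "deg_of X par v = deg_of X par q"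
    using sl[of "deg_of X par q" v] sl[of "deg_of X par q" q] that assms(2,3) by simp
  then show "(slot(deg_of X par q := 0)) d = Suc v \<longleftrightarrow>
      v \<in> X \<and> par' v = Suc n \<and> deg_of X par' v = d"
    using sl[of d v] assms(4,5)[of v] by auto
qed

text \<open>Node \<open>n\<close> is the root list, node \<open>n + 1\<close> the list of the roots that have a slot.\<close>

definition fheap :: "nat \<Rightarrow> nat \<Rightarrow> nat set \<Rightarrow> nat set \<Rightarrow> state \<Rightarrow> bool" where
  "fheap n M X Y s \<longleftrightarrow> lists n X s \<and> forest n X Y (arrs s ''qpar'') (arrs s ''qmark'') (arrs s ''deg'') \<and>
    (\<forall>v\<in>X. arrs s ''deg'' v \<le> M \<and> arrs s ''qpar'' v \<le> n + 1) \<and> slots n X (arrs s ''qpar'') (arrs s ''qslot'')"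

text \<open>Between queue operations all roots are in list \<open>n\<close>, so that all slots are
  empty.\<close>

definition fib :: "nat \<Rightarrow> nat \<Rightarrow> nat set \<Rightarrow> state \<Rightarrow> bool" where
  "fib n M X s \<longleftrightarrow> fheap n M X {} s \<and> (\<forall>v\<in>X. arrs s ''qpar'' v \<noteq> n + 1)"

text \<open>Only marks of non-roots count; a root is unmarked when it is linked.\<close>

definition marked :: "nat \<Rightarrow> nat set \<Rightarrow> state \<Rightarrow> nat set" where
  "marked n X s = {v \<in> X. arrs s ''qpar'' v < n \<and> arrs s ''qmark'' v = 1}"

text \<open>The usual potential of trees and marks. A mark is worth more than a tree, so a cascading
  cut, which turns a marked vertex into a root, releases 400 credits.\<close>

definition fib_pot :: "nat \<Rightarrow> nat set \<Rightarrow> state \<Rightarrow> nat" where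
  "fib_pot n X s = 800 * arrs s ''qrk'' n + 1200 * card (marked n X s)"

section \<open>The heap operations as programs\<close>

definition last_child :: "aexp \<Rightarrow> aexp" where
  "last_child p = Read ''qch'' (p \<otimes> Reg ''n'' \<oplus> (Read ''qrk'' p \<ominus> Num 1))"

definition fib_insert :: com where
  "fib_insert = Write ''qmark'' (Reg ''x'') (Num 0) ;;
     Assign ''qx'' (Reg ''x'') ;; Assign ''qt'' (Reg ''n'') ;; attach"

text \<open>The last root of list \<open>n\<close> either occupies the slot of its degree or is
  linked with the root found there. The winner is put or left in list \<open>n\<close>, as its new
  degree has to be looked up again.\<close>

definition fib_consolidate :: com where
  "fib_consolidate =
     Assign ''qr'' (last_child (Reg ''n'')) ;;
     Assign ''qd'' (Read ''qrk'' (Reg ''qr'')) ;;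
     Assign ''qs'' (Read ''qslot'' (Reg ''qd'')) ;;
     Cond (Reg ''qs'' \<doteq> Num 0)
      (Write ''qslot'' (Reg ''qd'') (Reg ''qr'' \<oplus> Num 1) ;; move_to (Reg ''qr'') (Reg ''n'' \<oplus> Num 1))
      (Assign ''qs'' (Reg ''qs'' \<ominus> Num 1) ;;
       Write ''qslot'' (Reg ''qd'') (Num 0) ;;
       Cond (Read ''deg'' (Reg ''qs'') \<prec> Read ''deg'' (Reg ''qr''))
        (Write ''qmark'' (Reg ''qr'') (Num 0) ;; move_to (Reg ''qr'') (Reg ''qs'') ;; move_to (Reg ''qs'') (Reg ''n''))
        (Write ''qmark'' (Reg ''qs'') (Num 0) ;; move_to (Reg ''qs'') (Reg ''qr'')))"

text \<open>Slots are cleared root by root on the way back to list \<open>n\<close>, which avoids a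
  pass over the slot array. \<open>u = n\<close> means that no root has been seen yet.\<close>

definition fib_collect :: com where
  "fib_collect =
     Assign ''qr'' (last_child (Reg ''n'' \<oplus> Num 1)) ;;
     Write ''qslot'' (Read ''qrk'' (Reg ''qr'')) (Num 0) ;;
     Cond (Reg ''u'' \<doteq> Reg ''n'') (Assign ''u'' (Reg ''qr''))
      (Cond (Read ''deg'' (Reg ''qr'') \<prec> Read ''deg'' (Reg ''u'')) (Assign ''u'' (Reg ''qr'')) Skip) ;;
     move_to (Reg ''qr'') (Reg ''n'')"

definition fib_find :: com where
  "fib_find =
     While (Read ''qrk'' (Reg ''n'')) fib_consolidate ;;
     Assign ''u'' (Reg ''n'') ;;
     While (Read ''qrk'' (Reg ''n'' \<oplus> Num 1)) fib_collect"

definition fib_delete :: com where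
  "fib_delete =
     While (Read ''qrk'' (Reg ''x'')) (move_to (last_child (Reg ''x'')) (Reg ''n'')) ;;
     Assign ''qx'' (Reg ''x'') ;; detach"

text \<open>\<open>qx\<close> is the vertex to cut and \<open>qg\<close> tells whether the cascade
  goes on. It ends if \<open>qx\<close> is a root or has an unmarked parent; a marked parent is the
  next \<open>qx\<close>.\<close>

definition fib_cut :: com where
  "fib_cut =
     Assign ''qz'' (Read ''qpar'' (Reg ''qx'')) ;;
     Cond (Reg ''qz'' \<prec> Reg ''n'')
      (move_to (Reg ''qx'') (Reg ''n'') ;;
       Cond (Read ''qmark'' (Reg ''qz'') \<doteq> Num 0)
        (Write ''qmark'' (Reg ''qz'') (Num 1) ;; Assign ''qg'' (Num 0))
        (Assign ''qx'' (Reg ''qz'')))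
      (Assign ''qg'' (Num 0))"

text \<open>A non-root is cut from its parent without comparing keys, which saves a case and still
  has constant amortized cost.\<close>

definition fib_decrease :: com where
  "fib_decrease =
     Write ''deg'' (Reg ''x'') (Read ''deg'' (Reg ''x'') \<ominus> Reg ''d'') ;;
     Assign ''qx'' (Reg ''x'') ;; Assign ''qg'' (Num 1) ;;
     While (Reg ''qg'') fib_cut"

lemma fib_scost:
  "scost fib_insert = 28" "scost fib_consolidate = 146" "scost fib_collect = 85" "scost fib_cut = 72"
  "straight fib_insert" "straight fib_consolidate" "straight fib_collect" "straight fib_cut"
  by (simp_all add: fib_insert_def fib_consolidate_def fib_collect_def fib_cut_def last_child_def)

text \<open>The value bounds behind the later \<open>fits\<close> conditions. The child matrix has
  the rows \<open>0\<close> to \<open>n + 1\<close>, the last two for roots, whence the summand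
  \<open>(n + 2) * (n + 1)\<close>.\<close>

lemma fheap_bounds:
  assumes H: "fheap n M X Y s" and B: "(n + 2) * (n + 1) + M \<le> B"
  shows "regs s ''n'' = n" "n + 1 \<le> B" "M \<le> B" "t \<le> n + 1 \<Longrightarrow> t * n + n \<le> B" "arrs s ''qrk'' p \<le> n" "finite X"
    "v \<in> X \<Longrightarrow> v < n" "v \<in> X \<Longrightarrow> arrs s ''qpar'' v * n + n \<le> B" "v \<in> X \<Longrightarrow> arrs s ''deg'' v \<le> B"
    "arrs s ''qrk'' p = deg_of X (arrs s ''qpar'') p"
    "v \<in> X \<Longrightarrow> arrs s ''qmark'' v \<le> 1" "arrs s ''qslot'' d \<le> n"
proof -
  have L: "lists n X s" using H by (simp add: fheap_def)
  show "regs s ''n'' = n" "finite X" and vn: "v \<in> X \<Longrightarrow> v < n" for v using listsD[OF L] by auto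
  show "arrs s ''qrk'' p \<le> n" using lists_rk_le[OF L] .
  show "arrs s ''qrk'' p = deg_of X (arrs s ''qpar'') p" using lists_deg_of[OF L] .
  have t: "t * n + n \<le> B" if "t \<le> n + 1" for t
  proof -
    have "t * n + n \<le> (n + 1) * n + n" using that by (intro add_le_mono1 mult_le_mono1)
    also have "\<dots> \<le> B" using B by simp
    finally show ?thesis .
  qed
  then show "t \<le> n + 1 \<Longrightarrow> t * n + n \<le> B" .
  show "n + 1 \<le> B" "M \<le> B" using B by simp_all
  then show "v \<in> X \<Longrightarrow> arrs s ''deg'' v \<le> B" using H le_trans unfolding fheap_def by blast
  show "v \<in> X \<Longrightarrow> arrs s ''qpar'' v * n + n \<le> B" using H t unfolding fheap_def by blast
  show "v \<in> X \<Longrightarrow> arrs s ''qmark'' v \<le> 1" using H by (auto simp: fheap_def forest_def)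
  show "arrs s ''qslot'' d \<le> n"
  proof (cases "arrs s ''qslot'' d")
    case (Suc r)
    then have "r \<in> X" using H slotsD by (auto simp: fheap_def)
    then show ?thesis using Suc vn[of r] by simp
  qed simp
qed

lemma fheap_last_child:
  assumes H: "fheap n M X Y s" and B: "(n + 2) * (n + 1) + M \<le> B" and p: "p \<le> n + 1" "0 < arrs s ''qrk'' p"
    and e: "aval e s = p" "fits B e s"
  defines "c \<equiv> aval (last_child e) s"
  shows "c \<in> X" "arrs s ''qpar'' c = p" "fits B (last_child e) s"
proof -
  note b = fheap_bounds[OF H B]
  have L: "lists n X s" using H by (simp add: fheap_def)
  have c: "c = arrs s ''qch'' (p * n + (arrs s ''qrk'' p - Suc 0))"
    by (simp add: c_def last_child_def b(1) e)
  show cX: "c \<in> X" "arrs s ''qpar'' c = p" using lists_last_child[OF L p(2)] by (simp_all add: c)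
  have "p * n + (arrs s ''qrk'' p - Suc 0) \<le> B" using b(4)[OF p(1)] b(5)[of p] by linarith
  then show "fits B (last_child e) s"
    using e b(1,2) b(5)[of p] b(7)[OF cX(1)] c by (simp add: last_child_def)
qed

section \<open>Minimum search by consolidation\<close>

lemma fheap_cong:
  assumes "agree (\<lambda>y. qname y \<or> y = ''n'' \<or> y = ''deg'') s s'"
  shows "fheap n M X Y s' = fheap n M X Y s" "fib n M X s' = fib n M X s" "fib_pot n X s' = fib_pot n X s"
proof -
  have "lists n X s' = lists n X s" using assms by (intro lists_cong) (auto simp: agree_def)
  then show "fheap n M X Y s' = fheap n M X Y s" "fib n M X s' = fib n M X s" "fib_pot n X s' = fib_pot n X s"
    using assms unfolding fheap_def fib_def fib_pot_def marked_def by (simp_all add: agree_def)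
qed

text \<open>Changing the root list is a cut from a parent outside \<open>X\<close>, so no vertex
  gets suspended.\<close>

lemma forest_cut_root:
  assumes "forest n X {} par mark key" "x \<in> X" "n \<le> par x" "n \<le> t"
  shows "forest n X {} (par(x := t)) mark key"
proof -
  have "X - (insert (par x) {} - {x}) = X - {}" using assms(2,3) forest_less[OF assms(1)] by fastforce
  then show ?thesis using forest_cut[OF assms(1,2,4)] unfolding forest_def by simp
qed

text \<open>Occupying a slot moves a root from list \<open>n\<close> to list \<open>n + 1\<close>,
  linking shortens list \<open>n + 1\<close>; with weights 2 and 1 both are progress. No counted
  mark changes, since the linked root is unmarked first.\<close>

lemma wp_fib_consolidate:
  assumes H: "fheap n M X {} s" and B: "(n + 2) * (n + 1) + M \<le> B" and pos: "0 < arrs s ''qrk'' n"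
    and Q: "\<And>s'. fheap n M X {} s' \<Longrightarrow> agree (\<lambda>y. \<not> qname y) s s' \<Longrightarrow> marked n X s' = marked n X s \<Longrightarrow>
      2 * arrs s' ''qrk'' n + arrs s' ''qrk'' (n + 1) < 2 * arrs s ''qrk'' n + arrs s ''qrk'' (n + 1) \<Longrightarrow> Q s'"
  shows "wp B fib_consolidate s Q"
proof -
  note b = fheap_bounds[OF H B]
  define r where "r = aval (last_child (Reg ''n'')) s"
  define d where "d = arrs s ''qrk'' r"
  have r: "r \<in> X" "arrs s ''qpar'' r = n" "fits B (last_child (Reg ''n'')) s"
    using fheap_last_child[OF H B, of n "Reg ''n''"] pos b(1,2) by (simp_all add: r_def)
  have L: "lists n X s" and F: "forest n X {} (arrs s ''qpar'') (arrs s ''qmark'') (arrs s ''deg'')"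
    and S: "slots n X (arrs s ''qpar'') (arrs s ''qslot'')"
    and M: "\<And>v. v \<in> X \<Longrightarrow> arrs s ''deg'' v \<le> M \<and> arrs s ''qpar'' v \<le> n + 1"
    using H by (auto simp: fheap_def)
  have Xn: "X \<subseteq> {..<n}" using b(7) by auto
  have d: "d = deg_of X (arrs s ''qpar'') r" using b(10) by (simp add: d_def)
  \<comment> \<open>Needed for strict progress: a slotted root shows that list \<open>n + 1\<close>
    is not empty.\<close>
  have rk_pos: "0 < arrs s ''qrk'' (n + 1)" if "q \<in> X" "arrs s ''qpar'' q = n + 1" for q
    using listsD(4)[OF L that(1)] that(2) by simp
  let ?P = "\<lambda>y. y \<notin> {''qx'', ''qt'', ''qp'', ''qi'', ''qy'', ''qrk'', ''qch'', ''qpos'', ''qpar''}"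
  have agq: "agree (\<lambda>y. \<not> qname y) s' s''" if "agree ?P s' s''" for s' s''
    using that by (rule agree_mono) auto
  define s1 where "s1 = setr ''qs'' (arrs s ''qslot'' d) (setr ''qd'' d (setr ''qr'' r s))"
  have s1: "arrs s1 = arrs s" "regs s1 ''qr'' = r" "regs s1 ''qd'' = d" "regs s1 ''qs'' = arrs s ''qslot'' d"
    "regs s1 ''n'' = n" "agree (\<lambda>y. \<not> qname y) s s1"
    using b(1) by (auto simp: s1_def intro!: agree_setr)
  have small: "r \<le> B" "Suc r \<le> B" "d \<le> B" "arrs s ''qslot'' d \<le> B" "1 \<le> B" "n \<le> B" "Suc n \<le> B"
    using b(7)[OF r(1)] b(2) b(5)[of r] b(12)[of d] by (simp_all add: d_def)
  have "wp B (Cond (Reg ''qs'' \<doteq> Num 0)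
      (Write ''qslot'' (Reg ''qd'') (Reg ''qr'' \<oplus> Num 1) ;; move_to (Reg ''qr'') (Reg ''n'' \<oplus> Num 1))
      (Assign ''qs'' (Reg ''qs'' \<ominus> Num 1) ;;
       Write ''qslot'' (Reg ''qd'') (Num 0) ;;
       Cond (Read ''deg'' (Reg ''qs'') \<prec> Read ''deg'' (Reg ''qr''))
        (Write ''qmark'' (Reg ''qr'') (Num 0) ;; move_to (Reg ''qr'') (Reg ''qs'') ;; move_to (Reg ''qs'') (Reg ''n''))
        (Write ''qmark'' (Reg ''qs'') (Num 0) ;; move_to (Reg ''qs'') (Reg ''qr'')))) s1 Q"
  proof (cases "arrs s ''qslot'' d")
    case 0
    define s2 where "s2 = seta ''qslot'' d (Suc r) s1"
    have L2: "lists n X s2" using L lists_cong[of s s2 n X] by (simp add: s2_def s1_def agree_def)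
    have "wp B (move_to (Reg ''qr'') (Reg ''n'' \<oplus> Num 1)) s2 Q"
    proof (rule wp_move_to[OF L2 r(1), where t = "Suc n"], goal_cases)
      case (7 s')
      have eq: "arrs s' ''qmark'' = arrs s ''qmark''" "arrs s' ''deg'' = arrs s ''deg''"
        "arrs s' ''qslot'' = (arrs s ''qslot'')(d := Suc r)" "arrs s' ''qpar'' = (arrs s ''qpar'')(r := Suc n)"
        using 7(2) agree_arrs[OF 7(3), of "''qmark''"] agree_arrs[OF 7(3), of "''deg''"] agree_arrs[OF 7(3), of "''qslot''"]
        by (simp_all add: s2_def s1)
      have rk: "arrs s' ''qrk'' n = arrs s ''qrk'' n - 1" "arrs s' ''qrk'' (n + 1) = Suc (arrs s ''qrk'' (n + 1))"
        unfolding lists_deg_of[OF 7(1)] b(10) eq(4) deg_of_upd[OF b(6) r(1), of "arrs s ''qpar''" "Suc n", unfolded r(2)]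
        by simp_all
      show ?case
      proof (rule Q)
        show "fheap n M X {} s'"
          unfolding fheap_def eq
          using 7(1) M forest_cut_root[OF F r(1), of "Suc n"] r(2) slots_add[OF S Xn r(1,2)] 0
          by (auto simp: d)
        show "agree (\<lambda>y. \<not> qname y) s s'"
          using agree_trans[OF agree_seta[OF s1(6)] agq[OF 7(3)[unfolded s2_def]]] by simp
        show "marked n X s' = marked n X s" using r(2) by (auto simp: marked_def eq)
      qed (use rk pos in simp)
    qed (use small s1 b(4)[of n] b(4)[of "Suc n"] r(2) in \<open>simp_all add: s2_def\<close>)
    then show ?thesis using 0 small s1 by (simp add: s2_def)
  next
    case (Suc q)
    have q: "q \<in> X" "arrs s ''qpar'' q = Suc n" "deg_of X (arrs s ''qpar'') q = d"
      using slotsD[OF S Suc] by auto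
    have qr: "q \<noteq> r" "q < n" "q \<le> B" using q(2) r(2) b(7)[OF q(1)] small by auto
    define s2 where "s2 = seta ''qslot'' d 0 (setr ''qs'' q s1)"
    have ag2: "agree (\<lambda>y. \<not> qname y) s s2" using s1(6) by (auto simp: s2_def intro!: agree_seta agree_setr)
    have "wp B (Cond (Read ''deg'' (Reg ''qs'') \<prec> Read ''deg'' (Reg ''qr''))
        (Write ''qmark'' (Reg ''qr'') (Num 0) ;; move_to (Reg ''qr'') (Reg ''qs'') ;; move_to (Reg ''qs'') (Reg ''n''))
        (Write ''qmark'' (Reg ''qs'') (Num 0) ;; move_to (Reg ''qs'') (Reg ''qr''))) s2 Q"
    proof (cases "arrs s ''deg'' q < arrs s ''deg'' r")
      case True
      define s3 where "s3 = seta ''qmark'' r 0 s2"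
      have L3: "lists n X s3" using L lists_cong[of s s3 n X] by (simp add: s3_def s2_def s1_def agree_def)
      have s3: "regs s3 ''qr'' = r" "regs s3 ''qs'' = q" "regs s3 ''n'' = n" "arrs s3 ''qpar'' = arrs s ''qpar''"
        by (simp_all add: s3_def s2_def s1)
      have "wp B (move_to (Reg ''qr'') (Reg ''qs'')) s3 (\<lambda>s'. wp B (move_to (Reg ''qs'') (Reg ''n'')) s' Q)"
      proof (rule wp_move_to[OF L3 r(1), where t = q], goal_cases)
        case (7 s4)
        have s4: "regs s4 ''qs'' = q" "regs s4 ''n'' = n" "arrs s4 ''qpar'' = (arrs s ''qpar'')(r := q)"
          using 7(2) agree_regs[OF 7(3), of "''qs''"] agree_regs[OF 7(3), of "''n''"] s3 by simp_all
        show ?case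
        proof (rule wp_move_to[OF 7(1) q(1), where t = n], goal_cases)
          case (7 s')
          note 72 = 7
          have ag: "agree ?P s3 s'" using agree_trans[OF \<open>agree ?P s3 s4\<close> 72(3)] .
          have eq: "arrs s' ''qmark'' = (arrs s ''qmark'')(r := 0)" "arrs s' ''deg'' = arrs s ''deg''"
            "arrs s' ''qslot'' = (arrs s ''qslot'')(d := 0)" "arrs s' ''qpar'' = (arrs s ''qpar'')(r := q, q := n)"
            using 72(2) agree_arrs[OF ag, of "''qmark''"] agree_arrs[OF ag, of "''deg''"] agree_arrs[OF ag, of "''qslot''"]
            by (simp_all add: s3_def s2_def s1 s4)
          \<comment> \<open>List \<open>n\<close> loses \<open>r\<close> and gains \<open>q\<close>;
            list \<open>n + 1\<close> loses \<open>q\<close>.\<close>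
          have deg: "deg_of X ((arrs s ''qpar'')(r := q, q := n)) v =
            (if v = n then deg_of X (arrs s ''qpar'') v - 1 + 1 else if v = Suc n then deg_of X (arrs s ''qpar'') v - 1
             else if v = q then Suc (deg_of X (arrs s ''qpar'') v) else deg_of X (arrs s ''qpar'') v)" for v
            using deg_of_upd[OF b(6) r(1), of "arrs s ''qpar''" q v]
              deg_of_upd[OF b(6) q(1), of "(arrs s ''qpar'')(r := q)" n v] q(2) r(2) qr by auto
          have rk: "arrs s' ''qrk'' n = arrs s ''qrk'' n" "arrs s' ''qrk'' (n + 1) = arrs s ''qrk'' (n + 1) - 1"
            using pos unfolding lists_deg_of[OF 72(1)] b(10) eq(4) deg by auto
          have F1: "forest n X {} ((arrs s ''qpar'')(r := q)) ((arrs s ''qmark'')(r := 0)) (arrs s ''deg'')"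
            using forest_link[OF F r(1) _ q(1)] r(2) q(2,3) qr True d by simp
          have F2: "forest n X {} ((arrs s ''qpar'')(r := q, q := n)) ((arrs s ''qmark'')(r := 0)) (arrs s ''deg'')"
            using forest_cut_root[OF F1 q(1), of n] q(2) qr by simp
          have S2: "slots n X ((arrs s ''qpar'')(r := q, q := n)) ((arrs s ''qslot'')(d := 0))"
            unfolding q(3)[symmetric]
          proof (rule slots_remove[OF S q(1,2)])
            fix v assume v: "v \<in> X"
            show "((arrs s ''qpar'')(r := q, q := n)) v = Suc n \<longleftrightarrow> arrs s ''qpar'' v = Suc n \<and> v \<noteq> q"
              using r(2) qr by auto
            assume "v \<noteq> q"
            then show "deg_of X ((arrs s ''qpar'')(r := q, q := n)) v = deg_of X (arrs s ''qpar'') v"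
              using deg[of v] b(7)[OF v] by simp
          qed
          show ?case
          proof (rule Q)
            show "fheap n M X {} s'"
              unfolding fheap_def eq using 72(1) M F2 S2 qr by auto
            show "agree (\<lambda>y. \<not> qname y) s s'"
              using agree_trans[OF agree_seta[OF ag2] agq[OF ag[unfolded s3_def]]] by simp
            show "marked n X s' = marked n X s" using r(2) q(2) by (auto simp: marked_def eq)
          qed (use rk pos rk_pos[of q] q in simp)
        qed (use small qr b(4)[of n] b(4)[of "Suc n"] q(2) in \<open>simp_all add: s4\<close>)
      qed (use small qr b(4)[of n] b(4)[of q] r(2) in \<open>simp_all add: s3\<close>)
      then show ?thesis using True small qr b(9)[OF q(1)] b(9)[OF r(1)] s1 by (simp add: s3_def s2_def)
    next
      case False
      define s3 where "s3 = seta ''qmark'' q 0 s2"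
      have L3: "lists n X s3" using L lists_cong[of s s3 n X] by (simp add: s3_def s2_def s1_def agree_def)
      have s3: "regs s3 ''qr'' = r" "regs s3 ''qs'' = q" "regs s3 ''n'' = n" "arrs s3 ''qpar'' = arrs s ''qpar''"
        by (simp_all add: s3_def s2_def s1)
      have "wp B (move_to (Reg ''qs'') (Reg ''qr'')) s3 Q"
      proof (rule wp_move_to[OF L3 q(1), where t = r], goal_cases)
        case (7 s')
        have eq: "arrs s' ''qmark'' = (arrs s ''qmark'')(q := 0)" "arrs s' ''deg'' = arrs s ''deg''"
          "arrs s' ''qslot'' = (arrs s ''qslot'')(d := 0)" "arrs s' ''qpar'' = (arrs s ''qpar'')(q := r)"
          using 7(2) agree_arrs[OF 7(3), of "''qmark''"] agree_arrs[OF 7(3), of "''deg''"] agree_arrs[OF 7(3), of "''qslot''"]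
          by (simp_all add: s3_def s2_def s1)
        have deg: "deg_of X ((arrs s ''qpar'')(q := r)) v =
            (if v = Suc n then deg_of X (arrs s ''qpar'') v - 1
             else if v = r then Suc (deg_of X (arrs s ''qpar'') v) else deg_of X (arrs s ''qpar'') v)" for v
          using deg_of_upd[OF b(6) q(1), of "arrs s ''qpar''" r v] q(2) b(7)[OF r(1)] by auto
        have rk: "arrs s' ''qrk'' n = arrs s ''qrk'' n" "arrs s' ''qrk'' (n + 1) = arrs s ''qrk'' (n + 1) - 1"
          using b(7)[OF r(1)] unfolding lists_deg_of[OF 7(1)] b(10) eq(4) deg by auto
        have F1: "forest n X {} ((arrs s ''qpar'')(q := r)) ((arrs s ''qmark'')(q := 0)) (arrs s ''deg'')"
          using forest_link[OF F q(1) _ r(1)] r(2) q(2,3) qr False d by simp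
        have S2: "slots n X ((arrs s ''qpar'')(q := r)) ((arrs s ''qslot'')(d := 0))"
          unfolding q(3)[symmetric]
        proof (rule slots_remove[OF S q(1,2)])
          fix v assume v: "v \<in> X"
          show "((arrs s ''qpar'')(q := r)) v = Suc n \<longleftrightarrow> arrs s ''qpar'' v = Suc n \<and> v \<noteq> q"
            using b(7)[OF r(1)] by auto
          assume "arrs s ''qpar'' v = Suc n" "v \<noteq> q"
          then show "deg_of X ((arrs s ''qpar'')(q := r)) v = deg_of X (arrs s ''qpar'') v"
            using deg[of v] b(7)[OF v] r(2) by auto
        qed
        show ?case
        proof (rule Q)
          show "fheap n M X {} s'"
            unfolding fheap_def eq using 7(1) M F1 S2 b(7)[OF r(1)] by auto
          show "agree (\<lambda>y. \<not> qname y) s s'"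
            using agree_trans[OF agree_seta[OF ag2] agq[OF 7(3)[unfolded s3_def]]] by simp
          show "marked n X s' = marked n X s" using q(2) by (auto simp: marked_def eq)
        qed (use rk rk_pos[of q] q in simp)
      qed (use small qr b(4)[of "Suc n"] b(4)[of r] b(7)[OF r(1)] q(2) in \<open>simp_all add: s3\<close>)
      then show ?thesis using False small qr b(9)[OF q(1)] b(9)[OF r(1)] s1 by (simp add: s3_def s2_def)
    qed
    then show ?thesis
      unfolding wp.simps(5)[of B "Reg ''qs'' \<doteq> Num 0"]
      using Suc small qr s1 by (simp add: s2_def del: wp.simps(5))
  qed
  then show ?thesis
    using r(3) small s1 b(1) unfolding fib_consolidate_def wp.simps(2,4)
    by (simp add: r_def[symmetric] d_def[symmetric] s1_def del: wp.simps)
qed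

abbreviation moved :: "string \<Rightarrow> bool" where
  "moved y \<equiv> y \<notin> {''qx'', ''qt'', ''qp'', ''qi'', ''qy'', ''qrk'', ''qch'', ''qpos'', ''qpar''}"

lemma moved_qname: "agree moved s s' \<Longrightarrow> agree (\<lambda>y. \<not> qname y) s s'"
  by (erule agree_mono) auto

lemma agree_weaken_u: "agree (\<lambda>y. \<not> qname y) s s' \<Longrightarrow> agree (\<lambda>y. \<not> qname y \<and> y \<noteq> z) s s'"
  by (erule agree_mono) auto

lemma slots_none:
  assumes "\<And>v. v \<in> X \<Longrightarrow> par v \<noteq> Suc n"
  shows "slots n X par slot \<longleftrightarrow> (\<forall>d. slot d = 0)"
proof
  assume S: "slots n X par slot"
  show "\<forall>d. slot d = 0"
  proof
    show "slot d = 0" for d using slotsD[OF S, of d "slot d - 1"] assms by (cases "slot d") auto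
  qed
qed (use assms in \<open>auto simp: slots_def\<close>)

text \<open>Slotted roots have pairwise different numbers of children, and the rank bound leaves
  \<open>3 * h\<close> possible numbers.\<close>

lemma card_slots:
  assumes H: "fheap n M X {} s" and B: "(n + 2) * (n + 1) + M \<le> B" and h: "n < 2 ^ h"
  shows "arrs s ''qrk'' (n + 1) \<le> 3 * h"
proof -
  let ?par = "arrs s ''qpar''"
  have F: "forest n X {} ?par (arrs s ''qmark'') (arrs s ''deg'')" and S: "slots n X ?par (arrs s ''qslot'')"
    using H by (auto simp: fheap_def)
  have slot: "arrs s ''qslot'' (deg_of X ?par v) = Suc v" if "v \<in> {v \<in> X. ?par v = n + 1}" for v
    using S that unfolding slots_def by auto
  have "inj_on (deg_of X ?par) {v \<in> X. ?par v = n + 1}"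
  proof (rule inj_onI)
    fix v v'
    assume v: "v \<in> {v \<in> X. ?par v = n + 1}" "v' \<in> {v \<in> X. ?par v = n + 1}"
      and eq: "deg_of X ?par v = deg_of X ?par v'"
    show "v = v'" using slot[OF v(1)] slot[OF v(2)] unfolding eq by simp
  qed
  moreover have "deg_of X ?par ` {v \<in> X. ?par v = n + 1} \<subseteq> {..<3 * h}"
    using forest_rank_less[OF F _ h] by auto
  ultimately have "card {v \<in> X. ?par v = n + 1} \<le> card {..<3 * h}"
    by (rule card_inj_on_le) simp
  then show ?thesis using fheap_bounds(10)[OF H B] by (simp add: deg_of_def)
qed

text \<open>Vertices are below \<open>n\<close>, so \<open>n\<close> can stand for a missing
  minimum.\<close>

abbreviation (input) min_root :: "nat \<Rightarrow> nat set \<Rightarrow> state \<Rightarrow> bool" where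
  "min_root n X s \<equiv> (regs s ''u'' = n \<and> (\<forall>v\<in>X. arrs s ''qpar'' v \<noteq> n)) \<or>
    (regs s ''u'' \<in> X \<and> arrs s ''qpar'' (regs s ''u'') = n \<and>
     (\<forall>v\<in>X. arrs s ''qpar'' v = n \<longrightarrow> arrs s ''deg'' (regs s ''u'') \<le> arrs s ''deg'' v))"

lemma wp_fib_collect:
  assumes H: "fheap n M X {} s" and B: "(n + 2) * (n + 1) + M \<le> B" and pos: "0 < arrs s ''qrk'' (n + 1)"
    and u: "min_root n X s"
    and Q: "\<And>s'. fheap n M X {} s' \<Longrightarrow> agree (\<lambda>y. \<not> qname y \<and> y \<noteq> ''u'') s s' \<Longrightarrow> marked n X s' = marked n X s \<Longrightarrow>
      min_root n X s' \<Longrightarrow> arrs s' ''qrk'' n = Suc (arrs s ''qrk'' n) \<Longrightarrow>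
      arrs s' ''qrk'' (n + 1) = arrs s ''qrk'' (n + 1) - 1 \<Longrightarrow> Q s'"
  shows "wp B fib_collect s Q"
proof -
  note b = fheap_bounds[OF H B]
  define r where "r = aval (last_child (Reg ''n'' \<oplus> Num 1)) s"
  define d where "d = arrs s ''qrk'' r"
  have r: "r \<in> X" "arrs s ''qpar'' r = n + 1" "fits B (last_child (Reg ''n'' \<oplus> Num 1)) s"
    using fheap_last_child[OF H B, of "n + 1" "Reg ''n'' \<oplus> Num 1"] pos b(1,2) by (simp_all add: r_def)
  have L: "lists n X s" and F: "forest n X {} (arrs s ''qpar'') (arrs s ''qmark'') (arrs s ''deg'')"
    and S: "slots n X (arrs s ''qpar'') (arrs s ''qslot'')"
    and M: "\<And>v. v \<in> X \<Longrightarrow> arrs s ''deg'' v \<le> M \<and> arrs s ''qpar'' v \<le> n + 1"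
    using H by (auto simp: fheap_def)
  have d: "d = deg_of X (arrs s ''qpar'') r" using b(10) by (simp add: d_def)
  have rn: "r < n" using b(7)[OF r(1)] .
  define s1 where "s1 = seta ''qslot'' d 0 (setr ''qr'' r s)"
  define c where "c \<longleftrightarrow> regs s ''u'' = n \<or> arrs s ''deg'' r < arrs s ''deg'' (regs s ''u'')"
  define s2 where "s2 = (if c then setr ''u'' r s1 else s1)"
  have s2: "regs s2 ''qr'' = r" "regs s2 ''n'' = n" "arrs s2 ''qpar'' = arrs s ''qpar''"
    "regs s2 ''u'' = (if c then r else regs s ''u'')"
    using b(1) by (simp_all add: s2_def s1_def)
  have ag2: "agree (\<lambda>y. \<not> qname y \<and> y \<noteq> ''u'') s s2"
    by (auto simp: s2_def s1_def intro!: agree_setr agree_seta)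
  have L2: "lists n X s2" using L lists_cong[of s s2 n X] by (simp add: s2_def s1_def agree_def)
  have ub: "regs s ''u'' \<le> B" "regs s ''u'' \<noteq> n \<Longrightarrow> arrs s ''deg'' (regs s ''u'') \<le> B"
    using u b(2) b(7)[of "regs s ''u''"] b(9) by auto
  have small: "r \<le> B" "d \<le> B" "1 \<le> B" "n \<le> B" "Suc n \<le> B"
    using rn b(2) b(5)[of r] by (simp_all add: d_def)
  have "wp B (move_to (Reg ''qr'') (Reg ''n'')) s2 Q"
  proof (rule wp_move_to[OF L2 r(1), where t = n], goal_cases)
    case (7 s')
    have eq: "arrs s' ''qmark'' = arrs s ''qmark''" "arrs s' ''deg'' = arrs s ''deg''"
      "arrs s' ''qslot'' = (arrs s ''qslot'')(d := 0)" "arrs s' ''qpar'' = (arrs s ''qpar'')(r := n)"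
      "regs s' ''u'' = (if c then r else regs s ''u'')"
      using 7(2) agree_arrs[OF 7(3), of "''qmark''"] agree_arrs[OF 7(3), of "''deg''"] agree_arrs[OF 7(3), of "''qslot''"]
        agree_regs[OF 7(3), of "''u''"] s2(4)
      by (simp_all add: s2_def s1_def)
    have deg: "deg_of X ((arrs s ''qpar'')(r := n)) v =
        (if v = Suc n then deg_of X (arrs s ''qpar'') v - 1
         else if v = n then Suc (deg_of X (arrs s ''qpar'') v) else deg_of X (arrs s ''qpar'') v)" for v
      using deg_of_upd[OF b(6) r(1), of "arrs s ''qpar''" n v] r(2) by auto
    have S2: "slots n X ((arrs s ''qpar'')(r := n)) ((arrs s ''qslot'')(d := 0))"
      unfolding d
    proof (rule slots_remove[OF S r(1)])
      fix v assume v: "v \<in> X"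
      show "((arrs s ''qpar'')(r := n)) v = Suc n \<longleftrightarrow> arrs s ''qpar'' v = Suc n \<and> v \<noteq> r" by auto
      show "deg_of X ((arrs s ''qpar'')(r := n)) v = deg_of X (arrs s ''qpar'') v"
        using deg[of v] b(7)[OF v] by simp
    qed (use r(2) in simp)
    show ?case
    proof (rule Q)
      show "fheap n M X {} s'"
        unfolding fheap_def eq(1-4) using 7(1) M forest_cut_root[OF F r(1), of n] r(2) S2 by auto
      show "agree (\<lambda>y. \<not> qname y \<and> y \<noteq> ''u'') s s'"
        using agree_trans[OF ag2 agree_weaken_u[OF moved_qname[OF 7(3)]]] .
      show "marked n X s' = marked n X s" using r(2) by (auto simp: marked_def eq)
      show "min_root n X s'"
      proof (cases c)
        case True
        have "arrs s ''deg'' r \<le> arrs s ''deg'' v" if "v \<in> X" "v \<noteq> r" "arrs s ''qpar'' v = n" for v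
        proof (cases "regs s ''u'' = n")
          case True
          then have "regs s ''u'' \<notin> X" using b(7)[of n] by auto
          then show ?thesis using u that by blast
        next
          case False
          then have "arrs s ''deg'' r < arrs s ''deg'' (regs s ''u'')" using \<open>c\<close> by (simp add: c_def)
          moreover have "arrs s ''deg'' (regs s ''u'') \<le> arrs s ''deg'' v" using u False that by blast
          ultimately show ?thesis by simp
        qed
        then show ?thesis unfolding eq using True r(1) by auto
      next
        case False
        then have "regs s ''u'' \<in> X" "arrs s ''qpar'' (regs s ''u'') = n"
          "\<forall>v\<in>X. arrs s ''qpar'' v = n \<longrightarrow> arrs s ''deg'' (regs s ''u'') \<le> arrs s ''deg'' v"
          "arrs s ''deg'' (regs s ''u'') \<le> arrs s ''deg'' r"
          using u unfolding c_def by auto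
        then show ?thesis unfolding eq using False r(2) by auto
      qed
      show "arrs s' ''qrk'' n = Suc (arrs s ''qrk'' n)" "arrs s' ''qrk'' (n + 1) = arrs s ''qrk'' (n + 1) - 1"
        unfolding lists_deg_of[OF 7(1)] b(10) eq(4) deg by simp_all
    qed
  qed (use small b(4)[of n] b(4)[of "Suc n"] r(2) in \<open>simp_all add: s2\<close>)
  moreover have "wp B (Cond (Reg ''u'' \<doteq> Reg ''n'') (Assign ''u'' (Reg ''qr''))
      (Cond (Read ''deg'' (Reg ''qr'') \<prec> Read ''deg'' (Reg ''u'')) (Assign ''u'' (Reg ''qr'')) Skip)) s1
      (\<lambda>s. wp B (move_to (Reg ''qr'') (Reg ''n'')) s Q) = wp B (move_to (Reg ''qr'') (Reg ''n'')) s2 Q"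
    using small ub b(1) b(9)[OF r(1)] by (simp add: s2_def s1_def c_def)
  ultimately show ?thesis
    using r(3) small unfolding fib_collect_def wp.simps(2,3,4) r_def[symmetric]
    by (simp add: d_def[symmetric] s1_def del: wp.simps(5))
qed

text \<open>Each root present at the start brings 800 credits, of which 400 pay for its
  consolidation. At most \<open>3 * h\<close> roots are left; 800 credits for each of them and 100
  for collecting it give \<open>2700 * h\<close>.\<close>

lemma run_fib_find:
  assumes H: "fib n M X s" and B: "(n + 2) * (n + 1) + M \<le> B" and h: "n < 2 ^ h" and X: "X \<noteq> {}"
  shows "run B fib_find s (2700 * h + 100 + fib_pot n X s) (\<lambda>s' T. fib n M X s' \<and> fib_pot n X s' \<le> T \<and>
    arrs s' ''qpar'' (regs s' ''u'') = n \<and> regs s' ''u'' \<in> X \<and>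
    (\<forall>v\<in>X. arrs s ''deg'' (regs s' ''u'') \<le> arrs s ''deg'' v) \<and>
    agree (\<lambda>y. \<not> qname y \<and> y \<noteq> ''u'') s s')"
    (is "run _ _ _ _ ?Q")
proof -
  let ?b = "Read ''qrk'' (Reg ''n'')" and ?b2 = "Read ''qrk'' (Reg ''n'' \<oplus> Num 1)"
  let ?m = "card (marked n X s)"
  define I where "I = (\<lambda>s'. fheap n M X {} s' \<and> agree (\<lambda>y. \<not> qname y) s s' \<and> marked n X s' = marked n X s)"
  define \<Phi> where "\<Phi> = (\<lambda>s' :: state. 200 * (2 * arrs s' ''qrk'' n + arrs s' ''qrk'' (n + 1)))"
  have "{v \<in> X. arrs s ''qpar'' v = n + 1} = {}" using H by (auto simp: fib_def)
  then have "deg_of X (arrs s ''qpar'') (n + 1) = 0" unfolding deg_of_def by (simp only: card.empty)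
  then have "arrs s ''qrk'' (n + 1) = 0"
    using fheap_bounds(10)[OF _ B, of X "{}" s "n + 1"] H unfolding fib_def by simp
  then have \<Phi>s: "\<Phi> s = 400 * arrs s ''qrk'' n" by (simp add: \<Phi>_def)
  have loop1: "run B (While ?b fib_consolidate) s (\<Phi> s + 3) (\<lambda>s' T. I s' \<and> T = \<Phi> s' \<and> arrs s' ''qrk'' n = 0)"
  proof (rule run_While[where I = I and \<Phi> = \<Phi>])
    show "I s" using H by (simp add: I_def fib_def)
  next
    fix s' assume "I s'"
    then have "fheap n M X {} s'" by (simp add: I_def)
    note b = fheap_bounds[OF this B]
    show "fits B ?b s'" using b(1,2) b(5)[of n] by simp
  next
    fix s' assume I: "I s'" and pos: "aval ?b s' \<noteq> 0"
    have H': "fheap n M X {} s'" using I by (simp add: I_def)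
    have n: "regs s' ''n'' = n" using fheap_bounds(1)[OF H' B] .
    have "wp B fib_consolidate s' (\<lambda>s''. I s'' \<and> \<Phi> s'' \<le> \<Phi> s' - 200)"
    proof (rule wp_fib_consolidate[OF H' B])
      fix s''
      assume "fheap n M X {} s''" "agree (\<lambda>y. \<not> qname y) s' s''" "marked n X s'' = marked n X s'"
        "2 * arrs s'' ''qrk'' n + arrs s'' ''qrk'' (n + 1) < 2 * arrs s' ''qrk'' n + arrs s' ''qrk'' (n + 1)"
      then show "I s'' \<and> \<Phi> s'' \<le> \<Phi> s' - 200"
        using I agree_trans unfolding I_def \<Phi>_def by fastforce
    qed (use pos n in simp)
    moreover have "200 \<le> \<Phi> s'" using pos n by (simp add: \<Phi>_def)
    ultimately show "\<exists>T'. cost ?b + 1 + T' \<le> \<Phi> s' \<and> run B fib_consolidate s' T' (\<lambda>s'' T''. I s'' \<and> \<Phi> s'' \<le> T'')"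
      by (intro exI[of _ "\<Phi> s' - 3"] conjI run_straight[where T' = "\<Phi> s' - 200"]) (simp_all add: fib_scost)
  next
    fix s' assume I: "I s'" and "aval ?b s' = 0"
    then show "I s' \<and> \<Phi> s' = \<Phi> s' \<and> arrs s' ''qrk'' n = 0"
      using fheap_bounds(1)[OF _ B] unfolding I_def by fastforce
  qed simp
  have loop2: "run B (While ?b2 fib_collect) s1 (100 * arrs s1 ''qrk'' (n + 1) + 5 + F) (\<lambda>s' T. ?Q s' (T + (800 * 3 * h + 1200 * ?m)))"
    if s1: "fheap n M X {} s1" "agree (\<lambda>y. \<not> qname y \<and> y \<noteq> ''u'') s s1" "marked n X s1 = marked n X s"
      "arrs s1 ''qrk'' n = 0" "regs s1 ''u'' = n" for s1 F
  proof -
    define I2 where "I2 = (\<lambda>s'. fheap n M X {} s' \<and> agree (\<lambda>y. \<not> qname y \<and> y \<noteq> ''u'') s s' \<and>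
      marked n X s' = marked n X s \<and> min_root n X s' \<and> arrs s' ''qrk'' n + arrs s' ''qrk'' (n + 1) = arrs s1 ''qrk'' (n + 1))"
    show ?thesis
    proof (rule run_While[where I = I2 and \<Phi> = "\<lambda>s. 100 * arrs s ''qrk'' (n + 1)"])
      have "{v \<in> X. arrs s1 ''qpar'' v = n} = {}"
        using s1(4) fheap_bounds(6)[OF s1(1) B] fheap_bounds(10)[OF s1(1) B, of n] by (simp add: deg_of_def)
      then show "I2 s1" using s1 by (auto simp: I2_def)
    next
      fix s' assume "I2 s'"
      then have "fheap n M X {} s'" by (simp add: I2_def)
      note b = fheap_bounds[OF this B]
      show "fits B ?b2 s'" using b(1,2) b(5)[of "Suc n"] by simp
    next
      fix s' assume I: "I2 s'" and pos: "aval ?b2 s' \<noteq> 0"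
      have H': "fheap n M X {} s'" "min_root n X s'" using I by (auto simp: I2_def)
      have n: "regs s' ''n'' = n" using fheap_bounds(1)[OF H'(1) B] .
      have "wp B fib_collect s' (\<lambda>s''. I2 s'' \<and> 100 * arrs s'' ''qrk'' (n + 1) \<le> 100 * arrs s' ''qrk'' (n + 1) - 100)"
      proof (rule wp_fib_collect[OF H'(1) B _ H'(2)])
        fix s''
        assume s'': "fheap n M X {} s''" "agree (\<lambda>y. \<not> qname y \<and> y \<noteq> ''u'') s' s''" "marked n X s'' = marked n X s'"
          "min_root n X s''" "arrs s'' ''qrk'' n = Suc (arrs s' ''qrk'' n)"
          "arrs s'' ''qrk'' (n + 1) = arrs s' ''qrk'' (n + 1) - 1"
        have "agree (\<lambda>y. \<not> qname y \<and> y \<noteq> ''u'') s s''"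
          using I agree_trans[OF _ s''(2)] unfolding I2_def by blast
        then show "I2 s'' \<and> 100 * arrs s'' ''qrk'' (n + 1) \<le> 100 * arrs s' ''qrk'' (n + 1) - 100"
          using s'' I pos n unfolding I2_def by simp
      qed (use pos n in simp)
      then show "\<exists>T'. cost ?b2 + 1 + T' \<le> 100 * arrs s' ''qrk'' (n + 1) \<and>
          run B fib_collect s' T' (\<lambda>s'' T''. I2 s'' \<and> 100 * arrs s'' ''qrk'' (n + 1) \<le> T'')"
        using pos n
        by (intro exI[of _ "100 * arrs s' ''qrk'' (n + 1) - 5"] conjI
            run_straight[where T' = "100 * arrs s' ''qrk'' (n + 1) - 100"]) (simp_all add: fib_scost)
    next
      fix s' assume I: "I2 s'" and 0: "aval ?b2 s' = 0"
      have H': "fheap n M X {} s'" using I by (simp add: I2_def)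
      note b = fheap_bounds[OF H' B]
      have z: "arrs s' ''qrk'' (n + 1) = 0" "arrs s' ''qrk'' n \<le> 3 * h"
        using 0 I card_slots[OF s1(1) B h] by (auto simp: I2_def b(1))
      have "{v \<in> X. arrs s' ''qpar'' v = n + 1} = {}"
        using z b(6) b(10)[of "n + 1"] by (simp add: deg_of_def)
      then have fib: "fib n M X s'" using H' by (auto simp: fib_def)
      have F: "forest n X {} (arrs s' ''qpar'') (arrs s' ''qmark'') (arrs s' ''deg'')"
        using H' by (simp add: fheap_def)
      \<comment> \<open>Minimal keys occur at roots, and all roots are back in list
        \<open>n\<close>.\<close>
      have root: "\<exists>r\<in>X. arrs s' ''qpar'' r = n \<and> arrs s' ''deg'' r \<le> arrs s' ''deg'' v" if v: "v \<in> X" for v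
      proof -
        obtain r where r: "r \<in> X" "n \<le> arrs s' ''qpar'' r" "arrs s' ''deg'' r \<le> arrs s' ''deg'' v"
          using forest_root[OF F v] by blast
        moreover have "arrs s' ''qpar'' r \<le> n + 1" "arrs s' ''qpar'' r \<noteq> n + 1"
          using fib r(1) by (auto simp: fib_def fheap_def)
        ultimately have "arrs s' ''qpar'' r = n" by simp
        then show ?thesis using r by blast
      qed
      then have u: "regs s' ''u'' \<in> X" "arrs s' ''qpar'' (regs s' ''u'') = n"
        "\<forall>v\<in>X. arrs s' ''qpar'' v = n \<longrightarrow> arrs s' ''deg'' (regs s' ''u'') \<le> arrs s' ''deg'' v"
        using I X unfolding I2_def by auto
      then have "\<forall>v\<in>X. arrs s' ''deg'' (regs s' ''u'') \<le> arrs s' ''deg'' v"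
        using root le_trans by blast
      moreover have "arrs s' ''deg'' = arrs s ''deg''" using I agree_arrs[of _ s s' "''deg''"] by (auto simp: I2_def)
      ultimately show "?Q s' (100 * arrs s' ''qrk'' (n + 1) + (800 * 3 * h + 1200 * ?m))"
        using fib u z I by (auto simp: fib_pot_def I2_def)
    qed simp
  qed
  show ?thesis
    unfolding fib_find_def
  proof (rule run_call_Seq[OF loop1])
    show "\<Phi> s + 3 + (2700 * h + 97 + 1200 * ?m) \<le> 2700 * h + 100 + fib_pot n X s"
      by (simp add: \<Phi>s fib_pot_def)
  next
    fix s' T' assume s': "I s' \<and> T' = \<Phi> s' \<and> arrs s' ''qrk'' n = 0"
    let ?s1 = "setr ''u'' n s'"
    have H': "fheap n M X {} s'" using s' by (simp add: I_def)
    note b = fheap_bounds[OF H' B]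
    have "arrs s' ''qrk'' (n + 1) \<le> 3 * h" using card_slots[OF H' B h] .
    have "run B (While ?b2 fib_collect) ?s1 (100 * arrs ?s1 ''qrk'' (n + 1) + 5 + 0) (\<lambda>s' T. ?Q s' (T + (800 * 3 * h + 1200 * ?m)))"
    proof (rule loop2)
      show "fheap n M X {} ?s1"
        using H' fheap_cong(1)[of s' ?s1 n M X "{}"] by (simp add: agree_def)
      show "agree (\<lambda>y. \<not> qname y \<and> y \<noteq> ''u'') s ?s1"
        using s' by (intro agree_setr agree_weaken_u) (auto simp: I_def)
    qed (use s' in \<open>simp_all add: I_def marked_def\<close>)
    then have "run B (While ?b2 fib_collect) ?s1 (T' + (2700 * h + 97 + 1200 * ?m) - 2) ?Q"
      by (rule run_conseq[where F = "800 * 3 * h + 1200 * ?m"])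
        (use s' \<open>arrs s' ''qrk'' (n + 1) \<le> 3 * h\<close> in \<open>simp_all add: \<Phi>_def\<close>)
    then show "run B (Assign ''u'' (Reg ''n'') ;; While ?b2 fib_collect) s' (T' + (2700 * h + 97 + 1200 * ?m)) ?Q"
      using b(1,2) by (intro run_straight_Seq) simp_all
  qed
qed

section \<open>Insertion and deletion in the heap\<close>

lemma slots_zero:
  assumes "slots n X par slot" "\<forall>v\<in>X. par v \<noteq> Suc n"
  shows "slot d = 0"
proof -
  have "slots n X par slot \<longleftrightarrow> (\<forall>d. slot d = 0)" by (rule slots_none) (use assms(2) in blast)
  then show ?thesis using assms(1) by blast
qed

lemma slots_zeroI: "\<forall>v\<in>X. par v \<noteq> Suc n \<Longrightarrow> \<forall>d. slot d = 0 \<Longrightarrow> slots n X par slot"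
  by (auto simp: slots_def)

text \<open>Insertion adds at most one tree and changes no counted mark.\<close>

lemma run_fib_insert:
  assumes H: "fib n M X s" and B: "(n + 2) * (n + 1) + M \<le> B"
    and x: "regs s ''x'' \<notin> X" "regs s ''x'' < n" "arrs s ''deg'' (regs s ''x'') \<le> M"
  shows "run B fib_insert s (3000 + fib_pot n X s) (\<lambda>s' T. fib n M (insert (regs s ''x'') X) s' \<and>
    fib_pot n (insert (regs s ''x'') X) s' \<le> T \<and> agree (\<lambda>y. \<not> qname y) s s')"
    (is "run _ _ _ _ ?Q")
proof -
  have H0: "fheap n M X {} s" using H by (simp add: fib_def)
  note b = fheap_bounds[OF H0 B]
  let ?x = "regs s ''x''"
  have L: "lists n X s" and F: "forest n X {} (arrs s ''qpar'') (arrs s ''qmark'') (arrs s ''deg'')"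
    and S: "slots n X (arrs s ''qpar'') (arrs s ''qslot'')"
    and M: "\<And>v. v \<in> X \<Longrightarrow> arrs s ''deg'' v \<le> M \<and> arrs s ''qpar'' v \<le> n + 1"
    using H0 by (auto simp: fheap_def)
  have no: "\<And>v. v \<in> X \<Longrightarrow> arrs s ''qpar'' v \<noteq> Suc n" using H by (simp add: fib_def)
  have slot: "arrs s ''qslot'' d = 0" for d by (rule slots_zero[OF S]) (use no in blast)
  define s1 where "s1 = setr ''qt'' n (setr ''qx'' ?x (seta ''qmark'' ?x 0 s))"
  have L1: "lists n X s1" using L lists_cong[of s s1 n X] by (simp add: s1_def agree_def)
  have "wp B attach s1 (\<lambda>s'. ?Q s' (800 + fib_pot n X s))"
  proof (rule wp_attach[OF L1], goal_cases)
    case (4 s')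
    have eq: "arrs s' ''qmark'' = (arrs s ''qmark'')(?x := 0)" "arrs s' ''deg'' = arrs s ''deg''"
      "arrs s' ''qslot'' = arrs s ''qslot''" "arrs s' ''qpar'' = (arrs s ''qpar'')(?x := n)"
      using 4(2) agree_arrs[OF 4(3), of "''qmark''"] agree_arrs[OF 4(3), of "''deg''"] agree_arrs[OF 4(3), of "''qslot''"]
      by (simp_all add: s1_def)
    have L': "lists n (insert ?x X) s'" using 4(1) by (simp add: s1_def)
    \<comment> \<open>\<open>x\<close> is not yet in the heap, so overwriting its parent and mark
      affects no tree.\<close>
    have F1: "forest n X {} ((arrs s ''qpar'')(?x := n)) ((arrs s ''qmark'')(?x := 0)) (arrs s ''deg'')"
    proof (rule forest_subI[OF F])
      fix c assume "c \<in> X - {}" "((arrs s ''qpar'')(?x := n)) c < n"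
      moreover have "deg_of X ((arrs s ''qpar'')(?x := n)) c = deg_of X (arrs s ''qpar'') c"
        unfolding deg_of_def using x(1) by (intro arg_cong[where f = card]) auto
      ultimately show "deg_of X (arrs s ''qpar'') c + arrs s ''qmark'' c \<le>
        deg_of X ((arrs s ''qpar'')(?x := n)) c + ((arrs s ''qmark'')(?x := 0)) c" using x(1) by auto
    next
      show "((arrs s ''qpar'')(?x := n)) v = arrs s ''qpar'' v \<and> arrs s ''qpar'' v \<in> X"
        if "v \<in> X" "((arrs s ''qpar'')(?x := n)) v < n" for v
        using that x(1) forest_par[OF F] by (auto split: if_splits)
    qed (use x(1) forest_mark_le[OF F] in auto)
    have F2: "forest n (insert ?x X) {} ((arrs s ''qpar'')(?x := n)) ((arrs s ''qmark'')(?x := 0)) (arrs s ''deg'')"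
      by (rule forest_insert[OF F1]) (use x in auto)
    have no': "((arrs s ''qpar'')(?x := n)) v \<noteq> Suc n" if "v \<in> insert ?x X" for v
      using that no by auto
    have "slots n (insert ?x X) ((arrs s ''qpar'')(?x := n)) (arrs s ''qslot'')"
      by (rule slots_zeroI) (use no' slot in blast)+
    then have fib': "fib n M (insert ?x X) s'"
      unfolding fib_def fheap_def eq using L' F2 x M no' by auto
    have marked': "marked n (insert ?x X) s' = marked n X s"
      using x(1) by (auto simp: marked_def eq)
    have "{v \<in> insert ?x X. ((arrs s ''qpar'')(?x := n)) v = n} \<subseteq> insert ?x {v \<in> X. arrs s ''qpar'' v = n}"
      by auto
    then have "deg_of (insert ?x X) ((arrs s ''qpar'')(?x := n)) n \<le> card (insert ?x {v \<in> X. arrs s ''qpar'' v = n})"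
      unfolding deg_of_def using b(6) by (intro card_mono) auto
    also have "\<dots> \<le> Suc (deg_of X (arrs s ''qpar'') n)"
      using b(6) by (simp add: deg_of_def card_insert_if)
    finally have rk': "arrs s' ''qrk'' n \<le> Suc (arrs s ''qrk'' n)"
      unfolding lists_deg_of[OF L'] b(10) eq .
    have "agree (\<lambda>y. \<not> qname y) s s1" unfolding s1_def by (intro agree_setr agree_seta) simp_all
    moreover have "agree (\<lambda>y. \<not> qname y) s1 s'" using 4(3) by (rule agree_mono) auto
    ultimately have "agree (\<lambda>y. \<not> qname y) s s'" by (rule agree_trans)
    then show ?case using fib' marked' rk' by (simp add: fib_pot_def)
  qed (use x b(4)[of n] in \<open>simp_all add: s1_def\<close>)
  then have "wp B fib_insert s (\<lambda>s'. ?Q s' (800 + fib_pot n X s))"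
    using x b(1,2) by (simp add: fib_insert_def s1_def)
  then show ?thesis
    by (intro run_straight[where T' = "800 + fib_pot n X s"]) (simp add: fib_scost, assumption, simp add: fib_scost)
qed

text \<open>Shared by deletion and cascading cuts: the old parent \<open>p\<close> is only suspended
  here, and the caller decides how to release it.\<close>

lemma fib_move_to_root:
  assumes H: "fheap n M X Y s" and B: "(n + 2) * (n + 1) + M \<le> B" and no: "\<forall>v\<in>X. arrs s ''qpar'' v \<noteq> Suc n"
    and x: "x \<in> X" "arrs s ''qpar'' x = p" "p < n" "fits B e s" "aval e s = x"
    and Q: "\<And>s'. fheap n M X (insert p Y - {x}) s' \<Longrightarrow> \<forall>v\<in>X. arrs s' ''qpar'' v \<noteq> Suc n \<Longrightarrow>
      arrs s' ''qpar'' = (arrs s ''qpar'')(x := n) \<Longrightarrow> agree moved s s' \<Longrightarrow>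
      arrs s' ''qrk'' n = Suc (arrs s ''qrk'' n) \<Longrightarrow> arrs s' ''qrk'' p = arrs s ''qrk'' p - 1 \<Longrightarrow> Q s'"
  shows "wp B (move_to e (Reg ''n'')) s Q"
proof -
  note b = fheap_bounds[OF H B]
  have L: "lists n X s" and F: "forest n X Y (arrs s ''qpar'') (arrs s ''qmark'') (arrs s ''deg'')"
    and S: "slots n X (arrs s ''qpar'') (arrs s ''qslot'')"
    and M: "\<And>v. v \<in> X \<Longrightarrow> arrs s ''deg'' v \<le> M \<and> arrs s ''qpar'' v \<le> n + 1"
    using H by (auto simp: fheap_def)
  have slot: "arrs s ''qslot'' d = 0" for d by (rule slots_zero[OF S no])
  show ?thesis
  proof (rule wp_move_to[OF L x(1), where t = n], goal_cases)
    case (7 s')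
    have eq: "arrs s' ''qmark'' = arrs s ''qmark''" "arrs s' ''deg'' = arrs s ''deg''"
      "arrs s' ''qslot'' = arrs s ''qslot''" "arrs s' ''qpar'' = (arrs s ''qpar'')(x := n)"
      using 7(2) agree_arrs[OF 7(3), of "''qmark''"] agree_arrs[OF 7(3), of "''deg''"] agree_arrs[OF 7(3), of "''qslot''"]
      by simp_all
    have no': "((arrs s ''qpar'')(x := n)) v \<noteq> Suc n" if "v \<in> X" for v using that no by auto
    have F': "forest n X (insert p Y - {x}) ((arrs s ''qpar'')(x := n)) (arrs s ''qmark'') (arrs s ''deg'')"
      using forest_cut[OF F x(1), of n] x(2) by simp
    have deg: "deg_of X ((arrs s ''qpar'')(x := n)) v =
        (if v = p then deg_of X (arrs s ''qpar'') v - 1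
         else if v = n then Suc (deg_of X (arrs s ''qpar'') v) else deg_of X (arrs s ''qpar'') v)" for v
      using deg_of_upd[OF b(6) x(1), of "arrs s ''qpar''" n v] x(2,3) by auto
    show ?case
    proof (rule Q)
      have "slots n X ((arrs s ''qpar'')(x := n)) (arrs s ''qslot'')"
        by (rule slots_zeroI) (use no' slot in blast)+
      then show "fheap n M X (insert p Y - {x}) s'"
        unfolding fheap_def eq using 7(1) M F' by auto
      show "\<forall>v\<in>X. arrs s' ''qpar'' v \<noteq> Suc n" unfolding eq using no' by blast
      show "arrs s' ''qrk'' n = Suc (arrs s ''qrk'' n)" "arrs s' ''qrk'' p = arrs s ''qrk'' p - 1"
        unfolding lists_deg_of[OF 7(1)] b(10) eq(4) deg using x(3) by simp_all
    qed (use 7 in simp_all)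
  qed (use x b(1,2) b(4)[of n] b(8)[OF x(1)] in simp_all)
qed

lemma marked_moved:
  assumes "agree moved s s'" "arrs s' ''qpar'' = (arrs s ''qpar'')(x := n)"
  shows "marked n X s' = marked n X s - {x}"
  using agree_arrs[OF assms(1), of "''qmark''"] assms(2) by (auto simp: marked_def)

text \<open>Each child of the deleted root becomes a root and takes 900 credits, 800 for the new
  tree and 100 for time; there are at most \<open>3 * h\<close> children.\<close>

lemma run_fib_delete:
  assumes H: "fib n M X s" and B: "(n + 2) * (n + 1) + M \<le> B" and h: "n < 2 ^ h"
    and x: "regs s ''x'' \<in> X" "arrs s ''qpar'' (regs s ''x'') = n"
  shows "run B fib_delete s (2700 * h + 100 + fib_pot n X s) (\<lambda>s' T. fib n M (X - {regs s ''x''}) s' \<and>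
    fib_pot n (X - {regs s ''x''}) s' \<le> T \<and> agree (\<lambda>y. \<not> qname y) s s')"
    (is "run _ _ _ _ ?Q")
proof -
  let ?x = "regs s ''x''" and ?b = "Read ''qrk'' (Reg ''x'')"
  define I where "I = (\<lambda>s'. fib n M X s' \<and> arrs s' ''qpar'' ?x = n \<and> agree (\<lambda>y. \<not> qname y) s s')"
  define \<Phi> where "\<Phi> = (\<lambda>s'. 900 * arrs s' ''qrk'' ?x + fib_pot n X s')"
  have H0: "fheap n M X {} s" using H by (simp add: fib_def)
  have xn: "?x < n" using fheap_bounds(7)[OF H0 B x(1)] .
  have regx: "regs s' ''x'' = ?x" if "I s'" for s'
    using that unfolding I_def by (simp add: agree_def)
  have loop: "run B (While ?b (move_to (last_child (Reg ''x'')) (Reg ''n''))) s (\<Phi> s + 3)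
      (\<lambda>s' T. I s' \<and> arrs s' ''qrk'' ?x = 0 \<and> T = \<Phi> s')"
  proof (rule run_While[where I = I and \<Phi> = \<Phi>])
    show "I s" using H x by (simp add: I_def)
  next
    fix s' assume I: "I s'"
    then have "fheap n M X {} s'" by (simp add: I_def fib_def)
    note b = fheap_bounds[OF this B]
    show "fits B ?b s'" using b(1,2) b(5)[of ?x] regx[OF I] xn by simp
  next
    fix s' assume I: "I s'" and pos: "aval ?b s' \<noteq> 0"
    have H': "fheap n M X {} s'" and no: "\<forall>v\<in>X. arrs s' ''qpar'' v \<noteq> Suc n" and px: "arrs s' ''qpar'' ?x = n"
      using I by (auto simp: I_def fib_def)
    note b = fheap_bounds[OF H' B]
    define c where "c = aval (last_child (Reg ''x'')) s'"
    have c: "c \<in> X" "arrs s' ''qpar'' c = ?x" "fits B (last_child (Reg ''x'')) s'"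
      using fheap_last_child[OF H' B, of ?x "Reg ''x''"] regx[OF I] xn pos b(2) unfolding c_def by auto
    have cx: "c \<noteq> ?x" using c(2) px xn by auto
    have "wp B (move_to (last_child (Reg ''x'')) (Reg ''n'')) s' (\<lambda>s''. I s'' \<and> \<Phi> s'' \<le> \<Phi> s' - 100)"
    proof (rule fib_move_to_root[OF H' B no c(1) c(2) xn c(3) c_def[symmetric]])
      fix s''
      assume s'': "fheap n M X (insert ?x {} - {c}) s''" "\<forall>v\<in>X. arrs s'' ''qpar'' v \<noteq> Suc n"
        "arrs s'' ''qpar'' = (arrs s' ''qpar'')(c := n)" "agree moved s' s''"
        "arrs s'' ''qrk'' n = Suc (arrs s' ''qrk'' n)" "arrs s'' ''qrk'' ?x = arrs s' ''qrk'' ?x - 1"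
      have px'': "arrs s'' ''qpar'' ?x = n" using s''(3) px by simp
      \<comment> \<open>The vertex to be deleted is a root, so its suspension is lifted
        immediately.\<close>
      have "forest n X (insert ?x {}) (arrs s'' ''qpar'') (arrs s'' ''qmark'') (arrs s'' ''deg'')"
        using s''(1) cx by (simp add: fheap_def insert_Diff_if)
      from forest_drop_root[OF this] have "fheap n M X {} s''"
        using s''(1) px'' by (simp add: fheap_def)
      then have "fib n M X s''" using s''(2) by (simp add: fib_def)
      moreover have "agree (\<lambda>y. \<not> qname y) s s''"
        using I agree_trans[OF _ moved_qname[OF s''(4)]] by (simp add: I_def)
      moreover have "card (marked n X s'') \<le> card (marked n X s')"
        using marked_moved[OF s''(4,3)] b(6) by (auto simp: marked_def intro!: card_mono)
      ultimately show "I s'' \<and> \<Phi> s'' \<le> \<Phi> s' - 100"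
        using px'' s''(5,6) pos regx[OF I] by (simp add: I_def \<Phi>_def fib_pot_def)
    qed
    moreover have "900 \<le> \<Phi> s'" using pos regx[OF I] by (simp add: \<Phi>_def)
    ultimately show "\<exists>T'. cost ?b + 1 + T' \<le> \<Phi> s' \<and>
        run B (move_to (last_child (Reg ''x'')) (Reg ''n'')) s' T' (\<lambda>s'' T''. I s'' \<and> \<Phi> s'' \<le> T'')"
      by (intro exI[of _ "\<Phi> s' - 3"] conjI run_straight[where T' = "\<Phi> s' - 100"]) (simp_all add: last_child_def)
  next
    fix s' assume "I s'" "aval ?b s' = 0"
    then show "I s' \<and> arrs s' ''qrk'' ?x = 0 \<and> \<Phi> s' = \<Phi> s'" using regx by simp
  qed simp
  have "arrs s ''qrk'' ?x \<le> 3 * h"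
    using forest_rank_less[OF _ x(1) h] H0 fheap_bounds(10)[OF H0 B, of ?x] unfolding fheap_def by fastforce
  then have "\<Phi> s \<le> 2700 * h + fib_pot n X s" by (simp add: \<Phi>_def)
  then have le: "\<Phi> s + 3 + (2700 * h + fib_pot n X s - \<Phi> s + 97) \<le> 2700 * h + 100 + fib_pot n X s" by simp
  show ?thesis
    unfolding fib_delete_def
  proof (rule run_call_Seq[OF loop le])
    fix s' T' assume s': "I s' \<and> arrs s' ''qrk'' ?x = 0 \<and> T' = \<Phi> s'"
    then have I: "I s'" and rk: "arrs s' ''qrk'' ?x = 0" and T': "T' = fib_pot n X s'" by (auto simp: \<Phi>_def)
    have H': "fheap n M X {} s'" and no: "\<forall>v\<in>X. arrs s' ''qpar'' v \<noteq> Suc n" and px: "arrs s' ''qpar'' ?x = n"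
      using I by (auto simp: I_def fib_def)
    note b = fheap_bounds[OF H' B]
    have L: "lists n X s'" and F: "forest n X {} (arrs s' ''qpar'') (arrs s' ''qmark'') (arrs s' ''deg'')"
      and S: "slots n X (arrs s' ''qpar'') (arrs s' ''qslot'')"
      using H' by (auto simp: fheap_def)
    have slot: "arrs s' ''qslot'' d = 0" for d by (rule slots_zero[OF S no])
    let ?s1 = "setr ''qx'' ?x s'"
    have L1: "lists n X ?s1" using L lists_cong[of s' ?s1 n X] by (simp add: agree_def)
    have W: "wp B detach ?s1 (\<lambda>s''. ?Q s'' (fib_pot n X s'))"
    proof (rule wp_detach[OF L1], goal_cases)
      case (3 s'')
      have eq: "arrs s'' ''qmark'' = arrs s' ''qmark''" "arrs s'' ''deg'' = arrs s' ''deg''"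
        "arrs s'' ''qslot'' = arrs s' ''qslot''" "arrs s'' ''qpar'' = arrs s' ''qpar''"
        using agree_arrs[OF 3(2), of "''qmark''"] agree_arrs[OF 3(2), of "''deg''"]
          agree_arrs[OF 3(2), of "''qslot''"] agree_arrs[OF 3(2), of "''qpar''"] by simp_all
      have L': "lists n (X - {?x}) s''" using 3(1) by simp
      have no': "arrs s' ''qpar'' v \<noteq> Suc n" if "v \<in> X - {?x}" for v using no that by blast
      have F': "forest n (X - {?x}) {} (arrs s' ''qpar'') (arrs s' ''qmark'') (arrs s' ''deg'')"
        using forest_delete[OF F x(1)] px rk b(10)[of ?x] by simp
      have "slots n (X - {?x}) (arrs s' ''qpar'') (arrs s' ''qslot'')"
        by (rule slots_zeroI) (use no' slot in blast)+
      then have "fib n M (X - {?x}) s''"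
        unfolding fib_def fheap_def eq using L' F' H' no' by (auto simp: fheap_def)
      moreover have "marked n (X - {?x}) s'' \<subseteq> marked n X s'" by (auto simp: marked_def eq)
      then have "card (marked n (X - {?x}) s'') \<le> card (marked n X s')"
        using b(6) by (intro card_mono) (auto simp: marked_def)
      moreover have "arrs s'' ''qrk'' n \<le> arrs s' ''qrk'' n"
        unfolding lists_deg_of[OF L'] b(10) eq deg_of_def using b(6) by (intro card_mono) auto
      moreover have "agree (\<lambda>y. \<not> qname y) s s''"
      proof -
        have "agree (\<lambda>y. \<not> qname y) s ?s1" using I by (intro agree_setr) (auto simp: I_def)
        moreover have "agree (\<lambda>y. \<not> qname y) ?s1 s''" using 3(2) by (rule agree_mono) auto
        ultimately show ?thesis by (rule agree_trans)
      qed
      ultimately show ?case by (simp add: fib_pot_def)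
    qed (use x px b(4)[of n] in simp_all)
    show "run B (Assign ''qx'' (Reg ''x'') ;; detach) s' (T' + (2700 * h + fib_pot n X s - \<Phi> s + 97)) ?Q"
      unfolding T'
      by (intro run_straight[where T' = "fib_pot n X s'"])
        (use W regx[OF I] xn b(2) in \<open>simp_all add: detach_def del: wp.simps(3)\<close>)
  qed
qed

text \<open>While \<open>qx\<close> is pending its own mark is not counted. The 2200 credits cover
  one cut: 800 for the new root, 1200 for a possible mark on the parent, the rest for time. A
  pending root needs time only.\<close>

definition cut_pot :: "nat \<Rightarrow> nat set \<Rightarrow> state \<Rightarrow> nat" where
  "cut_pot n X s = (if regs s ''qg'' = 0 then fib_pot n X s
     else 800 * arrs s ''qrk'' n + 1200 * card (marked n X s - {regs s ''qx''}) +
       (if arrs s ''qpar'' (regs s ''qx'') < n then 2200 else 100))"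

text \<open>During the cascade the pending \<open>qx\<close> is the only suspended vertex.\<close>

definition cut_inv :: "nat \<Rightarrow> nat \<Rightarrow> nat set \<Rightarrow> state \<Rightarrow> bool" where
  "cut_inv n M X s \<longleftrightarrow> (\<forall>v\<in>X. arrs s ''qpar'' v \<noteq> Suc n) \<and>
     (if regs s ''qg'' = 0 then fheap n M X {} s
      else regs s ''qg'' = 1 \<and> regs s ''qx'' \<in> X \<and> fheap n M X {regs s ''qx''} s)"

text \<open>The 74 credits are the cost 72 of the body and 2 for the loop test.\<close>

lemma wp_fib_cut:
  assumes I: "cut_inv n M X s" and B: "(n + 2) * (n + 1) + M \<le> B" and g: "regs s ''qg'' \<noteq> 0"
  shows "wp B fib_cut s (\<lambda>s'. cut_inv n M X s' \<and> agree (\<lambda>y. \<not> qname y) s s' \<and> cut_pot n X s' + 74 \<le> cut_pot n X s)"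
    (is "wp _ _ _ ?Q")
proof -
  define y where "y = regs s ''qx''"
  define p where "p = arrs s ''qpar'' y"
  have y: "y \<in> X" and H: "fheap n M X {y} s" and no: "\<forall>v\<in>X. arrs s ''qpar'' v \<noteq> Suc n"
    using I g by (auto simp: cut_inv_def y_def)
  note b = fheap_bounds[OF H B]
  have F: "forest n X {y} (arrs s ''qpar'') (arrs s ''qmark'') (arrs s ''deg'')" using H by (simp add: fheap_def)
  have yn: "y < n" using b(7)[OF y] .
  have pn: "p \<le> Suc n" "p \<le> B" using H y b(2) unfolding fheap_def p_def by auto
  define s1 where "s1 = setr ''qz'' p s"
  have finm: "finite (marked n X s)" using b(6) by (simp add: marked_def)
  have ag1: "agree (\<lambda>y. \<not> qname y) s s1" by (auto simp: s1_def intro!: agree_setr)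
  show ?thesis
  proof (cases "p < n")
    case False
    let ?s' = "setr ''qg'' 0 s1"
    have "forest n X {} (arrs s ''qpar'') (arrs s ''qmark'') (arrs s ''deg'')"
      using forest_drop_root[of n X y "{}"] F False by (simp add: p_def)
    moreover have "lists n X ?s'" using H lists_cong[of s ?s' n X] by (simp add: fheap_def s1_def agree_def)
    ultimately have "cut_inv n M X ?s'" using no H by (simp add: cut_inv_def fheap_def s1_def)
    moreover have "marked n X ?s' = marked n X s - {y}" using False by (auto simp: marked_def s1_def p_def)
    then have "cut_pot n X ?s' + 74 \<le> cut_pot n X s" using g False
      by (simp add: cut_pot_def fib_pot_def y_def[symmetric] p_def[symmetric]) (simp add: s1_def)
    moreover have "agree (\<lambda>y. \<not> qname y) s ?s'" using ag1 by (rule agree_setr) simp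
    ultimately have "?Q ?s'" by blast
    then show ?thesis using False yn b(1,2) pn unfolding fib_cut_def
      by (simp add: s1_def y_def[symmetric] p_def[symmetric])
  next
    case True
    have pX: "p \<in> X" using forest_par[OF F y] True by (simp add: p_def)
    \<comment> \<open>The tree edges are well-founded, so no vertex is its own parent.\<close>
    have py: "p \<noteq> y"
    proof
      assume "p = y"
      have "wf {(arrs s ''qpar'' v, v) | v. v \<in> X \<and> arrs s ''qpar'' v < n}" using F by (simp add: forest_def)
      moreover have "(y, y) \<in> {(arrs s ''qpar'' v, v) | v. v \<in> X \<and> arrs s ''qpar'' v < n}"
        using y True \<open>p = y\<close> by (auto simp: p_def)
      ultimately show False by (rule wf_not_refl[THEN notE])
    qed
    have H1: "fheap n M X {y} s1" using H fheap_cong(1)[of s s1 n M X "{y}"] lists_cong[of s s1 n X]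
      by (simp add: fheap_def s1_def agree_def)
    have "wp B (move_to (Reg ''qx'') (Reg ''n'')) s1
      (\<lambda>s'. wp B (Cond (Read ''qmark'' (Reg ''qz'') \<doteq> Num 0)
        (Write ''qmark'' (Reg ''qz'') (Num 1) ;; Assign ''qg'' (Num 0))
        (Assign ''qx'' (Reg ''qz''))) s' ?Q)"
    proof (rule fib_move_to_root[OF H1 B, of y p])
      fix s2
      assume s2: "fheap n M X (insert p {y} - {y}) s2" "\<forall>v\<in>X. arrs s2 ''qpar'' v \<noteq> Suc n"
        "arrs s2 ''qpar'' = (arrs s1 ''qpar'')(y := n)" "agree moved s1 s2"
        "arrs s2 ''qrk'' n = Suc (arrs s1 ''qrk'' n)"
      have z: "regs s2 ''qz'' = p" "regs s2 ''qg'' = regs s ''qg''" "arrs s2 ''qmark'' = arrs s ''qmark''"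
        "arrs s2 ''qpar'' = (arrs s ''qpar'')(y := n)" "arrs s2 ''deg'' = arrs s ''deg''"
        using s2(3) agree_regs[OF s2(4), of "''qz''"] agree_regs[OF s2(4), of "''qg''"]
          agree_arrs[OF s2(4), of "''qmark''"] agree_arrs[OF s2(4), of "''deg''"] by (simp_all add: s1_def)
      have mk: "marked n X s2 = marked n X s - {y}"
        using marked_moved[OF s2(4,3)] by (simp add: s1_def marked_def)
      have ag2: "agree (\<lambda>y. \<not> qname y) s s2" using agree_trans[OF ag1 moved_qname[OF s2(4)]] .
      have yp: "insert p {y} - {y} = {p}" using py by auto
      have bp: "p \<le> B" "arrs s ''qmark'' p \<le> 1" "1 \<le> B" "arrs s ''qmark'' p \<le> B"
        using pn b(2) b(11)[OF pX] by auto
      show "wp B (Cond (Read ''qmark'' (Reg ''qz'') \<doteq> Num 0)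
        (Write ''qmark'' (Reg ''qz'') (Num 1) ;; Assign ''qg'' (Num 0))
        (Assign ''qx'' (Reg ''qz''))) s2 ?Q"
      proof (cases "arrs s ''qmark'' p = 0")
        \<comment> \<open>End of the cascade: in the counting clause the new mark on
          \<open>p\<close> replaces the lost child.\<close>
        case True
        let ?s' = "setr ''qg'' 0 (seta ''qmark'' p 1 s2)"
        have "forest n X ({y} - {y}) ((arrs s ''qpar'')(y := n)) ((arrs s ''qmark'')(p := 1)) (arrs s ''deg'')"
          using forest_cut_mark[OF F y, of n] True by (simp add: p_def)
        moreover have "lists n X ?s'" using s2(1) lists_cong[of s2 ?s' n X] by (simp add: fheap_def agree_def)
        ultimately have "cut_inv n M X ?s'" using s2(1,2) by (simp add: cut_inv_def fheap_def z)
        moreover have "marked n X ?s' \<subseteq> insert p (marked n X s - {y})"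
          unfolding mk[symmetric] by (auto simp: marked_def)
        then have "card (marked n X ?s') \<le> card (insert p (marked n X s - {y}))"
          using finm by (intro card_mono) auto
        then have "card (marked n X ?s') \<le> Suc (card (marked n X s - {y}))"
          using finm by (simp add: card_insert_if split: if_splits)
        then have "cut_pot n X ?s' + 74 \<le> cut_pot n X s"
          using g \<open>p < n\<close> s2(5)
          by (simp add: cut_pot_def fib_pot_def y_def[symmetric] p_def[symmetric]) (simp add: s1_def)
        moreover have "agree (\<lambda>y. \<not> qname y) s ?s'" using ag2 by (intro agree_setr agree_seta) simp_all
        ultimately have "?Q ?s'" by blast
        then show ?thesis using True bp by (simp add: z)
      next
        case False
        then have m1: "arrs s ''qmark'' p = 1" using bp by simp
        let ?s' = "setr ''qx'' p s2"
        have "lists n X ?s'" using s2(1) lists_cong[of s2 ?s' n X] by (simp add: fheap_def agree_def)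
        then have "cut_inv n M X ?s'" using s2(1,2) g I pX yp by (simp add: cut_inv_def fheap_def z)
        moreover have mk': "marked n X ?s' = marked n X s - {y}" using mk by (simp add: marked_def)
        have par': "arrs s2 ''qpar'' p = arrs s ''qpar'' p" using z(4) py by simp
        have "cut_pot n X ?s' + 74 \<le> cut_pot n X s"
        proof (cases "arrs s ''qpar'' p < n")
          case True
          \<comment> \<open>The mark of \<open>p\<close> was counted and no longer is; its 1200
            credits pay for the new root and for this iteration, while the 2200 pass on to
            \<open>p\<close>.\<close>
          then have "p \<in> marked n X s - {y}" using pX py m1 by (simp add: marked_def)
          then have "Suc (card (marked n X s - {y} - {p})) = card (marked n X s - {y})"
            using finm by (intro card.remove[symmetric, THEN sym, symmetric]) simp_all
          then show ?thesis
            using g \<open>p < n\<close> True s2(5) mk' par' z(2)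
            by (simp add: cut_pot_def y_def[symmetric] p_def[symmetric]) (simp add: s1_def)
        next
          case False
          have "card (marked n X s - {y} - {p}) \<le> card (marked n X s - {y})"
            using finm by (intro card_mono) auto
          then show ?thesis
            using g \<open>p < n\<close> False s2(5) mk' par' z(2)
            by (simp add: cut_pot_def y_def[symmetric] p_def[symmetric]) (simp add: s1_def)
        qed
        moreover have "agree (\<lambda>y. \<not> qname y) s ?s'" using ag2 by (rule agree_setr) simp
        ultimately have "?Q ?s'" by blast
        then show ?thesis using False bp by (simp add: z)
      qed
    qed (use y True no yn b(2) in \<open>auto simp: s1_def p_def y_def\<close>)
    then show ?thesis using True yn b(1,2) pn unfolding fib_cut_def
      unfolding wp.simps(4) wp.simps(2) wp.simps(5)[of B "Reg ''qz'' \<prec> Reg ''n''"]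
      by (simp add: s1_def y_def[symmetric] p_def[symmetric] del: wp.simps(5))
  qed
qed

lemma run_fib_decrease:
  assumes H: "fib n M X s" and B: "(n + 2) * (n + 1) + M \<le> B"
    and x: "regs s ''x'' \<in> X" and d: "regs s ''d'' \<le> arrs s ''deg'' (regs s ''x'')"
  shows "run B fib_decrease s (3000 + fib_pot n X s) (\<lambda>s' T. fib n M X s' \<and> fib_pot n X s' \<le> T \<and>
    arrs s' ''deg'' = (arrs s ''deg'')(regs s ''x'' := arrs s ''deg'' (regs s ''x'') - regs s ''d'') \<and>
    agree (\<lambda>y. \<not> qname y \<and> y \<noteq> ''deg'') s s')"
    (is "run _ _ _ _ ?Q")
proof -
  let ?x = "regs s ''x''"
  define k where "k = arrs s ''deg'' ?x - regs s ''d''"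
  define s1 where "s1 = setr ''qg'' 1 (setr ''qx'' ?x (seta ''deg'' ?x k s))"
  have H0: "fheap n M X {} s" and no: "\<forall>v\<in>X. arrs s ''qpar'' v \<noteq> Suc n" using H by (auto simp: fib_def)
  note b = fheap_bounds[OF H0 B]
  have F: "forest n X {} (arrs s ''qpar'') (arrs s ''qmark'') (arrs s ''deg'')" using H0 by (simp add: fheap_def)
  \<comment> \<open>A smaller key can break the heap order only between \<open>x\<close> and its
    parent, and suspending \<open>x\<close> exempts this pair.\<close>
  have F1: "forest n X {?x} (arrs s ''qpar'') (arrs s ''qmark'') ((arrs s ''deg'')(?x := k))"
    by (rule forest_subI[OF F]) (use forest_par[OF F] forest_mark_le[OF F] in \<open>auto simp: k_def\<close>)
  have L1: "lists n X s1" using H0 lists_cong[of s s1 n X] by (simp add: fheap_def s1_def agree_def)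
  have "arrs s ''deg'' ?x \<le> M" using H0 x by (simp add: fheap_def)
  then have kM: "k \<le> M" by (simp add: k_def)
  have I1: "cut_inv n M X s1"
    using no H0 F1 L1 x kM unfolding cut_inv_def fheap_def by (simp add: s1_def)
  have ag1: "agree (\<lambda>y. \<not> qname y \<and> y \<noteq> ''deg'') s s1" unfolding s1_def by (intro agree_setr agree_seta) simp_all
  have "card (marked n X s - {?x}) \<le> card (marked n X s)"
    using b(6) by (intro card_mono) (auto simp: marked_def)
  moreover have "marked n X s1 = marked n X s" by (simp add: marked_def s1_def)
  ultimately have pot1: "cut_pot n X s1 \<le> fib_pot n X s + 2200"
    by (simp add: cut_pot_def fib_pot_def) (simp add: s1_def)
  define I where "I = (\<lambda>s'. cut_inv n M X s' \<and> agree (\<lambda>y. \<not> qname y) s1 s')"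
  have "run B (While (Reg ''qg'') fib_cut) s1 (cut_pot n X s1 + 2) ?Q"
  proof (rule run_While[where I = I and \<Phi> = "cut_pot n X"])
    show "I s1" using I1 by (simp add: I_def)
  next
    fix s' assume "I s'"
    then show "fits B (Reg ''qg'') s'" using b(2) by (auto simp: I_def cut_inv_def split: if_splits)
  next
    fix s' assume I: "I s'" and g: "aval (Reg ''qg'') s' \<noteq> 0"
    have W: "wp B fib_cut s' (\<lambda>s''. cut_inv n M X s'' \<and> agree (\<lambda>y. \<not> qname y) s' s'' \<and> cut_pot n X s'' + 74 \<le> cut_pot n X s')"
      using wp_fib_cut[OF _ B, of X s'] I g by (simp add: I_def)
    obtain t s'' where s'': "exec B fib_cut s' t s''" "t \<le> 72" "cut_inv n M X s''" "agree (\<lambda>y. \<not> qname y) s' s''"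
      "cut_pot n X s'' + 74 \<le> cut_pot n X s'"
      using wp_exec[OF fib_scost(8) W] by (auto simp: fib_scost)
    have "I s''" using I s''(3) agree_trans[OF _ s''(4)] by (simp add: I_def)
    then have "run B fib_cut s' (cut_pot n X s' - 2) (\<lambda>s' T''. I s' \<and> cut_pot n X s' \<le> T'')"
      using s'' by (intro runI[OF s''(1), of "cut_pot n X s''"]) auto
    then show "\<exists>T'. cost (Reg ''qg'') + 1 + T' \<le> cut_pot n X s' \<and> run B fib_cut s' T' (\<lambda>s' T''. I s' \<and> cut_pot n X s' \<le> T'')"
      using s''(5) by (intro exI[of _ "cut_pot n X s' - 2"]) simp
  next
    fix s' assume I: "I s'" and g: "aval (Reg ''qg'') s' = 0"
    have "agree (\<lambda>y. \<not> qname y) s1 s'" using I by (simp add: I_def)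
    moreover from this have "arrs s' ''deg'' = arrs s1 ''deg''" by (rule agree_arrs) simp
    moreover have "fib n M X s'" using I g by (simp add: I_def cut_inv_def fib_def)
    ultimately show "?Q s' (cut_pot n X s')"
      using g agree_trans[OF ag1 agree_weaken_u] by (simp add: cut_pot_def s1_def k_def)
  qed simp
  then have "run B (While (Reg ''qg'') fib_cut) s1 (fib_pot n X s + 2980) ?Q"
    by (rule run_conseq[where F = 0]) (use pot1 in simp_all)
  moreover have small: "?x \<le> B" "k \<le> B" "1 \<le> B" "arrs s ''deg'' ?x \<le> B" "regs s ''d'' \<le> B"
    using b(2,3) b(7)[OF x] kM b(9)[OF x] d by simp_all
  ultimately have "run B (Assign ''qg'' (Num 1) ;; While (Reg ''qg'') fib_cut) (setr ''qx'' ?x (seta ''deg'' ?x k s))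
      (fib_pot n X s + 2982) ?Q"
    by (intro run_straight_Seq[where T' = "fib_pot n X s + 2980"]) (simp_all add: s1_def)
  with small have "run B (Assign ''qx'' (Reg ''x'') ;; Assign ''qg'' (Num 1) ;; While (Reg ''qg'') fib_cut)
      (seta ''deg'' ?x k s) (fib_pot n X s + 2984) ?Q"
    by (intro run_straight_Seq[where T' = "fib_pot n X s + 2982"]) simp_all
  with small show ?thesis
    unfolding fib_decrease_def
    by (intro run_straight_Seq[where T' = "fib_pot n X s + 2984"]) (simp_all add: k_def)
qed

text \<open>Deletion requires a member of root list \<open>n\<close>, and the minimum returned by
  \<open>fib_find\<close> is one. Decrements of any size are allowed.\<close>

lemma fib_pq:
  assumes B: "(n + 2) * (n + 1) + M \<le> B" and h: "n < 2 ^ h"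
  shows "priority_queue B n M fib_insert fib_find fib_delete fib_decrease (fib n M) (fib n M)
    (\<lambda>s u. arrs s ''qpar'' u = n) (fib_pot n) (2700 * h + 100) 3000 0 (\<lambda>_. True)"
proof
  fix s :: state
  assume s: "regs s ''n'' = n" and q: "\<And>y. qname y \<Longrightarrow> regs s y = 0 \<and> arrs s y = (\<lambda>_. 0)"
  then show "fib n M {} s \<and> fib_pot n {} s \<le> 0"
    by (simp add: fib_def fheap_def lists_def forest_def slots_def fib_pot_def marked_def)
next
  fix X and s :: state
  assume "fib n M X s" "X \<noteq> {}"
  from run_fib_find[OF this(1) B h this(2)]
  show "run B fib_find s (2700 * h + 100 + fib_pot n X s) (\<lambda>s' T. fib n M X s' \<and> fib_pot n X s' \<le> T \<and>
    arrs s' ''qpar'' (regs s' ''u'') = n \<and> regs s' ''u'' \<in> X \<and>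
    (\<forall>v\<in>X. arrs s ''deg'' (regs s' ''u'') \<le> arrs s ''deg'' v) \<and> agree (\<lambda>y. \<not> qname y \<and> y \<noteq> ''u'') s s')" .
next
  fix s s' :: state and X
  assume "agree (\<lambda>y. qname y \<or> y = ''n'' \<or> y = ''deg'') s s'"
  then show "fib n M X s' = fib n M X s \<and> fib n M X s' = fib n M X s \<and> fib_pot n X s' = fib_pot n X s \<and>
      (\<lambda>u. arrs s' ''qpar'' u = n) = (\<lambda>u. arrs s ''qpar'' u = n)"
    using fheap_cong(2)[of s s' n M X] fheap_cong(3)[of s s' n X] by (simp add: agree_def)
qed (use run_fib_insert[OF _ B] run_fib_delete[OF _ B h] run_fib_decrease[OF _ B] in blast)+

section \<open>Reading the graph\<close>

text \<open>A vertex is put on the list \<open>vl\<close> when its first edge arrives, so isolated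
  vertices are never touched. Row \<open>u\<close> of \<open>adj\<close> has \<open>m\<close> cells,
  enough for all edges.\<close>

definition add_half :: "aexp \<Rightarrow> com" where
  "add_half we =
     Cond (Read ''cnt'' (Reg ''u'') \<doteq> Num 0)
       (Write ''vl'' (Reg ''nl'') (Reg ''u'') ;; Assign ''nl'' (Reg ''nl'' \<oplus> Num 1)) Skip ;;
     Write ''adj'' (Reg ''u'' \<otimes> Reg ''m'' \<oplus> Read ''cnt'' (Reg ''u'')) (Reg ''e'') ;;
     Write ''cnt'' (Reg ''u'') (Read ''cnt'' (Reg ''u'') \<oplus> Num 1) ;;
     Write ''deg'' (Reg ''u'') (Read ''deg'' (Reg ''u'') \<oplus> we)"

definition read_edges :: "aexp \<Rightarrow> com" where
  "read_edges we =
     While (Reg ''e'' \<prec> Reg ''m'')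
      (Assign ''u'' (Read ''src'' (Reg ''e'')) ;; add_half we ;;
       Assign ''u'' (Read ''tgt'' (Reg ''e'')) ;; add_half we ;;
       Assign ''ew'' (Reg ''ew'' \<oplus> we) ;; Assign ''e'' (Reg ''e'' \<oplus> Num 1))"

text \<open>\<open>we\<close> hides where weights come from: the constant 1 or a cell of the array
  \<open>weight\<close>, whose contents are \<open>WGT\<close>. Either costs at most 2.\<close>

locale edge_array =
  fixes n :: nat and es :: "(nat \<times> nat) list" and E :: "nat set set" and w :: "nat set \<Rightarrow> nat"
    and we :: aexp and WGT :: "nat \<Rightarrow> nat" and B M :: nat
  assumes graph: "simple_graph {..<n} E" and es: "edge_list E es"
    and B: "n * length es + length es + 2 * n + 2 * M + 3 \<le> B" and M: "(\<Sum>e\<in>E. w e) \<le> M"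
    and we: "regs s ''e'' < length es \<Longrightarrow> arrs s ''weight'' = WGT \<Longrightarrow> fits B we s \<and>
      aval we s = w {fst (es ! regs s ''e''), snd (es ! regs s ''e'')}"
    and cost_we: "cost we \<le> 2"
begin

definition m where "m = length es"
definition src where "src i = fst (es ! i)"
definition tgt where "tgt i = snd (es ! i)"
definition edge where "edge i = {src i, tgt i}"
definition wt where "wt i = w (edge i)"

lemma edge_bij: "bij_betw edge {..<m} E"
proof -
  have *: "map (\<lambda>(u, v). {u, v}) es = map edge [0..<m]"
    by (rule nth_equalityI) (auto simp: m_def edge_def src_def tgt_def case_prod_beta)
  have "distinct (map edge [0..<m])" "set (map edge [0..<m]) = E"
    using es unfolding edge_list_def * by auto
  then show ?thesis by (auto simp: bij_betw_def distinct_map atLeast0LessThan)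
qed

lemma edge_in: "i < m \<Longrightarrow> edge i \<in> E"
  using edge_bij by (auto simp: bij_betw_def)

lemma edge_eq_iff: "i < m \<Longrightarrow> j < m \<Longrightarrow> edge i = edge j \<longleftrightarrow> i = j"
  using edge_bij by (auto simp: bij_betw_def inj_on_def)

lemma E_conv: "E = edge ` {..<m}"
  using edge_bij by (simp add: bij_betw_def)

lemma finite_E: "finite E" unfolding E_conv by simp

lemma src_tgt:
  assumes "i < m"
  shows "src i < n" "tgt i < n" "src i \<noteq> tgt i"
proof -
  have "edge i \<subseteq> {..<n}" "card (edge i) = 2"
    using graph edge_in[OF assms] by (auto simp: simple_graph_def)
  then show "src i < n" "tgt i < n" "src i \<noteq> tgt i" by (auto simp: edge_def card_insert_if split: if_splits)
qed

lemma sum_edge: "I \<subseteq> {..<m} \<Longrightarrow> (\<Sum>e\<in>edge ` I. f e) = (\<Sum>i\<in>I. f (edge i))"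
  using edge_bij by (subst sum.reindex) (auto simp: bij_betw_def intro: inj_on_subset)

lemma wdeg_edge: "I \<subseteq> {..<m} \<Longrightarrow> wdeg w (edge ` I) v = (\<Sum>i | i \<in> I \<and> v \<in> edge i. wt i)"
proof -
  assume "I \<subseteq> {..<m}"
  moreover have "incident (edge ` I) v = edge ` {i \<in> I. v \<in> edge i}" by (auto simp: incident_def)
  ultimately show ?thesis unfolding wdeg_def wt_def
    using sum_edge[of "{i \<in> I. v \<in> edge i}" w] by auto
qed

lemma sum_wt_le: "I \<subseteq> {..<m} \<Longrightarrow> (\<Sum>i\<in>I. wt i) \<le> M"
proof -
  assume "I \<subseteq> {..<m}"
  then have "(\<Sum>i\<in>I. wt i) \<le> (\<Sum>i<m. wt i)" by (intro sum_mono2) auto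
  also have "\<dots> = (\<Sum>e\<in>E. w e)" unfolding E_conv wt_def by (simp add: sum_edge)
  finally show ?thesis using M by simp
qed

lemma bounds: "n * m + m + 2 * n + 2 * M + 3 \<le> B"
  using B by (simp add: m_def)

lemma adj_bound: "v < n \<Longrightarrow> i < m \<Longrightarrow> v * m + i \<le> B"
proof -
  assume "v < n" "i < m"
  then have "v * m + i \<le> n * m + m" by (intro add_mono mult_le_mono1) auto
  then show ?thesis using bounds by linarith
qed

lemma mult_bound: "v < n \<Longrightarrow> v * m \<le> B"
proof -
  assume "v < n"
  then have "v * m \<le> n * m" by (intro mult_le_mono1) auto
  then show ?thesis using bounds by linarith
qed

definition input :: "state \<Rightarrow> bool" where
  "input s \<longleftrightarrow> regs s ''n'' = n \<and> regs s ''m'' = m \<and>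
    (\<forall>i<m. arrs s ''src'' i = src i \<and> arrs s ''tgt'' i = tgt i) \<and> arrs s ''weight'' = WGT"

lemma weD: "input s \<Longrightarrow> regs s ''e'' < m \<Longrightarrow> fits B we s \<and> aval we s = wt (regs s ''e'')"
  using we[of s] by (simp add: input_def m_def wt_def edge_def src_def tgt_def)

text \<open>\<open>H\<close> is the set of pairs (vertex, index of incident edge) entered so far.\<close>

definition adjacency :: "(nat \<times> nat) set \<Rightarrow> state \<Rightarrow> bool" where
  "adjacency H s \<longleftrightarrow> (\<forall>v. arrs s ''cnt'' v = card (H `` {v})) \<and>
    (\<forall>v. (\<lambda>i. arrs s ''adj'' (v * m + i)) ` {..<arrs s ''cnt'' v} = H `` {v}) \<and>
    inj_on (arrs s ''vl'') {..<regs s ''nl''} \<and> arrs s ''vl'' ` {..<regs s ''nl''} = Domain H"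

lemma adjacency_setr [simp]: "x \<noteq> ''nl'' \<Longrightarrow> adjacency H (setr x v s) = adjacency H s"
  by (simp add: adjacency_def)

definition half_edges :: "nat \<Rightarrow> (nat \<times> nat) set" where
  "half_edges j = {(v, i). i < j \<and> v \<in> edge i}"

lemma wp_add_half:
  assumes s: "input s" "adjacency H s" "\<forall>v. arrs s ''deg'' v = sum wt (H `` {v})"
    and H: "H \<subseteq> {..<n} \<times> {..<m}" and u: "regs s ''u'' = v" "v < n"
    and e: "regs s ''e'' = j" "j < m" "(v, j) \<notin> H"
    and Q: "\<And>s'. adjacency (insert (v, j) H) s' \<Longrightarrow> \<forall>x. arrs s' ''deg'' x = sum wt (insert (v, j) H `` {x}) \<Longrightarrow>
      agree (\<lambda>y. y \<notin> {''nl'', ''vl'', ''adj'', ''cnt'', ''deg''}) s s' \<Longrightarrow> Q s'"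
  shows "wp B (add_half we) s Q"
proof -
  define c where "c = arrs s ''cnt'' v"
  define l where "l = regs s ''nl''"
  define s1 where "s1 = (if c = 0 then setr ''nl'' (Suc l) (seta ''vl'' l v s) else s)"
  define s2 where "s2 = seta ''cnt'' v (Suc c) (seta ''adj'' (v * m + c) j s1)"
  define s' where "s' = seta ''deg'' v (sum wt (H `` {v}) + wt j) s2"
  have finH: "finite H" using H finite_subset by blast
  then have fin: "finite (H `` {x})" for x by simp
  have Hm: "H `` {x} \<subseteq> {..<m}" for x using H by auto
  have cnt: "arrs s ''cnt'' x = card (H `` {x})" for x using s(2) by (simp add: adjacency_def)
  \<comment> \<open>The edges at \<open>v\<close> entered so far and \<open>j\<close> are different
    numbers below \<open>m\<close>, so the row still has room.\<close>
  have "insert j (H `` {v}) \<subseteq> {..<m}" using Hm e(2) by auto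
  then have "card (insert j (H `` {v})) \<le> m" using card_mono[of "{..<m}"] by fastforce
  then have c: "c < m" using e(3) fin[of v] by (simp add: c_def cnt)
  have vl: "inj_on (arrs s ''vl'') {..<l}" "arrs s ''vl'' ` {..<l} = Domain H"
    using s(2) by (auto simp: adjacency_def l_def)
  have "Domain H \<subseteq> {..<n}" using H by auto
  then have "card (Domain H) \<le> n" using card_mono[of "{..<n}"] by fastforce
  moreover have "card (Domain H) = l" using card_image[OF vl(1)] vl(2) by simp
  ultimately have l: "l \<le> n" by simp
  \<comment> \<open>A count of 0 means that \<open>v\<close> has not been listed yet.\<close>
  have dom: "v \<in> Domain H \<longleftrightarrow> c \<noteq> 0" using fin[of v] by (auto simp: c_def cnt card_eq_0_iff)
  have deg: "sum wt (H `` {v}) + wt j \<le> M"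
    using sum_wt_le[of "insert j (H `` {v})"] Hm e(2,3) fin[of v] by simp
  have wej: "fits B we s2 \<and> aval we s2 = wt j"
    using weD[of s2] s(1) e(1,2) by (simp add: input_def s2_def s1_def)
  have img: "(\<lambda>i. arrs s ''adj'' (x * m + i)) ` {..<arrs s ''cnt'' x} = H `` {x}" for x
    using s(2) unfolding adjacency_def by blast
  have cm: "arrs s ''cnt'' x \<le> m" for x
    unfolding cnt using card_mono[OF _ Hm, of x] by simp
  have "adjacency (insert (v, j) H) s'"
    unfolding adjacency_def
  proof (intro conjI allI)
    fix x
    show "arrs s' ''cnt'' x = card (insert (v, j) H `` {x})"
    proof (cases "x = v")
      case True
      then have "insert (v, j) H `` {x} = insert j (H `` {x})" by auto
      then show ?thesis using True e(3) fin[of v] by (simp add: s'_def s2_def c_def cnt)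
    next
      case False
      then have "insert (v, j) H `` {x} = H `` {x}" by auto
      then show ?thesis using False by (simp add: s'_def s2_def s1_def cnt)
    qed
    show "(\<lambda>i. arrs s' ''adj'' (x * m + i)) ` {..<arrs s' ''cnt'' x} = insert (v, j) H `` {x}"
    proof (cases "x = v")
      case True
      have "(\<lambda>i. arrs s' ''adj'' (v * m + i)) ` {..<Suc c} = insert j ((\<lambda>i. arrs s ''adj'' (v * m + i)) ` {..<c})"
        by (auto simp: s'_def s2_def s1_def lessThan_Suc image_iff)
      then show ?thesis using True img[of v] by (auto simp: s'_def s2_def c_def[symmetric])
    next
      case False
      have "(\<lambda>i. arrs s' ''adj'' (x * m + i)) ` {..<arrs s ''cnt'' x} = (\<lambda>i. arrs s ''adj'' (x * m + i)) ` {..<arrs s ''cnt'' x}"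
      proof (rule image_cong[OF refl])
        fix i assume "i \<in> {..<arrs s ''cnt'' x}"
        then have "i < m" using cm[of x] by auto
        then show "arrs s' ''adj'' (x * m + i) = arrs s ''adj'' (x * m + i)"
          using False index_eq_iff[of i m c x v] c by (auto simp: s'_def s2_def s1_def)
      qed
      moreover have "arrs s' ''cnt'' x = arrs s ''cnt'' x" using False by (simp add: s'_def s2_def s1_def)
      moreover have "insert (v, j) H `` {x} = H `` {x}" using False by auto
      ultimately show ?thesis using img[of x] by (simp only:)
    qed
    show "inj_on (arrs s' ''vl'') {..<regs s' ''nl''}"
    proof (cases "c = 0")
      case True
      have "inj_on ((arrs s ''vl'')(l := v)) {..<l}" using vl(1) by (auto simp: inj_on_def)
      moreover have "((arrs s ''vl'')(l := v)) ` {..<l} = Domain H" using vl(2) by auto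
      ultimately show ?thesis using True dom by (simp add: s'_def s2_def s1_def lessThan_Suc)
    next
      case False
      then show ?thesis using vl(1) by (simp add: s'_def s2_def s1_def l_def)
    qed
    show "arrs s' ''vl'' ` {..<regs s' ''nl''} = Domain (insert (v, j) H)"
    proof (cases "c = 0")
      case True
      have "{..<l} \<inter> {x. x \<noteq> l} = {..<l}" by auto
      then show ?thesis using True vl(2) by (simp add: s'_def s2_def s1_def lessThan_Suc)
    next
      case False
      then show ?thesis using vl(2) dom by (auto simp: s'_def s2_def s1_def l_def)
    qed
  qed
  moreover have "\<forall>x. arrs s' ''deg'' x = sum wt (insert (v, j) H `` {x})"
  proof
    fix x
    show "arrs s' ''deg'' x = sum wt (insert (v, j) H `` {x})"
    proof (cases "x = v")
      case True
      then have "insert (v, j) H `` {x} = insert j (H `` {x})" by auto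
      then show ?thesis using True e(3) fin[of v] by (simp add: s'_def)
    next
      case False
      then have "insert (v, j) H `` {x} = H `` {x}" by auto
      then show ?thesis using False s(3) by (simp add: s'_def s2_def s1_def)
    qed
  qed
  moreover have "agree (\<lambda>y. y \<notin> {''nl'', ''vl'', ''adj'', ''cnt'', ''deg''}) s s'"
    unfolding s'_def s2_def s1_def by (auto intro!: agree_seta agree_setr)
  ultimately have Q': "Q s'" by (rule Q)
  have small: "1 \<le> B" "v \<le> B" "c \<le> B" "Suc c \<le> B" "l \<le> B" "Suc l \<le> B" "m \<le> B" "j \<le> B" "v * m \<le> B" "v * m + c \<le> B"
    "sum wt (H `` {v}) \<le> B" "sum wt (H `` {v}) + wt j \<le> B"
    using bounds u(2) c l e(2) deg mult_bound[OF u(2)] adj_bound[OF u(2) c] by linarith+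
  have rm: "regs s ''m'' = m" using s(1) by (simp add: input_def)
  have "wp B (Cond (Read ''cnt'' (Reg ''u'') \<doteq> Num 0)
       (Write ''vl'' (Reg ''nl'') (Reg ''u'') ;; Assign ''nl'' (Reg ''nl'' \<oplus> Num 1)) Skip) s R = R s1" for R
    using small u by (simp add: s1_def c_def[symmetric] l_def[symmetric])
  moreover have s1: "regs s1 ''u'' = v" "regs s1 ''m'' = m" "regs s1 ''e'' = j" "arrs s1 ''cnt'' v = c"
    "arrs s1 ''deg'' v = sum wt (H `` {v})"
    using u e rm s(3) by (simp_all add: s1_def c_def)
  ultimately show ?thesis
    using small s1 Q' wej unfolding add_half_def wp.simps(4)
    by (simp add: s'_def s2_def)
qed

lemma straight_add_half [simp]: "straight (add_half we)"
  by (simp add: add_half_def)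

lemma scost_add_half: "scost (add_half we) \<le> 40"
  using cost_we by (simp add: add_half_def)

definition static :: "state \<Rightarrow> bool" where
  "static s \<longleftrightarrow> input s \<and> adjacency (half_edges m) s"

lemma static_cong:
  "agree (\<lambda>y. y \<in> {''n'', ''m'', ''nl'', ''src'', ''tgt'', ''weight'', ''cnt'', ''adj'', ''vl''}) s s' \<Longrightarrow> static s' = static s"
  by (simp add: static_def input_def adjacency_def agree_def)

lemma run_read_edges:
  assumes s0: "input s0" "regs s0 ''e'' = 0" "regs s0 ''ew'' = 0" "regs s0 ''nl'' = 0"
    "arrs s0 ''cnt'' = (\<lambda>_. 0)" "arrs s0 ''deg'' = (\<lambda>_. 0)"
  shows "run B (read_edges we) s0 (200 * (m + 1)) (\<lambda>s T. static s \<and> (\<forall>v. arrs s ''deg'' v = wdeg w E v) \<and>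
    regs s ''ew'' = (\<Sum>e\<in>E. w e) \<and>
    agree (\<lambda>y. y \<notin> {''e'', ''u'', ''ew'', ''nl'', ''vl'', ''adj'', ''cnt'', ''deg''}) s0 s)"
    (is "run _ _ _ _ (\<lambda>s T. ?Q s)")
proof -
  let ?P = "\<lambda>y. y \<notin> {''e'', ''u'', ''ew'', ''nl'', ''vl'', ''adj'', ''cnt'', ''deg''}"
  define I where "I = (\<lambda>s. regs s ''e'' \<le> m \<and> adjacency (half_edges (regs s ''e'')) s \<and>
    (\<forall>v. arrs s ''deg'' v = sum wt (half_edges (regs s ''e'') `` {v})) \<and>
    regs s ''ew'' = (\<Sum>i<regs s ''e''. wt i) \<and> agree ?P s0 s)"
  have inp: "input s" if "agree ?P s0 s" for s
    using that s0(1) by (simp add: agree_def input_def)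
  have half0: "half_edges 0 = {}" by (auto simp: half_edges_def)
  have "run B (read_edges we) s0 (4 + 200 * m) (\<lambda>s T. I s \<and> m \<le> regs s ''e'')"
    unfolding read_edges_def
  proof (rule run_While[where I = I and \<Phi> = "\<lambda>s. 200 * (m - regs s ''e'')"])
    have "adjacency {} s0" using s0(4,5) by (simp add: adjacency_def)
    then show "I s0" using s0 half0 by (simp add: I_def)
  next
    fix s assume "I s"
    then show "fits B (Reg ''e'' \<prec> Reg ''m'') s"
      using bounds inp[of s] by (auto simp: I_def input_def)
  next
    fix s assume I: "I s" and less: "aval (Reg ''e'' \<prec> Reg ''m'') s \<noteq> 0"
    define j where "j = regs s ''e''"
    have inps: "input s" using inp I by (simp add: I_def)
    have j: "j < m" using less inps by (simp add: j_def input_def split: if_splits)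
    have st: "src j < n" "tgt j < n" "src j \<noteq> tgt j" using src_tgt[OF j] by auto
    have srcj: "arrs s ''src'' j = src j" using inps j by (simp add: input_def)
    have half: "half_edges (Suc j) = insert (tgt j, j) (insert (src j, j) (half_edges j))"
      by (auto simp: half_edges_def edge_def less_Suc_eq)
    have sub: "half_edges j \<subseteq> {..<n} \<times> {..<m}"
      using src_tgt j by (auto simp: half_edges_def edge_def)
    have small: "j \<le> B" "src j \<le> B" "tgt j \<le> B" "Suc j \<le> B" using bounds j st by linarith+
    have ew: "(\<Sum>i<j. wt i) + wt j \<le> B" "(\<Sum>i<j. wt i) \<le> B"
      using sum_wt_le[of "{..<Suc j}"] j bounds by (auto simp: lessThan_Suc add.commute)
    let ?s1 = "setr ''u'' (src j) s"
    have W: "wp B (add_half we) ?s1 (\<lambda>s. wp B (Assign ''u'' (Read ''tgt'' (Reg ''e'')) ;; add_half we ;;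
       Assign ''ew'' (Reg ''ew'' \<oplus> we) ;; Assign ''e'' (Reg ''e'' \<oplus> Num 1)) s
      (\<lambda>s'. I s' \<and> regs s' ''e'' = Suc j))"
    proof (rule wp_add_half[where H = "half_edges j" and v = "src j" and j = j])
      fix s2
      assume s2: "adjacency (insert (src j, j) (half_edges j)) s2"
        "\<forall>x. arrs s2 ''deg'' x = sum wt (insert (src j, j) (half_edges j) `` {x})"
        "agree (\<lambda>y. y \<notin> {''nl'', ''vl'', ''adj'', ''cnt'', ''deg''}) ?s1 s2"
      have ag: "agree ?P s0 s2"
      proof -
        have "agree ?P s0 ?s1" using I by (intro agree_setr) (auto simp: I_def)
        moreover have "agree ?P ?s1 s2" using s2(3) by (rule agree_mono) auto
        ultimately show ?thesis by (rule agree_trans)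
      qed
      have r2: "regs s2 ''e'' = j" "regs s2 ''ew'' = (\<Sum>i<j. wt i)" "arrs s2 ''tgt'' j = tgt j"
        using agree_regs[OF s2(3), of "''e''"] agree_regs[OF s2(3), of "''ew''"] I inp[OF ag] j
        by (auto simp: I_def j_def input_def)
      let ?s3 = "setr ''u'' (tgt j) s2"
      have adj3: "adjacency (insert (src j, j) (half_edges j)) ?s3" using s2(1) by simp
      have "wp B (add_half we) ?s3 (\<lambda>s. wp B (Assign ''ew'' (Reg ''ew'' \<oplus> we) ;; Assign ''e'' (Reg ''e'' \<oplus> Num 1)) s
        (\<lambda>s'. I s' \<and> regs s' ''e'' = Suc j))"
      proof (rule wp_add_half[OF _ adj3])
        fix s4
        assume s4: "adjacency (insert (tgt j, j) (insert (src j, j) (half_edges j))) s4"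
          "\<forall>x. arrs s4 ''deg'' x = sum wt (insert (tgt j, j) (insert (src j, j) (half_edges j)) `` {x})"
          "agree (\<lambda>y. y \<notin> {''nl'', ''vl'', ''adj'', ''cnt'', ''deg''}) ?s3 s4"
        have ag4: "agree ?P s0 s4"
        proof -
          have "agree ?P s0 ?s3" using ag by (intro agree_setr) auto
          moreover have "agree ?P ?s3 s4" using s4(3) by (rule agree_mono) auto
          ultimately show ?thesis by (rule agree_trans)
        qed
        have r4: "regs s4 ''e'' = j" "regs s4 ''ew'' = (\<Sum>i<j. wt i)"
          using agree_regs[OF s4(3), of "''e''"] agree_regs[OF s4(3), of "''ew''"] r2 by auto
        have we4: "fits B we s4" "aval we s4 = wt j" using weD[OF inp[OF ag4]] r4 j by auto
        let ?s5 = "setr ''e'' (Suc j) (setr ''ew'' ((\<Sum>i<j. wt i) + wt j) s4)"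
        have "adjacency (half_edges (Suc j)) ?s5" unfolding half using s4(1) by simp
        moreover have "agree ?P s0 ?s5" using ag4 by (intro agree_setr) auto
        ultimately have "I ?s5" using j s4(2) by (simp add: I_def half)
        then show "wp B (Assign ''ew'' (Reg ''ew'' \<oplus> we) ;; Assign ''e'' (Reg ''e'' \<oplus> Num 1)) s4
          (\<lambda>s'. I s' \<and> regs s' ''e'' = Suc j)"
          using we4 r4 ew small by simp
      qed (use inp[OF ag] s2(2) r2 st sub j in \<open>auto simp: input_def half_edges_def\<close>)
      then show "wp B (Assign ''u'' (Read ''tgt'' (Reg ''e'')) ;; add_half we ;;
       Assign ''ew'' (Reg ''ew'' \<oplus> we) ;; Assign ''e'' (Reg ''e'' \<oplus> Num 1)) s2
      (\<lambda>s'. I s' \<and> regs s' ''e'' = Suc j)"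
        using r2 small unfolding wp.simps(2,4) by simp
    qed (use I inps st sub j in \<open>auto simp: I_def input_def j_def half_edges_def\<close>)
    have W': "wp B (Assign ''u'' (Read ''src'' (Reg ''e'')) ;; add_half we ;;
       Assign ''u'' (Read ''tgt'' (Reg ''e'')) ;; add_half we ;;
       Assign ''ew'' (Reg ''ew'' \<oplus> we) ;; Assign ''e'' (Reg ''e'' \<oplus> Num 1)) s
      (\<lambda>s'. I s' \<and> 200 * (m - regs s' ''e'') \<le> 200 * (m - j) - 200)"
      using W small srcj unfolding wp.simps(2,4)
      by (auto simp: j_def[symmetric] elim!: wp_mono)
    show "\<exists>T'. cost (Reg ''e'' \<prec> Reg ''m'') + 1 + T' \<le> 200 * (m - regs s ''e'') \<and>
      run B (Assign ''u'' (Read ''src'' (Reg ''e'')) ;; add_half we ;;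
       Assign ''u'' (Read ''tgt'' (Reg ''e'')) ;; add_half we ;;
       Assign ''ew'' (Reg ''ew'' \<oplus> we) ;; Assign ''e'' (Reg ''e'' \<oplus> Num 1)) s T'
       (\<lambda>s' T''. I s' \<and> 200 * (m - regs s' ''e'') \<le> T'')"
      using W' j scost_add_half cost_we
      by (intro exI[of _ "200 * (m - j) - 4"] conjI run_straight[where T' = "200 * (m - j) - 200"])
        (auto simp: j_def[symmetric])
  next
    fix s assume "I s" and "aval (Reg ''e'' \<prec> Reg ''m'') s = 0"
    then show "I s \<and> m \<le> regs s ''e''"
      using inp[of s] by (auto simp: I_def input_def split: if_splits)
  qed (use s0(2) in simp)
  then show ?thesis
  proof (rule run_conseq[where F = 0])
    fix s :: state and T' assume "I s \<and> m \<le> regs s ''e''"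
    then have I: "I s" and e: "regs s ''e'' = m" by (auto simp: I_def)
    have "half_edges m `` {v} = {i. i \<in> {..<m} \<and> v \<in> edge i}" for v by (auto simp: half_edges_def)
    then show "?Q s"
      using I e inp[of s] wdeg_edge[of "{..<m}"] sum_edge[of "{..<m}" w]
      by (auto simp: I_def static_def E_conv wt_def)
  qed simp
qed

end

section \<open>Peeling\<close>

text \<open>\<open>src + tgt - u\<close> is the other end of the edge. The arc has to point to
  \<open>u\<close>, so the output bit is 1, for reversed, exactly if \<open>u\<close> is the listed
  source.\<close>

definition visit :: "com \<Rightarrow> aexp \<Rightarrow> com" where
  "visit cdec we =
     (Assign ''e'' (Read ''adj'' (Reg ''u'' \<otimes> Reg ''m'' \<oplus> Reg ''i'')) ;;
      Assign ''i'' (Reg ''i'' \<oplus> Num 1)) ;;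
     Cond (Read ''done'' (Reg ''e'') \<doteq> Num 0)
      ((Write ''done'' (Reg ''e'') (Num 1) ;;
        Write ''out'' (Reg ''e'') (Read ''src'' (Reg ''e'') \<doteq> Reg ''u'') ;;
        Assign ''x'' (Read ''src'' (Reg ''e'') \<oplus> Read ''tgt'' (Reg ''e'') \<ominus> Reg ''u'') ;;
        Assign ''d'' we ;; Assign ''ew'' (Reg ''ew'' \<ominus> Reg ''d'')) ;; cdec)
      Skip"

definition peel :: "com \<Rightarrow> com \<Rightarrow> aexp \<Rightarrow> com" where
  "peel cdel cdec we =
     Assign ''x'' (Reg ''u'') ;; cdel ;;
     (Write ''gone'' (Reg ''u'') (Num 1) ;; Assign ''nv'' (Reg ''nv'' \<ominus> Num 1) ;; Assign ''i'' (Num 0)) ;;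
     While (Reg ''i'' \<prec> Read ''cnt'' (Reg ''u'')) (visit cdec we)"

definition ceiling_twice_density :: "aexp \<Rightarrow> aexp" where
  "ceiling_twice_density a = Op Div (Num 2 \<otimes> Reg ''ew'' \<oplus> a \<ominus> Num 1) a"

text \<open>Two integer comparisons steer the loop: a degree below \<open>k\<close> is at most
  \<open>\<lceil>2 * l\<rceil> - 1\<close>, and \<open>deg * nv = 2 * ew\<close> says that the
  minimum degree is the average, so that all degrees agree.\<close>

definition peel_loop :: "com \<Rightarrow> com \<Rightarrow> com \<Rightarrow> aexp \<Rightarrow> com" where
  "peel_loop cfind cdel cdec we =
     While (Reg ''go'')
      (Cond (Reg ''nv'' \<doteq> Num 0) (Assign ''go'' (Num 0))
       (cfind ;;
        Cond (Read ''deg'' (Reg ''u'') \<prec> Reg ''k'') (peel cdel cdec we)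
         (Cond (Read ''deg'' (Reg ''u'') \<otimes> Reg ''nv'' \<doteq> Num 2 \<otimes> Reg ''ew'') (Assign ''go'' (Num 0))
           (Assign ''k'' (ceiling_twice_density (Reg ''nv''))))))"

section \<open>Invariant of the peeling phase\<close>

lemma arcs_towards_Un: "arcs_towards (A \<union> B) v = arcs_towards A v \<union> arcs_towards B v"
  by (auto simp: arcs_towards_def)

lemma arcs_towards_pair: "a \<noteq> v \<Longrightarrow> arcs_towards {{a, v}} v = {(a, v)}"
  by (auto simp: arcs_towards_def doubleton_eq_iff)

lemma wdeg_remove:
  assumes "finite U" "f \<in> U"
  shows "wdeg w (U - {f}) v = wdeg w U v - (if v \<in> f then w f else 0)"
    and "v \<in> f \<Longrightarrow> w f \<le> wdeg w U v"
proof -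
  have fin: "finite (incident U v)" using assms(1) by (simp add: incident_def)
  have "incident (U - {f}) v = incident U v - {f}" by (auto simp: incident_def)
  moreover have "f \<in> incident U v \<longleftrightarrow> v \<in> f" using assms(2) by (simp add: incident_def)
  ultimately show "wdeg w (U - {f}) v = wdeg w U v - (if v \<in> f then w f else 0)"
    unfolding wdeg_def using sum_diff1_nat[of w "incident U v" f] fin by simp
  show "w f \<le> wdeg w U v" if "v \<in> f"
    unfolding wdeg_def using \<open>f \<in> incident U v \<longleftrightarrow> v \<in> f\<close> that fin by (intro member_le_sum) auto
qed

context edge_array
begin

definition V0 where "V0 = Domain (half_edges m)"

definition rest :: "state \<Rightarrow> nat set" where
  "rest s = {i. i < m \<and> arrs s ''done'' i = 0}"

definition rest_edges :: "state \<Rightarrow> nat set set" where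
  "rest_edges s = edge ` rest s"

definition arc :: "state \<Rightarrow> nat \<Rightarrow> nat \<times> nat" where
  "arc s i = (if arrs s ''out'' i = 0 then (src i, tgt i) else (tgt i, src i))"

definition arcs :: "state \<Rightarrow> (nat \<times> nat) set" where
  "arcs s = arc s ` ({..<m} - rest s)"

definition alive :: "state \<Rightarrow> nat set" where
  "alive s = {v \<in> V0. arrs s ''gone'' v = 0}"

lemma half_edges_image: "half_edges m `` {v} = {i. i < m \<and> v \<in> edge i}"
  by (auto simp: half_edges_def)

lemma V0_conv: "V0 = {v \<in> {..<n}. incident E v \<noteq> {}}"
  using src_tgt by (auto simp: V0_def half_edges_def incident_def E_conv edge_def)

lemma V0_less: "v \<in> V0 \<Longrightarrow> v < n"
  by (simp add: V0_conv)

lemma edge_V0: "i < m \<Longrightarrow> edge i \<subseteq> V0"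
  by (auto simp: V0_def half_edges_def)

lemma staticD:
  assumes "static s"
  shows "input s" "arrs s ''cnt'' v = card (half_edges m `` {v})" "arrs s ''cnt'' v \<le> m"
    "i < arrs s ''cnt'' v \<Longrightarrow> arrs s ''adj'' (v * m + i) < m \<and> v \<in> edge (arrs s ''adj'' (v * m + i))"
    "e < m \<Longrightarrow> v \<in> edge e \<Longrightarrow> \<exists>i < arrs s ''cnt'' v. arrs s ''adj'' (v * m + i) = e"
    "inj_on (arrs s ''vl'') {..<regs s ''nl''}" "arrs s ''vl'' ` {..<regs s ''nl''} = V0" "regs s ''nl'' = card V0"
    "regs s ''n'' = n" "regs s ''m'' = m" "e < m \<Longrightarrow> arrs s ''src'' e = src e \<and> arrs s ''tgt'' e = tgt e"
proof -
  have a: "adjacency (half_edges m) s" and inp: "input s" using assms by (auto simp: static_def)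
  show "input s" by (rule inp)
  show "regs s ''n'' = n" "regs s ''m'' = m" "e < m \<Longrightarrow> arrs s ''src'' e = src e \<and> arrs s ''tgt'' e = tgt e"
    using inp by (auto simp: input_def)
  have cnt: "arrs s ''cnt'' v = card (half_edges m `` {v})" for v using a by (simp add: adjacency_def)
  then show "arrs s ''cnt'' v = card (half_edges m `` {v})" .
  have "half_edges m `` {v} \<subseteq> {..<m}" by (auto simp: half_edges_def)
  then show "arrs s ''cnt'' v \<le> m" unfolding cnt using card_mono[of "{..<m}"] by fastforce
  have img: "(\<lambda>i. arrs s ''adj'' (v * m + i)) ` {..<arrs s ''cnt'' v} = {i. i < m \<and> v \<in> edge i}" for v
    using a unfolding adjacency_def half_edges_image by blast
  show "i < arrs s ''cnt'' v \<Longrightarrow> arrs s ''adj'' (v * m + i) < m \<and> v \<in> edge (arrs s ''adj'' (v * m + i))"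
    using img[of v] by blast
  show "\<exists>i < arrs s ''cnt'' v. arrs s ''adj'' (v * m + i) = e" if "e < m" "v \<in> edge e"
  proof -
    have "e \<in> (\<lambda>i. arrs s ''adj'' (v * m + i)) ` {..<arrs s ''cnt'' v}" unfolding img using that by simp
    then show ?thesis by auto
  qed
  show vl: "inj_on (arrs s ''vl'') {..<regs s ''nl''}" "arrs s ''vl'' ` {..<regs s ''nl''} = V0"
    using a by (auto simp: adjacency_def V0_def)
  show "regs s ''nl'' = card V0" using card_image[OF vl(1)] vl(2) by simp
qed

lemma finite_V0: "finite V0" by (simp add: V0_conv)

text \<open>The handshake lemma for unit weights, whatever \<open>w\<close> is.\<close>

lemma sum_cnt:
  assumes "static s"
  shows "(\<Sum>v\<in>V0. arrs s ''cnt'' v) = 2 * m"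
proof -
  have "(\<Sum>v\<in>V0. arrs s ''cnt'' v) = (\<Sum>v\<in>V0. wdeg (\<lambda>_. 1) E v)"
  proof (rule sum.cong[OF refl])
    fix v
    have "incident E v = edge ` (half_edges m `` {v})"
      by (auto simp: incident_def E_conv half_edges_image)
    moreover have "inj_on edge (half_edges m `` {v})"
      using edge_bij by (auto simp: bij_betw_def half_edges_image intro: inj_on_subset)
    ultimately show "arrs s ''cnt'' v = wdeg (\<lambda>_. 1) E v"
      by (simp add: wdeg_def staticD(2)[OF assms] card_image)
  qed
  also have "\<dots> = 2 * (\<Sum>e\<in>E. 1)"
  proof (rule wdeg_handshake[OF finite_V0 finite_E])
    fix e assume "e \<in> E"
    then show "e \<subseteq> V0 \<and> card e = 2" using graph edge_V0 by (auto simp: E_conv simple_graph_def)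
  qed
  also have "\<dots> = 2 * m" using bij_betw_same_card[OF edge_bij] by simp
  finally show ?thesis .
qed

text \<open>A nonisolated vertex has an incident edge, so \<open>2 * m\<close> can take the place of
  the number of vertices in the unweighted time bound.\<close>

lemma card_V0: "card V0 \<le> n" "static s \<Longrightarrow> card V0 \<le> 2 * m"
proof -
  have "V0 \<subseteq> {..<n}" using V0_less by auto
  then show "card V0 \<le> n" using card_mono[of "{..<n}"] by fastforce
  assume s: "static s"
  have "(\<Sum>v\<in>V0. 1) \<le> (\<Sum>v\<in>V0. arrs s ''cnt'' v)"
  proof (rule sum_mono)
    fix v assume "v \<in> V0"
    then obtain e where "e < m" "v \<in> edge e" by (auto simp: V0_def half_edges_def)
    then show "1 \<le> arrs s ''cnt'' v" using staticD(5)[OF s] by fastforce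
  qed
  then show "card V0 \<le> 2 * m" using sum_cnt[OF s] by simp
qed

end

locale orientation_program =
  edge_array n es E w we WGT B M +
  priority_queue B n M cins cfind cdel cdec PQ0 PQ removable pot kf kc k0 decrement
  for n es E w we WGT B M cins cfind cdel cdec PQ0 PQ removable pot kf kc k0 decrement +
  assumes decrement: "e \<in> E \<Longrightarrow> decrement (w e)"
begin

text \<open>\<open>Y\<close> holds the vertex being peeled: it has left the queue while some of its
  edges may still be in \<open>rest\<close>. Keys have to be right for vertices in the queue
  only.\<close>

definition peel_inv :: "nat set \<Rightarrow> state \<Rightarrow> bool" where
  "peel_inv Y s \<longleftrightarrow> static s \<and> PQ (alive s) s \<and> (\<forall>i\<in>rest s. edge i \<subseteq> Y \<union> alive s) \<and> (\<forall>i. arrs s ''done'' i \<le> 1) \<and>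
    (\<forall>v\<in>alive s. arrs s ''deg'' v = wdeg w (rest_edges s) v) \<and>
    regs s ''ew'' = (\<Sum>e\<in>rest_edges s. w e) \<and> regs s ''nv'' = card (alive s)"

lemma alive_less: "v \<in> alive s \<Longrightarrow> v < n"
  by (simp add: alive_def V0_less)

lemma rest_less: "i \<in> rest s \<Longrightarrow> i < m"
  by (simp add: rest_def)

lemma peel_inv_cong:
  assumes "agree (\<lambda>y. qname y \<or> y \<in> {''n'', ''m'', ''nl'', ''src'', ''tgt'', ''weight'', ''cnt'', ''adj'', ''vl'',
    ''deg'', ''done'', ''gone'', ''ew'', ''nv''}) s s'"
  shows "peel_inv Y s' = peel_inv Y s" "alive s' = alive s" "rest s' = rest s" "pot (alive s') s' = pot (alive s) s"
proof -
  have st: "static s' = static s" by (rule static_cong) (rule agree_mono[OF assms], auto)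
  have "agree (\<lambda>y. qname y \<or> y = ''n'' \<or> y = ''deg'') s s'" by (rule agree_mono[OF assms]) auto
  note pq = PQ_cong[OF this]
  have eq: "arrs s' ''gone'' = arrs s ''gone''" "arrs s' ''done'' = arrs s ''done''" "arrs s' ''deg'' = arrs s ''deg''"
    "regs s' ''ew'' = regs s ''ew''" "regs s' ''nv'' = regs s ''nv''"
    using assms by (simp_all add: agree_def)
  show a: "alive s' = alive s" "rest s' = rest s" by (simp_all add: alive_def rest_def eq)
  then show "pot (alive s') s' = pot (alive s) s" using pq by simp
  show "peel_inv Y s' = peel_inv Y s" using pq st by (simp add: peel_inv_def a rest_edges_def eq)
qed

abbreviation visited :: "string \<Rightarrow> bool" where
  "visited y \<equiv> \<not> qname y \<and> y \<notin> {''deg'', ''e'', ''i'', ''done'', ''out'', ''x'', ''d'', ''ew''}"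

lemma run_visit:
  assumes I: "peel_inv {u} s" and u: "regs s ''u'' = u" "u \<notin> alive s" "u < n"
    and i: "regs s ''i'' = i" "i < arrs s ''cnt'' u"
  shows "run B (visit cdec we) s (kc + 60 + pot (alive s) s) (\<lambda>s' T. pot (alive s') s' \<le> T \<and>
    peel_inv {u} s' \<and> alive s' = alive s \<and> regs s' ''i'' = Suc i \<and>
    rest s' = rest s - {arrs s ''adj'' (u * m + i)} \<and>
    arcs s' = arcs s \<union> arcs_towards (edge ` (rest s \<inter> {arrs s ''adj'' (u * m + i)})) u \<and> agree visited s s')"
    (is "run _ _ _ _ ?Q")
proof -
  define e where "e = arrs s ''adj'' (u * m + i)"
  have st: "static s" using I by (simp add: peel_inv_def)
  note D = staticD[OF st]
  have e: "e < m" "u \<in> edge e" using D(4)[OF i(2)] by (auto simp: e_def)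
  have im: "i < m" using i(2) D(3)[of u] by simp
  have ste: "src e < n" "tgt e < n" "src e \<noteq> tgt e" using src_tgt[OF e(1)] by auto
  have srcs: "arrs s ''src'' e = src e" "arrs s ''tgt'' e = tgt e" using D(11)[OF e(1)] by auto
  define x where "x = src e + tgt e - u"
  have x: "edge e = {x, u}" "x \<noteq> u" "x < n" "u = src e \<longrightarrow> x = tgt e" "u = tgt e \<longrightarrow> x = src e"
    using e(2) ste by (auto simp: edge_def x_def)
  have small: "1 \<le> B" "u \<le> B" "i \<le> B" "Suc i \<le> B" "e \<le> B" "m \<le> B" "u * m \<le> B" "u * m + i \<le> B" "src e \<le> B" "tgt e \<le> B"
    "src e + tgt e \<le> B" "x \<le> B"
    using bounds u(3) im e(1) ste x(3) mult_bound[OF u(3)] adj_bound[OF u(3) im] by linarith+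
  define s1 where "s1 = setr ''i'' (Suc i) (setr ''e'' e s)"
  have ag1: "agree visited s s1" unfolding s1_def by (intro agree_setr) simp_all
  have ag1': "agree (\<lambda>y. qname y \<or> y \<in> {''n'', ''m'', ''nl'', ''src'', ''tgt'', ''weight'', ''cnt'', ''adj'', ''vl'',
    ''deg'', ''done'', ''gone'', ''ew'', ''nv''}) s s1" unfolding s1_def by (intro agree_setr) simp_all
  note c1 = peel_inv_cong[OF ag1']
  have "arc s1 = arc s" by (rule ext) (simp add: arc_def s1_def)
  then have arcs1: "arcs s1 = arcs s" by (simp only: arcs_def c1(3))
  have "run B (Cond (Read ''done'' (Reg ''e'') \<doteq> Num 0)
      ((Write ''done'' (Reg ''e'') (Num 1) ;;
        Write ''out'' (Reg ''e'') (Read ''src'' (Reg ''e'') \<doteq> Reg ''u'') ;;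
        Assign ''x'' (Read ''src'' (Reg ''e'') \<oplus> Read ''tgt'' (Reg ''e'') \<ominus> Reg ''u'') ;;
        Assign ''d'' we ;; Assign ''ew'' (Reg ''ew'' \<ominus> Reg ''d'')) ;; cdec) Skip) s1 (kc + 48 + pot (alive s) s) ?Q"
  proof (cases "e \<in> rest s")
    case False
    \<comment> \<open>The edge was directed earlier, so there is nothing to do.\<close>
    then have d0: "arrs s ''done'' e \<noteq> 0" using e(1) by (simp add: rest_def)
    moreover have "arrs s ''done'' e \<le> B" using I small(1) le_trans unfolding peel_inv_def by blast
    moreover have "?Q s1 (pot (alive s) s)"
      using I c1 arcs1 ag1 False by (simp add: e_def[symmetric]) (simp add: s1_def arcs_towards_def)
    ultimately show ?thesis
      using small by (intro run_Cond[where T' = "kc + 43 + pot (alive s) s"] run_straight[where T' = "pot (alive s) s"])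
        (auto simp: s1_def)
  next
    case True
    then have d0: "arrs s ''done'' e = 0" by (simp add: rest_def)
    define d where "d = wt e"
    define b where "b = (if src e = u then 1 else 0 :: nat)"
    define s2 where "s2 = setr ''ew'' (regs s ''ew'' - d) (setr ''d'' d (setr ''x'' x (seta ''out'' e b (seta ''done'' e 1 s1))))"
    have ag2: "agree visited s s2" unfolding s2_def using ag1 by (intro agree_setr agree_seta) simp_all
    have "agree (\<lambda>y. qname y \<or> y = ''n'' \<or> y = ''deg'') s s2"
      unfolding s2_def s1_def by (intro agree_setr agree_seta) simp_all
    note pq = PQ_cong[OF this]
    have PQ2: "PQ (alive s) s2" using I pq by (simp add: peel_inv_def)
    have fin: "finite (rest_edges s)" by (simp add: rest_edges_def rest_def)
    have eU: "edge e \<in> rest_edges s" using True by (simp add: rest_edges_def)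
    have x_alive: "x \<in> alive s" using I True x by (auto simp: peel_inv_def)
    have deg: "\<And>v. v \<in> alive s \<Longrightarrow> arrs s ''deg'' v = wdeg w (rest_edges s) v"
      using I by (simp add: peel_inv_def)
    have d_le: "d \<le> arrs s ''deg'' x"
      unfolding deg[OF x_alive] d_def wt_def using wdeg_remove(2)[OF fin eU] x(1) by simp
    have s2: "regs s2 ''x'' = x" "regs s2 ''d'' = d" "arrs s2 ''deg'' = arrs s ''deg''"
      by (simp_all add: s2_def s1_def)
    have call: "run B cdec s2 (kc + pot (alive s) s) (\<lambda>s' T. PQ (alive s) s' \<and> pot (alive s) s' \<le> T \<and>
        arrs s' ''deg'' = (arrs s ''deg'')(x := arrs s ''deg'' x - d) \<and>
        agree (\<lambda>y. \<not> qname y \<and> y \<noteq> ''deg'') s2 s')"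
      using run_decrease[OF PQ2] x_alive d_le decrement[OF edge_in[OF e(1)]] pq unfolding s2 by (simp add: d_def wt_def)
    have ew: "d \<le> regs s ''ew''" "regs s ''ew'' \<le> B"
    proof -
      have "regs s ''ew'' = (\<Sum>e\<in>rest_edges s. w e)" using I by (simp add: peel_inv_def)
      then show "d \<le> regs s ''ew''" using member_le_sum[OF eU, of w] fin by (simp add: d_def wt_def)
      have "(\<Sum>e\<in>rest_edges s. w e) = (\<Sum>i\<in>rest s. wt i)"
        unfolding rest_edges_def wt_def by (rule sum_edge) (auto simp: rest_def)
      also have "\<dots> \<le> M" by (rule sum_wt_le) (auto simp: rest_def)
      finally show "regs s ''ew'' \<le> B" using I bounds by (simp add: peel_inv_def)
    qed
    have d_B: "d \<le> B" using ew by simp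
    let ?s = "setr ''x'' x (seta ''out'' e b (seta ''done'' e 1 s1))"
    have xx: "src e + tgt e - u = x" by (simp add: x_def)
    have s1: "regs s1 ''e'' = e" "regs s1 ''u'' = u" "regs s1 ''ew'' = regs s ''ew''"
      "arrs s1 ''src'' e = src e" "arrs s1 ''tgt'' e = tgt e"
      using u(1) srcs by (simp_all add: s1_def)
    have wes: "fits B we ?s \<and> aval we ?s = d"
      using weD[of ?s] D(1) e(1) by (simp add: input_def s1_def d_def)
    have "run B ((Write ''done'' (Reg ''e'') (Num 1) ;;
        Write ''out'' (Reg ''e'') (Read ''src'' (Reg ''e'') \<doteq> Reg ''u'') ;;
        Assign ''x'' (Read ''src'' (Reg ''e'') \<oplus> Read ''tgt'' (Reg ''e'') \<ominus> Reg ''u'') ;;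
        Assign ''d'' we ;; Assign ''ew'' (Reg ''ew'' \<ominus> Reg ''d'')) ;; cdec) s1 (kc + 43 + pot (alive s) s) ?Q"
    proof (rule run_straight_Seq[where T' = "kc + pot (alive s) s"])
      show "scost (Write ''done'' (Reg ''e'') (Num 1) ;;
        Write ''out'' (Reg ''e'') (Read ''src'' (Reg ''e'') \<doteq> Reg ''u'') ;;
        Assign ''x'' (Read ''src'' (Reg ''e'') \<oplus> Read ''tgt'' (Reg ''e'') \<ominus> Reg ''u'') ;;
        Assign ''d'' we ;; Assign ''ew'' (Reg ''ew'' \<ominus> Reg ''d'')) + (kc + pot (alive s) s) \<le> kc + 43 + pot (alive s) s"
        using cost_we by simp
      have "run B cdec s2 (kc + pot (alive s) s) ?Q"
        using call
      proof (rule run_conseq[where F = 0])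
        fix s3 :: state and T
        assume A: "PQ (alive s) s3 \<and> pot (alive s) s3 \<le> T \<and>
          arrs s3 ''deg'' = (arrs s ''deg'')(x := arrs s ''deg'' x - d) \<and>
          agree (\<lambda>y. \<not> qname y \<and> y \<noteq> ''deg'') s2 s3"
        then have ag3: "agree (\<lambda>y. \<not> qname y \<and> y \<noteq> ''deg'') s2 s3" by blast
        have "agree visited s2 s3" using ag3 by (rule agree_mono) auto
        with ag2 have ag: "agree visited s s3" by (rule agree_trans)
        have eq: "arrs s3 ''done'' = (arrs s ''done'')(e := 1)" "arrs s3 ''out'' = (arrs s ''out'')(e := b)"
          "regs s3 ''ew'' = regs s ''ew'' - d" "regs s3 ''i'' = Suc i"
          using agree_arrs[OF ag3, of "''done''"] agree_arrs[OF ag3, of "''out''"]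
            agree_regs[OF ag3, of "''ew''"] agree_regs[OF ag3, of "''i''"] by (simp_all add: s2_def s1_def)
        have eq': "arrs s3 ''gone'' = arrs s ''gone''" "regs s3 ''nv'' = regs s ''nv''"
          using agree_arrs[OF ag, of "''gone''"] agree_regs[OF ag, of "''nv''"] by simp_all
        have st3: "static s3" using static_cong[of s s3] st agree_mono[OF ag] by fastforce
        have al: "alive s3 = alive s" by (simp add: alive_def eq')
        have rest3: "rest s3 = rest s - {e}" by (auto simp: rest_def eq)
        have inj: "edge i \<noteq> edge e" if "i \<in> rest s" "i \<noteq> e" for i
          using that edge_eq_iff[of i e] e(1) by (simp add: rest_def)
        have re3: "rest_edges s3 = rest_edges s - {edge e}"
          unfolding rest_edges_def rest3 using inj by auto
        have "edge i \<subseteq> {u} \<union> alive s" if "i \<in> rest s" for i using that I by (simp add: peel_inv_def)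
        moreover have "arrs s3 ''deg'' v = wdeg w (rest_edges s3) v" if v: "v \<in> alive s" for v
        proof -
          \<comment> \<open>\<open>u\<close> has left the queue, so the only key that changes is
            that of \<open>x\<close>.\<close>
          have "v \<in> edge e \<longleftrightarrow> v = x" using v u(2) x(1) by auto
          then show ?thesis
            using A deg[OF v] deg[OF x_alive] by (simp add: re3 wdeg_remove(1)[OF fin eU] d_def wt_def)
        qed
        moreover have "regs s3 ''ew'' = (\<Sum>e\<in>rest_edges s3. w e)"
          using I fin eU by (simp add: eq re3 peel_inv_def sum_diff1_nat d_def wt_def)
        ultimately have "peel_inv {u} s3"
          using I A st3 unfolding peel_inv_def al rest3 eq eq' by auto
        moreover have "arcs s3 = insert (x, u) (arcs s)"
        proof -
          have "{..<m} - rest s3 = insert e ({..<m} - rest s)" using e(1) by (auto simp: rest3)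
          moreover have "arc s3 e = (x, u)" using x e(2) by (auto simp: arc_def eq b_def edge_def)
          moreover have "arc s3 i = arc s i" if "i \<in> {..<m} - rest s" for i
            using that True by (auto simp: arc_def eq)
          then have "arc s3 ` ({..<m} - rest s) = arc s ` ({..<m} - rest s)" by (rule image_cong[OF refl])
          ultimately show ?thesis by (simp add: arcs_def)
        qed
        moreover have "arcs_towards (edge ` (rest s \<inter> {e})) u = {(x, u)}"
          using True x(1) arcs_towards_pair[OF x(2)] by (simp add: Int_insert_right)
        ultimately show "?Q s3 (T + 0)"
          using A ag unfolding e_def[symmetric] al rest3 eq by simp
      qed simp
      then show "wp B (Write ''done'' (Reg ''e'') (Num 1) ;;
        Write ''out'' (Reg ''e'') (Read ''src'' (Reg ''e'') \<doteq> Reg ''u'') ;;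
        Assign ''x'' (Read ''src'' (Reg ''e'') \<oplus> Read ''tgt'' (Reg ''e'') \<ominus> Reg ''u'') ;;
        Assign ''d'' we ;; Assign ''ew'' (Reg ''ew'' \<ominus> Reg ''d'')) s1 (\<lambda>s'. run B cdec s' (kc + pot (alive s) s) ?Q)"
        using small wes ew d_B s1 xx unfolding s2_def
        by (cases "src e = u") (simp_all add: b_def)
    qed simp
    then show ?thesis
      using small d0
      by (intro run_Cond[where T' = "kc + 43 + pot (alive s) s"]) (auto simp: s1_def)
  qed
  then show ?thesis
    unfolding visit_def
    using small u i D(10)
    by (intro run_straight_Seq[where T' = "kc + 48 + pot (alive s) s"]) (simp_all add: s1_def e_def[symmetric])
qed

end

lemma div_round_up_mult: "0 < a \<Longrightarrow> (d * a + a - 1) div a = d" for a d :: nat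
proof -
  assume a: "0 < a"
  then have "d * a + a - 1 = (a - 1) + d * a" by simp
  then show ?thesis using a by (simp only: div_mult_self1) simp
qed

context orientation_program
begin

lemma setr_simps [simp]:
  "alive (setr z v s) = alive s" "rest (setr z v s) = rest s" "rest_edges (setr z v s) = rest_edges s" "arcs (setr z v s) = arcs s"
  by (simp_all add: alive_def rest_edges_def rest_def arcs_def arc_def)

lemma peel_inv_setr:
  assumes "z = ''go'' \<or> z = ''k''"
  shows "peel_inv Y (setr z v s) = peel_inv Y s" "pot X (setr z v s) = pot X s"
proof -
  have "agree (\<lambda>y. qname y \<or> y \<in> {''n'', ''m'', ''nl'', ''src'', ''tgt'', ''weight'', ''cnt'', ''adj'', ''vl'',
    ''deg'', ''done'', ''gone'', ''ew'', ''nv''}) s (setr z v s)"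
    using assms by (intro agree_setr) auto
  then show "peel_inv Y (setr z v s) = peel_inv Y s" by (rule peel_inv_cong)
  have "agree (\<lambda>y. qname y \<or> y = ''n'' \<or> y = ''deg'') s (setr z v s)"
    using assms by (intro agree_setr) auto
  then show "pot X (setr z v s) = pot X s" using PQ_cong by blast
qed

abbreviation peeled :: "string \<Rightarrow> bool" where
  "peeled y \<equiv> \<not> qname y \<and> y \<notin> {''deg'', ''e'', ''i'', ''done'', ''out'', ''x'', ''d'', ''ew'', ''gone'', ''nv''}"

text \<open>The time is charged to the full adjacency row, not to the current degree; each row is
  scanned at most once, so the charges sum up to at most \<open>2 * m\<close> rows entries in the
  end.\<close>

lemma run_peel:
  assumes I: "peel_inv {} s" and u: "regs s ''u'' \<in> alive s" "removable s (regs s ''u'')"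
  shows "run B (peel cdel cdec we) s (kf + (kc + 80) * arrs s ''cnt'' (regs s ''u'') + 40 + pot (alive s) s)
    (\<lambda>s' T. pot (alive s') s' \<le> T \<and> peel_inv {} s' \<and> alive s' = alive s - {regs s ''u''} \<and>
      rest_edges s' = rest_edges s - incident (rest_edges s) (regs s ''u'') \<and>
      arcs s' = arcs s \<union> arcs_towards (rest_edges s) (regs s ''u'') \<and> agree peeled s s')"
    (is "run _ _ _ ?T ?Q")
proof -
  define u where "u = regs s ''u''"
  define c where "c = arrs s ''cnt'' u"
  have un: "u < n" using alive_less u(1) by (simp add: u_def)
  have st: "static s" and PQs: "PQ (alive s) s" using I by (auto simp: peel_inv_def)
  have cm: "c \<le> m" using staticD(3)[OF st] by (simp add: c_def)
  define X where "X = alive s - {u}"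
  have finX: "finite (alive s)" using finite_V0 by (simp add: alive_def)
  have nv: "regs s ''nv'' = card (alive s)" using I by (simp add: peel_inv_def)
  have cardX: "card X = card (alive s) - 1" using finX u(1) by (simp add: X_def u_def)
  have "card (alive s) \<le> card V0" using finite_V0 by (intro card_mono) (auto simp: alive_def)
  then have nvB: "regs s ''nv'' \<le> B" using card_V0(1) bounds nv by linarith
  have small: "1 \<le> B" "u \<le> B" "m \<le> B" "Suc m \<le> B" using un bounds by linarith+
  define s1 where "s1 = setr ''x'' u s"
  have ag1: "agree peeled s s1" unfolding s1_def by (intro agree_setr) simp_all
  have "agree (\<lambda>y. qname y \<or> y = ''n'' \<or> y = ''deg'') s s1" unfolding s1_def by (intro agree_setr) simp_all
  note pq1 = PQ_cong[OF this]
  have del: "run B cdel s1 (kf + pot (alive s) s) (\<lambda>s' T. PQ X s' \<and> pot X s' \<le> T \<and> agree (\<lambda>y. \<not> qname y) s1 s')"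
    using run_delete[of "alive s" s1] PQs u pq1 by (simp add: s1_def u_def X_def)
  let ?blk = "Write ''gone'' (Reg ''u'') (Num 1) ;; Assign ''nv'' (Reg ''nv'' \<ominus> Num 1) ;; Assign ''i'' (Num 0)"
  let ?b = "Reg ''i'' \<prec> Read ''cnt'' (Reg ''u'')"
  let ?loop = "While ?b (visit cdec we)"
  have loop: "run B ?loop s3 (pot X s3 + (kc + 80) * c + 5) ?Q"
    if s3: "peel_inv {u} s3" "alive s3 = X" "rest s3 = rest s" "arcs s3 = arcs s" "agree peeled s s3" "regs s3 ''i'' = 0" for s3
  proof -
    define J where "J = (\<lambda>s'. peel_inv {u} s' \<and> alive s' = X \<and> regs s' ''i'' \<le> c \<and>
      rest s' = rest s - (\<lambda>i. arrs s ''adj'' (u * m + i)) ` {..<regs s' ''i''} \<and>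
      arcs s' = arcs s \<union> arcs_towards (edge ` (rest s - rest s')) u \<and> agree peeled s s')"
    have agJ: "regs s' ''u'' = u" "arrs s' ''cnt'' u = c" "arrs s' ''adj'' = arrs s ''adj''" if "J s'" for s'
      using that by (auto simp: J_def agree_def u_def c_def)
    show ?thesis
    proof (rule run_While[where I = J and \<Phi> = "\<lambda>s'. pot (alive s') s' + (kc + 80) * (c - regs s' ''i'')"])
      have "arcs_towards {} u = {}" by (simp add: arcs_towards_def)
      then show "J s3" using s3 by (simp add: J_def)
    next
      fix s' assume J: "J s'"
      then have "regs s' ''i'' \<le> c" by (simp add: J_def)
      then show "fits B ?b s'" using agJ[OF J] small cm by simp
    next
      fix s' assume J: "J s'" and b: "aval ?b s' \<noteq> 0"
      define i where "i = regs s' ''i''"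
      have i: "i < c" using b agJ[OF J] by (simp add: i_def split: if_splits)
      have P: "peel_inv {u} s'" "u \<notin> alive s'" using J by (auto simp: J_def X_def)
      have "run B (visit cdec we) s' (kc + 60 + pot (alive s') s')
        (\<lambda>s'' T. J s'' \<and> pot (alive s'') s'' + (kc + 80) * (c - regs s'' ''i'') \<le> T + (kc + 80) * (c - Suc i))"
      proof (rule run_conseq[OF run_visit[OF P(1) agJ(1)[OF J] P(2) un i_def[symmetric]], where F = 0])
        show "i < arrs s' ''cnt'' u" using i agJ[OF J] by simp
      next
        fix s'' :: state and T
        assume A: "pot (alive s'') s'' \<le> T \<and> peel_inv {u} s'' \<and> alive s'' = alive s' \<and> regs s'' ''i'' = Suc i \<and>
          rest s'' = rest s' - {arrs s' ''adj'' (u * m + i)} \<and>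
          arcs s'' = arcs s' \<union> arcs_towards (edge ` (rest s' \<inter> {arrs s' ''adj'' (u * m + i)})) u \<and> agree visited s' s''"
        define a where "a = arrs s ''adj'' (u * m + i)"
        have A': "rest s'' = rest s' - {a}" "arcs s'' = arcs s' \<union> arcs_towards (edge ` (rest s' \<inter> {a})) u"
          using A agJ[OF J] by (simp_all add: a_def)
        have J': "rest s' = rest s - (\<lambda>i. arrs s ''adj'' (u * m + i)) ` {..<i}"
          "arcs s' = arcs s \<union> arcs_towards (edge ` (rest s - rest s')) u" "agree peeled s s'" "alive s' = X"
          using J by (auto simp: J_def i_def)
        have A'': "pot X s'' \<le> T" "peel_inv {u} s''" "alive s'' = X" "regs s'' ''i'' = Suc i"
          using A unfolding J'(4) by auto
        have "rest s'' = rest s - (\<lambda>i. arrs s ''adj'' (u * m + i)) ` {..<Suc i}"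
          unfolding A'(1) J'(1) by (auto simp: lessThan_Suc a_def)
        moreover have "rest s - rest s'' = (rest s - rest s') \<union> (rest s' \<inter> {a})"
          unfolding A'(1) using J'(1) by auto
        then have "arcs s'' = arcs s \<union> arcs_towards (edge ` (rest s - rest s'')) u"
          unfolding A'(2) J'(2) by (simp add: image_Un arcs_towards_Un Un_assoc)
        moreover have "agree visited s' s''" using A by blast
        then have "agree peeled s' s''" by (rule agree_mono) auto
        with J'(3) have "agree peeled s s''" by (rule agree_trans)
        ultimately show "J s'' \<and> pot (alive s'') s'' + (kc + 80) * (c - regs s'' ''i'') \<le> T + 0 + (kc + 80) * (c - Suc i)"
          using A'' i by (simp add: J_def)
      qed simp
      then have "run B (visit cdec we) s' (pot (alive s') s' + (kc + 80) * (c - i) - 6)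
        (\<lambda>s'' T. J s'' \<and> pot (alive s'') s'' + (kc + 80) * (c - regs s'' ''i'') \<le> T)"
      proof (rule run_conseq[where F = "(kc + 80) * (c - Suc i)"])
        have "(kc + 80) * (c - i) = (kc + 80) * (c - Suc i) + (kc + 80)"
          using i by (metis Suc_diff_Suc mult_Suc_right add.commute)
        then show "kc + 60 + pot (alive s') s' + (kc + 80) * (c - Suc i) \<le> pot (alive s') s' + (kc + 80) * (c - i) - 6"
          by simp
      qed simp
      moreover have "6 \<le> (kc + 80) * (c - i)"
      proof -
        have "(kc + 80) * 1 \<le> (kc + 80) * (c - i)" using i by (intro mult_le_mono2) simp
        then show ?thesis by (rule le_trans[rotated]) simp
      qed
      ultimately show "\<exists>T'. cost ?b + 1 + T' \<le> pot (alive s') s' + (kc + 80) * (c - regs s' ''i'') \<and>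
          run B (visit cdec we) s' T' (\<lambda>s'' T''. J s'' \<and> pot (alive s'') s'' + (kc + 80) * (c - regs s'' ''i'') \<le> T'')"
        by (intro exI[of _ "pot (alive s') s' + (kc + 80) * (c - i) - 6"]) (simp add: i_def)
    next
      fix s' assume J: "J s'" and b: "aval ?b s' = 0"
      have i: "regs s' ''i'' = c" using b agJ[OF J] J by (auto simp: J_def split: if_splits)
      have J': "rest s' = rest s - (\<lambda>i. arrs s ''adj'' (u * m + i)) ` {..<c}"
        "arcs s' = arcs s \<union> arcs_towards (edge ` (rest s - rest s')) u" "agree peeled s s'" "alive s' = X" "peel_inv {u} s'"
        using J i by (auto simp: J_def)
      \<comment> \<open>The row of \<open>u\<close> contains exactly the edges at \<open>u\<close>,
        so a complete scan removes all that were left.\<close>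
      have img: "(\<lambda>i. arrs s ''adj'' (u * m + i)) ` {..<c} = {i. i < m \<and> u \<in> edge i}"
      proof (intro equalityI subsetI)
        fix a assume "a \<in> (\<lambda>i. arrs s ''adj'' (u * m + i)) ` {..<c}"
        then show "a \<in> {i. i < m \<and> u \<in> edge i}" using staticD(4)[OF st] by (auto simp: c_def)
      next
        fix a assume "a \<in> {i. i < m \<and> u \<in> edge i}"
        then show "a \<in> (\<lambda>i. arrs s ''adj'' (u * m + i)) ` {..<c}" using staticD(5)[OF st, of a u] by (auto simp: c_def)
      qed
      have rest': "rest s' = {i \<in> rest s. u \<notin> edge i}"
        unfolding J'(1) img by (auto simp: rest_def)
      then have "rest s - rest s' = {i \<in> rest s. u \<in> edge i}" by auto
      then have diff: "edge ` (rest s - rest s') = incident (rest_edges s) u"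
        by (auto simp: incident_def rest_edges_def)
      have "rest_edges s' = rest_edges s - incident (rest_edges s) u"
        unfolding rest_edges_def rest' by (auto simp: incident_def)
      moreover have "arcs s' = arcs s \<union> arcs_towards (rest_edges s) u"
        using J'(2) unfolding diff arcs_towards_incident .
      moreover have "peel_inv {} s'" using J'(5) rest' unfolding peel_inv_def by blast
      ultimately show "?Q s' (pot (alive s') s' + (kc + 80) * (c - regs s' ''i''))"
        using J' by (simp add: X_def u_def)
    qed (use s3 in simp)
  qed
  have "run B (cdel ;; ?blk ;; ?loop) s1 (kf + (kc + 80) * c + 38 + pot (alive s) s) ?Q"
  proof (rule run_call_Seq[OF del, where F = "(kc + 80) * c + 38"])
    fix s2 :: state and T assume A: "PQ X s2 \<and> pot X s2 \<le> T \<and> agree (\<lambda>y. \<not> qname y) s1 s2"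
    have "agree (\<lambda>y. \<not> qname y) s1 s2" using A by blast
    then have ag12: "agree peeled s1 s2" by (rule agree_mono) auto
    have "agree peeled s s2" by (rule agree_trans[OF ag1 ag12])
    have s2: "regs s2 ''u'' = u" "regs s2 ''nv'' = card (alive s)"
      "regs s2 ''ew'' = regs s ''ew''"
      using A nv by (auto simp: agree_def s1_def u_def)
    define s3 where "s3 = setr ''i'' 0 (setr ''nv'' (card (alive s) - 1) (seta ''gone'' u 1 s2))"
    have ag3: "agree peeled s s3" unfolding s3_def using \<open>agree peeled s s2\<close> by (intro agree_setr agree_seta) simp_all
    have arr: "arrs s2 a = arrs s a" if "\<not> qname a" for a using A that by (simp add: agree_def s1_def)
    have al3: "alive s3 = X" by (auto simp: alive_def s3_def arr X_def)
    have rest3: "rest s3 = rest s" by (simp add: rest_def s3_def arr)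
    have "arc s3 = arc s" by (rule ext) (simp add: arc_def s3_def arr)
    then have arcs3: "arcs s3 = arcs s" by (simp only: arcs_def rest3)
    have st3: "static s3" using static_cong[of s s3] st agree_mono[OF ag3] by fastforce
    have "agree (\<lambda>y. qname y \<or> y = ''n'' \<or> y = ''deg'') s2 s3" unfolding s3_def by (intro agree_setr agree_seta) simp_all
    note pq3 = PQ_cong[OF this]
    have "peel_inv {u} s3"
      unfolding peel_inv_def al3 rest_edges_def rest3
      using st3 I A pq3 cardX by (auto simp: peel_inv_def s3_def arr s2(3) rest_edges_def X_def)
    then have "run B ?loop s3 (pot X s3 + (kc + 80) * c + 5) ?Q"
      using al3 rest3 arcs3 ag3 by (intro loop) (simp_all add: s3_def)
    then have "run B ?loop s3 (T + (kc + 80) * c + 20) ?Q"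
      by (rule run_time_mono) (use A pq3 in simp)
    then show "run B (?blk ;; ?loop) s2 (T + ((kc + 80) * c + 38)) ?Q"
      using small s2 nvB nv by (intro run_straight_Seq[where T' = "T + (kc + 80) * c + 20"]) (simp_all add: s3_def)
  qed simp
  then have "run B (peel cdel cdec we) s (kf + (kc + 80) * c + 40 + pot (alive s) s) ?Q"
    unfolding peel_def using small
    by (intro run_straight_Seq[where T' = "kf + (kc + 80) * c + 38 + pot (alive s) s"]) (simp_all add: s1_def u_def)
  then show ?thesis by (simp add: c_def u_def)
qed

text \<open>The program stores only \<open>k\<close>; the \<open>l\<close> of the abstract run is
  some real with \<open>\<lceil>2 * l\<rceil> = k\<close>. \<open>G\<close> is the property wanted
  of the result.\<close>

definition loop_inv :: "((nat \<times> nat) set \<Rightarrow> bool) \<Rightarrow> state \<Rightarrow> bool" where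
  "loop_inv G s \<longleftrightarrow> peel_inv {} s \<and> regs s ''k'' \<le> B \<and>
    (regs s ''go'' = 1 \<and> (\<exists>l. int (regs s ''k'') = \<lceil>2 * l\<rceil> \<and>
        (\<forall>A. completes w l (alive s, rest_edges s, arcs s) A \<longrightarrow> G A)) \<or>
     regs s ''go'' = 0 \<and> (\<forall>A. finishes (alive s, rest_edges s, arcs s) A \<longrightarrow> G A))"

text \<open>Every second iteration removes a vertex: after an iteration that changes \<open>k\<close> some degree is
  less than \<open>k\<close>.\<close>

definition loop_pot :: "state \<Rightarrow> nat" where
  "loop_pot s = (if regs s ''go'' = 0 then 0 else pot (alive s) s +
    (2 * kf + 200) * (2 * card (alive s) + (if \<exists>v\<in>alive s. arrs s ''deg'' v < regs s ''k'' then 0 else 1)) +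
    (kc + 80) * (\<Sum>v\<in>alive s. arrs s ''cnt'' v) + 50)"

lemma handshake:
  assumes I: "peel_inv {} s"
  shows "(\<Sum>v\<in>alive s. arrs s ''deg'' v) = 2 * regs s ''ew''"
proof -
  have "(\<Sum>v\<in>alive s. arrs s ''deg'' v) = (\<Sum>v\<in>alive s. wdeg w (rest_edges s) v)"
    using I by (intro sum.cong) (auto simp: peel_inv_def)
  also have "\<dots> = 2 * (\<Sum>e\<in>rest_edges s. w e)"
  proof (rule wdeg_handshake)
    show "finite (alive s)" using finite_V0 by (simp add: alive_def)
    show "finite (rest_edges s)" by (simp add: rest_edges_def rest_def)
    fix e assume "e \<in> rest_edges s"
    then obtain i where i: "i \<in> rest s" "e = edge i" by (auto simp: rest_edges_def)
    then show "e \<subseteq> alive s \<and> card e = 2"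
      using I src_tgt[OF rest_less[OF i(1)]] by (auto simp: peel_inv_def edge_def card_insert_if)
  qed
  finally show ?thesis using I by (simp add: peel_inv_def)
qed

abbreviation looped :: "string \<Rightarrow> bool" where
  "looped y \<equiv> peeled y \<and> y \<notin> {''u'', ''k'', ''go''}"

lemma peel_inv_queue:
  assumes "peel_inv {} s" "agree (\<lambda>y. \<not> qname y \<and> y \<noteq> ''u'') s s'" "PQ (alive s) s'"
  shows "peel_inv {} s'" "alive s' = alive s" "rest_edges s' = rest_edges s" "arcs s' = arcs s"
proof -
  have arr: "arrs s' a = arrs s a" "a \<noteq> ''u'' \<Longrightarrow> regs s' a = regs s a" if "\<not> qname a" "a \<noteq> ''u''" for a
    using assms(2) that by (simp_all add: agree_def)
  show al: "alive s' = alive s" by (simp add: alive_def arr)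
  have re: "rest s' = rest s" by (simp add: rest_def arr)
  then show re': "rest_edges s' = rest_edges s" by (simp add: rest_edges_def)
  have "arc s' = arc s" by (rule ext) (simp add: arc_def arr)
  then show "arcs s' = arcs s" by (simp only: arcs_def re)
  have "static s' = static s" by (rule static_cong) (rule agree_mono[OF assms(2)], auto)
  then show "peel_inv {} s'"
    using assms(1,3) unfolding peel_inv_def al re re' by (simp add: arr)
qed

lemma run_peel_loop:
  assumes I: "loop_inv G s"
  shows "run B (peel_loop cfind cdel cdec we) s (loop_pot s + 2) (\<lambda>s' T. peel_inv {} s' \<and>
    (\<forall>A. finishes (alive s', rest_edges s', arcs s') A \<longrightarrow> G A) \<and> agree looped s s')"
    (is "run _ _ _ _ (\<lambda>s' T. ?Q s')")
  unfolding peel_loop_def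
proof (rule run_While[where I = "\<lambda>s'. loop_inv G s' \<and> agree looped s s'" and \<Phi> = loop_pot])
  show "loop_inv G s \<and> agree looped s s" using I by simp
next
  fix s' assume "loop_inv G s' \<and> agree looped s s'"
  then show "fits B (Reg ''go'') s'" using bounds by (auto simp: loop_inv_def)
next
  fix s' assume "loop_inv G s' \<and> agree looped s s'" and "aval (Reg ''go'') s' = 0"
  then show "?Q s'" by (auto simp: loop_inv_def)
next
  fix s1 assume s1: "loop_inv G s1 \<and> agree looped s s1" and "aval (Reg ''go'') s1 \<noteq> 0"
  then obtain l where l: "int (regs s1 ''k'') = \<lceil>2 * l\<rceil>" and go: "regs s1 ''go'' = 1"
    and G: "\<And>A. completes w l (alive s1, rest_edges s1, arcs s1) A \<Longrightarrow> G A"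
    by (auto simp: loop_inv_def)
  have P1: "peel_inv {} s1" and kB: "regs s1 ''k'' \<le> B" and ag1: "agree looped s s1"
    using s1 by (auto simp: loop_inv_def)
  let ?step = "\<lambda>s' T. (loop_inv G s' \<and> agree looped s s') \<and> loop_pot s' \<le> T"
  let ?a = "card (alive s1)" and ?F = "2 * kf + 200"
  let ?S = "\<Sum>v\<in>alive s1. arrs s1 ''cnt'' v"
  let ?upd = "Cond (Read ''deg'' (Reg ''u'') \<otimes> Reg ''nv'' \<doteq> Num 2 \<otimes> Reg ''ew'') (Assign ''go'' (Num 0))
           (Assign ''k'' (ceiling_twice_density (Reg ''nv'')))"
  have nv: "regs s1 ''nv'' = ?a" using P1 by (simp add: peel_inv_def)
  have finA: "finite (alive s1)" using finite_V0 by (simp add: alive_def)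
  have "?a \<le> card V0" using finite_V0 by (intro card_mono) (auto simp: alive_def)
  then have an: "?a \<le> n" using card_V0(1) by simp
  have ewM: "regs s1 ''ew'' \<le> M"
  proof -
    have "regs s1 ''ew'' = (\<Sum>i\<in>rest s1. wt i)"
      using P1 sum_edge[of "rest s1" w] rest_less[of _ s1] by (auto simp: peel_inv_def rest_edges_def wt_def subset_iff)
    also have "\<dots> \<le> M" using rest_less[of _ s1] by (intro sum_wt_le) auto
    finally show ?thesis .
  qed
  have small: "1 \<le> B" "?a \<le> B" "2 \<le> B" "2 * regs s1 ''ew'' + ?a \<le> B" "2 * regs s1 ''ew'' \<le> B" "regs s1 ''ew'' \<le> B"
    using bounds an ewM by linarith+
  have hs: "(\<Sum>v\<in>alive s1. arrs s1 ''deg'' v) = 2 * regs s1 ''ew''" using handshake[OF P1] .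
  have pot_ge: "50 \<le> loop_pot s1" using go by (simp add: loop_pot_def)
  have cond: "run B (Cond (Reg ''nv'' \<doteq> Num 0) (Assign ''go'' (Num 0))
       (cfind ;; Cond (Read ''deg'' (Reg ''u'') \<prec> Reg ''k'') (peel cdel cdec we) ?upd)) s1 (loop_pot s1 - 2) ?step"
  proof (cases "alive s1 = {}")
    case True
    have "rest s1 = {}" using P1 True by (auto simp: peel_inv_def edge_def)
    let ?s2 = "setr ''go'' 0 s1"
    have al2: "alive ?s2 = {}" "rest_edges ?s2 = {}" "arcs ?s2 = arcs s1"
      using True \<open>rest s1 = {}\<close> by (simp_all add: rest_edges_def)
    have "peel_inv {} ?s2" using P1 by (simp add: peel_inv_setr)
    \<comment> \<open>With no vertex left, both ways of ending produce the same arcs, so the walk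
      may be run on the empty graph.\<close>
    moreover have "G A" if "finishes ({}, {}, arcs s1) A" for A
    proof -
      have "A = arcs s1" using finishes_empty that by blast
      then show ?thesis using G True \<open>rest s1 = {}\<close> completes_empty[of w l "{}" "arcs s1"]
        by (simp add: rest_edges_def)
    qed
    ultimately have "loop_inv G ?s2" using kB al2 by (simp add: loop_inv_def)
    moreover have "agree looped s ?s2" using ag1 by (rule agree_setr) simp
    moreover have "loop_pot ?s2 = 0" by (simp add: loop_pot_def)
    ultimately show ?thesis
      using True nv small pot_ge
      by (intro run_Cond[where T' = 2] run_straight[where T' = 0]) simp_all
  next
    case False
    then have a0: "0 < ?a" and ne: "alive s1 \<noteq> {}" using finA by (simp_all add: card_gt_0_iff)
    have PQ1: "PQ (alive s1) s1" using P1 by (simp add: peel_inv_def)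
    have G_peel: "run B (cfind ;; Cond (Read ''deg'' (Reg ''u'') \<prec> Reg ''k'') (peel cdel cdec we) ?upd) s1
        (loop_pot s1 - 6) ?step"
    proof (rule run_call_Seq[OF run_find[OF PQ1 False]])
      show "kf + pot (alive s1) s1 + (loop_pot s1 - (kf + pot (alive s1) s1) - 6) \<le> loop_pot s1 - 6"
      proof -
        define y where "y = 2 * ?a + (if \<exists>v\<in>alive s1. arrs s1 ''deg'' v < regs s1 ''k'' then 0 else 1 :: nat)"
        define P Q where "P = ?F * y" and "Q = (kc + 80) * ?S"
        have "?F * 1 \<le> P" using a0 unfolding P_def y_def by (intro mult_le_mono2) simp
        moreover have "loop_pot s1 = pot (alive s1) s1 + P + Q + 50"
          using go by (simp add: loop_pot_def y_def P_def Q_def)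
        ultimately have "kf + pot (alive s1) s1 + 6 \<le> loop_pot s1" by simp
        then show ?thesis by simp
      qed
    next
      fix s2 :: state and T
      let ?u = "regs s2 ''u''"
      assume A: "PQ (alive s1) s2 \<and> pot (alive s1) s2 \<le> T \<and> removable s2 ?u \<and> ?u \<in> alive s1 \<and>
        (\<forall>v\<in>alive s1. arrs s1 ''deg'' ?u \<le> arrs s1 ''deg'' v) \<and> agree (\<lambda>y. \<not> qname y \<and> y \<noteq> ''u'') s1 s2"
      then have ag12: "agree (\<lambda>y. \<not> qname y \<and> y \<noteq> ''u'') s1 s2" and u: "?u \<in> alive s1" and
        min: "\<And>v. v \<in> alive s1 \<Longrightarrow> arrs s1 ''deg'' ?u \<le> arrs s1 ''deg'' v" by auto
      have q: "peel_inv {} s2" "alive s2 = alive s1" "rest_edges s2 = rest_edges s1" "arcs s2 = arcs s1"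
        using peel_inv_queue[OF P1 ag12] A by auto
      have r2: "regs s2 ''k'' = regs s1 ''k''" "regs s2 ''nv'' = ?a" "regs s2 ''ew'' = regs s1 ''ew''"
        "arrs s2 ''deg'' = arrs s1 ''deg''" "arrs s2 ''cnt'' = arrs s1 ''cnt''" "regs s2 ''go'' = 1"
        using ag12 nv go by (simp_all add: agree_def)
      have "agree looped s1 s2" using ag12 by (rule agree_mono) auto
      with ag1 have ag2: "agree looped s s2" by (rule agree_trans)
      have un: "?u < n" using alive_less[OF u] .
      have wd: "wdeg w (rest_edges s1) v = arrs s1 ''deg'' v" if "v \<in> alive s1" for v
        using P1 that by (simp add: peel_inv_def)
      \<comment> \<open>The minimum is at most the average; this also keeps the product within the
        word limit.\<close>
      have le: "arrs s1 ''deg'' ?u * ?a \<le> 2 * regs s1 ''ew''"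
        using sum_bounded_below[of "alive s1" "arrs s1 ''deg'' ?u" "arrs s1 ''deg''"] min hs by (simp add: mult.commute)
      then have degB: "arrs s1 ''deg'' ?u * ?a \<le> B" "arrs s1 ''deg'' ?u \<le> B" "?u \<le> B"
      proof -
        show "arrs s1 ''deg'' ?u * ?a \<le> B" using le small by simp
        have "arrs s1 ''deg'' ?u \<le> arrs s1 ''deg'' ?u * ?a" using a0 by simp
        also note le
        also note small(5)
        finally show "arrs s1 ''deg'' ?u \<le> B" .
        show "?u \<le> B" using un bounds by simp
      qed
      define R where "R = loop_pot s1 - (kf + pot (alive s1) s1) - 6"
      show "run B (Cond (Read ''deg'' (Reg ''u'') \<prec> Reg ''k'') (peel cdel cdec we) ?upd) s2
          (T + (loop_pot s1 - (kf + pot (alive s1) s1) - 6)) ?step"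
        unfolding R_def[symmetric]
      proof (cases "arrs s1 ''deg'' ?u < regs s1 ''k''")
        case True
        have "\<exists>v\<in>alive s1. arrs s1 ''deg'' v < regs s1 ''k''" using True u by blast
        then have lp1: "loop_pot s1 = pot (alive s1) s1 + ?F * (2 * ?a) + (kc + 80) * ?S + 50"
          using go by (simp add: loop_pot_def)
        have aF: "?F * (2 * ?a) = ?F * (2 * (?a - 1)) + 2 * ?F" using a0 by (cases ?a) simp_all
        have S: "?S = arrs s1 ''cnt'' ?u + (\<Sum>v\<in>alive s1 - {?u}. arrs s1 ''cnt'' v)"
          using finA u by (simp add: sum.remove)
        have "run B (peel cdel cdec we) s2 (kf + (kc + 80) * arrs s2 ''cnt'' ?u + 40 + pot (alive s2) s2)
          (\<lambda>s' T. pot (alive s') s' \<le> T \<and> peel_inv {} s' \<and> alive s' = alive s2 - {?u} \<and>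
      rest_edges s' = rest_edges s2 - incident (rest_edges s2) ?u \<and>
      arcs s' = arcs s2 \<union> arcs_towards (rest_edges s2) ?u \<and> agree peeled s2 s')"
          using run_peel[OF q(1)] u A q(2) by simp
        then have "run B (peel cdel cdec we) s2 (T + R - 5) ?step"
        \<comment> \<open>Of the two shares \<open>?F\<close> of the vertex, one pays for this
          search and deletion; the other is left in case \<open>k\<close> has to change
          next.\<close>
        proof (rule run_conseq[where F = "?F * (2 * (?a - 1) + 1) + (kc + 80) * (\<Sum>v\<in>alive s1 - {?u}. arrs s1 ''cnt'' v) + 50"])
          show "kf + (kc + 80) * arrs s2 ''cnt'' ?u + 40 + pot (alive s2) s2 +
            (?F * (2 * (?a - 1) + 1) + (kc + 80) * (\<Sum>v\<in>alive s1 - {?u}. arrs s1 ''cnt'' v) + 50) \<le> T + R - 5"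
          proof -
            have "pot (alive s2) s2 \<le> T" using A q(2) by simp
            moreover have "R = ?F * (2 * (?a - 1)) + 2 * ?F + (kc + 80) * arrs s1 ''cnt'' ?u +
              (kc + 80) * (\<Sum>v\<in>alive s1 - {?u}. arrs s1 ''cnt'' v) + 44 - kf"
              unfolding R_def lp1 aF S add_mult_distrib2 by simp
            ultimately show ?thesis unfolding r2(5) add_mult_distrib2 by simp
          qed
        next
          fix s3 :: state and T'
          assume B3: "pot (alive s3) s3 \<le> T' \<and> peel_inv {} s3 \<and> alive s3 = alive s2 - {?u} \<and>
      rest_edges s3 = rest_edges s2 - incident (rest_edges s2) ?u \<and>
      arcs s3 = arcs s2 \<union> arcs_towards (rest_edges s2) ?u \<and> agree peeled s2 s3"
          then have al3: "alive s3 = alive s1 - {?u}" "rest_edges s3 = rest_edges s1 - incident (rest_edges s1) ?u"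
            "arcs s3 = arcs s1 \<union> arcs_towards (rest_edges s1) ?u" and ag3: "agree peeled s2 s3"
            and P3: "peel_inv {} s3" and pot3: "pot (alive s3) s3 \<le> T'"
            using q by auto
          have r3: "regs s3 ''k'' = regs s1 ''k''" "regs s3 ''go'' = 1" "arrs s3 ''cnt'' = arrs s1 ''cnt''"
            using ag3 r2 by (simp_all add: agree_def)
          have "peel_step w l (alive s1, rest_edges s1, arcs s1) (alive s3, rest_edges s3, arcs s3)"
            unfolding al3 by (rule peel_step.intros) (use u wd[OF u] True l in auto)
          then have "loop_inv G s3"
            using P3 kB l r3 G completes_peel unfolding loop_inv_def by metis
          moreover have "agree looped s s3"
          proof (rule agree_trans[OF ag2])
            show "agree looped s2 s3" using ag3 by (rule agree_mono) auto
          qed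
          moreover have "loop_pot s3 \<le> T' + (?F * (2 * (?a - 1) + 1) + (kc + 80) * (\<Sum>v\<in>alive s1 - {?u}. arrs s1 ''cnt'' v) + 50)"
          proof -
            have "card (alive s3) = ?a - 1" using al3 finA u by simp
            moreover have "?F * (2 * (?a - 1) + (if \<exists>v\<in>alive s3. arrs s3 ''deg'' v < regs s3 ''k'' then 0 else 1))
              \<le> ?F * (2 * (?a - 1) + 1)" by (intro mult_le_mono2) simp
            ultimately show ?thesis
              using pot3 r3 unfolding loop_pot_def al3(1) by simp
          qed
          ultimately show "?step s3 (T' + (?F * (2 * (?a - 1) + 1) + (kc + 80) * (\<Sum>v\<in>alive s1 - {?u}. arrs s1 ''cnt'' v) + 50))"
            by simp
        qed
        then show "run B (Cond (Read ''deg'' (Reg ''u'') \<prec> Reg ''k'') (peel cdel cdec we) ?upd) s2 (T + R) ?step"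
        proof (intro run_Cond[where T' = "T + R - 5"])
          define P Q where "P = ?F * (2 * ?a)" and "Q = (kc + 80) * ?S"
          have "?F * 1 \<le> P" using a0 unfolding P_def by (intro mult_le_mono2) simp
          moreover have "R = P + Q + 44 - kf" unfolding R_def lp1 P_def Q_def by simp
          ultimately have "5 \<le> R" by simp
          then show "cost (Read ''deg'' (Reg ''u'') \<prec> Reg ''k'') + 1 + (T + R - 5) \<le> T + R" by simp
        qed (use True r2 degB kB small in simp_all)
      next
        case False
        have no: "\<not> (\<exists>v\<in>alive s1. arrs s1 ''deg'' v < regs s1 ''k'')"
          using False min by (meson leD le_less_trans not_le_imp_less)
        have lp1: "loop_pot s1 = pot (alive s1) s1 + ?F * (2 * ?a + 1) + (kc + 80) * ?S + 50"
          using go no by (simp add: loop_pot_def)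
        have Rge: "?F * (2 * ?a) + (kc + 80) * ?S + 50 + 100 \<le> R"
          unfolding R_def lp1 by (simp add: add_mult_distrib2)
        have stuck: "\<not> peel_step w l (alive s1, rest_edges s1, arcs s1) d" for d
        proof (rule no_peel_step)
          fix v assume "v \<in> alive s1"
          then show "\<lceil>2 * l\<rceil> \<le> int (wdeg w (rest_edges s1) v)" using no l wd by fastforce
        qed
        have dens: "edge_density w (alive s1) (rest_edges s1) = real (regs s1 ''ew'') / real ?a"
          using P1 by (simp add: edge_density_def peel_inv_def)
        have ceil: "\<lceil>2 * edge_density w (alive s1) (rest_edges s1)\<rceil> = int ((2 * regs s1 ''ew'' + ?a - 1) div ?a)"
          using ceiling_divide_nat[OF a0, of "2 * regs s1 ''ew''"] by (simp add: dens)
        have "run B ?upd s2 (T + R - 5) ?step"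
        proof (cases "arrs s1 ''deg'' ?u * ?a = 2 * regs s1 ''ew''")
          case True
          \<comment> \<open>If one degree exceeded the minimum, the degree sum would exceed minimum
            times number of vertices.\<close>
          have const: "arrs s1 ''deg'' v = arrs s1 ''deg'' ?u" if v: "v \<in> alive s1" for v
          proof (rule ccontr)
            assume "arrs s1 ''deg'' v \<noteq> arrs s1 ''deg'' ?u"
            then have "arrs s1 ''deg'' ?u < arrs s1 ''deg'' v" using min[OF v] by simp
            then have "(\<Sum>v\<in>alive s1. arrs s1 ''deg'' ?u) < (\<Sum>v\<in>alive s1. arrs s1 ''deg'' v)"
              using min v finA by (intro sum_strict_mono_ex1) auto
            then show False using True hs by (simp add: mult.commute)
          qed
          \<comment> \<open>Here the division is exact, so rounding up changes nothing.\<close>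
          have "(2 * regs s1 ''ew'' + ?a - 1) div ?a = arrs s1 ''deg'' ?u"
            unfolding True[symmetric] using a0 by (rule div_round_up_mult)
          then have all: "\<forall>v\<in>alive s1. int (wdeg w (rest_edges s1) v) = \<lceil>2 * edge_density w (alive s1) (rest_edges s1)\<rceil>"
            unfolding ceil using wd const by simp
          let ?s3 = "setr ''go'' 0 s2"
          have al3: "alive ?s3 = alive s1" "rest_edges ?s3 = rest_edges s1" "arcs ?s3 = arcs s1"
            using q(2-4) by simp_all
          have "peel_inv {} ?s3" using q(1) by (simp add: peel_inv_setr)
          moreover have "G A" if "finishes (alive s1, rest_edges s1, arcs s1) A" for A
            by (rule G[OF completes_finish[OF ne stuck all that]])
          ultimately have "loop_inv G ?s3" using kB al3 r2 by (simp add: loop_inv_def)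
          moreover have "agree looped s ?s3" using ag2 by (rule agree_setr) simp
          moreover have "loop_pot ?s3 = 0" by (simp add: loop_pot_def)
          ultimately show ?thesis
            using True r2 degB small Rge
            by (intro run_Cond[where T' = 2] run_straight[where T' = 0]) simp_all
        next
          case False
          define k' where "k' = (2 * regs s1 ''ew'' + ?a - 1) div ?a"
          \<comment> \<open>The minimum is below the average, hence below the new \<open>k\<close>:
            the next iteration will peel, and the extra share in \<open>loop_pot\<close> is
            released.\<close>
          have less: "arrs s1 ''deg'' ?u < k'"
          proof -
            have "arrs s1 ''deg'' ?u * ?a < 2 * regs s1 ''ew''" using le False by simp
            then have "(arrs s1 ''deg'' ?u + 1) * ?a \<le> 2 * regs s1 ''ew'' + ?a - 1" using a0 by simp
            then have "arrs s1 ''deg'' ?u + 1 \<le> k'" unfolding k'_def using a0 by (metis div_le_mono nonzero_mult_div_cancel_right not_gr_zero)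
            then show ?thesis by simp
          qed
          have notall: "\<not> (\<forall>v\<in>alive s1. int (wdeg w (rest_edges s1) v) = \<lceil>2 * edge_density w (alive s1) (rest_edges s1)\<rceil>)"
            unfolding ceil k'_def[symmetric]
          proof
            assume "\<forall>v\<in>alive s1. int (wdeg w (rest_edges s1) v) = int k'"
            then have "int (wdeg w (rest_edges s1) ?u) = int k'" using u by blast
            then show False using less wd[OF u] by simp
          qed
          have "k' \<le> 2 * regs s1 ''ew'' + ?a" unfolding k'_def using div_le_dividend le_trans diff_le_self by blast
          then have k'B: "k' \<le> B" using small by simp
          let ?s3 = "setr ''k'' k' s2"
          have al3: "alive ?s3 = alive s1" "rest_edges ?s3 = rest_edges s1" "arcs ?s3 = arcs s1"
            using q(2-4) by simp_all
          have "peel_inv {} ?s3" using q(1) by (simp add: peel_inv_setr)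
          moreover have "G A" if "completes w (edge_density w (alive s1) (rest_edges s1)) (alive s1, rest_edges s1, arcs s1) A" for A
            by (rule G[OF completes_again[OF ne stuck notall that]])
          then have "\<exists>l. int k' = \<lceil>2 * l\<rceil> \<and> (\<forall>A. completes w l (alive s1, rest_edges s1, arcs s1) A \<longrightarrow> G A)"
            using ceil unfolding k'_def[symmetric] by metis
          ultimately have inv3: "loop_inv G ?s3" using k'B al3 r2 by (simp add: loop_inv_def)
          have ag3: "agree looped s ?s3" using ag2 by (rule agree_setr) simp
          have pot3: "loop_pot ?s3 \<le> T + ?F * (2 * ?a) + (kc + 80) * ?S + 50"
          proof -
            have "\<exists>v\<in>alive s1. arrs s1 ''deg'' v < k'" using u less by blast
            moreover have "pot (alive s1) ?s3 = pot (alive s1) s2" by (simp add: peel_inv_setr)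
            ultimately show ?thesis using r2 A unfolding loop_pot_def al3(1) by simp
          qed
          have kk: "(2 * regs s1 ''ew'' + ?a - Suc 0) div ?a = k'" by (simp add: k'_def)
          have "run B (Assign ''k'' (ceiling_twice_density (Reg ''nv''))) s2 (T + R - 20) ?step"
          proof (rule run_straight[where T' = "T + ?F * (2 * ?a) + (kc + 80) * ?S + 50"])
            show "wp B (Assign ''k'' (ceiling_twice_density (Reg ''nv''))) s2
              (\<lambda>s'. ?step s' (T + ?F * (2 * ?a) + (kc + 80) * ?S + 50))"
              using r2 small k'B inv3 ag3 pot3 by (simp add: ceiling_twice_density_def kk)
          qed (use Rge in \<open>simp_all add: ceiling_twice_density_def\<close>)
          then show ?thesis
            using False r2 degB small Rge by (intro run_Cond[where T' = "T + R - 20"]) simp_all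
        qed
        then show "run B (Cond (Read ''deg'' (Reg ''u'') \<prec> Reg ''k'') (peel cdel cdec we) ?upd) s2 (T + R) ?step"
          by (rule run_Cond[where T' = "T + R - 5", rotated 3]) (use False r2 degB kB small Rge in simp_all)
      qed
    qed
    then show ?thesis
      using a0 nv small pot_ge by (intro run_Cond[where T' = "loop_pot s1 - 6"]) simp_all
  qed
  then show "\<exists>T'. cost (Reg ''go'') + 1 + T' \<le> loop_pot s1 \<and>
      run B (Cond (Reg ''nv'' \<doteq> Num 0) (Assign ''go'' (Num 0))
       (cfind ;; Cond (Read ''deg'' (Reg ''u'') \<prec> Reg ''k'') (peel cdel cdec we) ?upd)) s1 T' ?step"
    using pot_ge by (intro exI[of _ "loop_pot s1 - 2"]) simp
qed simp

end

section \<open>Orienting the remaining graph by a walk\<close>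

text \<open>Only the vertices above \<open>x\<close> are taken off the stack, since the walk
  continues at \<open>x\<close>.\<close>

definition pop_until :: com where
  "pop_until =
     While ((Read ''stk'' (Reg ''sp'' \<ominus> Num 1) \<doteq> Reg ''x'') \<doteq> Num 0)
      (Assign ''sp'' (Reg ''sp'' \<ominus> Num 1) ;; Write ''onp'' (Read ''stk'' (Reg ''sp'')) (Num 0))"

definition walk_start :: com where
  "walk_start =
     Assign ''v'' (Read ''vl'' (Reg ''j'')) ;; Assign ''j'' (Reg ''j'' \<oplus> Num 1) ;;
     Write ''stk'' (Num 0) (Reg ''v'') ;; Write ''onp'' (Reg ''v'') (Num 1) ;; Assign ''sp'' (Num 1)"

text \<open>The output bit is 1 if the listed target is \<open>v\<close>, because the arc has to
  leave \<open>v\<close>.\<close>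

definition walk_advance :: com where
  "walk_advance =
     (Write ''done'' (Reg ''e'') (Num 1) ;;
      Write ''out'' (Reg ''e'') (Read ''tgt'' (Reg ''e'') \<doteq> Reg ''v'') ;;
      Assign ''x'' (Read ''src'' (Reg ''e'') \<oplus> Read ''tgt'' (Reg ''e'') \<ominus> Reg ''v'')) ;;
     Cond (Read ''onp'' (Reg ''x'') \<doteq> Num 0)
      (Write ''stk'' (Reg ''sp'') (Reg ''x'') ;; Assign ''sp'' (Reg ''sp'' \<oplus> Num 1) ;; Write ''onp'' (Reg ''x'') (Num 1))
      pop_until"

text \<open>\<open>ptr\<close> is never set back, so each adjacency entry is read at most once, even
  if a vertex is popped and visited again.\<close>

definition walk_step :: com where
  "walk_step =
     Assign ''v'' (Read ''stk'' (Reg ''sp'' \<ominus> Num 1)) ;;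
     Cond (Read ''ptr'' (Reg ''v'') \<prec> Read ''cnt'' (Reg ''v''))
      ((Assign ''e'' (Read ''adj'' (Reg ''v'' \<otimes> Reg ''m'' \<oplus> Read ''ptr'' (Reg ''v''))) ;;
        Write ''ptr'' (Reg ''v'') (Read ''ptr'' (Reg ''v'') \<oplus> Num 1)) ;;
       Cond (Read ''done'' (Reg ''e'') \<doteq> Num 0) walk_advance Skip)
      (Assign ''sp'' (Reg ''sp'' \<ominus> Num 1) ;; Write ''onp'' (Reg ''v'') (Num 0))"

definition walk :: com where
  "walk =
     (Assign ''j'' (Num 0) ;; Assign ''sp'' (Num 0)) ;;
     While ((Num 0 \<prec> Reg ''sp'') \<oplus> (Reg ''j'' \<prec> Reg ''nl''))
      (Cond (Reg ''sp'' \<doteq> Num 0) walk_start walk_step)"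

section \<open>The walk stack as a list, and the invariant of the walk\<close>

definition stack :: "state \<Rightarrow> nat list" where
  "stack s = map (arrs s ''stk'') [0..<regs s ''sp'']"

lemma stack_simps [simp]:
  "x \<noteq> ''sp'' \<Longrightarrow> stack (setr x v s) = stack s" "a \<noteq> ''stk'' \<Longrightarrow> stack (seta a i v s) = stack s"
  by (simp_all add: stack_def)

lemma length_stack: "length (stack s) = regs s ''sp''"
  by (simp add: stack_def)

lemma last_stack: "0 < regs s ''sp'' \<Longrightarrow> arrs s ''stk'' (regs s ''sp'' - Suc 0) = last (stack s)"
  by (simp add: stack_def last_map)

lemma stack_pop: "stack s = p @ [v] \<Longrightarrow> stack (setr ''sp'' (regs s ''sp'' - Suc 0) s) = p \<and> regs s ''sp'' = Suc (length p)"
proof -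
  assume p: "stack s = p @ [v]"
  then have sp: "regs s ''sp'' = Suc (length p)" using length_stack[of s] by simp
  then show ?thesis using p by (simp add: stack_def)
qed

lemma stack_push: "stack (setr ''sp'' (Suc (regs s ''sp'')) (seta ''stk'' (regs s ''sp'') x s)) = stack s @ [x]"
  by (simp add: stack_def)

context edge_array
begin

definition on_stack :: "state \<Rightarrow> bool" where
  "on_stack s \<longleftrightarrow> distinct (stack s) \<and> set (stack s) \<subseteq> V0 \<and>
    (\<forall>v. arrs s ''onp'' v = (if v \<in> set (stack s) then 1 else 0))"

lemma sp_le: "on_stack s \<Longrightarrow> regs s ''sp'' \<le> n"
proof -
  assume "on_stack s"
  then have "distinct (stack s)" "set (stack s) \<subseteq> V0" by (auto simp: on_stack_def)
  then have "length (stack s) \<le> card V0" using card_mono[OF finite_V0] distinct_card by metis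
  then show ?thesis using card_V0(1) by (simp add: length_stack)
qed

lemma run_pop_until:
  assumes s: "on_stack s" "stack s = p @ x # q" "regs s ''x'' = x"
  shows "run B pop_until s (20 * length q + 9) (\<lambda>s' T. on_stack s' \<and> stack s' = p @ [x] \<and>
    agree (\<lambda>y. y \<notin> {''sp'', ''onp''}) s s')"
  unfolding pop_until_def
proof (rule run_While[where \<Phi> = "\<lambda>s'. 20 * (regs s' ''sp'' - Suc (length p))"
      and I = "\<lambda>s'. on_stack s' \<and> (\<exists>q. stack s' = p @ x # q) \<and> agree (\<lambda>y. y \<notin> {''sp'', ''onp''}) s s'"])
  show "on_stack s \<and> (\<exists>q. stack s = p @ x # q) \<and> agree (\<lambda>y. y \<notin> {''sp'', ''onp''}) s s"
    using s by auto
  have "regs s ''sp'' = Suc (length p + length q)" using s(2) length_stack[of s] by simp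
  then show "cost ((Read ''stk'' (Reg ''sp'' \<ominus> Num 1) \<doteq> Reg ''x'') \<doteq> Num 0) + 1 +
    20 * (regs s ''sp'' - Suc (length p)) \<le> 20 * length q + 9" by simp
next
  fix s' assume I: "on_stack s' \<and> (\<exists>q. stack s' = p @ x # q) \<and> agree (\<lambda>y. y \<notin> {''sp'', ''onp''}) s s'"
  then obtain q' where q': "stack s' = p @ x # q'" and os: "on_stack s'" by blast
  have sp: "regs s' ''sp'' = Suc (length p + length q')" using q' length_stack[of s'] by simp
  have x: "regs s' ''x'' = x" using I s(3) by (simp add: agree_def)
  have top: "arrs s' ''stk'' (regs s' ''sp'' - Suc 0) = last (x # q')" using last_stack[of s'] sp q' by simp
  have lV: "last (x # q') \<in> V0" "x \<in> V0" using os q' unfolding on_stack_def by auto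
  have small: "1 \<le> B" "regs s' ''sp'' \<le> B" "x \<le> B" "last (x # q') \<le> B" "regs s' ''sp'' - Suc 0 \<le> B"
    using bounds sp_le[OF os] V0_less[OF lV(1)] V0_less[OF lV(2)] by linarith+
  show "fits B ((Read ''stk'' (Reg ''sp'' \<ominus> Num 1) \<doteq> Reg ''x'') \<doteq> Num 0) s'"
    using small x top by simp
  let ?sp = "regs s' ''sp'' - Suc 0"
  {
    assume "aval ((Read ''stk'' (Reg ''sp'' \<ominus> Num 1) \<doteq> Reg ''x'') \<doteq> Num 0) s' = 0"
    then have "last (x # q') = x" using x top by (simp split: if_splits)
    moreover have "distinct (x # q')" using os q' by (simp add: on_stack_def)
    ultimately have "q' = []" by (cases q' rule: rev_cases) auto
    then show "on_stack s' \<and> stack s' = p @ [x] \<and> agree (\<lambda>y. y \<notin> {''sp'', ''onp''}) s s'"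
      using I q' by simp
  }
  assume "aval ((Read ''stk'' (Reg ''sp'' \<ominus> Num 1) \<doteq> Reg ''x'') \<doteq> Num 0) s' \<noteq> 0"
  then have "last (x # q') \<noteq> x" using x top by (simp split: if_splits)
  then obtain r v where r: "q' = r @ [v]" by (cases q' rule: rev_cases) auto
  let ?s2 = "seta ''onp'' v 0 (setr ''sp'' ?sp s')"
  have "stack (setr ''sp'' ?sp s') = p @ x # r"
    by (rule stack_pop[of s' "p @ x # r" v, THEN conjunct1]) (simp add: q' r)
  then have st2: "stack ?s2 = p @ x # r" by simp
  have "on_stack ?s2" using os st2 q' r by (auto simp: on_stack_def)
  moreover have "agree (\<lambda>y. y \<notin> {''sp'', ''onp''}) s ?s2" using I by (intro agree_seta agree_setr) auto
  ultimately have I2: "on_stack ?s2 \<and> (\<exists>q. stack ?s2 = p @ x # q) \<and> agree (\<lambda>y. y \<notin> {''sp'', ''onp''}) s ?s2"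
    using st2 by blast
  show "\<exists>T'. cost ((Read ''stk'' (Reg ''sp'' \<ominus> Num 1) \<doteq> Reg ''x'') \<doteq> Num 0) + 1 + T' \<le> 20 * (regs s' ''sp'' - Suc (length p)) \<and>
    run B (Assign ''sp'' (Reg ''sp'' \<ominus> Num 1) ;; Write ''onp'' (Read ''stk'' (Reg ''sp'')) (Num 0)) s' T'
     (\<lambda>s' T''. (on_stack s' \<and> (\<exists>q. stack s' = p @ x # q) \<and> agree (\<lambda>y. y \<notin> {''sp'', ''onp''}) s s') \<and>
        20 * (regs s' ''sp'' - Suc (length p)) \<le> T'')"
  proof (intro exI conjI)
    show "run B (Assign ''sp'' (Reg ''sp'' \<ominus> Num 1) ;; Write ''onp'' (Read ''stk'' (Reg ''sp'')) (Num 0)) s'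
      (8 + 20 * (?sp - Suc (length p)))
     (\<lambda>s' T''. (on_stack s' \<and> (\<exists>q. stack s' = p @ x # q) \<and> agree (\<lambda>y. y \<notin> {''sp'', ''onp''}) s s') \<and>
        20 * (regs s' ''sp'' - Suc (length p)) \<le> T'')"
      by (rule run_straight[where T' = "20 * (?sp - Suc (length p))"]) (use small top r I2 in simp_all)
  qed (use sp r in simp)
qed

text \<open>Stack edges are done in memory but still undeleted in the abstract run, so their arcs
  are split off as \<open>path_arcs p\<close>. \<open>V\<close> is existential because the program
  keeps no vertex set here; popped leaves vanish from it silently.\<close>

definition extends :: "((nat \<times> nat) set \<Rightarrow> bool) \<Rightarrow> nat set set \<Rightarrow> nat list \<Rightarrow> (nat \<times> nat) set \<Rightarrow> bool" where
  "extends G U p A \<longleftrightarrow> (\<exists>V A0. finite V \<and> (\<forall>e\<in>U \<union> path_edges p. e \<subseteq> V) \<and> A0 \<union> path_arcs p = A \<and>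
     (\<forall>A'. finishes (V, U \<union> path_edges p, A0) A' \<longrightarrow> G A'))"

text \<open>Of the vertices from which the walk has been started, only the bottom of the stack may
  have unread entries. So once all starts are used and the stack is empty, every edge has been
  read.\<close>

definition walk_inv :: "((nat \<times> nat) set \<Rightarrow> bool) \<Rightarrow> state \<Rightarrow> bool" where
  "walk_inv G s \<longleftrightarrow> static s \<and> on_stack s \<and> path_edges (stack s) \<inter> rest_edges s = {} \<and> path_edges (stack s) \<subseteq> E \<and>
    (\<forall>i. arrs s ''done'' i \<le> 1) \<and> (\<forall>v. arrs s ''ptr'' v \<le> arrs s ''cnt'' v) \<and>
    (\<forall>v i. i < arrs s ''ptr'' v \<longrightarrow> arrs s ''adj'' (v * m + i) \<notin> rest s) \<and> regs s ''j'' \<le> regs s ''nl'' \<and>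
    (\<forall>i<regs s ''j''. arrs s ''ptr'' (arrs s ''vl'' i) = arrs s ''cnt'' (arrs s ''vl'' i) \<or>
       stack s \<noteq> [] \<and> arrs s ''vl'' i = hd (stack s)) \<and>
    extends G (rest_edges s) (stack s) (arcs s)"

text \<open>The 150 credits of an adjacency entry pay for reading it and for pushing a vertex, which
  takes 40 along for its removal; 80 credits start a walk.\<close>

definition walk_pot :: "state \<Rightarrow> nat" where
  "walk_pot s = 150 * (\<Sum>v\<in>V0. arrs s ''cnt'' v - arrs s ''ptr'' v) + 40 * regs s ''sp'' + 80 * (regs s ''nl'' - regs s ''j'')"

lemma wp_walk_start:
  assumes I: "walk_inv G s" and sp: "regs s ''sp'' = 0" and j: "regs s ''j'' < regs s ''nl''"
  shows "wp B walk_start s (\<lambda>s'. walk_inv G s' \<and> walk_pot s' + 40 \<le> walk_pot s)"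
proof -
  define v where "v = arrs s ''vl'' (regs s ''j'')"
  let ?s' = "setr ''sp'' 1 (seta ''onp'' v 1 (seta ''stk'' 0 v (setr ''j'' (Suc (regs s ''j'')) (setr ''v'' v s))))"
  have st: "static s" using I by (simp add: walk_inv_def)
  note D = staticD[OF st]
  have v: "v \<in> V0" using D(7) j by (auto simp: v_def)
  have nl: "regs s ''nl'' \<le> n" using D(8) card_V0(1) by simp
  have small: "1 \<le> B" "v \<le> B" "regs s ''j'' \<le> B" "Suc (regs s ''j'') \<le> B"
    using bounds V0_less[OF v] nl j by linarith+
  have stk: "stack s = []" "stack ?s' = [v]" using sp by (simp_all add: stack_def)
  have st': "static ?s'" using static_cong[of s ?s'] st by (simp add: agree_def)
  have eqs: "rest ?s' = rest s" "rest_edges ?s' = rest_edges s" "arcs ?s' = arcs s"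
    by (simp_all add: rest_edges_def rest_def arcs_def arc_def)
  have "on_stack ?s'" using I v stk by (auto simp: on_stack_def walk_inv_def)
  moreover have "extends G (rest_edges s) [v] (arcs s)"
    using I stk by (simp add: walk_inv_def extends_def)
  ultimately have "walk_inv G ?s'"
    using I st' stk j unfolding walk_inv_def eqs
    by (auto simp: less_Suc_eq v_def)
  moreover have "walk_pot ?s' + 40 \<le> walk_pot s" using sp j by (simp add: walk_pot_def)
  ultimately show ?thesis using small sp by (simp add: walk_start_def v_def)
qed

text \<open>A stuck top is removed as a leaf, an edge to a new vertex only changes from remaining
  edge to stack edge, and an edge to a stack vertex closes a cycle. An entry already done merely
  lowers the potential.\<close>

lemma run_walk_step:
  assumes I: "walk_inv G s" and sp: "0 < regs s ''sp''"
  shows "run B walk_step s (walk_pot s - 12) (\<lambda>s' T. walk_inv G s' \<and> walk_pot s' \<le> T)"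
    (is "run _ _ _ _ ?Q")
proof -
  define v where "v = last (stack s)"
  have st: "static s" and os: "on_stack s" using I by (auto simp: walk_inv_def)
  note D = staticD[OF st]
  have ne: "stack s \<noteq> []" using sp length_stack[of s] by auto
  define p where "p = butlast (stack s)"
  have p: "stack s = p @ [v]" using ne by (simp add: p_def v_def)
  have v: "v \<in> V0" "v < n" using os p V0_less by (auto simp: on_stack_def)
  have dist: "distinct (p @ [v])" using os p by (simp add: on_stack_def)
  have spp: "regs s ''sp'' = Suc (length p)" using p length_stack[of s] by simp
  have "extends G (rest_edges s) (stack s) (arcs s)" using I by (simp add: walk_inv_def)
  then obtain V A where VA0: "finite V \<and> (\<forall>e\<in>rest_edges s \<union> path_edges (stack s). e \<subseteq> V) \<and> A \<union> path_arcs (stack s) = arcs s \<and>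
    (\<forall>A'. finishes (V, rest_edges s \<union> path_edges (stack s), A) A' \<longrightarrow> G A')"
    unfolding extends_def by (elim exE)
  have VA: "finite V" "\<forall>e\<in>rest_edges s \<union> path_edges (stack s). e \<subseteq> V" "A \<union> path_arcs (stack s) = arcs s"
    using VA0 by simp_all
  have G: "G A'" if "finishes (V, rest_edges s \<union> path_edges (stack s), A) A'" for A'
    using VA0 that by simp
  have dis: "path_edges (stack s) \<inter> rest_edges s = {}" and PE: "path_edges (stack s) \<subseteq> E"
    and done1: "\<And>i. arrs s ''done'' i \<le> 1" and ptr: "\<And>v. arrs s ''ptr'' v \<le> arrs s ''cnt'' v"
    and ptr_done: "\<And>v i. i < arrs s ''ptr'' v \<Longrightarrow> arrs s ''adj'' (v * m + i) \<notin> rest s"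
    and j: "regs s ''j'' \<le> regs s ''nl''"
    and roots: "\<And>i. i < regs s ''j'' \<Longrightarrow> arrs s ''ptr'' (arrs s ''vl'' i) = arrs s ''cnt'' (arrs s ''vl'' i) \<or>
       arrs s ''vl'' i = hd (stack s)"
    using I unfolding walk_inv_def by blast+
  have finU: "finite (rest_edges s \<union> path_edges (stack s))"
    using finite_subset[OF PE finite_E] by (simp add: rest_edges_def rest_def)
  define c where "c = arrs s ''ptr'' v"
  have cm: "c \<le> m" "arrs s ''cnt'' v \<le> m" using ptr[of v] D(3)[of v] by (auto simp: c_def)
  have small: "1 \<le> B" "v \<le> B" "c \<le> B" "Suc c \<le> B" "arrs s ''cnt'' v \<le> B" "regs s ''sp'' \<le> B" "regs s ''sp'' + 1 \<le> B" "m \<le> B"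
    using bounds v(2) cm sp_le[OF os] by linarith+
  define s1 where "s1 = setr ''v'' v s"
  have s1: "regs s1 ''v'' = v" "arrs s1 = arrs s" "regs s1 ''sp'' = regs s ''sp''" "regs s1 ''m'' = m" "stack s1 = stack s"
    using D(10) by (simp_all add: s1_def)
  have pot40: "40 \<le> walk_pot s" using sp by (simp add: walk_pot_def)
  have "run B (Cond (Read ''ptr'' (Reg ''v'') \<prec> Read ''cnt'' (Reg ''v''))
      ((Assign ''e'' (Read ''adj'' (Reg ''v'' \<otimes> Reg ''m'' \<oplus> Read ''ptr'' (Reg ''v''))) ;;
        Write ''ptr'' (Reg ''v'') (Read ''ptr'' (Reg ''v'') \<oplus> Num 1)) ;;
       Cond (Read ''done'' (Reg ''e'') \<doteq> Num 0) walk_advance Skip)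
      (Assign ''sp'' (Reg ''sp'' \<ominus> Num 1) ;; Write ''onp'' (Reg ''v'') (Num 0))) s1 (walk_pot s - 17) ?Q"
  proof (cases "c < arrs s ''cnt'' v")
    case False
    then have ptr_v: "arrs s ''ptr'' v = arrs s ''cnt'' v" using ptr[of v] by (simp add: c_def)
    \<comment> \<open>All entries before \<open>ptr\<close> are done, so with its row read to the
      end \<open>v\<close> has no edge left.\<close>
    have "i \<notin> rest s" if vi: "v \<in> edge i" for i
    proof
      assume i: "i \<in> rest s"
      then obtain k where "k < arrs s ''cnt'' v" "arrs s ''adj'' (v * m + k) = i"
        using D(5)[of i v] vi by (auto simp: rest_def)
      then show False using ptr_done[of k v] ptr_v i by simp
    qed
    then have inc: "incident (rest_edges s) v = {}" by (auto simp: incident_def rest_edges_def)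
    let ?s' = "seta ''onp'' v 0 (setr ''sp'' (regs s ''sp'' - Suc 0) s1)"
    have "stack (setr ''sp'' (regs s1 ''sp'' - Suc 0) s1) = p"
      by (rule stack_pop[of s1 p v, THEN conjunct1]) (simp add: s1 p)
    then have stk': "stack ?s' = p" by (simp add: s1)
    have os': "on_stack ?s'" using os stk' p dist s1 by (auto simp: on_stack_def)
    have st': "static ?s'" using static_cong[of s ?s'] st by (simp add: agree_def s1_def)
    have eqs: "rest ?s' = rest s" "rest_edges ?s' = rest_edges s" "arcs ?s' = arcs s"
      by (simp_all add: rest_edges_def rest_def arcs_def arc_def s1)
    have sub: "path_edges p \<subseteq> path_edges (stack s)"
    proof (cases p rule: rev_cases)
      case (snoc r a)
      then show ?thesis using path_edges_append[of r a "[v]"] p by auto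
    qed simp
    \<comment> \<open>The bottom of the stack simply stays in \<open>V\<close> as an isolated
      vertex; any other top is removed as a leaf.\<close>
    have ext: "extends G (rest_edges s) p (arcs s)"
    proof (cases p rule: rev_cases)
      case Nil
      then show ?thesis unfolding extends_def using VA G p by (intro exI[of _ V] exI[of _ A]) simp
    next
      case (snoc r a)
      then have pr: "stack s = r @ [a, v]" and dist': "distinct (r @ [a, v])" using p dist by auto
      note leaf = walk_leaf[OF dist' inc]
      have "{a, v} \<subseteq> V" using VA(2) unfolding pr by (auto simp: path_edges_append[of r a "[v]"])
      then have vV: "v \<in> V" by simp
      have "finishes (V, rest_edges s \<union> path_edges (stack s), A) A'"
        if "finishes (V - {v}, rest_edges s \<union> path_edges p, A \<union> {(a, v)}) A'" for A'
        by (rule finishes_leaf[OF finU vV]) (use that in \<open>simp_all add: pr leaf snoc\<close>)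
      moreover have "e \<subseteq> V - {v}" if "e \<in> rest_edges s \<union> path_edges p" for e
      proof -
        have "v \<notin> e" using that inc path_edges_subset[of e p] dist by (auto simp: incident_def)
        then show ?thesis using VA(2) that sub by blast
      qed
      moreover have "A \<union> {(a, v)} \<union> path_arcs p = arcs s"
        using VA(3) unfolding pr snoc path_arcs_append[of r a "[v]"] by auto
      ultimately show ?thesis
        unfolding extends_def using VA(1) G by (intro exI[of _ "V - {v}"] exI[of _ "A \<union> {(a, v)}"]) blast
    qed
    have "arrs s ''ptr'' (arrs s ''vl'' i) = arrs s ''cnt'' (arrs s ''vl'' i) \<or> p \<noteq> [] \<and> arrs s ''vl'' i = hd p"
      if "i < regs s ''j''" for i
      using roots[OF that] ptr_v unfolding p by (cases p) auto
    moreover have "path_edges p \<inter> rest_edges s = {}" "path_edges p \<subseteq> E" using sub dis PE by blast+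
    ultimately have "walk_inv G ?s'"
      using st' os' ext done1 ptr ptr_done j unfolding walk_inv_def eqs stk' by (simp add: s1_def)
    moreover have "walk_pot ?s' + 40 = walk_pot s" using sp by (simp add: walk_pot_def s1_def)
    ultimately show ?thesis
      using False small s1 pot40
      by (intro run_Cond[where T' = "walk_pot s - 23"] run_straight[where T' = "walk_pot s - 40"])
        (auto simp: c_def)
  next
    case True
    define e where "e = arrs s ''adj'' (v * m + c)"
    have e: "e < m" "v \<in> edge e" using D(4)[OF True] by (auto simp: e_def)
    have ste: "src e < n" "tgt e < n" "src e \<noteq> tgt e" using src_tgt[OF e(1)] by auto
    have srcs: "arrs s ''src'' e = src e" "arrs s ''tgt'' e = tgt e" using D(11)[OF e(1)] by auto
    have adjB: "v * m \<le> B" "v * m + c \<le> B" using mult_bound[OF v(2)] adj_bound[OF v(2), of c] True cm by auto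
    have eB: "e \<le> B" using e(1) bounds by linarith
    define s2 where "s2 = seta ''ptr'' v (Suc c) (setr ''e'' e s1)"
    have vV: "v \<in> V0" by (rule v(1))
    have pot2: "150 * (\<Sum>u\<in>V0. arrs s ''cnt'' u - ((arrs s ''ptr'')(v := Suc c)) u) + 150 =
      150 * (\<Sum>u\<in>V0. arrs s ''cnt'' u - arrs s ''ptr'' u)"
    proof -
      have "(\<Sum>u\<in>V0 - {v}. arrs s ''cnt'' u - ((arrs s ''ptr'')(v := Suc c)) u) =
        (\<Sum>u\<in>V0 - {v}. arrs s ''cnt'' u - arrs s ''ptr'' u)" by (rule sum.cong) auto
      then show ?thesis using True by (simp add: sum.remove[OF finite_V0 vV] c_def)
    qed
    have ptr2: "((arrs s ''ptr'')(v := Suc c)) u \<le> arrs s ''cnt'' u" for u using ptr[of u] True by auto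
    have ptr_done2: "i < ((arrs s ''ptr'')(v := Suc c)) u \<Longrightarrow> arrs s ''adj'' (u * m + i) \<notin> rest s - {e}" for u i
      using ptr_done[of i u] by (auto simp: less_Suc_eq c_def e_def split: if_splits)
    have roots2: "((arrs s ''ptr'')(v := Suc c)) (arrs s ''vl'' i) = arrs s ''cnt'' (arrs s ''vl'' i) \<or> arrs s ''vl'' i = hd (stack s)"
      if "i < regs s ''j''" for i
      using roots[OF that] True by (auto simp: c_def)
    have W: "walk_pot s = 150 * (\<Sum>u\<in>V0. arrs s ''cnt'' u - ((arrs s ''ptr'')(v := Suc c)) u) + 150 + 40 * regs s ''sp'' +
      80 * (regs s ''nl'' - regs s ''j'')"
      unfolding walk_pot_def pot2 ..
    have "run B (Cond (Read ''done'' (Reg ''e'') \<doteq> Num 0) walk_advance Skip) s2 (walk_pot s - 37) ?Q"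
    proof (cases "e \<in> rest s")
      case False
      then have d0: "arrs s ''done'' e \<noteq> 0" using e(1) by (simp add: rest_def)
      have st2: "static s2" using static_cong[of s s2] st by (simp add: agree_def s2_def s1_def)
      have eqs: "rest s2 = rest s" "rest_edges s2 = rest_edges s" "arcs s2 = arcs s" "stack s2 = stack s"
        by (simp_all add: rest_edges_def rest_def arcs_def arc_def s2_def s1)
      have os2: "on_stack s2" using os eqs(4) by (simp add: on_stack_def s2_def s1)
      have "rest s - {e} = rest s" using False by simp
      then have "walk_inv G s2"
        using st2 os2 dis PE done1 ptr2 ptr_done2 j roots2 ne I
        unfolding walk_inv_def eqs by (simp add: s2_def s1_def)
      moreover have "walk_pot s2 + 150 = walk_pot s" unfolding W by (simp add: walk_pot_def s2_def s1_def)
      moreover have "arrs s ''done'' e \<le> B" using done1[of e] small(1) by simp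
      ultimately show ?thesis
        using d0 small eB by (intro run_Cond[where T' = "walk_pot s - 42"] run_straight[where T' = "walk_pot s - 150"])
          (simp_all add: s2_def s1)
    next
      case True
      then have d0: "arrs s ''done'' e = 0" by (simp add: rest_def)
      define x where "x = src e + tgt e - v"
      define b where "b = (if tgt e = v then 1 else 0 :: nat)"
      have x: "edge e = {v, x}" "x \<noteq> v" "x < n" "v = src e \<longrightarrow> x = tgt e" "v = tgt e \<longrightarrow> x = src e"
        using e(2) ste by (auto simp: edge_def x_def)
      have xV: "x \<in> V0" using edge_V0[OF e(1)] x(1) by auto
      have xB: "src e \<le> B" "tgt e \<le> B" "src e + tgt e \<le> B" "x \<le> B" using ste x(3) bounds by linarith+
      define s3 where "s3 = setr ''x'' x (seta ''out'' e b (seta ''done'' e 1 s2))"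
      have rest3: "{i. i < m \<and> ((arrs s ''done'')(e := 1)) i = 0} = rest s - {e}" by (auto simp: rest_def)
      have inj: "edge ` (rest s - {e}) = rest_edges s - {edge e}"
        using edge_eq_iff[OF _ e(1)] by (auto simp: rest_edges_def rest_def)
      have eU: "edge e \<in> rest_edges s" using True by (simp add: rest_edges_def)
      \<comment> \<open>Pushing and popping differ only in the stack; \<open>finish\<close> gathers
        the common part for the new stack \<open>p4\<close>.\<close>
      have finish: "walk_inv G s4" if ag: "agree (\<lambda>y. y \<notin> {''sp'', ''onp'', ''stk''}) s3 s4" and os4: "on_stack s4"
        and p4: "stack s4 = p4" "p4 \<noteq> []" "hd p4 = hd (stack s)"
        and dis4: "path_edges p4 \<inter> (rest_edges s - {edge e}) = {}" "path_edges p4 \<subseteq> E"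
        and ext4: "extends G (rest_edges s - {edge e}) p4 (insert (v, x) (arcs s))" for s4 p4
      proof -
        have arr: "arrs s4 a = arrs s3 a" "regs s4 a = regs s3 a" if "a \<notin> {''sp'', ''onp'', ''stk''}" for a
          using ag that by (auto simp: agree_def)
        have st3: "static s3" using static_cong[of s s3] st by (simp add: agree_def s3_def s2_def s1_def)
        have "static s4 = static s3" by (rule static_cong) (rule agree_mono[OF ag], auto)
        then have st4: "static s4" using st3 by simp
        have done4: "arrs s4 ''done'' = (arrs s ''done'')(e := 1)" using arr by (simp add: s3_def s2_def s1)
        have out4: "arrs s4 ''out'' = (arrs s ''out'')(e := b)" using arr by (simp add: s3_def s2_def s1)
        have rest4: "rest s4 = rest s - {e}" unfolding rest_def[of s4] done4 by (rule rest3)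
        have re4: "rest_edges s4 = rest_edges s - {edge e}" unfolding rest_edges_def[of s4] rest4 by (rule inj)
        have arcs4: "arcs s4 = insert (v, x) (arcs s)"
        proof -
          have "{..<m} - rest s4 = insert e ({..<m} - rest s)" using e(1) by (auto simp: rest4)
          moreover have "arc s4 e = (v, x)" using x(4,5) e(2) unfolding edge_def by (auto simp: arc_def out4 b_def)
          moreover have "arc s4 i = arc s i" if "i \<in> {..<m} - rest s" for i
            using that True by (auto simp: arc_def out4)
          then have "arc s4 ` ({..<m} - rest s) = arc s ` ({..<m} - rest s)" by (rule image_cong[OF refl])
          ultimately show ?thesis by (simp add: arcs_def)
        qed
        have eq4: "arrs s4 ''ptr'' = (arrs s ''ptr'')(v := Suc c)" "arrs s4 ''cnt'' = arrs s ''cnt''"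
          "arrs s4 ''adj'' = arrs s ''adj''" "arrs s4 ''vl'' = arrs s ''vl''"
          "regs s4 ''j'' = regs s ''j''" "regs s4 ''nl'' = regs s ''nl''"
          using arr by (simp_all add: s3_def s2_def s1_def)
        have c: "\<forall>i. arrs s4 ''done'' i \<le> 1" "\<forall>u. ((arrs s ''ptr'')(v := Suc c)) u \<le> arrs s ''cnt'' u"
          "\<forall>u i. i < ((arrs s ''ptr'')(v := Suc c)) u \<longrightarrow> arrs s ''adj'' (u * m + i) \<notin> rest s - {e}"
          "\<forall>i<regs s ''j''. ((arrs s ''ptr'')(v := Suc c)) (arrs s ''vl'' i) = arrs s ''cnt'' (arrs s ''vl'' i) \<or>
             p4 \<noteq> [] \<and> arrs s ''vl'' i = hd p4"
          using done1 ptr2 ptr_done2 roots2 p4(2,3) by (simp_all only: done4) simp_all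
        show ?thesis
          unfolding walk_inv_def re4 arcs4 eq4 p4(1) rest4 by (intro conjI st4 os4 dis4 c j ext4)
      qed
      have pot4: "walk_pot s4 + 40 * regs s ''sp'' + 150 = walk_pot s + 40 * regs s4 ''sp''"
        if ag: "agree (\<lambda>y. y \<notin> {''sp'', ''onp'', ''stk''}) s3 s4" for s4
      proof -
        have "arrs s4 ''ptr'' = (arrs s ''ptr'')(v := Suc c)" "arrs s4 ''cnt'' = arrs s ''cnt''"
          "regs s4 ''j'' = regs s ''j''" "regs s4 ''nl'' = regs s ''nl''"
          using ag by (simp_all add: agree_def s3_def s2_def s1_def)
        then show ?thesis unfolding W by (simp add: walk_pot_def)
      qed
      have stk3: "stack s3 = stack s" "regs s3 ''sp'' = regs s ''sp''" "regs s3 ''x'' = x" "arrs s3 ''onp'' = arrs s ''onp''"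
        by (simp_all add: s3_def s2_def s1)
      have onp: "arrs s ''onp'' x = (if x \<in> set (stack s) then 1 else 0)" using os by (simp add: on_stack_def)
      have os3: "on_stack s3" using os stk3 by (simp add: on_stack_def)
      have Wge: "150 + 40 * regs s ''sp'' \<le> walk_pot s" unfolding W by simp
      have push: "run B (Cond (Read ''onp'' (Reg ''x'') \<doteq> Num 0)
      (Write ''stk'' (Reg ''sp'') (Reg ''x'') ;; Assign ''sp'' (Reg ''sp'' \<oplus> Num 1) ;; Write ''onp'' (Reg ''x'') (Num 1))
      pop_until) s3 (walk_pot s - 59) ?Q"
      proof (cases "x \<in> set (stack s)")
        case False
        let ?s4 = "seta ''onp'' x 1 (setr ''sp'' (Suc (regs s ''sp'')) (seta ''stk'' (regs s ''sp'') x s3))"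
        have ag4: "agree (\<lambda>y. y \<notin> {''sp'', ''onp'', ''stk''}) s3 ?s4" by (intro agree_seta agree_setr) simp_all
        have stk4: "stack ?s4 = stack s @ [x]" using stack_push[of s3 x] stk3 by simp
        have pe: "path_edges (stack s @ [x]) = insert (edge e) (path_edges (stack s))"
          using path_edges_append[of p v "[x]"] p x(1) by simp
        have pa: "path_arcs (stack s @ [x]) = insert (v, x) (path_arcs (stack s))"
          using path_arcs_append[of p v "[x]"] p by simp
        have "walk_inv G ?s4"
        proof (rule finish[OF ag4 _ stk4])
          show "on_stack ?s4" unfolding on_stack_def stk4 using os False xV stk3 by (auto simp: on_stack_def)
          show "hd (stack s @ [x]) = hd (stack s)" using ne by simp
          show "path_edges (stack s @ [x]) \<inter> (rest_edges s - {edge e}) = {}" using dis by (auto simp: pe)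
          show "path_edges (stack s @ [x]) \<subseteq> E" using PE edge_in[OF e(1)] by (simp add: pe)
          \<comment> \<open>The edge moves from the remaining edges to the stack, so the abstract
            configuration is the same.\<close>
          have "rest_edges s - {edge e} \<union> path_edges (stack s @ [x]) = rest_edges s \<union> path_edges (stack s)"
            using eU by (auto simp: pe)
          then show "extends G (rest_edges s - {edge e}) (stack s @ [x]) (insert (v, x) (arcs s))"
            unfolding extends_def pa using VA G by (intro exI[of _ V] exI[of _ A]) auto
        qed simp
        moreover have "walk_pot ?s4 + 110 = walk_pot s" using pot4[OF ag4] by simp
        ultimately show ?thesis
          using False onp stk3 small xB
          by (intro run_Cond[where T' = "walk_pot s - 64"] run_straight[where T' = "walk_pot s - 110"]) simp_all
      next
        case True
        then obtain r q where rq: "stack s = r @ x # q" by (meson split_list)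
        have q: "q \<noteq> []" "last (x # q) = v" using rq p x(2) by (cases q rule: rev_cases; auto)+
        \<comment> \<open>Stepping straight back would take the edge just walked, which is no longer
          in \<open>rest\<close>; so the cycle has at least three vertices.\<close>
        have "q \<noteq> [v]"
        proof
          assume "q = [v]"
          then have "edge e \<in> path_edges (stack s)"
            unfolding rq path_edges_append[of r x q] using x(1) by (auto simp: insert_commute)
          then show False using dis eU by blast
        qed
        then have q2: "2 \<le> length q" using q by (cases q; cases "tl q") auto
        have pop: "run B pop_until s3 (20 * length q + 9) (\<lambda>s' T. on_stack s' \<and> stack s' = r @ [x] \<and>
          agree (\<lambda>y. y \<notin> {''sp'', ''onp''}) s3 s')"
          using run_pop_until[OF os3] rq stk3 by simp
        have cyc: "cycle_step (V, rest_edges s \<union> path_edges (stack s), A)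
          (V, (rest_edges s - {edge e}) \<union> path_edges (r @ [x]), A \<union> insert (v, x) (path_arcs (x # q)))"
          using walk_cycle[of r x q "rest_edges s" V A] os q2 q(2) x(1) eU dis rq by (simp add: on_stack_def Int_commute)
        have sub: "path_edges (r @ [x]) \<subseteq> path_edges (stack s)"
          unfolding rq path_edges_append[of r x q] by blast
        have ext: "extends G (rest_edges s - {edge e}) (r @ [x]) (insert (v, x) (arcs s))"
          unfolding extends_def
        proof (intro exI conjI allI impI)
          show "finite V" by (rule VA(1))
          show "\<forall>f\<in>rest_edges s - {edge e} \<union> path_edges (r @ [x]). f \<subseteq> V" using VA(2) sub by blast
          show "A \<union> insert (v, x) (path_arcs (x # q)) \<union> path_arcs (r @ [x]) = insert (v, x) (arcs s)"
            using VA(3) unfolding rq path_arcs_append[of r x q] by blast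
          show "G A'" if "finishes (V, rest_edges s - {edge e} \<union> path_edges (r @ [x]), A \<union> insert (v, x) (path_arcs (x # q))) A'" for A'
            by (rule G[OF finishes_cycle[OF cyc that]])
        qed
        have "run B pop_until s3 (walk_pot s - 64) ?Q"
        proof (rule run_conseq[OF pop, where F = "walk_pot s - 150 - 40 * length q"])
          have "length q + 1 \<le> regs s ''sp''" using rq length_stack[of s] by simp
          then show "20 * length q + 9 + (walk_pot s - 150 - 40 * length q) \<le> walk_pot s - 64" using Wge by simp
        next
          fix s4 :: state and T
          assume s4: "on_stack s4 \<and> stack s4 = r @ [x] \<and> agree (\<lambda>y. y \<notin> {''sp'', ''onp''}) s3 s4"
          then have "agree (\<lambda>y. y \<notin> {''sp'', ''onp''}) s3 s4" by blast
          then have ag4: "agree (\<lambda>y. y \<notin> {''sp'', ''onp'', ''stk''}) s3 s4" by (rule agree_mono) auto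
          have "walk_inv G s4"
          proof (rule finish[OF ag4])
            show "hd (r @ [x]) = hd (stack s)" unfolding rq by (cases r) auto
            show "path_edges (r @ [x]) \<inter> (rest_edges s - {edge e}) = {}" "path_edges (r @ [x]) \<subseteq> E"
              using sub dis PE by blast+
          qed (use s4 ext in auto)
          moreover have "regs s4 ''sp'' = Suc (length r)" using s4 length_stack[of s4] by simp
          moreover have "regs s ''sp'' = Suc (length r + length q)" using rq length_stack[of s] by simp
          ultimately show "?Q s4 (T + (walk_pot s - 150 - 40 * length q))"
            using pot4[OF ag4] by simp
        qed
        then show ?thesis
          using True onp stk3 small xB Wge
          by (intro run_Cond[where T' = "walk_pot s - 64"]) simp_all
      qed
      have "run B walk_advance s2 (walk_pot s - 42) ?Q"
        unfolding walk_advance_def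
      proof (rule run_straight_Seq[where T' = "walk_pot s - 59"])
        have s2: "regs s2 ''e'' = e" "regs s2 ''v'' = v" "arrs s2 ''src'' e = src e" "arrs s2 ''tgt'' e = tgt e"
          by (simp_all add: s2_def s1 srcs)
        have xx: "src e + tgt e - v = x" by (simp add: x_def)
        show "wp B (Write ''done'' (Reg ''e'') (Num 1) ;;
      Write ''out'' (Reg ''e'') (Read ''tgt'' (Reg ''e'') \<doteq> Reg ''v'') ;;
      Assign ''x'' (Read ''src'' (Reg ''e'') \<oplus> Read ''tgt'' (Reg ''e'') \<ominus> Reg ''v'')) s2
          (\<lambda>s'. run B (Cond (Read ''onp'' (Reg ''x'') \<doteq> Num 0)
      (Write ''stk'' (Reg ''sp'') (Reg ''x'') ;; Assign ''sp'' (Reg ''sp'' \<oplus> Num 1) ;; Write ''onp'' (Reg ''x'') (Num 1))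
      pop_until) s' (walk_pot s - 59) ?Q)"
          using push small xB eB s2 xx unfolding s3_def
          by (cases "tgt e = v") (simp_all add: b_def)
      qed (use Wge in simp_all)
      then show ?thesis
        using d0 small eB Wge by (intro run_Cond[where T' = "walk_pot s - 42"]) (simp_all add: s2_def s1)
    qed
    then have "run B ((Assign ''e'' (Read ''adj'' (Reg ''v'' \<otimes> Reg ''m'' \<oplus> Read ''ptr'' (Reg ''v''))) ;;
        Write ''ptr'' (Reg ''v'') (Read ''ptr'' (Reg ''v'') \<oplus> Num 1)) ;;
       Cond (Read ''done'' (Reg ''e'') \<doteq> Num 0) walk_advance Skip) s1 (walk_pot s - 23) ?Q"
      using small adjB eB s1 W
      by (intro run_straight_Seq[where T' = "walk_pot s - 37"]) (simp_all add: s2_def c_def[symmetric] e_def[symmetric])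
    then show ?thesis
      using True small s1 W
      by (intro run_Cond[where T' = "walk_pot s - 23"]) (simp_all add: c_def)
  qed
  then show ?thesis
    unfolding walk_step_def
    using small sp last_stack[OF sp] pot40
    by (intro run_straight_Seq[where T' = "walk_pot s - 17"]) (simp_all add: s1_def v_def[symmetric])
qed

end

section \<open>The complete program\<close>

definition insert_all :: "com \<Rightarrow> com" where
  "insert_all cins =
     Assign ''i'' (Num 0) ;;
     While (Reg ''i'' \<prec> Reg ''nl'')
      (Assign ''x'' (Read ''vl'' (Reg ''i'')) ;; cins ;; Assign ''i'' (Reg ''i'' \<oplus> Num 1))"

definition orient_edges :: "aexp \<Rightarrow> com \<Rightarrow> com \<Rightarrow> com \<Rightarrow> com \<Rightarrow> com" where
  "orient_edges we cins cfind cdel cdec =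
     read_edges we ;; insert_all cins ;;
     (Assign ''k'' (ceiling_twice_density (Reg ''n'')) ;; Assign ''nv'' (Reg ''nl'') ;; Assign ''go'' (Num 1)) ;;
     peel_loop cfind cdel cdec we ;; walk"

context edge_array
begin

text \<open>The adjacency entries account for \<open>150 * (2 * m)\<close> and the starts from all
  nonisolated vertices for \<open>80 * card V0\<close>.\<close>

lemma run_walk:
  assumes st: "static s" and done1: "\<And>i. arrs s ''done'' i \<le> 1"
    and zero: "arrs s ''onp'' = (\<lambda>_. 0)" "arrs s ''ptr'' = (\<lambda>_. 0)"
    and V: "finite V" "\<And>e. e \<in> rest_edges s \<Longrightarrow> e \<subseteq> V"
    and G: "\<And>A. finishes (V, rest_edges s, arcs s) A \<Longrightarrow> G A"
  shows "run B walk s (300 * m + 80 * card V0 + 20) (\<lambda>s' T. G (output_orientation es s'))"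
proof -
  let ?s = "setr ''sp'' 0 (setr ''j'' 0 s)" and ?b = "(Num 0 \<prec> Reg ''sp'') \<oplus> (Reg ''j'' \<prec> Reg ''nl'')"
  have stk: "stack ?s = []" by (simp add: stack_def)
  have eqs: "rest ?s = rest s" "rest_edges ?s = rest_edges s" "arcs ?s = arcs s"
    by (simp_all add: rest_edges_def rest_def arcs_def arc_def)
  have st1: "static ?s" using static_cong[of s ?s] st by (simp add: agree_def)
  have "on_stack ?s" using zero by (simp add: on_stack_def stk)
  moreover have "extends G (rest_edges s) [] (arcs s)"
    unfolding extends_def using V G by (intro exI[of _ V] exI[of _ "arcs s"]) simp
  ultimately have I0: "walk_inv G ?s"
    using st1 done1 zero unfolding walk_inv_def eqs stk by simp
  have nl: "regs s ''nl'' = card V0" "regs s ''nl'' \<le> n" using staticD(8)[OF st] card_V0(1) by simp_all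
  have pot0: "walk_pot ?s = 300 * m + 80 * card V0"
    using sum_cnt[OF st] nl zero by (simp add: walk_pot_def)
  have "run B (While ?b (Cond (Reg ''sp'' \<doteq> Num 0) walk_start walk_step)) ?s (8 + walk_pot ?s)
    (\<lambda>s' T. G (output_orientation es s'))"
  proof (rule run_While[where I = "walk_inv G" and \<Phi> = walk_pot])
    show "walk_inv G ?s" by (rule I0)
  next
    fix s assume I: "walk_inv G s"
    then have st: "static s" and os: "on_stack s" and j: "regs s ''j'' \<le> regs s ''nl''" by (auto simp: walk_inv_def)
    have nl: "regs s ''nl'' \<le> n" using staticD(8)[OF st] card_V0(1) by simp
    have small: "2 \<le> B" "regs s ''sp'' \<le> B" "regs s ''nl'' \<le> B" "regs s ''j'' \<le> B"
      using bounds sp_le[OF os] nl j by linarith+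
    then show "fits B ?b s" by simp
    {
      assume "aval ?b s \<noteq> 0"
      then have act: "0 < regs s ''sp'' \<or> regs s ''j'' < regs s ''nl''" by (auto split: if_splits)
      have pot40: "40 \<le> walk_pot s" using act by (auto simp: walk_pot_def)
      have "run B (Cond (Reg ''sp'' \<doteq> Num 0) walk_start walk_step) s (walk_pot s - 8)
        (\<lambda>s' T. walk_inv G s' \<and> walk_pot s' \<le> T)"
      proof (rule run_Cond[where T' = "walk_pot s - 12"])
        show "fits B (Reg ''sp'' \<doteq> Num 0) s" using small by simp
        show "cost (Reg ''sp'' \<doteq> Num 0) + 1 + (walk_pot s - 12) \<le> walk_pot s - 8" using pot40 by simp
        show "run B walk_step s (walk_pot s - 12) (\<lambda>s' T. walk_inv G s' \<and> walk_pot s' \<le> T)"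
          if "aval (Reg ''sp'' \<doteq> Num 0) s = 0"
          using that by (intro run_walk_step[OF I]) (simp split: if_splits)
        assume "aval (Reg ''sp'' \<doteq> Num 0) s \<noteq> 0"
        then have sp0: "regs s ''sp'' = 0" by (simp split: if_splits)
        then have "wp B walk_start s (\<lambda>s'. walk_inv G s' \<and> walk_pot s' + 40 \<le> walk_pot s)"
          using act by (intro wp_walk_start[OF I]) simp_all
        then have "wp B walk_start s (\<lambda>s'. walk_inv G s' \<and> walk_pot s' \<le> walk_pot s - 40)"
          by (rule wp_mono) auto
        then show "run B walk_start s (walk_pot s - 12) (\<lambda>s' T. walk_inv G s' \<and> walk_pot s' \<le> T)"
          by (rule run_straight[where T' = "walk_pot s - 40", rotated]) (use pot40 in \<open>simp_all add: walk_start_def\<close>)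
      qed
      then show "\<exists>T'. cost ?b + 1 + T' \<le> walk_pot s \<and> run B (Cond (Reg ''sp'' \<doteq> Num 0) walk_start walk_step) s T'
        (\<lambda>s' T''. walk_inv G s' \<and> walk_pot s' \<le> T'')"
        using pot40 by (intro exI[of _ "walk_pot s - 8"]) simp
    }
    assume "aval ?b s = 0"
    then have sp0: "regs s ''sp'' = 0" and jn: "regs s ''j'' = regs s ''nl''"
      using j by (auto split: if_splits)
    have stk: "stack s = []" using sp0 by (simp add: stack_def)
    \<comment> \<open>A remaining edge would be listed at its source, which has served as a start
      and whose row is exhausted.\<close>
    have rest0: "i \<notin> rest s" for i
    proof
      assume i: "i \<in> rest s"
      then have im: "i < m" by (simp add: rest_def)
      have "src i \<in> V0" using edge_V0[OF im] by (simp add: edge_def)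
      then have "src i \<in> arrs s ''vl'' ` {..<regs s ''nl''}" using staticD(7)[OF st] by (simp only:)
      then obtain a where a: "a < regs s ''nl''" "arrs s ''vl'' a = src i" by auto
      have "\<forall>a<regs s ''j''. arrs s ''ptr'' (arrs s ''vl'' a) = arrs s ''cnt'' (arrs s ''vl'' a)"
        using I stk by (simp add: walk_inv_def)
      then have ptr: "arrs s ''ptr'' (src i) = arrs s ''cnt'' (src i)" using a jn by auto
      have "src i \<in> edge i" by (simp add: edge_def)
      then obtain k where "k < arrs s ''cnt'' (src i)" "arrs s ''adj'' (src i * m + k) = i"
        using staticD(5)[OF st im] by auto
      moreover have "\<forall>v i. i < arrs s ''ptr'' v \<longrightarrow> arrs s ''adj'' (v * m + i) \<notin> rest s"
        using I by (simp add: walk_inv_def)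
      ultimately show False using ptr i by metis
    qed
    then have rest: "rest s = {}" "rest_edges s = {}" by (auto simp: rest_edges_def)
    have "extends G {} [] (arcs s)" using I stk rest by (simp add: walk_inv_def)
    then have "G (arcs s)" unfolding extends_def using finishes_no_edges by auto
    moreover have "arcs s = output_orientation es s"
      unfolding arcs_def rest output_orientation_def setcompr_eq_image
      by (rule image_cong) (auto simp: arc_def src_def tgt_def m_def)
    ultimately show "G (output_orientation es s)" by simp
  qed simp
  then show ?thesis
    unfolding walk_def using bounds
    by (intro run_straight_Seq[where T' = "8 + walk_pot ?s"]) (simp_all add: pot0)
qed

end

context orientation_program
begin

lemma run_insert_all:
  assumes st: "static s" and deg: "\<And>v. arrs s ''deg'' v \<le> M" and PQ: "PQ0 {} s"
  shows "run B (insert_all cins) s ((kc + 30) * card V0 + pot {} s + 10) (\<lambda>s' T. PQ0 V0 s' \<and> pot V0 s' \<le> T \<and>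
    agree (\<lambda>y. \<not> qname y \<and> y \<notin> {''x'', ''i''}) s s')"
    (is "run _ _ _ _ ?Q")
proof -
  let ?P = "\<lambda>y. \<not> qname y \<and> y \<notin> {''x'', ''i''}"
  define X where "X = (\<lambda>s' :: state. arrs s ''vl'' ` {..<regs s' ''i''})"
  define I where "I = (\<lambda>s'. regs s' ''i'' \<le> card V0 \<and> PQ0 (X s') s' \<and> agree ?P s s')"
  define \<Phi> where "\<Phi> = (\<lambda>s'. (kc + 30) * (card V0 - regs s' ''i'') + pot (X s') s')"
  let ?s = "setr ''i'' 0 s"
  note D = staticD[OF st]
  have nl: "regs s ''nl'' = card V0" by (rule D(8))
  have cn: "card V0 \<le> n" by (rule card_V0(1))
  have PQ_setr: "PQ0 Y (setr ''i'' k s') = PQ0 Y s'" "pot Y (setr ''i'' k s') = pot Y s'"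
    "PQ0 Y (setr ''x'' k s') = PQ0 Y s'" "pot Y (setr ''x'' k s') = pot Y s'" for Y k s'
  proof -
    have "agree (\<lambda>y. qname y \<or> y = ''n'' \<or> y = ''deg'') s' (setr ''i'' k s')"
      "agree (\<lambda>y. qname y \<or> y = ''n'' \<or> y = ''deg'') s' (setr ''x'' k s')" by (intro agree_setr; simp)+
    then show "PQ0 Y (setr ''i'' k s') = PQ0 Y s'" "pot Y (setr ''i'' k s') = pot Y s'"
      "PQ0 Y (setr ''x'' k s') = PQ0 Y s'" "pot Y (setr ''x'' k s') = pot Y s'" using PQ_cong by blast+
  qed
  have r: "regs s' ''nl'' = card V0" "arrs s' ''vl'' = arrs s ''vl''" "arrs s' ''deg'' = arrs s ''deg''" if "I s'" for s'
    using that nl by (simp_all add: I_def agree_def)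
  let ?b = "Reg ''i'' \<prec> Reg ''nl''"
  let ?body = "Assign ''x'' (Read ''vl'' (Reg ''i'')) ;; cins ;; Assign ''i'' (Reg ''i'' \<oplus> Num 1)"
  have "run B (While ?b ?body) ?s (4 + \<Phi> ?s) ?Q"
  proof (rule run_While[where I = I and \<Phi> = \<Phi>])
    show "I ?s" using PQ by (auto simp: I_def X_def PQ_setr intro!: agree_setr)
  next
    fix s' assume I: "I s'"
    then show "fits B ?b s'" using r[OF I] cn bounds by (simp add: I_def)
  next
    fix s' assume I: "I s'" and b: "aval ?b s' \<noteq> 0"
    define i where "i = regs s' ''i''"
    have i: "i < card V0" using b r[OF I] by (simp add: i_def split: if_splits)
    define v where "v = arrs s ''vl'' i"
    have v: "v \<in> V0" using D(7) i nl by (auto simp: v_def)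
    have vX: "v \<notin> X s'"
    proof
      assume "v \<in> X s'"
      then obtain k where k: "k < i" "arrs s ''vl'' k = arrs s ''vl'' i" by (auto simp: X_def v_def i_def)
      then show False using inj_onD[OF D(6) k(2)] i nl by simp
    qed
    have small: "1 \<le> B" "v \<le> B" "i \<le> B" "Suc i \<le> B" using V0_less[OF v] cn i bounds by linarith+
    have XS: "insert v (X s') = arrs s ''vl'' ` {..<Suc i}" by (auto simp: X_def v_def i_def lessThan_Suc)
    let ?s1 = "setr ''x'' v s'"
    have call: "run B cins ?s1 (kc + pot (X s') s') (\<lambda>s'' T. PQ0 (insert v (X s')) s'' \<and>
        pot (insert v (X s')) s'' \<le> T \<and> agree (\<lambda>y. \<not> qname y) ?s1 s'')"
      using run_insert[of "X s'" ?s1] I vX V0_less[OF v] deg[of v] r[OF I] by (simp add: PQ_setr I_def)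
    have "run B (cins ;; Assign ''i'' (Reg ''i'' \<oplus> Num 1)) ?s1
      (kc + pot (X s') s' + (4 + (kc + 30) * (card V0 - Suc i))) (\<lambda>s' T'. I s' \<and> \<Phi> s' \<le> T')"
    proof (rule run_call_Seq[OF call])
      fix s2 :: state and T
      assume A: "PQ0 (insert v (X s')) s2 \<and> pot (insert v (X s')) s2 \<le> T \<and> agree (\<lambda>y. \<not> qname y) ?s1 s2"
      have "agree ?P s ?s1" using I by (intro agree_setr) (auto simp: I_def)
      moreover have "agree (\<lambda>y. \<not> qname y) ?s1 s2" using A by blast
      then have "agree ?P ?s1 s2" by (rule agree_mono) auto
      ultimately have ag: "agree ?P s s2" by (rule agree_trans)
      have i2: "regs s2 ''i'' = i" using A by (simp add: agree_def i_def)
      have ag3: "agree ?P s (setr ''i'' (Suc i) s2)" using ag by (rule agree_setr) simp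
      have X3: "X (setr ''i'' (Suc i) s2) = insert v (X s')" unfolding XS by (simp add: X_def)
      have "I (setr ''i'' (Suc i) s2)" using A i ag3 unfolding I_def X3 by (simp add: PQ_setr)
      moreover have "\<Phi> (setr ''i'' (Suc i) s2) \<le> T + (kc + 30) * (card V0 - Suc i)"
        using A unfolding \<Phi>_def X3 by (simp add: PQ_setr)
      ultimately show "run B (Assign ''i'' (Reg ''i'' \<oplus> Num 1)) s2 (T + (4 + (kc + 30) * (card V0 - Suc i)))
        (\<lambda>s' T'. I s' \<and> \<Phi> s' \<le> T')"
        using small i2 by (intro run_straight[where T' = "T + (kc + 30) * (card V0 - Suc i)"]) simp_all
    qed simp
    moreover have "arrs s' ''vl'' i = v" using r[OF I] by (simp add: v_def)
    ultimately have "run B ?body s' (kc + pot (X s') s' + (7 + (kc + 30) * (card V0 - Suc i))) (\<lambda>s' T'. I s' \<and> \<Phi> s' \<le> T')"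
      using small by (intro run_straight_Seq[where T' = "kc + pot (X s') s' + (4 + (kc + 30) * (card V0 - Suc i))"])
        (simp_all add: i_def[symmetric])
    moreover have "(kc + 30) * (card V0 - i) = (kc + 30) * (card V0 - Suc i) + (kc + 30)"
      using i by (metis Suc_diff_Suc mult_Suc_right add.commute)
    ultimately show "\<exists>T'. cost ?b + 1 + T' \<le> \<Phi> s' \<and> run B ?body s' T' (\<lambda>s' T''. I s' \<and> \<Phi> s' \<le> T'')"
      by (intro exI[of _ "kc + pot (X s') s' + (7 + (kc + 30) * (card V0 - Suc i))"])
        (simp add: \<Phi>_def i_def[symmetric])
  next
    fix s' assume I: "I s'" and b: "aval ?b s' = 0"
    have "regs s' ''i'' = card V0" using b r[OF I] I by (simp add: I_def split: if_splits)
    then have "X s' = V0" using D(7) nl by (simp add: X_def)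
    then show "?Q s' (\<Phi> s')" using I by (simp add: I_def \<Phi>_def)
  qed simp
  moreover have "\<Phi> ?s = (kc + 30) * card V0 + pot {} s" by (simp add: \<Phi>_def X_def PQ_setr)
  ultimately show ?thesis
    unfolding insert_all_def using bounds by (intro run_straight_Seq[where T' = "4 + \<Phi> ?s"]) simp_all
qed

text \<open>The factor \<open>2 * card V0 + 1\<close> comes from two iterations per vertex and a
  possible first change of \<open>k\<close>. The bound on \<open>card V0\<close> is handed on so
  that callers can express the time by \<open>m\<close> alone.\<close>

lemma run_orient_edges:
  assumes inp: "input s" and reg0: "\<And>y. y \<notin> {''n'', ''m''} \<Longrightarrow> regs s y = 0"
    and arr0: "\<And>a. a \<notin> {''src'', ''tgt'', ''weight''} \<Longrightarrow> arrs s a = (\<lambda>_. 0)"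
  shows "run B (orient_edges we cins cfind cdel cdec) s
    ((2 * kc + 700) * m + (kc + 200) * card V0 + (2 * kf + 200) * (2 * card V0 + 1) + k0 + 500)
    (\<lambda>s' T. orientation_algorithm w {..<n} E (output_orientation es s') \<and> card V0 \<le> 2 * m)"
    (is "run _ _ _ _ ?Q")
proof -
  let ?l = "edge_density w {..<n} E" and ?c = "card V0"
  let ?G = "orientation_algorithm w {..<n} E"
  let ?walk = "\<lambda>s' T :: nat. ?G (output_orientation es s')"
  let ?prep = "Assign ''k'' (ceiling_twice_density (Reg ''n'')) ;; Assign ''nv'' (Reg ''nl'') ;; Assign ''go'' (Num 1)"
  let ?tw = "300 * m + 80 * ?c + 20"
  let ?tl = "(2 * kf + 200) * (2 * ?c + 1) + (kc + 80) * (2 * m) + 52"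
  have walk: "run B walk s4 ?tw ?Q"
    if s4: "peel_inv {} s4" "\<And>A. finishes (alive s4, rest_edges s4, arcs s4) A \<Longrightarrow> ?G A"
      "arrs s4 ''onp'' = (\<lambda>_. 0)" "arrs s4 ''ptr'' = (\<lambda>_. 0)" for s4
  proof -
    have "run B walk s4 ?tw ?walk"
    proof (rule run_walk[where V = "alive s4"])
      show "finite (alive s4)" using finite_V0 by (simp add: alive_def)
      show "e \<subseteq> alive s4" if "e \<in> rest_edges s4" for e
        using that s4(1) by (auto simp: rest_edges_def peel_inv_def)
    qed (use s4 in \<open>simp_all add: peel_inv_def\<close>)
    moreover have "?c \<le> 2 * m" using card_V0(2)[of s4] s4(1) by (simp add: peel_inv_def)
    ultimately show ?thesis by (auto simp: run_def)
  qed
  have main: "run B (?prep ;; peel_loop cfind cdel cdec we ;; walk) s2 (pot V0 s2 + ?tl + ?tw + 14) ?Q"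
    if s2: "static s2" "PQ0 V0 s2" "\<And>v. arrs s2 ''deg'' v = wdeg w E v" "regs s2 ''ew'' = (\<Sum>e\<in>E. w e)"
      and zero: "arrs s2 ''done'' = (\<lambda>_. 0)" "arrs s2 ''gone'' = (\<lambda>_. 0)"
        "arrs s2 ''onp'' = (\<lambda>_. 0)" "arrs s2 ''ptr'' = (\<lambda>_. 0)" for s2
  proof -
    define k where "k = (2 * regs s2 ''ew'' + n - 1) div n"
    define s3 where "s3 = setr ''go'' 1 (setr ''nv'' ?c (setr ''k'' k s2))"
    note D = staticD[OF s2(1)]
    have ewM: "regs s2 ''ew'' \<le> M" using M s2(4) by simp
    have cn: "?c \<le> n" by (rule card_V0(1))
    have "k \<le> 2 * regs s2 ''ew'' + n" unfolding k_def using div_le_dividend le_trans diff_le_self by blast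
    then have small: "2 \<le> B" "k \<le> B" "regs s2 ''ew'' \<le> B" "2 * regs s2 ''ew'' \<le> B" "2 * regs s2 ''ew'' + n \<le> B" "n \<le> B" "?c \<le> B"
      using bounds ewM cn by linarith+
    have ceil: "int k = \<lceil>2 * ?l\<rceil>"
    \<comment> \<open>For \<open>n = 0\<close> both the integer and the real division by zero give
      0.\<close>
    proof (cases "n = 0")
      case False
      then show ?thesis using ceiling_divide_nat[of n "2 * regs s2 ''ew''"] s2(4)
        by (simp add: k_def edge_density_def)
    qed (simp add: k_def edge_density_def)
    have rest: "rest s3 = {..<m}" using zero by (auto simp: rest_def s3_def)
    then have re: "rest_edges s3 = E" by (simp add: rest_edges_def E_conv)
    have arcs: "arcs s3 = {}" by (simp add: arcs_def rest)
    have al: "alive s3 = V0" using zero by (simp add: alive_def s3_def)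
    have st3: "static s3" using static_cong[of s2 s3] s2(1) by (simp add: agree_def s3_def)
    have "agree (\<lambda>y. qname y \<or> y = ''n'' \<or> y = ''deg'') s2 s3" unfolding s3_def by (intro agree_setr) simp_all
    note pq = PQ_cong[OF this]
    have PQ3: "PQ V0 s3" using PQ0_PQ[OF s2(2)] pq by simp
    have "peel_inv {} s3"
      unfolding peel_inv_def al re using st3 PQ3 rest edge_V0 s2(3,4) zero by (auto simp: s3_def)
    \<comment> \<open>The initial \<open>k\<close> is computed with all \<open>n\<close> vertices,
      whereas \<open>nv\<close> counts only the listed ones; the lemma on nonisolated vertices
      bridges this difference.\<close>
    moreover have "?G A" if "completes w ?l (V0, E, {}) A" for A
      using orientation_algorithm_nonisolated[OF graph V0_conv that] .
    ultimately have LI: "loop_inv ?G s3"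
      using ceil small unfolding loop_inv_def al re arcs by (auto simp: s3_def)
    have lp: "loop_pot s3 + 2 \<le> pot V0 s2 + ?tl"
    proof -
      let ?f = "if \<exists>v\<in>V0. arrs s3 ''deg'' v < regs s3 ''k'' then 0 else 1 :: nat"
      have "(2 * kf + 200) * (2 * ?c + ?f) \<le> (2 * kf + 200) * (2 * ?c + 1)" by (intro mult_le_mono2) simp
      moreover have "(\<Sum>v\<in>V0. arrs s3 ''cnt'' v) = 2 * m" by (rule sum_cnt[OF st3])
      ultimately show ?thesis using pq unfolding loop_pot_def al by (simp add: s3_def)
    qed
    have "run B (peel_loop cfind cdel cdec we ;; walk) s3 (pot V0 s2 + ?tl + ?tw) ?Q"
    proof (rule run_call_Seq[OF run_peel_loop[OF LI]])
      show "loop_pot s3 + 2 + ?tw \<le> pot V0 s2 + ?tl + ?tw" using lp by simp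
    next
      fix s4 :: state and T
      assume A: "peel_inv {} s4 \<and> (\<forall>A. finishes (alive s4, rest_edges s4, arcs s4) A \<longrightarrow> ?G A) \<and> agree looped s3 s4"
      then have ag: "agree looped s3 s4" by blast
      have "run B walk s4 ?tw ?Q"
        using A zero agree_arrs[OF ag, of "''onp''"] agree_arrs[OF ag, of "''ptr''"]
        by (intro walk) (simp_all add: s3_def)
      then show "run B walk s4 (T + ?tw) ?Q" by (rule run_time_mono) simp
    qed
    then show ?thesis
      using small D(8,9)
      by (intro run_straight_Seq[where T' = "pot V0 s2 + ?tl + ?tw"])
        (simp_all add: ceiling_twice_density_def s3_def k_def)
  qed
  let ?Pr = "\<lambda>y. y \<notin> {''e'', ''u'', ''ew'', ''nl'', ''vl'', ''adj'', ''cnt'', ''deg''}"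
  let ?ti = "(kc + 30) * ?c + k0 + 10"
  have "run B (read_edges we ;; insert_all cins ;; ?prep ;; peel_loop cfind cdel cdec we ;; walk) s
    (200 * (m + 1) + (?ti + ?tl + ?tw + 14)) ?Q"
  proof (rule run_call_Seq[OF run_read_edges])
    fix s1 :: state and T
    assume s1: "static s1 \<and> (\<forall>v. arrs s1 ''deg'' v = wdeg w E v) \<and> regs s1 ''ew'' = (\<Sum>e\<in>E. w e) \<and> agree ?Pr s s1"
    then have ag1: "agree ?Pr s s1" by blast
    have "regs s1 ''n'' = n" using s1 staticD(9) by blast
    moreover have "regs s1 y = 0 \<and> arrs s1 y = (\<lambda>_. 0)" if "qname y" for y
    proof -
      have "?Pr y" "y \<notin> {''n'', ''m''}" "y \<notin> {''src'', ''tgt'', ''weight''}" using that by auto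
      then show ?thesis using agree_regs[OF ag1] agree_arrs[OF ag1] reg0 arr0 by simp
    qed
    ultimately have PQ1: "PQ0 {} s1" "pot {} s1 \<le> k0" using PQ0_init by blast+
    have deg: "arrs s1 ''deg'' v \<le> M" for v
    proof -
      have "wdeg w E v \<le> (\<Sum>e\<in>E. w e)"
        unfolding wdeg_def using finite_E by (intro sum_mono2) (auto simp: incident_def)
      then show ?thesis using s1 M by simp
    qed
    have "run B (insert_all cins ;; ?prep ;; peel_loop cfind cdel cdec we ;; walk) s1
      ((kc + 30) * ?c + pot {} s1 + 10 + (?tl + ?tw + 14)) ?Q"
    proof (rule run_call_Seq[OF run_insert_all])
      show "static s1" "PQ0 {} s1" using s1 PQ1 by auto
      show "arrs s1 ''deg'' v \<le> M" for v by (rule deg)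
    next
      fix s2 :: state and T
      assume s2: "PQ0 V0 s2 \<and> pot V0 s2 \<le> T \<and> agree (\<lambda>y. \<not> qname y \<and> y \<notin> {''x'', ''i''}) s1 s2"
      then have ag2: "agree (\<lambda>y. \<not> qname y \<and> y \<notin> {''x'', ''i''}) s1 s2" by blast
      have "run B (?prep ;; peel_loop cfind cdel cdec we ;; walk) s2 (pot V0 s2 + ?tl + ?tw + 14) ?Q"
      proof (rule main)
        have "static s2 = static s1" by (rule static_cong) (rule agree_mono[OF ag2], auto)
        then show "static s2" using s1 by blast
        show "PQ0 V0 s2" using s2 by blast
        show "arrs s2 ''deg'' v = wdeg w E v" for v using s1 agree_arrs[OF ag2, of "''deg''"] by simp
        show "regs s2 ''ew'' = (\<Sum>e\<in>E. w e)" using s1 agree_regs[OF ag2, of "''ew''"] by simp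
        have z: "arrs s2 a = (\<lambda>_. 0)" if "\<not> qname a" "a \<notin> {''x'', ''i''}" "?Pr a" "a \<notin> {''src'', ''tgt'', ''weight''}" for a
          using agree_arrs[OF ag2, of a] agree_arrs[OF ag1, of a] arr0[of a] that by simp
        show "arrs s2 ''done'' = (\<lambda>_. 0)" "arrs s2 ''gone'' = (\<lambda>_. 0)" "arrs s2 ''onp'' = (\<lambda>_. 0)" "arrs s2 ''ptr'' = (\<lambda>_. 0)"
          by (rule z; simp)+
      qed
      then show "run B (?prep ;; peel_loop cfind cdel cdec we ;; walk) s2 (T + (?tl + ?tw + 14)) ?Q"
        by (rule run_time_mono) (use s2 in simp)
    qed simp
    then show "run B (insert_all cins ;; ?prep ;; peel_loop cfind cdel cdec we ;; walk) s1 (T + (?ti + ?tl + ?tw + 14)) ?Q"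
      by (rule run_time_mono) (use PQ1 in simp)
  qed (use inp reg0 arr0 in simp_all)
  then show ?thesis
    unfolding orient_edges_def by (rule run_time_mono) (simp add: algebra_simps)
qed

end

section \<open>Instances for the two input formats\<close>

lemma edge_list_length:
  assumes "edge_list E es"
  shows "length es = card E"
proof -
  have "card (set (map (\<lambda>(u, v). {u, v}) es)) = length (map (\<lambda>(u, v). {u, v}) es)"
    by (rule distinct_card) (use assms in \<open>simp add: edge_list_def\<close>)
  then show ?thesis using assms by (simp add: edge_list_def)
qed

lemma graph_input_simps:
  "regs (graph_input n es) ''n'' = n" "regs (graph_input n es) ''m'' = length es"
  "y \<notin> {''n'', ''m''} \<Longrightarrow> regs (graph_input n es) y = 0"
  "arrs (graph_input n es) ''src'' = (\<lambda>i. if i < length es then fst (es ! i) else 0)"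
  "arrs (graph_input n es) ''tgt'' = (\<lambda>i. if i < length es then snd (es ! i) else 0)"
  "a \<notin> {''src'', ''tgt''} \<Longrightarrow> arrs (graph_input n es) a = (\<lambda>_. 0)"
  by (simp_all add: graph_input_def)

lemma weighted_graph_input_simps:
  "regs (weighted_graph_input n es w) = regs (graph_input n es)"
  "arrs (weighted_graph_input n es w) ''weight'' = (\<lambda>i. if i < length es then w {fst (es ! i), snd (es ! i)} else 0)"
  "a \<noteq> ''weight'' \<Longrightarrow> arrs (weighted_graph_input n es w) a = arrs (graph_input n es) a"
  by (simp_all add: weighted_graph_input_def)

text \<open>With unit weights every key is at most \<open>card E\<close>, so the square in the word
  limit dominates all adjacency and bucket addresses.\<close>

lemma orient_unweighted:
  assumes graph: "simple_graph {..<n} E" and es: "edge_list E es"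
  shows "\<exists>t s. exec ((n + card E + 2) ^ 2)
      (orient_edges (Num 1) bucket_insert bucket_find bucket_delete bucket_decrease) (graph_input n es) t s
    \<and> real t \<le> 4000 * (real (card E) + 1)
    \<and> orientation_algorithm (\<lambda>_. 1) {..<n} E (output_orientation es s)"
proof -
  define c where "c = card E"
  let ?B = "(n + c + 2) ^ 2"
  have len: "length es = c" using edge_list_length[OF es] by (simp add: c_def)
  have sq: "?B = n * n + c * c + 2 * (n * c) + 4 * n + 4 * c + 4"
    by (simp add: power2_eq_square algebra_simps)
  have B1: "n * length es + length es + 2 * n + 2 * c + 3 \<le> ?B" unfolding sq len by simp
  have B2: "(c + 1) * n + c \<le> ?B" unfolding sq by (simp add: algebra_simps)
  have "edge_array n es E (\<lambda>_. 1) (Num 1) (\<lambda>_. 0) ?B c"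
    by (unfold_locales; use graph es B1 in \<open>simp add: c_def\<close>)
  then have "orientation_program n es E (\<lambda>_. 1) (Num 1) (\<lambda>_. 0) ?B c bucket_insert bucket_find bucket_delete
      bucket_decrease (\<lambda>X s. buckets n c X s \<and> regs s ''qcur'' = 0) (buckets n c) (\<lambda>_ _. True) (bucket_pot c)
      100 100 (10 * c) (\<lambda>d. d = 1)"
    by (intro orientation_program.intro orientation_program_axioms.intro buckets_pq B2) simp_all
  then interpret orientation_program n es E "\<lambda>_. 1" "Num 1" "\<lambda>_. 0" ?B c bucket_insert bucket_find bucket_delete
    bucket_decrease "\<lambda>X s. buckets n c X s \<and> regs s ''qcur'' = 0" "buckets n c" "\<lambda>_ _. True" "bucket_pot c"
    100 100 "10 * c" "\<lambda>d. d = 1" .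
  have "input (graph_input n es)"
    by (simp add: input_def graph_input_simps m_def src_def tgt_def)
  from run_orient_edges[OF this] obtain t s where ts:
    "exec ?B (orient_edges (Num 1) bucket_insert bucket_find bucket_delete bucket_decrease) (graph_input n es) t s"
    "t \<le> (2 * 100 + 700) * m + (100 + 200) * card V0 + (2 * 100 + 200) * (2 * card V0 + 1) + 10 * c + 500"
    "orientation_algorithm (\<lambda>_. 1) {..<n} E (output_orientation es s)" "card V0 \<le> 2 * m"
    unfolding run_def using graph_input_simps by fastforce
  \<comment> \<open>Replacing \<open>card V0\<close> by \<open>2 * m\<close> leaves at most
    \<open>3110 * m + 900\<close>.\<close>
  from ts(2,4) have "t \<le> 4000 * (c + 1)" using len by (simp add: m_def)
  then have "real t \<le> real (4000 * (c + 1))" by (simp only: of_nat_le_iff)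
  then have "real t \<le> 4000 * (real c + 1)" by simp
  with ts(1,3) show ?thesis unfolding c_def[symmetric] by blast
qed

lemma orient_weighted:
  assumes graph: "simple_graph {..<n} E" and es: "edge_list E es"
  shows "\<exists>t s. exec ((n + card E + (\<Sum>e\<in>E. w e) + 2) ^ 2)
      (orient_edges (Read ''weight'' (Reg ''e'')) fib_insert fib_find fib_delete fib_decrease)
      (weighted_graph_input n es w) t s
    \<and> real t \<le> 60000 * (real (card E) + real n * log 2 (real n) + 1)
    \<and> orientation_algorithm w {..<n} E (output_orientation es s)"
proof -
  define c where "c = card E"
  define W where "W = (\<Sum>e\<in>E. w e)"
  define WGT where "WGT = (\<lambda>i. if i < length es then w {fst (es ! i), snd (es ! i)} else 0)"
  \<comment> \<open>For positive \<open>n\<close> this is the number of binary digits of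
    \<open>n\<close>, so \<open>n < 2 ^ h\<close>.\<close>
  define h where "h = nat \<lfloor>log 2 (real n)\<rfloor> + 1"
  let ?B = "(n + c + W + 2) ^ 2"
  have len: "length es = c" using edge_list_length[OF es] by (simp add: c_def)
  have sq: "?B = n * n + c * c + W * W + 2 * (n * c) + 2 * (n * W) + 2 * (c * W) + 4 * n + 4 * c + 4 * W + 4"
    by (simp add: power2_eq_square algebra_simps)
  have B1: "n * length es + length es + 2 * n + 2 * W + 3 \<le> ?B" unfolding sq len by simp
  have B2: "(n + 2) * (n + 1) + W \<le> ?B" unfolding sq by (simp add: algebra_simps)
  have h: "n < 2 ^ h"
  proof (cases "n = 0")
    case False
    then have l0: "0 \<le> log 2 (real n)" by simp
    have "log 2 (real n) < real h" unfolding h_def using l0 by linarith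
    then have "real n < 2 powr real h" using False by (simp add: log_less_iff)
    then have "real n < real (2 ^ h)" by (simp add: powr_realpow)
    then show ?thesis by (simp only: of_nat_less_iff)
  qed simp
  have finE: "finite E" using es unfolding edge_list_def by (metis List.finite_set)
  have "edge_array n es E w (Read ''weight'' (Reg ''e'')) WGT ?B W"
  proof
    fix s :: state
    assume e: "regs s ''e'' < length es" "arrs s ''weight'' = WGT"
    define i where "i = regs s ''e''"
    have "{fst (es ! i), snd (es ! i)} \<in> E"
      using es nth_mem[OF e(1)] unfolding edge_list_def i_def by (force simp: case_prod_beta)
    then have "w {fst (es ! i), snd (es ! i)} \<le> W" unfolding W_def using finE by (intro member_le_sum) auto
    moreover have "i \<le> ?B" "W \<le> ?B" using e(1) B1 by (simp_all add: i_def)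
    ultimately show "fits ?B (Read ''weight'' (Reg ''e'')) s \<and>
      aval (Read ''weight'' (Reg ''e'')) s = w {fst (es ! regs s ''e''), snd (es ! regs s ''e'')}"
      using e by (simp add: WGT_def i_def[symmetric])
  qed (use graph es B1 in \<open>simp_all add: W_def\<close>)
  then have "orientation_program n es E w (Read ''weight'' (Reg ''e'')) WGT ?B W fib_insert fib_find fib_delete fib_decrease
      (fib n W) (fib n W) (\<lambda>s u. arrs s ''qpar'' u = n) (fib_pot n) (2700 * h + 100) 3000 0 (\<lambda>_. True)"
    by (intro orientation_program.intro orientation_program_axioms.intro fib_pq B2 h) simp_all
  then interpret orientation_program n es E w "Read ''weight'' (Reg ''e'')" WGT ?B W fib_insert fib_find fib_delete fib_decrease
      "fib n W" "fib n W" "\<lambda>s u. arrs s ''qpar'' u = n" "fib_pot n" "2700 * h + 100" 3000 0 "\<lambda>_. True" .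
  have inp: "input (weighted_graph_input n es w)"
    unfolding input_def
    by (simp add: weighted_graph_input_simps graph_input_simps m_def src_def tgt_def WGT_def)
  have "run ?B (orient_edges (Read ''weight'' (Reg ''e'')) fib_insert fib_find fib_delete fib_decrease)
    (weighted_graph_input n es w)
    ((2 * 3000 + 700) * m + (3000 + 200) * card V0 + (2 * (2700 * h + 100) + 200) * (2 * card V0 + 1) + 0 + 500)
    (\<lambda>s' T. orientation_algorithm w {..<n} E (output_orientation es s') \<and> card V0 \<le> 2 * m)"
    by (rule run_orient_edges[OF inp]) (simp_all add: weighted_graph_input_simps graph_input_simps)
  then obtain t s where ex:
    "exec ?B (orient_edges (Read ''weight'' (Reg ''e'')) fib_insert fib_find fib_delete fib_decrease)
      (weighted_graph_input n es w) t s"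
    "orientation_algorithm w {..<n} E (output_orientation es s)"
    and t: "t \<le> (2 * 3000 + 700) * m + (3000 + 200) * card V0 + (2 * (2700 * h + 100) + 200) * (2 * card V0 + 1) + 0 + 500"
    unfolding run_def by fastforce
  have V0: "card V0 \<le> n" by (rule card_V0(1))
  have mc: "m = c" using len by (simp add: m_def)
  have "real t \<le> 60000 * (real c + real n * log 2 (real n) + 1)"
  \<comment> \<open>For \<open>n\<close> at most 1 the term with the logarithm is 0 and the additive
    constant has to suffice; for larger \<open>n\<close> the logarithm is at least 1 and absorbs the
    linear terms.\<close>
  proof (cases "n \<le> 1")
    case True
    then have "h = 1" by (cases n) (auto simp: h_def log_def)
    then have "t \<le> 60000 * (c + 1)" using t V0 True mc by simp
    then have "real t \<le> real (60000 * (c + 1))" by (simp only: of_nat_le_iff)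
    moreover have "real n * log 2 (real n) = 0" using True by (cases n) auto
    ultimately show ?thesis by (simp only:) simp
  next
    case False
    define L where "L = log 2 (real n)"
    have L1: "1 \<le> L" using False by (simp add: L_def le_log_iff)
    have hL: "real h \<le> 2 * L"
    proof -
      have "real h \<le> L + 1" using L1 unfolding h_def L_def by linarith
      then show ?thesis using L1 by simp
    qed
    have nL: "real n * 1 \<le> real n * L" using L1 by (intro mult_left_mono) simp_all
    define P where "P = (2 * (2700 * h + 100) + 200) * (2 * card V0 + 1)"
    define R where "R = (5400 * h + 400) * (3 * n)"
    have "P \<le> R" unfolding P_def R_def using V0 False by (intro mult_le_mono) simp_all
    then have "t \<le> 6700 * c + 3200 * n + (5400 * h + 400) * (3 * n) + 500"
      using t V0 unfolding mc P_def[symmetric] R_def[symmetric] by simp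
    then have "real t \<le> real (6700 * c + 3200 * n + (5400 * h + 400) * (3 * n) + 500)" by (simp only: of_nat_le_iff)
    also have "\<dots> = 6700 * real c + 4400 * real n + 16200 * (real n * real h) + 500" by (simp add: algebra_simps)
    also have "real n * real h \<le> real n * (2 * L)" using hL by (intro mult_left_mono) simp_all
    finally show ?thesis using nL unfolding L_def[symmetric] by simp
  qed
  with ex show ?thesis unfolding c_def[symmetric] W_def[symmetric] by blast
qed

text \<open>Exponent 2 serves as \<open>k\<close> in both parts. The summand 1 in the time bounds
  covers the constant work on graphs without edges.\<close>

theorem theorem23:
  shows "(\<exists>p k C. \<forall>n E es. simple_graph {..<n} E \<and> edge_list E es \<longrightarrow>
            (\<exists>t s. exec ((n + card E + 2) ^ k) p (graph_input n es) t s
                 \<and> real t \<le> C * (real (card E) + 1)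
                 \<and> orientation_algorithm (\<lambda>_. 1) {..<n} E (output_orientation es s)))
       \<and> (\<exists>p k C. \<forall>n E es w. simple_graph {..<n} E \<and> edge_list E es \<longrightarrow>
            (\<exists>t s. exec ((n + card E + (\<Sum>e\<in>E. w e) + 2) ^ k) p (weighted_graph_input n es w) t s
                 \<and> real t \<le> C * (real (card E) + real n * log 2 (real n) + 1)
                 \<and> orientation_algorithm w {..<n} E (output_orientation es s)))"
  using orient_unweighted orient_weighted by blast

end
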